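(* Let $m,n\geq 3$ be natural numbers and let $p,q$ be distinct primes. Let $E$ be the orbit equivalence relation on $\mathrm{PSL}_m(\mathbb{Z}_p)$ induced by the action of $\mathrm{PSL}_m(\mathbb{Z})$ by left multiplication, and let $F$ be the orbit equivalence relation on $\mathrm{PSL}_n(\mathbb{Z}_q)$ induced by the action of $\mathrm{PSL}_n(\mathbb{Z})$ by left multiplication. Then $E$ and $F$ are Borel incomparable, i.e. $E\not\leq_B F$ and $F\not\leq_B E$.
   Context: $\mathbb{Z}_p$ denotes the ring of $p$-adic integers; $\mathrm{PSL}_m(\mathbb{Z})$ is regarded as a (dense) subgroup of the compact group $\mathrm{PSL}_m(\mathbb{Z}_p)$. If $E,F$ are equivalence relations on standard Borel spaces $X,Y$, then $E\leq_B F$ means there is a Borel function $f\colon X\to Y$ with $x\mathrel{E}x' \iff f(x)\mathrel{F}f(x')$ for all $x,x'\in X$. The orbit equivalence relation of an action of a group $\Gamma$ on $X$ relates $x,y$ iff $\Gamma x=\Gamma y$. *)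

theory Defs
  imports
    "HOL-Analysis.Analysis"
    "HOL-Algebra.IntRing"
    "HOL-Algebra.Group_Action"
    "HOL-Combinatorics.Permutations"
    "HOL-Computational_Algebra.Primes"
begin

text \<open>The $p$-adic integers are the inverse limit of the rings $\mathbb{Z}/p^k\mathbb{Z}$; residue
  classes modulo $p^k$ are represented by $0, \ldots, p^k - 1$. Since $p^0 = 1$, every component
  with index $0$ is $0$, which is why the constant in \<open>one\<close> is reduced too.\<close>

definition padic_int :: "nat \<Rightarrow> (nat \<Rightarrow> int) ring" where
  "padic_int p =
    \<lparr>carrier = {a. \<forall>k. a k \<in> {0..<int p ^ k} \<and> a (Suc k) mod int p ^ k = a k},
     monoid.mult = (\<lambda>a b k. (a k * b k) mod int p ^ k),
     one = (\<lambda>k. 1 mod int p ^ k),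
     ring.zero = (\<lambda>k. 0),
     ring.add = (\<lambda>a b k. (a k + b k) mod int p ^ k)\<rparr>"

definition padic_of_int :: "nat \<Rightarrow> int \<Rightarrow> nat \<Rightarrow> int" where
  "padic_of_int p z = (\<lambda>k. z mod int p ^ k)"

definition padic_topology :: "nat \<Rightarrow> (nat \<Rightarrow> int) topology" where
  "padic_topology p =
    subtopology (product_topology (\<lambda>k. discrete_topology UNIV) UNIV) (carrier (padic_int p))"

lemma padic_intD:
  assumes "a \<in> carrier (padic_int p)"
  shows "0 \<le> a k" "a k < int p ^ k" "a (Suc k) mod int p ^ k = a k" "a k mod int p ^ k = a k"
proof -
  have *: "0 \<le> a k \<and> a k < int p ^ k \<and> a (Suc k) mod int p ^ k = a k"
    using assms by (simp add: padic_int_def)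
  then show "0 \<le> a k" "a k < int p ^ k" "a (Suc k) mod int p ^ k = a k" by auto
  from * show "a k mod int p ^ k = a k" by simp
qed

lemma padic_intI:
  assumes "p > 0" "\<And>k. a k = b k mod int p ^ k"
    "\<And>k. b (Suc k) mod int p ^ k = b k mod int p ^ k"
  shows "a \<in> carrier (padic_int p)"
  using assms by (auto simp: padic_int_def mod_mod_cancel)

lemma cring_padic_int:
  assumes "p > 0"
  shows "cring (padic_int p)"
proof (rule cringI)
  note red = padic_intD(3,4)
  show "abelian_group (padic_int p)"
  proof (rule abelian_groupI)
    fix x y assume xy: "x \<in> carrier (padic_int p)" "y \<in> carrier (padic_int p)"
    have "(x (Suc k) + y (Suc k)) mod int p ^ k = (x k + y k) mod int p ^ k" for k
      by (metis mod_add_eq red(1) xy)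
    then show "x \<oplus>\<^bsub>padic_int p\<^esub> y \<in> carrier (padic_int p)"
      by (intro padic_intI[OF assms, where b = "\<lambda>k. x k + y k"]) (auto simp: padic_int_def)
    show "x \<oplus>\<^bsub>padic_int p\<^esub> y = y \<oplus>\<^bsub>padic_int p\<^esub> x"
      by (simp add: padic_int_def add.commute)
    fix z
    show "x \<oplus>\<^bsub>padic_int p\<^esub> y \<oplus>\<^bsub>padic_int p\<^esub> z = x \<oplus>\<^bsub>padic_int p\<^esub> (y \<oplus>\<^bsub>padic_int p\<^esub> z)"
      by (simp add: padic_int_def mod_simps add.assoc)
  next
    show "\<zero>\<^bsub>padic_int p\<^esub> \<in> carrier (padic_int p)"
      using assms by (simp add: padic_int_def)
    fix x assume x: "x \<in> carrier (padic_int p)"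
    then show "\<zero>\<^bsub>padic_int p\<^esub> \<oplus>\<^bsub>padic_int p\<^esub> x = x"
      using red(2)[OF x] by (simp add: padic_int_def)
    have "(- x (Suc k)) mod int p ^ k = (- x k) mod int p ^ k" for k
      by (metis mod_minus_eq red(1) x)
    then have "(\<lambda>k. (- x k) mod int p ^ k) \<in> carrier (padic_int p)"
      by (intro padic_intI[OF assms, where b = "\<lambda>k. - x k"]) auto
    moreover have "(\<lambda>k. (- x k) mod int p ^ k) \<oplus>\<^bsub>padic_int p\<^esub> x = \<zero>\<^bsub>padic_int p\<^esub>"
      by (simp add: padic_int_def mod_simps)
    ultimately show "\<exists>y\<in>carrier (padic_int p). y \<oplus>\<^bsub>padic_int p\<^esub> x = \<zero>\<^bsub>padic_int p\<^esub>"
      by blast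
  qed
  show "comm_monoid (padic_int p)"
  proof (rule comm_monoidI)
    fix x y assume xy: "x \<in> carrier (padic_int p)" "y \<in> carrier (padic_int p)"
    have "(x (Suc k) * y (Suc k)) mod int p ^ k = (x k * y k) mod int p ^ k" for k
      by (metis mod_mult_eq red(1) xy)
    then show "x \<otimes>\<^bsub>padic_int p\<^esub> y \<in> carrier (padic_int p)"
      by (intro padic_intI[OF assms, where b = "\<lambda>k. x k * y k"]) (auto simp: padic_int_def)
    show "x \<otimes>\<^bsub>padic_int p\<^esub> y = y \<otimes>\<^bsub>padic_int p\<^esub> x"
      by (simp add: padic_int_def mult.commute)
    fix z
    show "x \<otimes>\<^bsub>padic_int p\<^esub> y \<otimes>\<^bsub>padic_int p\<^esub> z = x \<otimes>\<^bsub>padic_int p\<^esub> (y \<otimes>\<^bsub>padic_int p\<^esub> z)"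
      by (simp add: padic_int_def mod_simps mult.assoc)
  next
    show "\<one>\<^bsub>padic_int p\<^esub> \<in> carrier (padic_int p)"
      by (rule padic_intI[OF assms, where b = "\<lambda>_. 1"]) (auto simp: padic_int_def)
    fix x assume x: "x \<in> carrier (padic_int p)"
    show "\<one>\<^bsub>padic_int p\<^esub> \<otimes>\<^bsub>padic_int p\<^esub> x = x"
      using red(2)[OF x] by (simp add: padic_int_def mod_simps)
  qed
  show "(x \<oplus>\<^bsub>padic_int p\<^esub> y) \<otimes>\<^bsub>padic_int p\<^esub> z
      = x \<otimes>\<^bsub>padic_int p\<^esub> z \<oplus>\<^bsub>padic_int p\<^esub> y \<otimes>\<^bsub>padic_int p\<^esub> z" for x y z
    by (simp add: padic_int_def mod_simps distrib_right)
qed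

lemma padic_of_int_ring_hom:
  assumes "p > 0"
  shows "padic_of_int p \<in> ring_hom \<Z> (padic_int p)"
proof (rule ring_hom_memI)
  fix z
  show "padic_of_int p z \<in> carrier (padic_int p)"
    by (rule padic_intI[OF assms, where b = "\<lambda>_. z"]) (auto simp: padic_of_int_def)
qed (auto simp: padic_int_def padic_of_int_def mod_simps)

lemma inj_padic_of_int:
  assumes "p > 1"
  shows "inj (padic_of_int p)"
proof (rule injI)
  fix x y assume eq: "padic_of_int p x = padic_of_int p y"
  obtain k where k: "\<bar>x - y\<bar> < int p ^ k"
    using real_arch_pow[of "real p" "real_of_int \<bar>x - y\<bar>"] assms
    by (metis of_int_less_iff of_int_of_nat_eq of_int_power of_nat_1 of_nat_less_iff)
  have "x mod int p ^ k = y mod int p ^ k"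
    using eq by (metis padic_of_int_def)
  then have "int p ^ k dvd x - y"
    by (simp add: mod_eq_dvd_iff)
  then show "x = y"
    using k zdvd_imp_le[of "int p ^ k" "\<bar>x - y\<bar>"] by fastforce
qed

text \<open>An $n \times n$ matrix over \<open>R\<close> is an extensional function on \<open>{..<n} \<times> {..<n}\<close>.\<close>

definition mat_carrier :: "nat \<Rightarrow> ('a, 'b) ring_scheme \<Rightarrow> (nat \<times> nat \<Rightarrow> 'a) set" where
  "mat_carrier n R = {..<n} \<times> {..<n} \<rightarrow>\<^sub>E carrier R"

definition mat_mult ::
  "nat \<Rightarrow> ('a, 'b) ring_scheme \<Rightarrow> (nat \<times> nat \<Rightarrow> 'a) \<Rightarrow> (nat \<times> nat \<Rightarrow> 'a) \<Rightarrow> nat \<times> nat \<Rightarrow> 'a" where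
  "mat_mult n R A B =
    (\<lambda>(i, j)\<in>{..<n} \<times> {..<n}. \<Oplus>\<^bsub>R\<^esub>k\<in>{..<n}. A (i, k) \<otimes>\<^bsub>R\<^esub> B (k, j))"

definition mat_one :: "nat \<Rightarrow> ('a, 'b) ring_scheme \<Rightarrow> nat \<times> nat \<Rightarrow> 'a" where
  "mat_one n R = (\<lambda>(i, j)\<in>{..<n} \<times> {..<n}. if i = j then \<one>\<^bsub>R\<^esub> else \<zero>\<^bsub>R\<^esub>)"

definition mat_det :: "nat \<Rightarrow> ('a, 'b) ring_scheme \<Rightarrow> (nat \<times> nat \<Rightarrow> 'a) \<Rightarrow> 'a" where
  "mat_det n R A =
    (\<Oplus>\<^bsub>R\<^esub>\<sigma>\<in>{\<sigma>. \<sigma> permutes {..<n}}.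
      add_pow R (sign \<sigma> :: int) (\<Otimes>\<^bsub>R\<^esub>i\<in>{..<n}. A (i, \<sigma> i)))"

definition SL :: "nat \<Rightarrow> ('a, 'b) ring_scheme \<Rightarrow> (nat \<times> nat \<Rightarrow> 'a) monoid" where
  "SL n R =
    \<lparr>carrier = {A \<in> mat_carrier n R. mat_det n R A = \<one>\<^bsub>R\<^esub>},
     monoid.mult = mat_mult n R,
     one = mat_one n R\<rparr>"

definition group_center :: "('a, 'b) monoid_scheme \<Rightarrow> 'a set" where
  "group_center G = {z \<in> carrier G. \<forall>g\<in>carrier G. z \<otimes>\<^bsub>G\<^esub> g = g \<otimes>\<^bsub>G\<^esub> z}"

definition PSL :: "nat \<Rightarrow> ('a, 'b) ring_scheme \<Rightarrow> (nat \<times> nat \<Rightarrow> 'a) set monoid" where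
  "PSL n R = SL n R Mod group_center (SL n R)"

text \<open>For a ring homomorphism \<open>h\<close> from \<open>R\<close> to \<open>S\<close> that carries the centre of \<open>SL n R\<close> into that of
  \<open>SL n S\<close>, this sends the class of a matrix \<open>A\<close> to the class of the matrix obtained by applying
  \<open>h\<close> to the entries of \<open>A\<close>. For \<open>h = padic_of_int p\<close> it is the inclusion of $PSL_n(\mathbb{Z})$
  into $PSL_n(\mathbb{Z}_p)$.\<close>

definition PSL_map ::
  "nat \<Rightarrow> ('b, 'c) ring_scheme \<Rightarrow> ('a \<Rightarrow> 'b) \<Rightarrow> (nat \<times> nat \<Rightarrow> 'a) set \<Rightarrow> (nat \<times> nat \<Rightarrow> 'b) set" where
  "PSL_map n S h C =
    group_center (SL n S) <#>\<^bsub>SL n S\<^esub> ((\<lambda>A. \<lambda>ij\<in>{..<n} \<times> {..<n}. h (A ij)) ` C)"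

definition quotient_topology :: "'a topology \<Rightarrow> ('a \<Rightarrow> 'b) \<Rightarrow> 'b topology" where
  "quotient_topology X f =
    topology (\<lambda>U. U \<subseteq> f ` topspace X \<and> openin X {x \<in> topspace X. f x \<in> U})"

lemma openin_quotient_topology:
  "openin (quotient_topology X f) U \<longleftrightarrow>
    U \<subseteq> f ` topspace X \<and> openin X {x \<in> topspace X. f x \<in> U}"
proof -
  have "istopology (\<lambda>U. U \<subseteq> f ` topspace X \<and> openin X {x \<in> topspace X. f x \<in> U})"
    unfolding istopology_def
  proof (intro conjI allI impI)
    fix S T
    assume "S \<subseteq> f ` topspace X \<and> openin X {x \<in> topspace X. f x \<in> S}"
      "T \<subseteq> f ` topspace X \<and> openin X {x \<in> topspace X. f x \<in> T}"
    moreover have "{x \<in> topspace X. f x \<in> S \<inter> T} =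
      {x \<in> topspace X. f x \<in> S} \<inter> {x \<in> topspace X. f x \<in> T}" by auto
    ultimately show "S \<inter> T \<subseteq> f ` topspace X" "openin X {x \<in> topspace X. f x \<in> S \<inter> T}"
      by auto
  next
    fix \<K>
    assume K: "\<forall>K\<in>\<K>. K \<subseteq> f ` topspace X \<and> openin X {x \<in> topspace X. f x \<in> K}"
    then show "\<Union>\<K> \<subseteq> f ` topspace X" by blast
    have "{x \<in> topspace X. f x \<in> \<Union>\<K>} = (\<Union>K\<in>\<K>. {x \<in> topspace X. f x \<in> K})" by auto
    then show "openin X {x \<in> topspace X. f x \<in> \<Union>\<K>}" using K by auto
  qed
  then show ?thesis by (simp add: quotient_topology_def)
qed

lemma topspace_quotient_topology: "topspace (quotient_topology X f) = f ` topspace X"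
proof -
  have "{x \<in> topspace X. f x \<in> f ` topspace X} = topspace X" by auto
  then have "openin (quotient_topology X f) (f ` topspace X)"
    by (simp add: openin_quotient_topology)
  then show ?thesis
    by (meson openin_quotient_topology openin_subset openin_topspace subset_antisym)
qed

lemma quotient_map_quotient_topology: "quotient_map X (quotient_topology X f) f"
  by (simp add: quotient_map_def topspace_quotient_topology openin_quotient_topology)

definition SL_padic_topology :: "nat \<Rightarrow> nat \<Rightarrow> (nat \<times> nat \<Rightarrow> nat \<Rightarrow> int) topology" where
  "SL_padic_topology n p =
    subtopology (product_topology (\<lambda>_. padic_topology p) ({..<n} \<times> {..<n}))
      (carrier (SL n (padic_int p)))"

definition PSL_padic_topology :: "nat \<Rightarrow> nat \<Rightarrow> (nat \<times> nat \<Rightarrow> nat \<Rightarrow> int) set topology" where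
  "PSL_padic_topology n p =
    quotient_topology (SL_padic_topology n p)
      (\<lambda>A. group_center (SL n (padic_int p)) #>\<^bsub>SL n (padic_int p)\<^esub> A)"

lemma topspace_PSL_padic_topology:
  "topspace (PSL_padic_topology n p) = carrier (PSL n (padic_int p))"
proof -
  have "topspace (SL_padic_topology n p) = carrier (SL n (padic_int p))"
    by (auto simp: SL_padic_topology_def padic_topology_def SL_def mat_carrier_def)
  then show ?thesis
    by (auto simp: PSL_padic_topology_def topspace_quotient_topology PSL_def FactGroup_def
        RCOSETS_def)
qed

definition borel_of :: "'a topology \<Rightarrow> 'a measure" where
  "borel_of X = sigma (topspace X) {U. openin X U}"

lemma space_borel_of: "space (borel_of X) = topspace X"
  by (simp add: borel_of_def space_measure_of_conv)

definition orbit_eq_rel :: "('g, 'c) monoid_scheme \<Rightarrow> ('g \<Rightarrow> 'a \<Rightarrow> 'a) \<Rightarrow> 'a set \<Rightarrow> ('a \<times> 'a) set" where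
  "orbit_eq_rel G \<phi> X = {(x, y). x \<in> X \<and> y \<in> X \<and> orbit G \<phi> x = orbit G \<phi> y}"

definition borel_reducible ::
  "'a measure \<Rightarrow> ('a \<times> 'a) set \<Rightarrow> 'b measure \<Rightarrow> ('b \<times> 'b) set \<Rightarrow> bool" where
  "borel_reducible M E N F \<longleftrightarrow>
    (\<exists>f\<in>M \<rightarrow>\<^sub>M N. \<forall>x\<in>space M. \<forall>y\<in>space M. (x, y) \<in> E \<longleftrightarrow> (f x, f y) \<in> F)"

definition PSL_left_action ::
  "nat \<Rightarrow> nat \<Rightarrow> (nat \<times> nat \<Rightarrow> int) set \<Rightarrow> (nat \<times> nat \<Rightarrow> nat \<Rightarrow> int) set
    \<Rightarrow> (nat \<times> nat \<Rightarrow> nat \<Rightarrow> int) set" where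
  "PSL_left_action n p g =
    (\<lambda>x\<in>carrier (PSL n (padic_int p)).
      PSL_map n (padic_int p) (padic_of_int p) g \<otimes>\<^bsub>PSL n (padic_int p)\<^esub> x)"

definition PSL_orbit_rel :: "nat \<Rightarrow> nat \<Rightarrow> ((nat \<times> nat \<Rightarrow> nat \<Rightarrow> int) set \<times> _) set" where
  "PSL_orbit_rel n p =
    orbit_eq_rel (PSL n \<Z>) (PSL_left_action n p) (carrier (PSL n (padic_int p)))"

end

theory Submission
  imports Defs "HOL-Probability.Probability" "HOL-Number_Theory.Cong" "Jordan_Normal_Form.Determinant"
begin

text \<open>
  Let \<open>f\<close> be a Borel reduction. Only two consequences are used: \<open>f (g x)\<close> lies in \<open>\<Lambda> f x\<close> for
  \<open>g\<close> in \<open>SL\<^sub>3(\<int>)\<close>, where \<open>\<Lambda> = PSL\<^sub>n(\<int>)\<close>, and \<open>f\<close> is countable-to-one.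

  Restrict \<open>f\<close> to a set \<open>\<Omega>\<close> of block matrices with coordinates \<open>(k, t)\<close>, \<open>k\<close> a \<open>2 \<times> 2\<close> matrix and \<open>t\<close> a
  vector over \<open>\<int>\<^sub>p\<close>, and write \<open>F\<close> for the result. The group generated by \<open>\<int>\<^sup>2\<close> and by the two elementary
  matrices with entry \<open>s = 5 p\<close> acts on \<open>\<Omega>\<close> from the left, preserving Haar measure, and commutes with
  the translations \<open>t \<mapsto> t + u\<close>. The function \<open>D\<^sub>u \<omega> = (F \<omega>)\<^sup>-\<^sup>1 F (\<omega> + u)\<close> is unchanged by a generator \<open>g\<close>
  wherever the cocycle \<open>F (g \<omega>) (F \<omega>)\<^sup>-\<^sup>1\<close>, which takes countably many values, agrees at \<open>\<omega>\<close> and \<open>\<omega> + u\<close>;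
  for \<open>u\<close> close to \<open>0\<close> this happens with probability close to \<open>1\<close>.

  Relative rigidity then makes \<open>D\<^sub>u\<close> almost invariant under all of \<open>\<int>\<^sup>2\<close>, uniformly: the correlation
  \<open>\<phi> a = P (D (T\<^sub>a \<omega>) = D \<omega>)\<close> is positive definite on \<open>\<int>\<^sup>2\<close>, and the functional on trigonometric polynomials
  that it defines is almost invariant under the two shears of the torus. These play ping-pong on the
  sectors around \<open>1\<close>, which forces the functional to be concentrated near \<open>1\<close>.

  By density of \<open>\<int>\<^sup>2\<close> in \<open>\<int>\<^sub>p\<^sup>2\<close> and Fubini, for some \<open>k\<close> the equation \<open>F (k, x + p\<^sup>i \<tau>) = F (k, x) \<sigma> \<tau>\<close> holds for
  most \<open>(x, \<tau>)\<close>. This corrects \<open>\<sigma>\<close> to a continuous homomorphism from \<open>\<int>\<^sub>p\<^sup>2\<close> to \<open>PSL\<^sub>n(\<int>\<^sub>q)\<close>; the target has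
  an open pro-\<open>q\<close> subgroup and \<open>p \<noteq> q\<close>, so \<open>\<sigma>\<close> is trivial on an open subgroup. Hence \<open>F (k, \<cdot>)\<close> has an
  uncountable fibre, a contradiction.
\<close>

text \<open>The interpretation of \<open>(int, \<le>)\<close> as a lattice declares order rules for \<^typ>\<open>int\<close> to the classical
  reasoner on which proof search for integer goals diverges.\<close>

declare int.le_antisym [rule del] int.le_cong_l [rule del] int.le_cong_r [rule del]
  int.weak_refl [rule del, simp del]

section \<open>Coloured lattice points and trigonometric sums\<close>

text \<open>The obstacle is accumulation of errors: \<open>D\<close> is unchanged by each generator
  only up to a small probability, and along words of growing length these errors add up without
  bound. The block has size 3 because the source must contain shears acting on Z^2 by automorphisms;
  with them an error at the generators controls all of Z^2 at once. No spectral measure is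
  constructed for this. The values of \<open>D\<close> along an orbit colour a large box of lattice
  points, the squared exponential sums of the colour classes form a nonnegative density on the
  torus, and sums over a finite grid of torsion points integrate it exactly. The functional is the
  limit of the expected averages as the box grows, and almost invariance comes from comparing two
  colourings that rarely differ. In \<open>s = 5 * p\<close> the factor \<open>p\<close> keeps
  matrices of the form \<open>1 + p k\<close> in that form, and the factor 5 separates the sheared
  sectors.\<close>

definition torus :: "(complex \<times> complex) set" where
  "torus = {x. norm (fst x) = 1 \<and> norm (snd x) = 1}"

definition chr :: "int \<times> int \<Rightarrow> complex \<times> complex \<Rightarrow> complex" where
  "chr a x = fst x powi fst a * snd x powi snd a"

definition trig :: "(complex \<times> (int \<times> int)) list \<Rightarrow> complex \<times> complex \<Rightarrow> complex" where
  "trig ps x = (\<Sum>(c, a)\<leftarrow>ps. c * chr a x)"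

lemma chr_add:
  assumes "x \<in> torus"
  shows "chr (a + b) x = chr a x * chr b x"
proof -
  have "fst x \<noteq> 0" "snd x \<noteq> 0" using assms by (auto simp: torus_def)
  then show ?thesis by (simp add: chr_def power_int_add)
qed

lemma cnj_chr:
  assumes "x \<in> torus"
  shows "cnj (chr a x) = chr (- a) x"
proof -
  have *: "cnj (z powi n) = z powi (- n)" if "norm z = 1" for z :: complex and n
  proof -
    have "cnj z = inverse z"
      using that by (metis complex_div_cnj divide_inverse mult_1_left of_real_1 power_one div_by_1
          norm_one)
    then show ?thesis
      by (cases n rule: int_cases2) (simp_all add: power_int_minus power_inverse power_int_def)
  qed
  show ?thesis using assms unfolding chr_def torus_def complex_cnj_mult by (simp only: * mem_Collect_eq fst_uminus snd_uminus)
qed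

lemma norm_chr: "x \<in> torus \<Longrightarrow> norm (chr a x) = 1"
  by (simp add: chr_def torus_def norm_mult norm_power_int)

text \<open>The torsion points of order dividing \<open>M\<close>. Averaging over them integrates
  exactly every trigonometric polynomial whose exponents are below \<open>M\<close> in absolute
  value, so finite sums replace integrals over the torus.\<close>

definition grid_point :: "nat \<Rightarrow> nat \<times> nat \<Rightarrow> complex \<times> complex" where
  "grid_point M j = (cis (2 * pi * real (fst j) / real M), cis (2 * pi * real (snd j) / real M))"

definition grid_sum :: "nat \<Rightarrow> (complex \<times> complex \<Rightarrow> 'a::real_vector) \<Rightarrow> 'a" where
  "grid_sum M f = (\<Sum>j\<in>{..<M} \<times> {..<M}. f (grid_point M j))"

lemma grid_point_torus: "grid_point M j \<in> torus"
  by (simp add: grid_point_def torus_def)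

lemma sum_cis_powi:
  fixes r :: int
  assumes "\<bar>r\<bar> < int M"
  shows "(\<Sum>j<M. cis (2 * pi * real j / real M) powi r) = (if r = 0 then of_nat M else 0)"
proof (cases "r = 0")
  case False
  have M: "M > 0" using assms by linarith
  define \<zeta> where "\<zeta> = cis (2 * pi * of_int r / real M)"
  have eq: "cis (2 * pi * real j / real M) powi r = \<zeta> ^ j" for j
    by (simp add: \<zeta>_def cis_power_int Complex.DeMoivre mult_ac)
  have "\<zeta> ^ M = cis (2 * pi * of_int r)"
    using M by (simp add: \<zeta>_def Complex.DeMoivre)
  then have 1: "\<zeta> ^ M = 1" by (simp add: cis_multiple_2pi)
  have "\<zeta> \<noteq> 1"
  proof
    assume "\<zeta> = 1"
    then have "cos (2 * pi * of_int r / real M) = 1"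
      by (metis \<zeta>_def cis.sel(1) one_complex.sel(1))
    then obtain n :: int where n: "2 * pi * of_int r / real M = of_int n * 2 * pi"
      by (auto simp: cos_one_2pi_int)
    then have "real_of_int r = of_int n * real M" using M by (simp add: field_simps)
    then have "r = n * int M" by (metis of_int_eq_iff of_int_mult of_int_of_nat_eq)
    then have "\<bar>r\<bar> = \<bar>n\<bar> * int M" by (simp add: abs_mult)
    moreover have "\<bar>n\<bar> \<ge> 1" using False \<open>r = n * int M\<close> by auto
    ultimately show False using assms mult_right_mono[of 1 "\<bar>n\<bar>" "int M"] by simp
  qed
  then have "(\<Sum>j<M. \<zeta> ^ j) = 0" using 1 by (simp add: sum_gp_strict)
  then show ?thesis using False by (simp add: eq)
qed simp

lemma grid_sum_chr:
  assumes "\<bar>fst a\<bar> < int M" "\<bar>snd a\<bar> < int M"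
  shows "grid_sum M (chr a) = (if a = 0 then of_nat (M\<^sup>2) else 0)"
proof -
  have "grid_sum M (chr a) = (\<Sum>j<M. cis (2 * pi * real j / real M) powi fst a) *
     (\<Sum>j<M. cis (2 * pi * real j / real M) powi snd a)"
    by (simp add: grid_sum_def chr_def grid_point_def sum_product sum.cartesian_product
        case_prod_beta)
  then show ?thesis
    using assms by (simp add: sum_cis_powi power2_eq_square prod_eq_iff)
qed

lemma norm_sum_chr_squared:
  assumes "x \<in> torus"
  shows "complex_of_real ((norm (\<Sum>a\<in>B. of_real (r a) * chr a x))\<^sup>2) =
    (\<Sum>a\<in>B. \<Sum>b\<in>B. of_real (r a * r b) * chr (a - b) x)"
proof -
  let ?S = "\<Sum>a\<in>B. of_real (r a) * chr a x"
  have "complex_of_real ((norm ?S)\<^sup>2) = ?S * cnj ?S"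
    by (rule complex_norm_square)
  also have "cnj ?S = (\<Sum>b\<in>B. of_real (r b) * chr (- b) x)"
    using assms by (simp add: cnj_chr)
  also have "?S * (\<Sum>b\<in>B. of_real (r b) * chr (- b) x) =
      (\<Sum>a\<in>B. \<Sum>b\<in>B. of_real (r a) * chr a x * (of_real (r b) * chr (- b) x))"
    by (simp add: sum_product)
  also have "\<dots> = (\<Sum>a\<in>B. \<Sum>b\<in>B. of_real (r a * r b) * chr (a - b) x)"
    using chr_add[OF assms, of _ "- _"] by (intro sum.cong refl) simp
  finally show ?thesis .
qed

definition sqbox :: "nat \<Rightarrow> (int \<times> int) set" where
  "sqbox N = {0..<int N} \<times> {0..<int N}"

lemma finite_sqbox [simp]: "finite (sqbox N)" and card_sqbox: "card (sqbox N) = N\<^sup>2"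
  by (simp_all add: sqbox_def power2_eq_square)

lemma box_diff:
  assumes "a \<in> sqbox N" "b \<in> sqbox N"
  shows "\<bar>fst (a - b)\<bar> < int N" "\<bar>snd (a - b)\<bar> < int N"
  using assms by (auto simp: sqbox_def)

text \<open>Differences of box points stay below \<open>N \<le> M\<close> in both coordinates, so
  the grid annihilates every term off the diagonal.\<close>

lemma grid_sum_parseval:
  assumes "N \<le> M"
  shows "grid_sum M (\<lambda>x. (norm (\<Sum>a\<in>sqbox N. of_real (r a) * chr a x))\<^sup>2) =
    real (M\<^sup>2) * (\<Sum>a\<in>sqbox N. (r a)\<^sup>2)"
proof -
  have z: "grid_sum M (chr (a - b)) = (if a = b then of_nat (M\<^sup>2) else 0)"
    if "a \<in> sqbox N" "b \<in> sqbox N" for a b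
    using box_diff[OF that] assms grid_sum_chr[of "a - b" M] by auto
  have "complex_of_real (grid_sum M (\<lambda>x. (norm (\<Sum>a\<in>sqbox N. of_real (r a) * chr a x))\<^sup>2)) =
     (\<Sum>j\<in>{..<M} \<times> {..<M}. \<Sum>a\<in>sqbox N. \<Sum>b\<in>sqbox N. of_real (r a * r b) * chr (a - b) (grid_point M j))"
    by (simp only: grid_sum_def of_real_sum norm_sum_chr_squared[OF grid_point_torus])
  also have "\<dots> = (\<Sum>a\<in>sqbox N. \<Sum>b\<in>sqbox N. of_real (r a * r b) * grid_sum M (chr (a - b)))"
    unfolding grid_sum_def sum_distrib_left
    by (subst sum.swap, rule sum.cong, rule refl, rule sum.swap)
  also have "\<dots> = (\<Sum>a\<in>sqbox N. of_real ((r a)\<^sup>2) * of_nat (M\<^sup>2))"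
    by (intro sum.cong refl) (simp add: z if_distrib cong: if_cong, simp add: power2_eq_square)
  also have "\<dots> = complex_of_real (real (M\<^sup>2) * (\<Sum>a\<in>sqbox N. (r a)\<^sup>2))"
    by (simp add: sum_distrib_left mult_ac)
  finally show ?thesis by (simp only: of_real_eq_iff)
qed

text \<open>The exponential sum over the points of the sqbox of a given colour.\<close>
definition colour_sum :: "nat \<Rightarrow> (int \<times> int \<Rightarrow> 'c) \<Rightarrow> 'c \<Rightarrow> complex \<times> complex \<Rightarrow> complex" where
  "colour_sum N d y x = (\<Sum>a\<in>sqbox N. of_real (of_bool (d a = y)) * chr a x)"

text \<open>The mean over the torus of \<open>chr u\<close> against the density formed by the
  squared norms of all colour sums; see \<open>grid_sum_trig\<close>.\<close>

definition mono_pairs :: "nat \<Rightarrow> (int \<times> int \<Rightarrow> 'c) \<Rightarrow> int \<times> int \<Rightarrow> real" where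
  "mono_pairs N d u = (\<Sum>a\<in>sqbox N. \<Sum>b\<in>sqbox N. of_bool (d a = d b \<and> b - a = u))"

lemma sum_colour_sum_squared:
  assumes x: "x \<in> torus" and Y: "finite Y" "d ` sqbox N \<subseteq> Y"
  shows "complex_of_real (\<Sum>y\<in>Y. (norm (colour_sum N d y x))\<^sup>2) =
    (\<Sum>a\<in>sqbox N. \<Sum>b\<in>sqbox N. of_bool (d a = d b) * chr (a - b) x)"
proof -
  have "complex_of_real (\<Sum>y\<in>Y. (norm (colour_sum N d y x))\<^sup>2) =
    (\<Sum>y\<in>Y. \<Sum>a\<in>sqbox N. \<Sum>b\<in>sqbox N.
      of_real (of_bool (d a = y) * of_bool (d b = y)) * chr (a - b) x)"
    by (simp only: of_real_sum colour_sum_def norm_sum_chr_squared[OF x])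
  also have "\<dots> = (\<Sum>a\<in>sqbox N. \<Sum>b\<in>sqbox N. \<Sum>y\<in>Y.
      of_real (of_bool (d a = y) * of_bool (d b = y)) * chr (a - b) x)"
    by (subst sum.swap, rule sum.cong, rule refl, rule sum.swap)
  also have "\<dots> = (\<Sum>a\<in>sqbox N. \<Sum>b\<in>sqbox N. of_bool (d a = d b) * chr (a - b) x)"
  proof (intro sum.cong refl)
    fix a b assume ab: "a \<in> sqbox N" "b \<in> sqbox N"
    have "(\<Sum>y\<in>Y. complex_of_real (of_bool (d a = y) * of_bool (d b = y)) * chr (a - b) x) =
       (\<Sum>y\<in>Y. if y = d a then of_bool (d a = d b) * chr (a - b) x else 0)"
      by (intro sum.cong) auto
    then show "(\<Sum>y\<in>Y. complex_of_real (of_bool (d a = y) * of_bool (d b = y)) * chr (a - b) x) =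
       of_bool (d a = d b) * chr (a - b) x"
      using Y ab by auto
  qed
  finally show ?thesis .
qed

lemma sum_list_swap: "(\<Sum>x\<leftarrow>xs. \<Sum>a\<in>A. f x a) = (\<Sum>a\<in>A. \<Sum>x\<leftarrow>xs. f x a)"
  by (induction xs) (simp_all add: sum.distrib)

lemma complex_of_bool: "complex_of_real (of_bool b) = of_bool b"
  by (cases b) auto

text \<open>Turns pair counts into integrals against a density. Two colourings are treated together
  so that the same grid serves both when they are compared in
  \<open>mono_pairs_diff\<close>.\<close>

lemma grid_sum_trig:
  assumes Y: "finite Y" "d ` sqbox N \<subseteq> Y" "d' ` sqbox N \<subseteq> Y"
  obtains M where "M > 0" "M \<ge> N"
    "grid_sum M (\<lambda>x. of_real (\<Sum>y\<in>Y. (norm (colour_sum N d y x))\<^sup>2) * trig ps x) =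
      of_nat (M\<^sup>2) * (\<Sum>(c, u)\<leftarrow>ps. c * of_real (mono_pairs N d u))"
    "grid_sum M (\<lambda>x. of_real (\<Sum>y\<in>Y. (norm (colour_sum N d' y x))\<^sup>2) * trig ps x) =
      of_nat (M\<^sup>2) * (\<Sum>(c, u)\<leftarrow>ps. c * of_real (mono_pairs N d' u))"
proof -
  define R where "R = (\<Sum>(c, u)\<leftarrow>ps. nat (\<bar>fst u\<bar> + \<bar>snd u\<bar>))"
  \<comment> \<open>The density has exponents below \<open>N\<close> and \<open>trig ps\<close> has
    exponents of size at most \<open>R\<close>, so all exponents of the product stay below
    \<open>M\<close>.\<close>
  define M where "M = N + R + 1"
  have R: "\<bar>fst u\<bar> + \<bar>snd u\<bar> \<le> int R" if "(c, u) \<in> set ps" for c u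
  proof -
    have "nat (\<bar>fst u\<bar> + \<bar>snd u\<bar>) \<le> R"
      unfolding R_def using that by (intro member_le_sum_list) (force, simp)
    then show ?thesis by linarith
  qed
  have main: "grid_sum M (\<lambda>x. of_real (\<Sum>y\<in>Y. (norm (colour_sum N e y x))\<^sup>2) * trig ps x) =
      of_nat (M\<^sup>2) * (\<Sum>(c, u)\<leftarrow>ps. c * of_real (mono_pairs N e u))"
    if e: "e ` sqbox N \<subseteq> Y" for e :: "int \<times> int \<Rightarrow> 'a"
  proof -
    have z: "grid_sum M (chr (a - b + u)) = of_nat (M\<^sup>2) * of_bool (b - a = u)"
      if "a \<in> sqbox N" "b \<in> sqbox N" "(c, u) \<in> set ps" for a b c u
    proof -
      have "\<bar>fst (a - b + u)\<bar> < int M" "\<bar>snd (a - b + u)\<bar> < int M"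
        using box_diff[OF that(1,2)] R[OF that(3)] unfolding M_def by auto
      then have "grid_sum M (chr (a - b + u)) = (if a - b + u = 0 then of_nat (M\<^sup>2) else 0)"
        by (rule grid_sum_chr)
      moreover have "a - b + u = 0 \<longleftrightarrow> b - a = u" by (auto simp: algebra_simps)
      ultimately show ?thesis by simp
    qed
    have "grid_sum M (\<lambda>x. of_real (\<Sum>y\<in>Y. (norm (colour_sum N e y x))\<^sup>2) * trig ps x) =
      (\<Sum>j\<in>{..<M} \<times> {..<M}. \<Sum>a\<in>sqbox N. \<Sum>b\<in>sqbox N. \<Sum>(c, u)\<leftarrow>ps.
         of_bool (e a = e b) * c * chr (a - b + u) (grid_point M j))"
      unfolding grid_sum_def
    proof (intro sum.cong refl)
      fix j
      have "of_real (\<Sum>y\<in>Y. (norm (colour_sum N e y (grid_point M j)))\<^sup>2) * trig ps (grid_point M j)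
        = (\<Sum>a\<in>sqbox N. \<Sum>b\<in>sqbox N. of_bool (e a = e b) * chr (a - b) (grid_point M j) *
            trig ps (grid_point M j))"
        by (simp only: sum_colour_sum_squared[OF grid_point_torus Y(1) e] sum_distrib_right)
      also have "\<dots> = (\<Sum>a\<in>sqbox N. \<Sum>b\<in>sqbox N. \<Sum>(c, u)\<leftarrow>ps.
         of_bool (e a = e b) * c * chr (a - b + u) (grid_point M j))"
        by (intro sum.cong refl)
          (simp only: trig_def sum_list_const_mult[symmetric] chr_add[OF grid_point_torus]
            case_prod_unfold mult_ac)
      finally show "of_real (\<Sum>y\<in>Y. (norm (colour_sum N e y (grid_point M j)))\<^sup>2) * trig ps (grid_point M j)
        = \<dots>" .
    qed
    also have "\<dots> = (\<Sum>a\<in>sqbox N. \<Sum>b\<in>sqbox N. \<Sum>(c, u)\<leftarrow>ps.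
         of_bool (e a = e b) * c * grid_sum M (chr (a - b + u)))"
      unfolding grid_sum_def sum_distrib_left case_prod_unfold sum_list_swap
      by (subst sum.swap, rule sum.cong, rule refl, rule sum.swap)
    also have "\<dots> = (\<Sum>a\<in>sqbox N. \<Sum>b\<in>sqbox N. \<Sum>(c, u)\<leftarrow>ps.
         of_nat (M\<^sup>2) * (c * of_bool (e a = e b \<and> b - a = u)))"
    proof -
      have "of_bool (e a = e b) * c * grid_sum M (chr (a - b + u)) =
          of_nat (M\<^sup>2) * (c * of_bool (e a = e b \<and> b - a = u))"
        if "a \<in> sqbox N" "b \<in> sqbox N" "(c, u) \<in> set ps" for a b c u
        unfolding z[OF that] by simp
      then show ?thesis
        by (intro sum.cong refl arg_cong[where f = sum_list] map_cong)
          (simp only: case_prod_unfold prod.collapse)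
    qed
    also have "\<dots> = of_nat (M\<^sup>2) * (\<Sum>(c, u)\<leftarrow>ps. c * of_real (mono_pairs N e u))"
      unfolding mono_pairs_def of_real_sum complex_of_bool sum_distrib_left case_prod_unfold
        sum_list_const_mult[symmetric] sum_list_swap by (rule refl)
    finally show ?thesis .
  qed
  show thesis
    by (rule that[OF _ _ main[OF Y(2)] main[OF Y(3)]]) (simp_all add: M_def)
qed

text \<open>The expression is the mean of a nonnegative density times a function with nonnegative
  real part.\<close>

lemma mono_pairs_nonneg:
  assumes "\<And>x. x \<in> torus \<Longrightarrow> Re (trig ps x) \<ge> 0"
  shows "Re (\<Sum>(c, u)\<leftarrow>ps. c * of_real (mono_pairs N d u)) \<ge> 0"
proof -
  obtain M where M: "M > 0" "grid_sum M (\<lambda>x. of_real (\<Sum>y\<in>d ` sqbox N. (norm (colour_sum N d y x))\<^sup>2) * trig ps x) =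
      of_nat (M\<^sup>2) * (\<Sum>(c, u)\<leftarrow>ps. c * of_real (mono_pairs N d u))"
    using grid_sum_trig[of "d ` sqbox N" d N d ps] by auto
  have "Re (grid_sum M (\<lambda>x. of_real (\<Sum>y\<in>d ` sqbox N. (norm (colour_sum N d y x))\<^sup>2) * trig ps x)) \<ge> 0"
    unfolding grid_sum_def Re_sum
    by (intro sum_nonneg) (simp add: assms grid_point_torus sum_nonneg)
  then have "0 \<le> real (M\<^sup>2) * Re (\<Sum>(c, u)\<leftarrow>ps. c * of_real (mono_pairs N d u))"
    unfolding M(2) by simp
  then show ?thesis using M(1) by (simp add: zero_le_mult_iff)
qed

text \<open>Colourings that differ at few points have densities that are close in L^1: the
  difference of two squared norms is bounded by the product of the norms of difference and sum, this
  product is split with weight \<open>\<eta>\<close>, and Parseval evaluates both halves.\<close>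

lemma mono_pairs_diff:
  fixes d d' :: "int \<times> int \<Rightarrow> 'c"
  assumes K: "\<And>x. x \<in> torus \<Longrightarrow> \<bar>Re (trig ps x)\<bar> \<le> K" and \<eta>: "\<eta> > 0"
  shows "\<bar>Re (\<Sum>(c, u)\<leftarrow>ps. c * of_real (mono_pairs N d u)) -
      Re (\<Sum>(c, u)\<leftarrow>ps. c * of_real (mono_pairs N d' u))\<bar> \<le>
    K * ((\<Sum>a\<in>sqbox N. of_bool (d a \<noteq> d' a)) / \<eta> + 2 * \<eta> * real (N\<^sup>2))"
proof -
  define Y where "Y = d ` sqbox N \<union> d' ` sqbox N"
  have Y: "finite Y" "d ` sqbox N \<subseteq> Y" "d' ` sqbox N \<subseteq> Y" by (auto simp: Y_def)
  obtain M where M: "M > 0" "M \<ge> N" "grid_sum M (\<lambda>x. of_real (\<Sum>y\<in>Y. (norm (colour_sum N d y x))\<^sup>2) * trig ps x) =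
      of_nat (M\<^sup>2) * (\<Sum>(c, u)\<leftarrow>ps. c * of_real (mono_pairs N d u))"
      "grid_sum M (\<lambda>x. of_real (\<Sum>y\<in>Y. (norm (colour_sum N d' y x))\<^sup>2) * trig ps x) =
      of_nat (M\<^sup>2) * (\<Sum>(c, u)\<leftarrow>ps. c * of_real (mono_pairs N d' u))"
    by (rule grid_sum_trig[OF Y, of ps])
  have re: "Re (of_nat (M\<^sup>2) * w) = real (M\<^sup>2) * Re w" for w
    by simp
  have K0: "K \<ge> 0" using K[OF grid_point_torus[of M "(0,0)"]] by linarith
  let ?S = "colour_sum N d" and ?S' = "colour_sum N d'"
  define r1 where "r1 y a = of_bool (d a = y) - (of_bool (d' a = y) :: real)" for y a
  define r2 where "r2 y a = of_bool (d a = y) + (of_bool (d' a = y) :: real)" for y a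
  have S1: "?S y x - ?S' y x = (\<Sum>a\<in>sqbox N. of_real (r1 y a) * chr a x)" for x y
    by (simp add: colour_sum_def r1_def sum_subtractf[symmetric] algebra_simps)
  have S2: "?S y x + ?S' y x = (\<Sum>a\<in>sqbox N. of_real (r2 y a) * chr a x)" for x y
    by (simp add: colour_sum_def r2_def sum.distrib[symmetric] algebra_simps)
  \<comment> \<open>The weight \<open>\<eta>\<close> makes the rare difference term expensive and
    the bounded sum term cheap; it is optimised in \<open>L_almost_invariant\<close>.\<close>
  have pt: "\<bar>(norm (?S y x))\<^sup>2 - (norm (?S' y x))\<^sup>2\<bar> \<le>
      (norm (?S y x - ?S' y x))\<^sup>2 / (2 * \<eta>) + \<eta> / 2 * (norm (?S y x + ?S' y x))\<^sup>2" for x y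
  proof -
    let ?u = "norm (?S y x - ?S' y x)" and ?v = "norm (?S y x + ?S' y x)"
    have "(norm (?S y x))\<^sup>2 - (norm (?S' y x))\<^sup>2 = Re ((?S y x - ?S' y x) * cnj (?S y x + ?S' y x))"
      unfolding cmod_power2 by (simp add: power2_eq_square algebra_simps)
    then have "\<bar>(norm (?S y x))\<^sup>2 - (norm (?S' y x))\<^sup>2\<bar> \<le> ?u * ?v"
      by (metis abs_Re_le_cmod complex_mod_cnj norm_mult)
    also have "?u * ?v \<le> ?u\<^sup>2 / (2 * \<eta>) + \<eta> / 2 * ?v\<^sup>2"
    proof -
      have "0 \<le> (?u - \<eta> * ?v)\<^sup>2 / (2 * \<eta>)" using \<eta> by simp
      also have "(?u - \<eta> * ?v)\<^sup>2 / (2 * \<eta>) = ?u\<^sup>2 / (2 * \<eta>) + \<eta> / 2 * ?v\<^sup>2 - ?u * ?v"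
        using \<eta> by (simp add: power2_eq_square field_simps)
      finally show ?thesis by linarith
    qed
    finally show ?thesis .
  qed
  have P: "grid_sum M (\<lambda>x. \<Sum>y\<in>Y. (norm (\<Sum>a\<in>sqbox N. of_real (r y a) * chr a x))\<^sup>2) =
     real (M\<^sup>2) * (\<Sum>a\<in>sqbox N. \<Sum>y\<in>Y. (r y a)\<^sup>2)" for r :: "'c \<Rightarrow> int \<times> int \<Rightarrow> real"
  proof -
    have "grid_sum M (\<lambda>x. \<Sum>y\<in>Y. (norm (\<Sum>a\<in>sqbox N. of_real (r y a) * chr a x))\<^sup>2) =
      (\<Sum>y\<in>Y. grid_sum M (\<lambda>x. (norm (\<Sum>a\<in>sqbox N. of_real (r y a) * chr a x))\<^sup>2))"
      unfolding grid_sum_def by (rule sum.swap)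
    also have "\<dots> = real (M\<^sup>2) * (\<Sum>y\<in>Y. \<Sum>a\<in>sqbox N. (r y a)\<^sup>2)"
      by (simp only: grid_sum_parseval[OF M(2)] sum_distrib_left)
    finally show ?thesis by (subst sum.swap)
  qed
  have r1: "(\<Sum>y\<in>Y. (r1 y a)\<^sup>2) = 2 * of_bool (d a \<noteq> d' a)" if a: "a \<in> sqbox N" for a
  proof (cases "d a = d' a")
    case False
    have "(\<Sum>y\<in>Y. (r1 y a)\<^sup>2) = (\<Sum>y\<in>Y. (if y = d a then 1 else 0) + (if y = d' a then 1 else 0))"
      using False by (intro sum.cong) (auto simp: r1_def)
    also have "\<dots> = 2" using Y a by (subst sum.distrib) auto
    finally show ?thesis using False by simp
  qed (simp add: r1_def)
  have r2: "(\<Sum>y\<in>Y. (r2 y a)\<^sup>2) \<le> 4" if a: "a \<in> sqbox N" for a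
  proof -
    have "(\<Sum>y\<in>Y. (r2 y a)\<^sup>2) \<le> (\<Sum>y\<in>Y. (if y = d a then 2 else 0) + (if y = d' a then 2 else 0))"
      by (intro sum_mono) (auto simp: r2_def)
    also have "\<dots> = 4" using Y a by (subst sum.distrib) auto
    finally show ?thesis .
  qed
  have "real (M\<^sup>2) * \<bar>Re (\<Sum>(c, u)\<leftarrow>ps. c * of_real (mono_pairs N d u)) -
      Re (\<Sum>(c, u)\<leftarrow>ps. c * of_real (mono_pairs N d' u))\<bar> =
    \<bar>Re (grid_sum M (\<lambda>x. of_real (\<Sum>y\<in>Y. (norm (?S y x))\<^sup>2) * trig ps x)) -
      Re (grid_sum M (\<lambda>x. of_real (\<Sum>y\<in>Y. (norm (?S' y x))\<^sup>2) * trig ps x))\<bar>"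
    unfolding M(3,4) re by (simp add: abs_mult flip: right_diff_distrib)
  also have "\<dots> = \<bar>grid_sum M (\<lambda>x. (\<Sum>y\<in>Y. (norm (?S y x))\<^sup>2 - (norm (?S' y x))\<^sup>2) * Re (trig ps x))\<bar>"
  proof -
    have *: "Re (complex_of_real r * w) = r * Re w" for r w by simp
    show ?thesis
      by (simp only: grid_sum_def Re_sum * sum_subtractf[symmetric] left_diff_distrib[symmetric])
  qed
  also have "\<dots> \<le> grid_sum M (\<lambda>x. (\<Sum>y\<in>Y. (norm (?S y x - ?S' y x))\<^sup>2 / (2 * \<eta>) +
        \<eta> / 2 * (norm (?S y x + ?S' y x))\<^sup>2) * K)"
    unfolding grid_sum_def
  proof (rule order_trans[OF sum_abs], rule sum_mono)
    fix j
    let ?x = "grid_point M j"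
    have "\<bar>\<Sum>y\<in>Y. (norm (?S y ?x))\<^sup>2 - (norm (?S' y ?x))\<^sup>2\<bar> \<le>
       (\<Sum>y\<in>Y. (norm (?S y ?x - ?S' y ?x))\<^sup>2 / (2 * \<eta>) + \<eta> / 2 * (norm (?S y ?x + ?S' y ?x))\<^sup>2)"
      by (rule order_trans[OF sum_abs sum_mono]) (rule pt)
    then show "\<bar>(\<Sum>y\<in>Y. (norm (?S y ?x))\<^sup>2 - (norm (?S' y ?x))\<^sup>2) * Re (trig ps ?x)\<bar> \<le>
       (\<Sum>y\<in>Y. (norm (?S y ?x - ?S' y ?x))\<^sup>2 / (2 * \<eta>) + \<eta> / 2 * (norm (?S y ?x + ?S' y ?x))\<^sup>2) * K"
      unfolding abs_mult by (intro mult_mono K grid_point_torus) auto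
  qed
  also have "\<dots> = K * (grid_sum M (\<lambda>x. \<Sum>y\<in>Y. (norm (?S y x - ?S' y x))\<^sup>2) / (2 * \<eta>) +
     \<eta> / 2 * grid_sum M (\<lambda>x. \<Sum>y\<in>Y. (norm (?S y x + ?S' y x))\<^sup>2))"
    unfolding grid_sum_def sum.distrib sum_distrib_left sum_divide_distrib sum_distrib_right
      distrib_left distrib_right by (simp add: mult_ac)
  also have "\<dots> = K * (real (M\<^sup>2) * (\<Sum>a\<in>sqbox N. \<Sum>y\<in>Y. (r1 y a)\<^sup>2) / (2 * \<eta>) +
     \<eta> / 2 * (real (M\<^sup>2) * (\<Sum>a\<in>sqbox N. \<Sum>y\<in>Y. (r2 y a)\<^sup>2)))"
    unfolding S1 S2 P by simp
  also have "\<dots> \<le> K * (real (M\<^sup>2) * (\<Sum>a\<in>sqbox N. 2 * of_bool (d a \<noteq> d' a)) / (2 * \<eta>) +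
     \<eta> / 2 * (real (M\<^sup>2) * (\<Sum>a\<in>sqbox N. 4)))"
    using K0 \<eta> by (intro mult_left_mono add_mono sum_mono divide_right_mono) (auto simp: r1 r2)
  also have "\<dots> = real (M\<^sup>2) * (K * ((\<Sum>a\<in>sqbox N. of_bool (d a \<noteq> d' a)) / \<eta> + 2 * \<eta> * real (N\<^sup>2)))"
    unfolding sum_distrib_left[symmetric] sum_constant card_sqbox using \<eta> by (simp add: field_simps)
  finally show ?thesis
    using M(1) by (simp add: mult_le_cancel_left_pos)
qed

lemma trig_Nil [simp]: "trig [] x = 0"
  and trig_Cons [simp]: "trig ((c, a) # ps) x = c * chr a x + trig ps x"
  and trig_append [simp]: "trig (ps @ qs) x = trig ps x + trig qs x"
  by (simp_all add: trig_def)

section \<open>Measure-preserving maps and limits over growing boxes\<close>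

definition mpt :: "'a measure \<Rightarrow> ('a \<Rightarrow> 'a) \<Rightarrow> bool" where
  "mpt M f \<longleftrightarrow> f \<in> M \<rightarrow>\<^sub>M M \<and> distr M M f = M"

lemma mpt_measurable: "mpt M f \<Longrightarrow> f \<in> M \<rightarrow>\<^sub>M M"
  by (simp add: mpt_def)

lemma mpt_measure:
  assumes "mpt M f" "{x \<in> space M. P x} \<in> sets M"
  shows "measure M {x \<in> space M. P (f x)} = measure M {x \<in> space M. P x}"
proof -
  have "measure M {x \<in> space M. P x} = measure (distr M M f) {x \<in> space M. P x}"
    using assms by (simp add: mpt_def)
  also have "\<dots> = measure M (f -` {x \<in> space M. P x} \<inter> space M)"
    using assms by (subst measure_distr) (auto simp: mpt_def)
  also have "f -` {x \<in> space M. P x} \<inter> space M = {x \<in> space M. P (f x)}"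
    using measurable_space[OF mpt_measurable[OF assms(1)]] by auto
  finally show ?thesis by simp
qed

lemma mpt_comp:
  assumes "mpt M f" "mpt M g"
  shows "mpt M (\<lambda>x. f (g x))"
proof -
  have "distr M M (f \<circ> g) = distr (distr M M g) M f"
    using assms by (subst distr_distr) (auto simp: mpt_def)
  then show ?thesis using assms by (auto simp: mpt_def comp_def)
qed

text \<open>Boxes are asymptotically invariant: for fixed \<open>u\<close> the points that leave the
  box under translation by \<open>u\<close> number at most a constant times \<open>N\<close>,
  against \<open>N^2\<close> points in total.\<close>

lemma mono_pairs_const_tendsto:
  "(\<lambda>N. mono_pairs N (\<lambda>_. ()) u / real (N\<^sup>2)) \<longlonglongrightarrow> 1"
proof -
  have eq: "mono_pairs N (\<lambda>_. ()) u = real (nat (int N - \<bar>fst u\<bar>)) * real (nat (int N - \<bar>snd u\<bar>))" for N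
  proof -
    have inner: "(\<Sum>b\<in>sqbox N. of_bool (() = () \<and> b - a = u)) = (of_bool (a + u \<in> sqbox N) :: real)"
      for a
    proof -
      have "(\<Sum>b\<in>sqbox N. of_bool (() = () \<and> b - a = u)) = (\<Sum>b\<in>sqbox N. if b = a + u then 1 else 0 :: real)"
        by (intro sum.cong) (auto simp: algebra_simps)
      then show ?thesis by simp
    qed
    have "mono_pairs N (\<lambda>_. ()) u = real (card {a \<in> sqbox N. a + u \<in> sqbox N})"
      unfolding mono_pairs_def inner by (simp add: Collect_conj_eq Int_commute)
    also have "{a \<in> sqbox N. a + u \<in> sqbox N} =
       {max 0 (- fst u)..<min (int N) (int N - fst u)} \<times> {max 0 (- snd u)..<min (int N) (int N - snd u)}"
      by (auto simp: sqbox_def mem_Times_iff)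
    also have "card \<dots> = nat (int N - \<bar>fst u\<bar>) * nat (int N - \<bar>snd u\<bar>)"
      by (simp only: card_cartesian_product card_atLeastLessThan_int)
        (intro arg_cong2[where f = "(*)"] arg_cong[where f = nat]; linarith)
    finally show ?thesis by simp
  qed
  have 1: "(\<lambda>N. real (nat (int N - \<bar>k\<bar>)) / real N) \<longlonglongrightarrow> 1" for k :: int
  proof -
    have "(\<lambda>N. 1 - real_of_int \<bar>k\<bar> / real N) \<longlonglongrightarrow> 1 - 0"
      by (intro tendsto_intros lim_const_over_n)
    moreover have "eventually (\<lambda>N. 1 - real_of_int \<bar>k\<bar> / real N = real (nat (int N - \<bar>k\<bar>)) / real N) sequentially"
      using eventually_gt_at_top[of "nat \<bar>k\<bar>"]
      by eventually_elim (auto simp: field_simps of_nat_diff nat_less_iff)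
    ultimately show ?thesis by (simp cong: filterlim_cong)
  qed
  have "(\<lambda>N. (real (nat (int N - \<bar>fst u\<bar>)) / real N) * (real (nat (int N - \<bar>snd u\<bar>)) / real N)) \<longlonglongrightarrow> 1 * 1"
    by (intro tendsto_intros 1)
  then show ?thesis unfolding eq by (simp add: power2_eq_square)
qed

lemma Re_sum_list_of_real:
  "Re (\<Sum>(c, u)\<leftarrow>ps. c * complex_of_real (r u)) = (\<Sum>(c, u)\<leftarrow>ps. Re c * r u)"
  by (induction ps) auto

lemma tendsto_sum_list:
  fixes f :: "'a \<Rightarrow> 'b \<Rightarrow> real"
  assumes "\<And>x. x \<in> set xs \<Longrightarrow> ((\<lambda>n. f n x) \<longlongrightarrow> l x) F"
  shows "((\<lambda>n. \<Sum>x\<leftarrow>xs. f n x) \<longlongrightarrow> (\<Sum>x\<leftarrow>xs. l x)) F"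
  using assms by (induction xs) (auto intro!: tendsto_intros)

lemma integral_sum_list:
  fixes f :: "'a \<Rightarrow> 'b \<Rightarrow> real"
  assumes "\<And>x. x \<in> set xs \<Longrightarrow> integrable M (f x)"
  shows "integrable M (\<lambda>w. \<Sum>x\<leftarrow>xs. f x w)" "(\<integral>w. (\<Sum>x\<leftarrow>xs. f x w) \<partial>M) = (\<Sum>x\<leftarrow>xs. \<integral>w. f x w \<partial>M)"
  using assms by (induction xs) auto

section \<open>Relative rigidity\<close>

text \<open>The colours carry no sigma-algebra. Everything is expressed by events that two colours
  agree, and \<open>sets_eq\<close> provides their measurability.\<close>

locale coloured_action = prob_space M for M :: "'w measure" +
  fixes T :: "int \<times> int \<Rightarrow> 'w \<Rightarrow> 'w" and D :: "'w \<Rightarrow> 'c"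
  assumes mpt_T: "mpt M (T a)"
    and T_add: "\<omega> \<in> space M \<Longrightarrow> T (a + b) \<omega> = T a (T b \<omega>)"
    and T_zero: "\<omega> \<in> space M \<Longrightarrow> T 0 \<omega> = \<omega>"
    and sets_eq: "f \<in> M \<rightarrow>\<^sub>M M \<Longrightarrow> g \<in> M \<rightarrow>\<^sub>M M \<Longrightarrow> {\<omega> \<in> space M. D (f \<omega>) = D (g \<omega>)} \<in> sets M"
begin

definition \<phi> :: "int \<times> int \<Rightarrow> real" where
  "\<phi> a = prob {\<omega> \<in> space M. D (T a \<omega>) = D \<omega>}"

text \<open>In terms of Bochner's theorem, the integral of \<open>Re (trig ps)\<close> against the
  probability measure on the torus with Fourier transform \<open>\<phi>\<close>. Real parts of the
  coefficients suffice because \<open>\<phi>\<close> is real.\<close>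

definition L :: "(complex \<times> (int \<times> int)) list \<Rightarrow> real" where
  "L ps = (\<Sum>(c, u)\<leftarrow>ps. Re c * \<phi> u)"

lemma L_Nil [simp]: "L [] = 0"
  and L_Cons [simp]: "L ((c, a) # ps) = Re c * \<phi> a + L ps"
  and L_append [simp]: "L (ps @ qs) = L ps + L qs"
  by (simp_all add: L_def)

lemma id_measurable: "(\<lambda>\<omega>. \<omega>) \<in> M \<rightarrow>\<^sub>M M" by simp

lemma prob_T_eq: "prob {\<omega> \<in> space M. D (T a \<omega>) = D (T b \<omega>)} = \<phi> (b - a)"
proof -
  have "prob {\<omega> \<in> space M. D (T a \<omega>) = D (T b \<omega>)} =
    prob {\<omega> \<in> space M. D (T (b - a) (T a \<omega>)) = D (T a \<omega>)}"
    by (intro arg_cong[where f = prob] Collect_cong) (auto simp: T_add[symmetric])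
  also have "\<dots> = \<phi> (b - a)"
    unfolding \<phi>_def
    by (rule mpt_measure[OF mpt_T, where P = "\<lambda>\<omega>. D (T (b - a) \<omega>) = D \<omega>"],
        rule sets_eq[OF mpt_measurable[OF mpt_T] id_measurable])
  finally show ?thesis .
qed

lemma phi_zero [simp]: "\<phi> 0 = 1"
proof -
  have "{\<omega> \<in> space M. D (T 0 \<omega>) = D \<omega>} = space M" by (auto simp: T_zero)
  then show ?thesis by (simp add: \<phi>_def prob_space)
qed

lemma phi_minus: "\<phi> (- a) = \<phi> a"
  using prob_T_eq[of a 0] prob_T_eq[of 0 a] by (simp add: eq_commute)

lemma integral_of_bool:
  assumes "{\<omega> \<in> space M. P \<omega>} \<in> sets M"
  shows "integrable M (\<lambda>\<omega>. of_bool (P \<omega>) :: real)"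
    and "(\<integral>\<omega>. of_bool (P \<omega>) \<partial>M) = (prob {\<omega> \<in> space M. P \<omega>} :: real)"
proof -
  have eq: "of_bool (P \<omega>) = (indicator {\<omega> \<in> space M. P \<omega>} \<omega> :: real)" if "\<omega> \<in> space M" for \<omega>
    using that by (auto simp: indicator_def)
  have "integrable M (\<lambda>\<omega>. of_bool (P \<omega>) :: real) \<longleftrightarrow>
     integrable M (indicator {\<omega> \<in> space M. P \<omega>} :: _ \<Rightarrow> real)"
    by (intro Bochner_Integration.integrable_cong refl eq)
  then show "integrable M (\<lambda>\<omega>. of_bool (P \<omega>) :: real)"
    using assms by (simp add: emeasure_eq_measure)
  have "(\<integral>\<omega>. of_bool (P \<omega>) \<partial>M) = (\<integral>\<omega>. indicator {\<omega> \<in> space M. P \<omega>} \<omega> \<partial>M :: real)"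
    by (intro Bochner_Integration.integral_cong refl eq)
  moreover have "{\<omega> \<in> space M. P \<omega>} \<inter> space M = {\<omega> \<in> space M. P \<omega>}" by auto
  ultimately show "(\<integral>\<omega>. of_bool (P \<omega>) \<partial>M) = prob {\<omega> \<in> space M. P \<omega>}"
    by simp
qed

text \<open>Stated for general \<open>f\<close> and \<open>\<psi>\<close> because it is applied both
  to \<open>T\<close> and to \<open>h\<close> composed with \<open>T\<close>, whose pair
  probabilities differ by the automorphism \<open>\<gamma>\<close>.\<close>

lemma integral_mono_pairs:
  assumes meas: "\<And>a. f a \<in> M \<rightarrow>\<^sub>M M"
    and eq: "\<And>a b. prob {\<omega> \<in> space M. D (f a \<omega>) = D (f b \<omega>)} = \<psi> (b - a)"
  shows "integrable M (\<lambda>\<omega>. mono_pairs N (\<lambda>a. D (f a \<omega>)) u)"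
    and "(\<integral>\<omega>. mono_pairs N (\<lambda>a. D (f a \<omega>)) u \<partial>M) = \<psi> u * mono_pairs N (\<lambda>_. ()) u"
proof -
  note ib = integral_of_bool[OF sets_eq[OF meas meas]]
  have c: "of_bool (D (f a \<omega>) = D (f b \<omega>) \<and> b - a = u) =
      (of_bool (b - a = u) * of_bool (D (f a \<omega>) = D (f b \<omega>)) :: real)" for a b \<omega>
    by auto
  show "integrable M (\<lambda>\<omega>. mono_pairs N (\<lambda>a. D (f a \<omega>)) u)"
    unfolding mono_pairs_def c
    by (intro Bochner_Integration.integrable_sum integrable_mult_right ib)
  have "(\<integral>\<omega>. mono_pairs N (\<lambda>a. D (f a \<omega>)) u \<partial>M) =
     (\<Sum>a\<in>sqbox N. \<Sum>b\<in>sqbox N. of_bool (b - a = u) * \<psi> (b - a))"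
    unfolding mono_pairs_def c
    by (subst Bochner_Integration.integral_sum, intro Bochner_Integration.integrable_sum integrable_mult_right ib,
        intro sum.cong refl, subst Bochner_Integration.integral_sum, intro integrable_mult_right ib,
        intro sum.cong refl)
       (simp only: integral_mult_right_zero ib eq)
  also have "\<dots> = (\<Sum>a\<in>sqbox N. \<Sum>b\<in>sqbox N. \<psi> u * of_bool (() = () \<and> b - a = u))"
    by (intro sum.cong refl) auto
  also have "\<dots> = \<psi> u * mono_pairs N (\<lambda>_. ()) u"
    unfolding mono_pairs_def sum_distrib_left ..
  finally show "(\<integral>\<omega>. mono_pairs N (\<lambda>a. D (f a \<omega>)) u \<partial>M) = \<psi> u * mono_pairs N (\<lambda>_. ()) u" .
qed

lemma integral_mono_pairs_sum:
  assumes meas: "\<And>a. f a \<in> M \<rightarrow>\<^sub>M M"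
    and eq: "\<And>a b. prob {\<omega> \<in> space M. D (f a \<omega>) = D (f b \<omega>)} = \<psi> (b - a)"
  shows "integrable M (\<lambda>\<omega>. \<Sum>(c, u)\<leftarrow>ps. Re c * mono_pairs N (\<lambda>a. D (f a \<omega>)) u)"
    and "(\<integral>\<omega>. (\<Sum>(c, u)\<leftarrow>ps. Re c * mono_pairs N (\<lambda>a. D (f a \<omega>)) u) \<partial>M) =
      (\<Sum>(c, u)\<leftarrow>ps. Re c * (\<psi> u * mono_pairs N (\<lambda>_. ()) u))"
proof -
  note i = integral_mono_pairs[of f \<psi>, OF assms]
  show "integrable M (\<lambda>\<omega>. \<Sum>(c, u)\<leftarrow>ps. Re c * mono_pairs N (\<lambda>a. D (f a \<omega>)) u)"
    unfolding case_prod_unfold by (intro integral_sum_list(1) integrable_mult_right i)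
  show "(\<integral>\<omega>. (\<Sum>(c, u)\<leftarrow>ps. Re c * mono_pairs N (\<lambda>a. D (f a \<omega>)) u) \<partial>M) =
      (\<Sum>(c, u)\<leftarrow>ps. Re c * (\<psi> u * mono_pairs N (\<lambda>_. ()) u))"
    unfolding case_prod_unfold
    by (subst integral_sum_list(2), intro integrable_mult_right i)
      (simp only: integral_mult_right_zero i)
qed

lemma tendsto_mono_pairs_sum:
  "(\<lambda>N. (\<Sum>(c, u)\<leftarrow>ps. Re c * (\<psi> u * mono_pairs N (\<lambda>_. ()) u)) / real (N\<^sup>2)) \<longlonglongrightarrow>
    (\<Sum>(c, u)\<leftarrow>ps. Re c * \<psi> u)"
proof -
  have "(\<lambda>N. \<Sum>x\<leftarrow>ps. Re (fst x) * (\<psi> (snd x) * (mono_pairs N (\<lambda>_. ()) (snd x) / real (N\<^sup>2)))) \<longlonglongrightarrow>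
    (\<Sum>x\<leftarrow>ps. Re (fst x) * (\<psi> (snd x) * 1))"
    by (intro tendsto_sum_list tendsto_intros mono_pairs_const_tendsto)
  moreover have "(\<Sum>x\<leftarrow>ps. Re (fst x) * (\<psi> (snd x) * (mono_pairs N (\<lambda>_. ()) (snd x) / real (N\<^sup>2)))) =
    (\<Sum>x\<leftarrow>ps. Re (fst x) * (\<psi> (snd x) * mono_pairs N (\<lambda>_. ()) (snd x))) / real (N\<^sup>2)" for N
    by (induction ps) (simp_all add: add_divide_distrib)
  ultimately show ?thesis by (simp add: case_prod_unfold)
qed

text \<open>For the colouring of a box along a random orbit the pair counts give a nonnegative value
  by \<open>mono_pairs_nonneg\<close>. Its expectation divided by \<open>N^2\<close> tends to
  \<open>L ps\<close>.\<close>

lemma L_nonneg: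
  assumes "\<And>x. x \<in> torus \<Longrightarrow> Re (trig ps x) \<ge> 0"
  shows "L ps \<ge> 0"
proof -
  note i = integral_mono_pairs_sum[of T \<phi>, OF mpt_measurable[OF mpt_T] prob_T_eq]
  have "(\<Sum>(c, u)\<leftarrow>ps. Re c * (\<phi> u * mono_pairs N (\<lambda>_. ()) u)) / real (N\<^sup>2) \<ge> 0" for N
  proof -
    have "0 \<le> (\<integral>\<omega>. (\<Sum>(c, u)\<leftarrow>ps. Re c * mono_pairs N (\<lambda>a. D (T a \<omega>)) u) \<partial>M)"
      using mono_pairs_nonneg[OF assms, of N] unfolding Re_sum_list_of_real
      by (intro integral_nonneg_AE) auto
    then show ?thesis unfolding i by simp
  qed
  then show ?thesis
    unfolding L_def by (intro LIMSEQ_le_const[OF tendsto_mono_pairs_sum]) auto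
qed

lemma L_mono:
  assumes "\<And>x. x \<in> torus \<Longrightarrow> Re (trig ps x) \<le> Re (trig qs x)"
  shows "L ps \<le> L qs"
proof -
  have "L (qs @ map (\<lambda>(c, u). (- c, u)) ps) \<ge> 0"
  proof (rule L_nonneg)
    fix x assume "x \<in> torus"
    moreover have "trig (map (\<lambda>(c, u). (- c, u)) ps) x = - trig ps x"
      by (induction ps) auto
    ultimately show "Re (trig (qs @ map (\<lambda>(c, u). (- c, u)) ps) x) \<ge> 0"
      using assms by simp
  qed
  moreover have "L (map (\<lambda>(c, u). (- c, u)) ps) = - L ps"
    by (induction ps) auto
  ultimately show ?thesis by simp
qed

text \<open>Colour the box by \<open>D (T a \<omega>)\<close> and by
  \<open>D (h (T a \<omega>))\<close>. The second colouring has pair probabilities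
  \<open>\<phi> (\<gamma> u)\<close> by equivariance, and the two are expected to differ at no more
  than \<open>\<epsilon> * N^2\<close> points, so \<open>mono_pairs_diff\<close> compares the two
  functionals.\<close>

lemma L_almost_invariant:
  assumes h: "mpt M h" and eqv: "\<And>a \<omega>. \<omega> \<in> space M \<Longrightarrow> h (T a \<omega>) = T (\<gamma> a) (h \<omega>)"
    and \<gamma>: "\<And>a b. \<gamma> (a - b) = \<gamma> a - \<gamma> b"
    and \<epsilon>: "prob {\<omega> \<in> space M. D (h \<omega>) \<noteq> D \<omega>} \<le> \<epsilon>" "\<epsilon> > 0"
    and K: "\<And>x. x \<in> torus \<Longrightarrow> \<bar>Re (trig ps x)\<bar> \<le> K"
  shows "\<bar>L ps - L (map (\<lambda>(c, u). (c, \<gamma> u)) ps)\<bar> \<le> 3 * sqrt \<epsilon> * K"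
proof -
  \<comment> \<open>This balances the error terms \<open>\<epsilon> / \<eta>\<close> and
    \<open>2 * \<eta>\<close> of \<open>mono_pairs_diff\<close>; together they give
    \<open>3 * sqrt \<epsilon>\<close>.\<close>
  define \<eta> where "\<eta> = sqrt \<epsilon>"
  have \<eta>: "\<eta> > 0" using \<epsilon> by (simp add: \<eta>_def)
  have K0: "K \<ge> 0" using K[OF grid_point_torus[of 1 "(0,0)"]] by linarith
  note mT = mpt_measurable[OF mpt_T] and mh = mpt_measurable[OF h]
  have mhT: "(\<lambda>\<omega>. h (T a \<omega>)) \<in> M \<rightarrow>\<^sub>M M" for a
    using mT mh by measurable
  have phT: "prob {\<omega> \<in> space M. D (h (T a \<omega>)) = D (h (T b \<omega>))} = \<phi> (\<gamma> (b - a))" for a b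
  proof -
    have "prob {\<omega> \<in> space M. D (h (T a \<omega>)) = D (h (T b \<omega>))} =
       prob {\<omega> \<in> space M. D (T (\<gamma> a) (h \<omega>)) = D (T (\<gamma> b) (h \<omega>))}"
      by (intro arg_cong[where f = prob] Collect_cong) (auto simp: eqv)
    also have "\<dots> = prob {\<omega> \<in> space M. D (T (\<gamma> a) \<omega>) = D (T (\<gamma> b) \<omega>)}"
      by (rule mpt_measure[OF h sets_eq[OF mT mT]])
    finally show ?thesis by (simp add: prob_T_eq \<gamma>)
  qed
  note i = integral_mono_pairs_sum[of T \<phi>, OF mT prob_T_eq]
  note i' = integral_mono_pairs_sum[of "\<lambda>a \<omega>. h (T a \<omega>)" "\<lambda>u. \<phi> (\<gamma> u)", OF mhT phT]
  have ne: "{\<omega> \<in> space M. D (f \<omega>) \<noteq> D (g \<omega>)} \<in> sets M"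
    if "f \<in> M \<rightarrow>\<^sub>M M" "g \<in> M \<rightarrow>\<^sub>M M" for f g
  proof -
    have "{\<omega> \<in> space M. D (f \<omega>) \<noteq> D (g \<omega>)} = space M - {\<omega> \<in> space M. D (f \<omega>) = D (g \<omega>)}" by auto
    then show ?thesis using sets_eq[OF that] by auto
  qed
  note ib = integral_of_bool[OF ne]
  let ?A = "\<lambda>N \<omega>. \<Sum>(c, u)\<leftarrow>ps. Re c * mono_pairs N (\<lambda>a. D (T a \<omega>)) u"
  let ?B = "\<lambda>N \<omega>. \<Sum>(c, u)\<leftarrow>ps. Re c * mono_pairs N (\<lambda>a. D (h (T a \<omega>))) u"
  let ?C = "\<lambda>N \<omega>. K * ((\<Sum>a\<in>sqbox N. of_bool (D (T a \<omega>) \<noteq> D (h (T a \<omega>)))) / \<eta> + 2 * \<eta> * real (N\<^sup>2))"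
  have iC: "integrable M (?C N)" for N
    by (intro integrable_mult_right Bochner_Integration.integrable_add integrable_divide
        Bochner_Integration.integrable_sum ib mT mhT) auto
  have bound: "\<bar>(\<Sum>(c, u)\<leftarrow>ps. Re c * (\<phi> u * mono_pairs N (\<lambda>_. ()) u)) / real (N\<^sup>2) -
      (\<Sum>(c, u)\<leftarrow>ps. Re c * (\<phi> (\<gamma> u) * mono_pairs N (\<lambda>_. ()) u)) / real (N\<^sup>2)\<bar> \<le> 3 * sqrt \<epsilon> * K"
    if N: "N > 0" for N
  proof -
    have "\<bar>(\<integral>\<omega>. ?A N \<omega> \<partial>M) - (\<integral>\<omega>. ?B N \<omega> \<partial>M)\<bar> = \<bar>\<integral>\<omega>. ?A N \<omega> - ?B N \<omega> \<partial>M\<bar>"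
      by (subst Bochner_Integration.integral_diff[OF i(1) i'(1)]) simp
    also have "\<dots> \<le> (\<integral>\<omega>. \<bar>?A N \<omega> - ?B N \<omega>\<bar> \<partial>M)"
      by (rule integral_abs_bound)
    also have "\<dots> \<le> (\<integral>\<omega>. ?C N \<omega> \<partial>M)"
    proof (rule integral_mono)
      show "integrable M (\<lambda>\<omega>. \<bar>?A N \<omega> - ?B N \<omega>\<bar>)"
        by (intro integrable_abs Bochner_Integration.integrable_diff i i')
      fix \<omega>
      show "\<bar>?A N \<omega> - ?B N \<omega>\<bar> \<le> ?C N \<omega>"
        using mono_pairs_diff[OF K \<eta>, where d = "\<lambda>a. D (T a \<omega>)" and d' = "\<lambda>a. D (h (T a \<omega>))" and N = N]
        unfolding Re_sum_list_of_real .
    qed (rule iC)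
    also have "\<dots> = K * ((\<Sum>a\<in>sqbox N. prob {\<omega> \<in> space M. D (T a \<omega>) \<noteq> D (h (T a \<omega>))}) / \<eta> + 2 * \<eta> * real (N\<^sup>2))"
      by (simp add: integral_mult_right_zero Bochner_Integration.integral_sum ib mT mhT prob_space
          Bochner_Integration.integral_add del: sum_of_bool_eq)
    also have "(\<Sum>a\<in>sqbox N. prob {\<omega> \<in> space M. D (T a \<omega>) \<noteq> D (h (T a \<omega>))}) \<le> (\<Sum>a\<in>sqbox N. \<epsilon>)"
    proof (intro sum_mono)
      fix a
      have "prob {\<omega> \<in> space M. D (h (T a \<omega>)) \<noteq> D (T a \<omega>)} = prob {\<omega> \<in> space M. D (h \<omega>) \<noteq> D \<omega>}"
        by (rule mpt_measure[OF mpt_T, where P = "\<lambda>\<omega>. D (h \<omega>) \<noteq> D \<omega>"], rule ne[OF mh id_measurable])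
      then show "prob {\<omega> \<in> space M. D (T a \<omega>) \<noteq> D (h (T a \<omega>))} \<le> \<epsilon>"
        using \<epsilon> by (simp add: eq_commute)
    qed
    also have "K * ((\<Sum>a\<in>sqbox N. \<epsilon>) / \<eta> + 2 * \<eta> * real (N\<^sup>2)) = real (N\<^sup>2) * (3 * sqrt \<epsilon> * K)"
    proof -
      have "(\<Sum>a\<in>sqbox N. \<epsilon>) / \<eta> = real (N\<^sup>2) * sqrt \<epsilon>"
        using \<epsilon>(2) by (simp add: card_sqbox \<eta>_def real_div_sqrt flip: times_divide_eq_right)
      then show ?thesis by (simp add: \<eta>_def algebra_simps)
    qed
    finally have "\<bar>(\<integral>\<omega>. ?A N \<omega> \<partial>M) - (\<integral>\<omega>. ?B N \<omega> \<partial>M)\<bar> \<le> real (N\<^sup>2) * (3 * sqrt \<epsilon> * K)"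
      using K0 \<eta> by (simp add: mult_left_mono divide_right_mono)
    then show ?thesis
      unfolding i i' diff_divide_distrib[symmetric] using N by (simp add: field_simps)
  qed
  have "(\<lambda>N. \<bar>(\<Sum>(c, u)\<leftarrow>ps. Re c * (\<phi> u * mono_pairs N (\<lambda>_. ()) u)) / real (N\<^sup>2) -
      (\<Sum>(c, u)\<leftarrow>ps. Re c * (\<phi> (\<gamma> u) * mono_pairs N (\<lambda>_. ()) u)) / real (N\<^sup>2)\<bar>) \<longlonglongrightarrow>
      \<bar>(\<Sum>(c, u)\<leftarrow>ps. Re c * \<phi> u) - (\<Sum>(c, u)\<leftarrow>ps. Re c * \<phi> (\<gamma> u))\<bar>"
    by (intro tendsto_intros tendsto_mono_pairs_sum)
  then have "\<bar>(\<Sum>(c, u)\<leftarrow>ps. Re c * \<phi> u) - (\<Sum>(c, u)\<leftarrow>ps. Re c * \<phi> (\<gamma> u))\<bar> \<le> 3 * sqrt \<epsilon> * K"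
    using bound by (intro LIMSEQ_le_const2) (auto intro!: exI[of _ 1])
  moreover have "(\<Sum>(c, u)\<leftarrow>ps. Re c * \<phi> (\<gamma> u)) = L (map (\<lambda>(c, u). (c, \<gamma> u)) ps)"
    by (simp add: L_def comp_def case_prod_unfold)
  ultimately show ?thesis by (simp add: L_def)
qed

end

section \<open>Approximation by trigonometric polynomials\<close>

lemma trig_real_polynomial_function:
  assumes "real_polynomial_function g"
  shows "\<exists>ps. \<forall>x\<in>torus. trig ps x = of_real (g x)"
  using assms
proof induction
  case (linear g)
  \<comment> \<open>On the unit circle the inverse is the conjugate, so the coefficients come from
    \<open>Re z = (z + 1/z) / 2\<close> and \<open>Im z = (z - 1/z) / (2 i)\<close>.\<close>
  define ps :: "(complex \<times> int \<times> int) list" where "ps = [(of_real (g (1, 0) / 2) - \<i> * of_real (g (\<i>, 0) / 2), (1, 0)),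
    (of_real (g (1, 0) / 2) + \<i> * of_real (g (\<i>, 0) / 2), (- 1, 0)),
    (of_real (g (0, 1) / 2) - \<i> * of_real (g (0, \<i>) / 2), (0, 1)),
    (of_real (g (0, 1) / 2) + \<i> * of_real (g (0, \<i>) / 2), (0, - 1))]"
  have "trig ps x = of_real (g x)" if "x \<in> torus" for x
  proof -
    obtain z w where x: "x = (z, w)" by fastforce
    have inv: "y powi (- 1) = cnj y" if "norm y = 1" for y :: complex
      using that by (simp add: power_int_minus inverse_eq_divide field_simps complex_norm_square[symmetric])
         (metis complex_norm_square mult.commute norm_eq_zero of_real_1 one_power2 nonzero_eq_divide_eq norm_zero zero_neq_one divide_eq_eq)
    have zw: "norm z = 1" "norm w = 1" using that by (auto simp: torus_def x)
    have "x = Re z *\<^sub>R (1, 0) + Im z *\<^sub>R (\<i>, 0) + Re w *\<^sub>R (0, 1) + Im w *\<^sub>R (0, \<i>)"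
      by (simp add: x complex_eq_iff)
    then have "g x = g (Re z *\<^sub>R (1, 0) + Im z *\<^sub>R (\<i>, 0) + Re w *\<^sub>R (0, 1) + Im w *\<^sub>R (0, \<i>))"
      by simp
    also have "\<dots> = Re z * g (1, 0) + Im z * g (\<i>, 0) + Re w * g (0, 1) + Im w * g (0, \<i>)"
      using linear_add[OF bounded_linear.linear[OF linear]] linear_scale[OF bounded_linear.linear[OF linear]]
      by (metis real_scaleR_def)
    finally have g: "g x = \<dots>" .
    have e: "chr (1, 0) x = z" "chr (- 1, 0) x = cnj z" "chr (0, 1) x = w" "chr (0, - 1) x = cnj w"
      by (simp_all only: chr_def x fst_conv snd_conv inv[OF zw(1)] inv[OF zw(2)] power_int_1_right
          power_int_0_right mult_1_left mult_1_right)
    show ?thesis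
      unfolding g ps_def trig_Cons trig_Nil e by (simp add: complex_eq_iff field_simps)
  qed
  then show ?case by blast
next
  case (const c)
  have "trig [(of_real c, 0)] x = of_real c" for x by (simp add: chr_def)
  then show ?case by blast
next
  case (add f g)
  then obtain ps qs where "\<forall>x\<in>torus. trig ps x = of_real (f x)" "\<forall>x\<in>torus. trig qs x = of_real (g x)"
    by blast
  then have "\<forall>x\<in>torus. trig (ps @ qs) x = of_real (f x + g x)" by simp
  then show ?case by blast
next
  case (mult f g)
  then obtain ps qs where pq: "\<forall>x\<in>torus. trig ps x = of_real (f x)" "\<forall>x\<in>torus. trig qs x = of_real (g x)"
    by blast
  have "trig (concat (map (\<lambda>(c, a). map (\<lambda>(d, b). (c * d, a + b)) qs) ps)) x = trig ps x * trig qs x"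
    if "x \<in> torus" for x
  proof (induction ps)
    case (Cons p ps)
    obtain c a where p: "p = (c, a)" by (cases p)
    have "trig (map (\<lambda>(d, b). (c * d, a + b)) qs) x = c * chr a x * trig qs x"
      by (induction qs) (auto simp: chr_add[OF that] algebra_simps)
    then show ?case using Cons by (simp add: p algebra_simps)
  qed simp
  then have "\<forall>x\<in>torus. trig (concat (map (\<lambda>(c, a). map (\<lambda>(d, b). (c * d, a + b)) qs) ps)) x
      = of_real (f x * g x)"
    using pq by simp
  then show ?case by blast
qed

lemma trig_approximation:
  assumes "continuous_on torus f" "\<kappa> > 0"
  obtains ps where "\<And>x. x \<in> torus \<Longrightarrow> \<bar>Re (trig ps x) - f x\<bar> \<le> \<kappa>"
proof -
  have "torus = sphere 0 1 \<times> sphere 0 1" by (auto simp: torus_def)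
  then have "compact torus" by (metis compact_Times compact_sphere)
  then obtain g where g: "real_polynomial_function g" "\<And>x. x \<in> torus \<Longrightarrow> \<bar>f x - g x\<bar> < \<kappa>"
    using Stone_Weierstrass_real_polynomial_function[of torus f \<kappa>] assms by blast
  obtain ps where "\<forall>x\<in>torus. trig ps x = of_real (g x)"
    using trig_real_polynomial_function[OF g(1)] by blast
  then show thesis using g(2) by (intro that[of ps]) (simp add: abs_minus_commute less_imp_le)
qed

section \<open>Shears of the torus and the sector estimate\<close>

definition shear :: "int \<Rightarrow> int \<times> int \<Rightarrow> int \<times> int" where
  "shear t a = (fst a, snd a + t * fst a)"

definition shear' :: "int \<Rightarrow> int \<times> int \<Rightarrow> int \<times> int" where
  "shear' t a = (fst a + t * snd a, snd a)"

text \<open>The dual of \<open>shear\<close>: composing characters with this map shears their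
  exponents (\<open>trig_map_shear\<close>). The dual of \<open>shear'\<close> is its conjugate by
  \<open>prod.swap\<close>.\<close>

definition torus_shear :: "int \<Rightarrow> complex \<times> complex \<Rightarrow> complex \<times> complex" where
  "torus_shear t x = (fst x * snd x powi t, snd x)"

lemma torus_shear_in: "x \<in> torus \<Longrightarrow> torus_shear t x \<in> torus"
  by (simp add: torus_def torus_shear_def norm_mult norm_power_int)

lemma torus_swap: "x \<in> torus \<Longrightarrow> prod.swap x \<in> torus"
  by (simp add: torus_def)

lemma trig_map_shear:
  assumes "x \<in> torus"
  shows "trig (map (\<lambda>(c, a). (c, shear t a)) ps) x = trig ps (torus_shear t x)"
proof -
  have "chr (shear t a) x = chr a (torus_shear t x)" for a
  proof -
    have "snd x \<noteq> 0" using assms by (auto simp: torus_def)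
    then show ?thesis
      by (simp add: chr_def shear_def torus_shear_def power_int_add power_int_mult_distrib
          power_int_mult mult_ac)
  qed
  then show ?thesis by (induction ps) auto
qed

lemma trig_map_swap: "trig (map (\<lambda>(c, a). (c, prod.swap a)) ps) x = trig ps (prod.swap x)"
proof -
  have "chr (prod.swap a) x = chr a (prod.swap x)" for a by (simp add: chr_def)
  then show ?thesis by (induction ps) auto
qed

lemma norm_power_minus_one_le:
  fixes w :: complex assumes "norm w = 1"
  shows "norm (w ^ n - 1) \<le> real n * norm (w - 1)"
  using norm_power_diff[of w 1 n] assms by simp

lemma norm_powi_minus_one:
  fixes w :: complex assumes "norm w = 1"
  shows "norm (w powi n - 1) = norm (w ^ nat \<bar>n\<bar> - 1)"
proof (cases "n \<ge> 0")
  case False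
  define k where "k = nat \<bar>n\<bar>"
  have n: "n = - int k" using False by (simp add: k_def)
  have w: "w \<noteq> 0" using assms by auto
  have "w powi n - 1 = - inverse (w ^ k) * (w ^ k - 1)"
    using w by (simp add: n power_int_minus field_simps)
  then have "norm (w powi n - 1) = norm (w ^ k - 1)"
    using assms by (simp add: norm_mult norm_inverse norm_power)
  then show ?thesis by (simp add: k_def)
qed (simp add: power_int_def)

text \<open>Factor \<open>w ^ k - 1\<close> as \<open>w - 1\<close> times a geometric sum. Each of
  its \<open>k\<close> terms lies within \<open>k * norm (w - 1)\<close> of 1, so the sum is close
  to \<open>k\<close> when \<open>w\<close> is close to 1.\<close>

lemma norm_power_minus_one_ge:
  fixes w :: complex
  assumes "norm w = 1"
  shows "norm (w ^ k - 1) \<ge> (real k - (real k)\<^sup>2 * norm (w - 1)) * norm (w - 1)"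
proof -
  have "real k - (real k)\<^sup>2 * norm (w - 1) \<le> norm (\<Sum>i<k. w ^ i)"
  proof -
    have "norm (of_nat k - (\<Sum>i<k. w ^ i)) = norm (\<Sum>i<k. 1 - w ^ i)"
      by (simp add: sum_subtractf)
    also have "\<dots> \<le> (\<Sum>i<k. real k * norm (w - 1))"
    proof (rule order_trans[OF norm_sum sum_mono])
      fix i assume "i \<in> {..<k}"
      then have "real i * norm (w - 1) \<le> real k * norm (w - 1)" by (intro mult_right_mono) auto
      then show "norm (1 - w ^ i) \<le> real k * norm (w - 1)"
        using norm_power_minus_one_le[OF assms, of i] by (simp add: norm_minus_commute)
    qed
    finally have "norm (of_nat k - (\<Sum>i<k. w ^ i)) \<le> (real k)\<^sup>2 * norm (w - 1)"
      by (simp add: power2_eq_square)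
    moreover have "norm (of_nat k :: complex) \<le> norm (of_nat k - (\<Sum>i<k. w ^ i)) + norm (\<Sum>i<k. w ^ i)"
      by (metis diff_add_cancel norm_triangle_ineq)
    ultimately show ?thesis by simp
  qed
  then have "(real k - (real k)\<^sup>2 * norm (w - 1)) * norm (w - 1) \<le> norm (\<Sum>i<k. w ^ i) * norm (w - 1)"
    by (intro mult_right_mono) auto
  also have "\<dots> = norm (w ^ k - 1)"
    by (metis mult.commute norm_mult power_diff_1_eq)
  finally show ?thesis .
qed

text \<open>The sector functions of the ping-pong argument: \<open>sector\<close> is \<open>1\<close> where the second coordinate
  dominates and vanishes where the first one is at least twice the second; \<open>cutoff\<close> removes a
  neighbourhood of the identity on a logarithmic scale, so that shears hardly change it.\<close>

definition dist1 :: "complex \<times> complex \<Rightarrow> real" where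
  "dist1 x = norm (fst x - 1) + norm (snd x - 1)"

definition cutoff :: "real \<Rightarrow> real \<Rightarrow> complex \<times> complex \<Rightarrow> real" where
  "cutoff \<delta> m x = max 0 (min 1 (ln (max (dist1 x) \<delta> / \<delta>) / m))"

definition sector :: "real \<Rightarrow> complex \<times> complex \<Rightarrow> real" where
  "sector \<delta> x = max 0 (min 1 (6 * norm (snd x - 1) / max (dist1 x) \<delta> - 2))"

lemma cutoff_bounds: "0 \<le> cutoff \<delta> m x" "cutoff \<delta> m x \<le> 1"
  and sector_bounds: "0 \<le> sector \<delta> x" "sector \<delta> x \<le> 1"
  by (auto simp: cutoff_def sector_def)

lemma continuous_cutoff: "\<delta> > 0 \<Longrightarrow> m > 0 \<Longrightarrow> continuous_on A (cutoff \<delta> m)"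
  unfolding cutoff_def dist1_def by (intro continuous_intros) (auto simp: max_def)

lemma continuous_sector: "\<delta> > 0 \<Longrightarrow> continuous_on A (sector \<delta>)"
  unfolding sector_def dist1_def by (intro continuous_intros) (auto simp: max_def)

text \<open>Beyond radius \<open>\<delta>\<close> the larger coordinate carries at least half of
  \<open>dist1\<close>, where its sector function is \<open>6 * (1/2) - 2 = 1\<close> or more before
  truncation. Within radius \<open>\<delta>\<close> the logarithm, and with it the cutoff,
  vanishes.\<close>

lemma cutoff_le_sectors:
  assumes "\<delta> > 0"
  shows "cutoff \<delta> m x \<le> sector \<delta> x * cutoff \<delta> m x + sector \<delta> (prod.swap x) * cutoff \<delta> m x"
proof (cases "dist1 x \<ge> \<delta>")
  case True
  have d: "dist1 (prod.swap x) = dist1 x" by (simp add: dist1_def)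
  have "dist1 x > 0" using True assms by linarith
  have "sector \<delta> x = 1 \<or> sector \<delta> (prod.swap x) = 1"
  proof (cases "norm (snd x - 1) \<ge> norm (fst x - 1)")
    case *: True
    have "6 * norm (snd x - 1) / dist1 x - 2 \<ge> 1"
      using * \<open>dist1 x > 0\<close> by (simp add: field_simps) (simp add: dist1_def)
    then show ?thesis using True by (simp add: sector_def max_absorb1)
  next
    case False
    have "6 * norm (fst x - 1) / dist1 x - 2 \<ge> 1"
      using False \<open>dist1 x > 0\<close> by (simp add: field_simps) (simp add: dist1_def)
    then show ?thesis using True d by (simp add: sector_def max_absorb1)
  qed
  then show ?thesis using cutoff_bounds[of \<delta> m x] sector_bounds[of \<delta> x] sector_bounds[of \<delta> "prod.swap x"]
    by (auto simp: mult_nonneg_nonneg)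
next
  case False
  then show ?thesis using assms by (simp add: cutoff_def max_absorb2)
qed

lemma sector_pos:
  assumes "\<delta> > 0" "sector \<delta> x > 0"
  shows "norm (fst x - 1) < 2 * norm (snd x - 1)"
proof -
  have "6 * norm (snd x - 1) / max (dist1 x) \<delta> > 2" using assms(2) by (simp add: sector_def)
  then have "3 * norm (snd x - 1) > max (dist1 x) \<delta>" using assms(1) by (simp add: field_simps max_def split: if_splits)
  then show ?thesis by (simp add: dist1_def)
qed

lemma dist1_torus_shear:
  assumes "x \<in> torus"
  shows "dist1 (torus_shear t x) \<le> (1 + real_of_int \<bar>t\<bar>) * dist1 x"
proof -
  have n: "norm (fst x) = 1" "norm (snd x) = 1" using assms by (auto simp: torus_def)
  have "norm (snd x powi t - 1) \<le> real_of_int \<bar>t\<bar> * norm (snd x - 1)"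
    using norm_power_minus_one_le[OF n(2), of "nat \<bar>t\<bar>"] by (simp add: norm_powi_minus_one[OF n(2)])
  moreover have "norm (fst x * snd x powi t - 1) \<le> norm (fst x * (snd x powi t - 1)) + norm (fst x - 1)"
    by (metis (no_types, lifting) diff_add_cancel add_diff_eq mult.right_neutral norm_triangle_ineq right_diff_distrib)
  ultimately have "norm (fst x * snd x powi t - 1) \<le> real_of_int \<bar>t\<bar> * norm (snd x - 1) + norm (fst x - 1)"
    using n by (simp add: norm_mult)
  moreover have "real_of_int \<bar>t\<bar> * norm (fst x - 1) \<ge> 0" by simp
  ultimately show ?thesis
    unfolding dist1_def torus_shear_def fst_conv snd_conv distrib_left distrib_right by linarith
qed

text \<open>A shear stretches \<open>dist1\<close> by at most \<open>1 + \<bar>t\<bar>\<close>,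
  which on the logarithmic scale is an additive change, divided by \<open>m\<close>.\<close>

lemma cutoff_torus_shear:
  assumes "x \<in> torus" "\<delta> > 0" "m > 0" "ln (1 + real_of_int \<bar>t\<bar>) \<le> \<kappa> * m"
  shows "cutoff \<delta> m (torus_shear t x) \<le> cutoff \<delta> m x + \<kappa>"
proof -
  let ?C = "1 + real_of_int \<bar>t\<bar>"
  have C: "?C \<ge> 1" by simp
  have "max (dist1 (torus_shear t x)) \<delta> \<le> ?C * max (dist1 x) \<delta>"
  proof (rule max.boundedI)
    have "dist1 (torus_shear t x) \<le> ?C * dist1 x" by (rule dist1_torus_shear[OF assms(1)])
    also have "\<dots> \<le> ?C * max (dist1 x) \<delta>" by (intro mult_left_mono) auto
    finally show "dist1 (torus_shear t x) \<le> ?C * max (dist1 x) \<delta>" .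
    have "\<delta> \<le> 1 * max (dist1 x) \<delta>" by simp
    also have "\<dots> \<le> ?C * max (dist1 x) \<delta>" using assms(2) C by (intro mult_right_mono) auto
    finally show "\<delta> \<le> ?C * max (dist1 x) \<delta>" .
  qed
  then have "ln (max (dist1 (torus_shear t x)) \<delta> / \<delta>) \<le> ln (?C * (max (dist1 x) \<delta> / \<delta>))"
    using assms(2) C by (subst ln_le_cancel_iff) (auto simp: field_simps less_max_iff_disj)
  also have "\<dots> = ln ?C + ln (max (dist1 x) \<delta> / \<delta>)"
    using assms(2) C by (subst ln_mult) (auto simp: less_max_iff_disj)
  finally have "ln (max (dist1 (torus_shear t x)) \<delta> / \<delta>) / m \<le> \<kappa> + ln (max (dist1 x) \<delta> / \<delta>) / m"
    using assms(3,4) by (simp add: field_simps)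
  moreover have "\<kappa> \<ge> 0" using assms(3,4) C ln_ge_zero[OF C] by (smt (verit) zero_le_mult_iff mult_less_0_iff)
  ultimately show ?thesis unfolding cutoff_def by linarith
qed

text \<open>Ping-pong: near 1 at most one of the three terms is nonzero, and it is bounded by the
  cutoff up to \<open>\<kappa>\<close>. Farther away the trivial bound 3 is absorbed by the
  quadratic term, whose contribution is small because the functional nearly fixes the unit
  characters.\<close>

lemma sector_shears:
  fixes s :: nat
  assumes s: "s \<ge> 5" and x: "x \<in> torus" and \<delta>: "\<delta> > 0" and m: "m > 0" "ln (1 + real s) \<le> \<kappa> * m"
  defines "F \<equiv> \<lambda>x. sector \<delta> x * cutoff \<delta> m x"
  shows "F x + F (torus_shear (int s) x) + F (torus_shear (- int s) x) \<le>
    cutoff \<delta> m x + \<kappa> + 96 * (real s)^4 * ((norm (fst x - 1))\<^sup>2 + (norm (snd x - 1))\<^sup>2)"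
proof -
  let ?U = "norm (fst x - 1)" and ?V = "norm (snd x - 1)"
  have n: "norm (fst x) = 1" "norm (snd x) = 1" using x by (auto simp: torus_def)
  have k0: "\<kappa> \<ge> 0" using m ln_ge_zero[of "1 + real s"] by (smt (verit) mult_less_0_iff of_nat_0_le_iff)
  have nn: "96 * (real s)^4 * (?U\<^sup>2 + ?V\<^sup>2) \<ge> 0" by simp
  have F: "0 \<le> F y" "F y \<le> 1" "F y \<le> cutoff \<delta> m y" for y
    using sector_bounds[of \<delta> y] cutoff_bounds[of \<delta> m y]
    by (auto simp: F_def mult_le_one mult_left_le_one_le)
  show ?thesis
  proof (cases "dist1 x \<ge> 1 / (4 * (real s)\<^sup>2)")
    case True
    \<comment> \<open>Here the sum of the two squared norms is at least \<open>1 / (32 s^4)\<close>,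
      so \<open>96 s^4\<close> times it is at least 3.\<close>
    have "(1 / (4 * (real s)\<^sup>2))\<^sup>2 \<le> (?U + ?V)\<^sup>2"
      using True by (intro power_mono) (auto simp: dist1_def)
    also have "\<dots> \<le> 2 * (?U\<^sup>2 + ?V\<^sup>2)"
      using sum_squares_ge_zero[of "?U - ?V" 0] by (simp add: power2_eq_square algebra_simps)
    finally have "96 * (real s)^4 * (1 / (4 * (real s)\<^sup>2))\<^sup>2 \<le> 96 * (real s)^4 * (2 * (?U\<^sup>2 + ?V\<^sup>2))"
      by (intro mult_left_mono) auto
    moreover have "96 * (real s)^4 * (1 / (4 * (real s)\<^sup>2))\<^sup>2 = 6"
      using s by (simp add: power_divide power_mult_distrib flip: power_mult)
    ultimately have *: "6 \<le> 96 * (real s)^4 * (2 * (?U\<^sup>2 + ?V\<^sup>2))" by linarith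
    have "3 \<le> 96 * (real s)^4 * (?U\<^sup>2 + ?V\<^sup>2)" using * by (simp only: mult.left_commute[of _ 2])
    then show ?thesis using F(2)[of x] F(2)[of "torus_shear (int s) x"] F(2)[of "torus_shear (- int s) x"]
      k0 cutoff_bounds[of \<delta> m x] by linarith
  next
    case False
    then have V: "?V < 1 / (4 * (real s)\<^sup>2)" unfolding dist1_def using norm_ge_zero[of "fst x - 1"] by linarith
    \<comment> \<open>For these \<open>k\<close> the loss \<open>k^2 * ?V\<close> is at most 1, so
      the factor in \<open>norm_power_minus_one_ge\<close> is at least \<open>5 - 1 = 4\<close>. The
      upper limit \<open>2 * s\<close> is the gap between the shears by \<open>s\<close> and
      \<open>-s\<close>.\<close>
    have big: "norm (snd x ^ k - 1) \<ge> 4 * ?V" if k: "5 \<le> k" "k \<le> 2 * s" for k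
    proof -
      have "(real k)\<^sup>2 * ?V \<le> (2 * real s)\<^sup>2 * (1 / (4 * (real s)\<^sup>2))"
        using k V by (intro mult_mono power_mono) auto
      also have "\<dots> = 1" using s by (simp add: power_mult_distrib)
      finally have "4 \<le> real k - (real k)\<^sup>2 * ?V" using k by simp
      then have "4 * ?V \<le> (real k - (real k)\<^sup>2 * ?V) * ?V" by (intro mult_right_mono) auto
      also have "\<dots> \<le> norm (snd x ^ k - 1)" by (rule norm_power_minus_one_ge[OF n(2)])
      finally show ?thesis .
    qed
    have sh: "snd (torus_shear t x) = snd x" for t by (simp add: torus_shear_def)
    have Fpos: "norm (fst x * snd x powi t - 1) < 2 * ?V" if "F (torus_shear t x) > 0" for t
    proof -
      have "sector \<delta> (torus_shear t x) > 0"
        using that sector_bounds[of \<delta> "torus_shear t x"] cutoff_bounds[of \<delta> m "torus_shear t x"]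
        by (auto simp: F_def zero_less_mult_iff)
      from sector_pos[OF \<delta> this] show ?thesis by (simp add: torus_shear_def)
    qed
    \<comment> \<open>If both sheared points lay in the sector, their first coordinates would each
      be within \<open>2 * ?V\<close> of 1. Their distance from each other is the norm bounded below
      by \<open>4 * ?V\<close> in \<open>big\<close>.\<close>
    have excl: "F (torus_shear t x) = 0 \<or> F (torus_shear t' x) = 0"
      if tt: "5 \<le> nat \<bar>t - t'\<bar>" "nat \<bar>t - t'\<bar> \<le> 2 * s" for t t'
    proof (rule ccontr)
      assume "\<not> ?thesis"
      then have p: "F (torus_shear t x) > 0" "F (torus_shear t' x) > 0"
        using F(1)[of "torus_shear t x"] F(1)[of "torus_shear t' x"] by auto
      have w0: "snd x \<noteq> 0" using n by auto
      have "norm (snd x ^ nat \<bar>t - t'\<bar> - 1) = norm (snd x powi (t - t') - 1)"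
        by (simp add: norm_powi_minus_one[OF n(2)])
      also have "\<dots> = norm (fst x * snd x powi t' * (snd x powi (t - t') - 1))"
        by (simp add: norm_mult norm_power_int n)
      also have "fst x * snd x powi t' * (snd x powi (t - t') - 1) = (fst x * snd x powi t - 1) - (fst x * snd x powi t' - 1)"
        using w0 by (simp add: algebra_simps power_int_diff)
      also have "norm \<dots> \<le> norm (fst x * snd x powi t - 1) + norm (fst x * snd x powi t' - 1)"
        by (rule norm_triangle_ineq4)
      also have "\<dots> < 4 * ?V" using Fpos[OF p(1)] Fpos[OF p(2)] by simp
      finally show False using big[OF tt] by simp
    qed
    have x0: "torus_shear 0 x = x" by (simp add: torus_shear_def)
    have e: "F x = 0 \<or> F (torus_shear (int s) x) = 0" "F x = 0 \<or> F (torus_shear (- int s) x) = 0"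
      "F (torus_shear (int s) x) = 0 \<or> F (torus_shear (- int s) x) = 0"
      using excl[of 0 "int s"] excl[of 0 "- int s"] excl[of "int s" "- int s"] s
      by (auto simp: x0)
    have c: "F (torus_shear (int s) x) \<le> cutoff \<delta> m x + \<kappa>" "F (torus_shear (- int s) x) \<le> cutoff \<delta> m x + \<kappa>"
      using F(3)[of "torus_shear (int s) x"] F(3)[of "torus_shear (- int s) x"]
        cutoff_torus_shear[OF x \<delta> m(1), of "int s" \<kappa>] cutoff_torus_shear[OF x \<delta> m(1), of "- int s" \<kappa>] m(2)
      by auto
    show ?thesis
      using e by (elim disjE; use c F(3)[of x] k0 nn cutoff_bounds[of \<delta> m x] in linarith)
  qed
qed

text \<open>Beyond radius \<open>\<delta> * exp m\<close> the cutoff is 1 and twice it covers the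
  trivial bound 2. Inside, \<open>chr a\<close> varies at most linearly in \<open>dist1\<close> and
  stays within \<open>\<kappa>\<close> of 1.\<close>

lemma one_minus_chr_le:
  assumes x: "x \<in> torus" and "\<delta> > 0" "m > 0" and \<kappa>: "(real_of_int \<bar>fst a\<bar> + real_of_int \<bar>snd a\<bar>) * (\<delta> * exp m) \<le> \<kappa>"
    "\<kappa> \<ge> 0"
  shows "1 - Re (chr a x) \<le> 2 * cutoff \<delta> m x + \<kappa>"
proof (cases "dist1 x \<ge> \<delta> * exp m")
  case True
  have "\<delta> * 1 \<le> \<delta> * exp m" using assms by (intro mult_left_mono) auto
  then have "max (dist1 x) \<delta> / \<delta> \<ge> exp m" using True assms by (simp add: field_simps max_absorb1)
  then have "ln (max (dist1 x) \<delta> / \<delta>) \<ge> m"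
    by (metis exp_gt_zero ln_exp ln_mono order_less_le_trans)
  then have "cutoff \<delta> m x = 1" using assms(3) by (simp add: cutoff_def)
  moreover have "Re (chr a x) \<ge> - 1" using norm_chr[OF x, of a] abs_Re_le_cmod[of "chr a x"] by linarith
  ultimately show ?thesis using \<kappa> by simp
next
  case False
  have n: "norm (fst x) = 1" "norm (snd x) = 1" using x by (auto simp: torus_def)
  have "1 - Re (chr a x) \<le> norm (chr a x - 1)"
    using abs_Re_le_cmod[of "chr a x - 1"] by simp
  also have "\<dots> = norm (fst x powi fst a * (snd x powi snd a - 1) + (fst x powi fst a - 1))"
    by (simp add: chr_def algebra_simps)
  also have "\<dots> \<le> norm (snd x powi snd a - 1) + norm (fst x powi fst a - 1)"
    by (rule order_trans[OF norm_triangle_ineq]) (simp add: norm_mult norm_power_int n)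
  also have "\<dots> \<le> real_of_int \<bar>snd a\<bar> * norm (snd x - 1) + real_of_int \<bar>fst a\<bar> * norm (fst x - 1)"
    using norm_power_minus_one_le[OF n(1), of "nat \<bar>fst a\<bar>"] norm_power_minus_one_le[OF n(2), of "nat \<bar>snd a\<bar>"]
    by (simp add: norm_powi_minus_one n)
  also have "\<dots> \<le> real_of_int \<bar>snd a\<bar> * dist1 x + real_of_int \<bar>fst a\<bar> * dist1 x"
    by (intro add_mono mult_left_mono) (auto simp: dist1_def)
  also have "\<dots> = (real_of_int \<bar>fst a\<bar> + real_of_int \<bar>snd a\<bar>) * dist1 x"
    by (simp add: algebra_simps)
  also have "\<dots> \<le> (real_of_int \<bar>fst a\<bar> + real_of_int \<bar>snd a\<bar>) * (\<delta> * exp m)"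
    using False by (intro mult_left_mono) auto
  finally show ?thesis using \<kappa> cutoff_bounds[of \<delta> m x] by linarith
qed

text \<open>\<open>L\<close> is defined on trigonometric polynomials. In this form the quadratic
  error of \<open>sector_shears\<close> becomes one, and its value under \<open>L\<close> is
  governed by \<open>1 - \<phi>\<close> at the two unit vectors.\<close>

lemma norm_minus_one_squared_trig:
  assumes "x \<in> torus"
  shows "Re (trig [(of_real (2 * K), 0), (of_real (- K), (1, 0)), (of_real (- K), (- 1, 0))] x) =
      K * (norm (fst x - 1))\<^sup>2"
    and "Re (trig [(of_real (2 * K), 0), (of_real (- K), (0, 1)), (of_real (- K), (0, - 1))] x) =
      K * (norm (snd x - 1))\<^sup>2"
proof -
  have n: "norm (fst x) = 1" "norm (snd x) = 1" using assms by (auto simp: torus_def)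
  have sq: "(norm (y - 1))\<^sup>2 = 2 - 2 * Re y" if "norm y = 1" for y :: complex
  proof -
    have "(Re y)\<^sup>2 + (Im y)\<^sup>2 = 1" using that cmod_power2[of y] by simp
    then show ?thesis unfolding cmod_power2 by (simp add: power2_eq_square algebra_simps)
  qed
  have c: "chr 0 x = 1" "Re (chr (1, 0) x) = Re (fst x)" "Re (chr (0, 1) x) = Re (snd x)"
    by (simp_all add: chr_def)
  have c': "Re (chr (- 1, 0) x) = Re (fst x)" "Re (chr (0, - 1) x) = Re (snd x)"
    using c cnj_chr[OF assms, of "(1, 0)"] cnj_chr[OF assms, of "(0, 1)"]
    by (metis complex_cnj(1) complex_cnj_cancel_iff cnj.sel(1) minus_zero uminus_Pair)+
  show "Re (trig [(of_real (2 * K), 0), (of_real (- K), (1, 0)), (of_real (- K), (- 1, 0))] x) =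
      K * (norm (fst x - 1))\<^sup>2"
    using c c' by (simp add: sq n algebra_simps)
  show "Re (trig [(of_real (2 * K), 0), (of_real (- K), (0, 1)), (of_real (- K), (0, - 1))] x) =
      K * (norm (snd x - 1))\<^sup>2"
    using c c' by (simp add: sq n algebra_simps)
qed

section \<open>Relative rigidity for Z^2 under two opposite shears\<close>

context coloured_action
begin

text \<open>The two sheared copies of \<open>ps\<close> have nearly the same value as
  \<open>ps\<close>, so a pointwise bound on the sum of the three bounds \<open>3 * L ps\<close>.
  The abstract \<open>\<gamma>\<close> and \<open>S\<close> let it serve both kinds of
  shear.\<close>

lemma L_shear_sum:
  fixes s :: nat
  assumes h: "mpt M h" and eqv: "\<And>a \<omega>. \<omega> \<in> space M \<Longrightarrow> h (T a \<omega>) = T (\<gamma> (int s) a) (h \<omega>)"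
    and \<gamma>: "\<And>t a b. \<gamma> t (a - b) = \<gamma> t a - \<gamma> t b" "\<And>t a. \<gamma> t (\<gamma> (- t) a) = a"
    and \<epsilon>: "prob {\<omega> \<in> space M. D (h \<omega>) \<noteq> D \<omega>} \<le> \<epsilon>" "\<epsilon> > 0"
    and S: "\<And>t x. x \<in> torus \<Longrightarrow> S t x \<in> torus"
      "\<And>t ps x. x \<in> torus \<Longrightarrow> trig (map (\<lambda>(c, u). (c, \<gamma> t u)) ps) x = trig ps (S t x)"
    and K: "\<And>x. x \<in> torus \<Longrightarrow> \<bar>Re (trig ps x)\<bar> \<le> K"
    and B: "\<And>x. x \<in> torus \<Longrightarrow> Re (trig ps x) + Re (trig ps (S (int s) x)) + Re (trig ps (S (- int s) x)) \<le> Re (trig qs x)"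
  shows "3 * L ps \<le> L qs + 6 * sqrt \<epsilon> * K"
proof -
  let ?p = "\<lambda>t. map (\<lambda>(c, u). (c, \<gamma> t u)) ps"
  have "\<bar>L ps - L (?p (int s))\<bar> \<le> 3 * sqrt \<epsilon> * K"
    by (rule L_almost_invariant[OF h eqv \<gamma>(1) \<epsilon> K])
  \<comment> \<open>\<open>h\<close> realises the positive shear; almost invariance is therefore
    applied to the negatively sheared list, which the positive shear carries back to
    \<open>ps\<close>.\<close>
  moreover have "\<bar>L (?p (- int s)) - L ps\<bar> \<le> 3 * sqrt \<epsilon> * K"
  proof -
    have "\<bar>L (?p (- int s)) - L (map (\<lambda>(c, u). (c, \<gamma> (int s) u)) (?p (- int s)))\<bar> \<le> 3 * sqrt \<epsilon> * K"
      by (rule L_almost_invariant[OF h eqv \<gamma>(1) \<epsilon>]) (use K S in auto)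
    moreover have "map (\<lambda>(c, u). (c, \<gamma> (int s) u)) (?p (- int s)) = ps"
      by (simp add: comp_def case_prod_unfold \<gamma>(2))
    ultimately show ?thesis by simp
  qed
  moreover have "L (ps @ ?p (int s) @ ?p (- int s)) \<le> L qs"
    by (rule L_mono) (use B S in \<open>simp add: add.assoc\<close>)
  ultimately show ?thesis by simp
qed

text \<open>Let X, V, H be the values of \<open>L\<close> at the cutoff and at the two sector
  functions. Up to error, \<open>3 V \<le> X\<close> and \<open>3 H \<le> X\<close> by ping-pong,
  while the sectors cover the cutoff, so \<open>X \<le> V + H \<le> 2 X / 3\<close>. Thus X is
  small, and \<open>1 - \<phi> a\<close> is at most 2 X up to error. Two disjoint shears per sector
  would not suffice. The surviving error depends on \<open>s\<close> and \<open>\<epsilon>\<close>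
  alone, hence uniformity in \<open>a\<close>.\<close>

theorem relative_rigidity:
  fixes s :: nat
  assumes s: "s \<ge> 5"
    and h1: "mpt M h1" "\<And>a \<omega>. \<omega> \<in> space M \<Longrightarrow> h1 (T a \<omega>) = T (shear (int s) a) (h1 \<omega>)"
    and h2: "mpt M h2" "\<And>a \<omega>. \<omega> \<in> space M \<Longrightarrow> h2 (T a \<omega>) = T (shear' (int s) a) (h2 \<omega>)"
    and \<epsilon>: "\<epsilon> > 0" "prob {\<omega> \<in> space M. D (h1 \<omega>) \<noteq> D \<omega>} \<le> \<epsilon>" "prob {\<omega> \<in> space M. D (h2 \<omega>) \<noteq> D \<omega>} \<le> \<epsilon>"
      "1 - \<phi> (1, 0) \<le> \<epsilon>" "1 - \<phi> (0, 1) \<le> \<epsilon>"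
  shows "1 - \<phi> a \<le> 1536 * (real s)^4 * \<epsilon> + 24 * sqrt \<epsilon>"
proof (rule field_le_epsilon)
  fix e :: real assume e: "e > 0"
  \<comment> \<open>The approximation errors will add up to
    \<open>\<kappa> * (41 + 24 * sqrt \<epsilon>)\<close>, which this choice makes equal to
    \<open>e\<close>.\<close>
  define \<kappa> where "\<kappa> = e / (41 + 24 * sqrt \<epsilon>)"
  have den: "41 + 24 * sqrt \<epsilon> > 0" using \<epsilon>(1) by (simp add: add_pos_pos)
  have \<kappa>: "\<kappa> > 0" using e den by (simp add: \<kappa>_def)
  define m where "m = ln (1 + real s) / \<kappa> + 1"
  have m: "m > 0" "ln (1 + real s) \<le> \<kappa> * m"
    using \<kappa> by (auto simp: m_def field_simps intro!: add_pos_nonneg)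
  \<comment> \<open>\<open>m\<close> was chosen so that a shear hardly changes the cutoff;
    \<open>\<delta>\<close> is then shrunk according to \<open>a\<close>, so that
    \<open>chr a\<close> is within \<open>\<kappa>\<close> of 1 up to radius
    \<open>\<delta> * exp m\<close>. Neither enters the final bound.\<close>
  define \<delta> where "\<delta> = \<kappa> * exp (- m) / (real_of_int \<bar>fst a\<bar> + real_of_int \<bar>snd a\<bar> + 1)"
  have \<delta>: "\<delta> > 0" "(real_of_int \<bar>fst a\<bar> + real_of_int \<bar>snd a\<bar>) * (\<delta> * exp m) \<le> \<kappa>"
  proof -
    define A where "A = real_of_int \<bar>fst a\<bar> + real_of_int \<bar>snd a\<bar>"
    have A: "A \<ge> 0" by (simp add: A_def)
    have e: "\<delta> * exp m = \<kappa> / (A + 1)" and d: "\<delta> = \<kappa> * exp (- m) / (A + 1)"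
      by (simp_all add: \<delta>_def A_def exp_minus)
    show "\<delta> > 0" unfolding d using \<kappa> A by simp
    have "A * \<kappa> \<le> \<kappa> * (A + 1)" using \<kappa> by (simp add: algebra_simps)
    then show "(real_of_int \<bar>fst a\<bar> + real_of_int \<bar>snd a\<bar>) * (\<delta> * exp m) \<le> \<kappa>"
      unfolding e A_def[symmetric] using A by (simp add: divide_le_eq)
  qed
  define K where "K = 96 * (real s)^4"
  define F where "F = (\<lambda>x. sector \<delta> x * cutoff \<delta> m x)"
  have F01: "0 \<le> F x" "F x \<le> 1" for x
    using sector_bounds[of \<delta> x] cutoff_bounds[of \<delta> m x] by (auto simp: F_def mult_le_one)
  obtain pX where pX: "\<And>x. x \<in> torus \<Longrightarrow> \<bar>Re (trig pX x) - cutoff \<delta> m x\<bar> \<le> \<kappa>"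
    using trig_approximation[OF continuous_cutoff[OF \<delta>(1) m(1)] \<kappa>] by blast
  have "continuous_on torus F"
    unfolding F_def by (intro continuous_on_mult continuous_cutoff continuous_sector \<delta> m)
  from trig_approximation[OF this \<kappa>]
  obtain pV where pV: "\<And>x. x \<in> torus \<Longrightarrow> \<bar>Re (trig pV x) - F x\<bar> \<le> \<kappa>" by blast
  define pH where "pH = map (\<lambda>(c, a). (c, prod.swap a)) pV"
  have tH: "trig pH x = trig pV (prod.swap x)" for x by (simp add: pH_def trig_map_swap)
  define u2 :: "(complex \<times> int \<times> int) list" where "u2 = [(complex_of_real (2 * K), 0), (of_real (- K), (1, 0)), (of_real (- K), (- 1, 0)),
     (complex_of_real (2 * K), 0), (of_real (- K), (0, 1)), (of_real (- K), (0, - 1 :: int))]"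
  have u2: "Re (trig u2 x) = K * ((norm (fst x - 1))\<^sup>2 + (norm (snd x - 1))\<^sup>2)" if "x \<in> torus" for x
    using norm_minus_one_squared_trig[OF that, of K] by (simp add: u2_def algebra_simps)
  have "L u2 = K * (2 * (1 - \<phi> (1, 0)) + 2 * (1 - \<phi> (0, 1)))"
    using phi_minus[of "(1, 0)"] phi_minus[of "(0, 1)"] by (simp add: u2_def algebra_simps)
  also have "\<dots> \<le> K * (4 * \<epsilon>)"
    using \<epsilon> by (intro mult_left_mono) (auto simp: K_def)
  finally have Lu2: "L u2 \<le> K * (4 * \<epsilon>)" .
  define qs where "qs = pX @ [(of_real (5 * \<kappa>), 0)] @ u2"
  have Lqs: "L qs \<le> L pX + 5 * \<kappa> + K * (4 * \<epsilon>)" using Lu2 by (simp add: qs_def)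
  have tq: "Re (trig qs x) = Re (trig pX x) + 5 * \<kappa> + K * ((norm (fst x - 1))\<^sup>2 + (norm (snd x - 1))\<^sup>2)"
    if "x \<in> torus" for x using u2[OF that] by (simp add: qs_def chr_def)
  have swp: "cutoff \<delta> m (prod.swap x) = cutoff \<delta> m x" for x by (simp add: cutoff_def dist1_def add.commute)
  have three: "Re (trig pV x) + Re (trig pV (torus_shear (int s) x)) + Re (trig pV (torus_shear (- int s) x)) \<le>
      cutoff \<delta> m x + 4 * \<kappa> + K * ((norm (fst x - 1))\<^sup>2 + (norm (snd x - 1))\<^sup>2)" if x: "x \<in> torus" for x
  proof -
    have "F x + F (torus_shear (int s) x) + F (torus_shear (- int s) x) \<le>
      cutoff \<delta> m x + \<kappa> + K * ((norm (fst x - 1))\<^sup>2 + (norm (snd x - 1))\<^sup>2)"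
      unfolding F_def K_def by (rule sector_shears[OF s x \<delta>(1) m])
    then show ?thesis
      using pV[OF x] pV[OF torus_shear_in[OF x], of "int s"] pV[OF torus_shear_in[OF x], of "- int s"] by linarith
  qed
  have KV: "\<bar>Re (trig pV x)\<bar> \<le> 1 + \<kappa>" if "x \<in> torus" for x
    using pV[OF that] F01[of x] by linarith
  have V: "3 * L pV \<le> L qs + 6 * sqrt \<epsilon> * (1 + \<kappa>)"
  proof (rule L_shear_sum[where \<gamma> = shear and S = torus_shear and s = s, OF h1])
    show "Re (trig pV x) + Re (trig pV (torus_shear (int s) x)) + Re (trig pV (torus_shear (- int s) x)) \<le> Re (trig qs x)"
      if "x \<in> torus" for x using three[OF that] tq[OF that] pX[OF that] by linarith
  qed (use \<epsilon> KV torus_shear_in trig_map_shear in \<open>auto simp: shear_def algebra_simps\<close>)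
  have H: "3 * L pH \<le> L qs + 6 * sqrt \<epsilon> * (1 + \<kappa>)"
  proof (rule L_shear_sum[where \<gamma> = shear' and S = "\<lambda>t x. prod.swap (torus_shear t (prod.swap x))" and s = s, OF h2])
    fix x assume x: "x \<in> torus"
    show "Re (trig pH x) + Re (trig pH (prod.swap (torus_shear (int s) (prod.swap x)))) +
        Re (trig pH (prod.swap (torus_shear (- int s) (prod.swap x)))) \<le> Re (trig qs x)"
      using three[OF torus_swap[OF x]] tq[OF x] pX[OF x] by (simp add: tH swp add.commute)
    show "\<bar>Re (trig pH x)\<bar> \<le> 1 + \<kappa>" using KV[OF torus_swap[OF x]] by (simp add: tH)
    fix t
    show "prod.swap (torus_shear t (prod.swap x)) \<in> torus" by (intro torus_swap torus_shear_in x)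
    fix ps
    have "trig (map (\<lambda>(c, u). (c, shear' t u)) ps) x =
      trig (map (\<lambda>(c, a). (c, prod.swap a)) (map (\<lambda>(c, u). (c, shear t u)) (map (\<lambda>(c, a). (c, prod.swap a)) ps))) x"
      by (rule arg_cong[where f = "\<lambda>l. trig l x"]) (simp add: comp_def case_prod_unfold shear_def shear'_def)
    also have "\<dots> = trig ps (prod.swap (torus_shear t (prod.swap x)))"
      by (simp only: trig_map_swap trig_map_shear[OF torus_swap[OF x]])
    finally show "trig (map (\<lambda>(c, u). (c, shear' t u)) ps) x = trig ps (prod.swap (torus_shear t (prod.swap x)))" .
  qed (use \<epsilon> in \<open>auto simp: shear'_def algebra_simps\<close>)
  have "L pX \<le> L (pV @ pH @ [(of_real (3 * \<kappa>), 0)])"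
  proof (rule L_mono)
    fix x assume x: "x \<in> torus"
    have "cutoff \<delta> m x \<le> F x + F (prod.swap x)"
      using cutoff_le_sectors[OF \<delta>(1), of m x] by (simp add: F_def swp)
    then show "Re (trig pX x) \<le> Re (trig (pV @ pH @ [(of_real (3 * \<kappa>), 0)]) x)"
      using pX[OF x] pV[OF x] pV[OF torus_swap[OF x]] by (simp add: tH chr_def)
  qed
  then have "L pX \<le> L pV + L pH + 3 * \<kappa>" by simp
  \<comment> \<open>Tripling the covering inequality and inserting \<open>V\<close> and
    \<open>H\<close> produces \<open>2 * L pX\<close> on the right, which leaves one
    \<open>L pX\<close> on the left.\<close>
  with V H Lqs have X: "L pX \<le> 19 * \<kappa> + 8 * (K * \<epsilon>) + 12 * sqrt \<epsilon> * (1 + \<kappa>)" by argo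
  have "L [(1, 0), (- 1, a)] \<le> L (pX @ pX @ [(of_real (3 * \<kappa>), 0)])"
  proof (rule L_mono)
    fix x assume x: "x \<in> torus"
    show "Re (trig [(1, 0), (- 1, a)] x) \<le> Re (trig (pX @ pX @ [(of_real (3 * \<kappa>), 0)]) x)"
      using one_minus_chr_le[OF x \<delta>(1) m(1) \<delta>(2)] pX[OF x] \<kappa> by (simp add: chr_def)
  qed
  then have "1 - \<phi> a \<le> 2 * L pX + 3 * \<kappa>" by simp
  also have "\<dots> \<le> 41 * \<kappa> + 16 * (K * \<epsilon>) + 24 * sqrt \<epsilon> * (1 + \<kappa>)" using X by argo
  also have "\<dots> = 1536 * (real s)^4 * \<epsilon> + 24 * sqrt \<epsilon> + \<kappa> * (41 + 24 * sqrt \<epsilon>)"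
    by (simp add: K_def algebra_simps)
  also have "\<kappa> * (41 + 24 * sqrt \<epsilon>) = e" using den by (simp add: \<kappa>_def)
  finally show "1 - \<phi> a \<le> 1536 * (real s)^4 * \<epsilon> + 24 * sqrt \<epsilon> + e" .
qed

end

section \<open>Haar measure on powers of the p-adic integers\<close>

text \<open>\<open>zspace p\<close> is \<open>\<int>\<^sub>p\<close> to the power of the index type: \<open>w k i\<close> is the residue of coordinate \<open>i\<close> modulo \<open>p ^ k\<close>.\<close>

definition zlev :: "nat \<Rightarrow> nat \<Rightarrow> ('i::finite \<Rightarrow> int) set" where
  "zlev p k = UNIV \<rightarrow>\<^sub>E {0..<int p ^ k}"

lemma mem_zlev: "v \<in> zlev p k \<longleftrightarrow> (\<forall>i. 0 \<le> v i \<and> v i < int p ^ k)"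
  by (auto simp: zlev_def PiE_UNIV_domain)

lemma finite_zlev [simp]: "finite (zlev p k)"
  by (simp add: zlev_def finite_PiE)

lemma card_zlev: "card (zlev p k :: ('i::finite \<Rightarrow> int) set) = (p ^ k) ^ CARD('i)"
  by (simp add: zlev_def card_PiE nat_power_eq)

definition zspace :: "nat \<Rightarrow> (nat \<Rightarrow> 'i::finite \<Rightarrow> int) set" where
  "zspace p = {w. \<forall>k. w k \<in> zlev p k \<and> (\<forall>i. w (Suc k) i mod int p ^ k = w k i)}"

definition zcyl :: "nat \<Rightarrow> nat \<Rightarrow> ('i::finite \<Rightarrow> int) \<Rightarrow> (nat \<Rightarrow> 'i \<Rightarrow> int) set" where
  "zcyl p k v = {w \<in> zspace p. w k = v}"

definition zsigma :: "nat \<Rightarrow> (nat \<Rightarrow> 'i::finite \<Rightarrow> int) measure" where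
  "zsigma p = sigma (zspace p) (range (\<lambda>(k, v). zcyl p k v))"

definition zdigits :: "nat \<Rightarrow> (nat \<Rightarrow> 'i::finite \<Rightarrow> int) measure" where
  "zdigits p = (\<Pi>\<^sub>M l\<in>UNIV. uniform_count_measure (zlev p 1))"

definition zval :: "nat \<Rightarrow> (nat \<Rightarrow> 'i \<Rightarrow> int) \<Rightarrow> nat \<Rightarrow> 'i \<Rightarrow> int" where
  "zval p d k i = (\<Sum>l<k. d l i * int p ^ l)"

text \<open>The law of a p-adic expansion with independent, uniformly distributed digits. Invariance
  is derived later from the equal measure of cylinders of the same level.\<close>

definition haar :: "nat \<Rightarrow> (nat \<Rightarrow> 'i::finite \<Rightarrow> int) measure" where
  "haar p = distr (zdigits p) (zsigma p) (zval p)"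

lemma zspaceD:
  assumes "w \<in> zspace p"
  shows "w k \<in> zlev p k" "w (Suc k) i mod int p ^ k = w k i" "0 \<le> w k i" "w k i < int p ^ k"
    "w k i mod int p ^ k = w k i"
proof -
  show a: "w k \<in> zlev p k" "w (Suc k) i mod int p ^ k = w k i" using assms by (auto simp: zspace_def)
  then show "0 \<le> w k i" "w k i < int p ^ k" by (auto simp: mem_zlev)
  then show "w k i mod int p ^ k = w k i" by simp
qed

lemma zspace_mod:
  assumes "w \<in> zspace p" "j \<le> k"
  shows "w k i mod int p ^ j = w j i"
  using assms(2)
proof (induction k rule: dec_induct)
  case base
  show ?case using zspaceD(5)[OF assms(1)] .
next
  case (step n)
  have "w (Suc n) i mod int p ^ n mod int p ^ j = w (Suc n) i mod int p ^ j"
    using step by (intro mod_mod_cancel le_imp_power_dvd) auto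
  then show ?case using step zspaceD(2)[OF assms(1)] by simp
qed

lemma zspace_level_mono:
  assumes "w \<in> zspace p" "w' \<in> zspace p" "w k = w' k" "j \<le> k"
  shows "w j = w' j"
proof
  fix i show "w j i = w' j i"
    using zspace_mod[OF assms(1,4), of i] zspace_mod[OF assms(2,4), of i] assms(3) by simp
qed

lemma zcylE:
  assumes "X \<in> range (\<lambda>(k, v). zcyl p k v)"
  obtains k v where "X = zcyl p k v"
  using assms by auto

lemma space_zsigma [simp]: "space (zsigma p) = zspace p"
  by (simp add: zsigma_def space_measure_of_conv)

lemma space_haar [simp]: "space (haar p) = zspace p" and sets_haar: "sets (haar p) = sets (zsigma p)"
  by (simp_all add: haar_def)

lemma sets_haar_sigma_sets: "sets (haar p) = sigma_sets (zspace p) (range (\<lambda>(k, v). zcyl p k v))"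
  unfolding sets_haar zsigma_def by (rule sets_measure_of) (auto simp: zcyl_def)

lemma zcyl_in_sets: "zcyl p k v \<in> sets (haar p)"
  unfolding sets_haar_sigma_sets by (rule sigma_sets.Basic) (auto intro!: image_eqI[of _ _ "(k, v)"])

lemma measurable_level [measurable]:
  "(\<lambda>w. w k) \<in> (haar p :: (nat \<Rightarrow> 'i::finite \<Rightarrow> int) measure) \<rightarrow>\<^sub>M count_space UNIV"
proof (rule measurableI)
  fix S :: "('i \<Rightarrow> int) set"
  have "(\<lambda>w. w k) -` S \<inter> space (haar p) = (\<Union>v\<in>S \<inter> zlev p k. zcyl p k v)"
    by (auto simp: zcyl_def zspaceD(1))
  also have "\<dots> \<in> sets (haar p)" by (intro sets.finite_UN) (auto simp: zcyl_in_sets)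
  finally show "(\<lambda>w. w k) -` S \<inter> space (haar p) \<in> sets (haar p)" .
qed simp

lemma measurable_haarI:
  fixes f :: "'a \<Rightarrow> nat \<Rightarrow> 'i::finite \<Rightarrow> int"
  assumes "\<And>x. x \<in> space N \<Longrightarrow> f x \<in> zspace p"
    and "\<And>k. (\<lambda>x. f x k) \<in> N \<rightarrow>\<^sub>M count_space UNIV"
  shows "f \<in> N \<rightarrow>\<^sub>M haar p"
proof -
  have "f \<in> N \<rightarrow>\<^sub>M zsigma p"
    unfolding zsigma_def
  proof (rule measurable_measure_of)
    fix A :: "(nat \<Rightarrow> 'i \<Rightarrow> int) set" assume "A \<in> range (\<lambda>(k, v). zcyl p k v)"
    then obtain k v where A: "A = zcyl p k v" by auto
    have "f -` A \<inter> space N = (\<lambda>x. f x k) -` {v} \<inter> space N"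
      using assms(1) by (auto simp: A zcyl_def)
    then show "f -` A \<inter> space N \<in> sets N" using measurable_sets[OF assms(2), of "{v}" k] by simp
  qed (use assms(1) in \<open>auto simp: zcyl_def\<close>)
  then show ?thesis by (simp cong: measurable_cong_sets add: sets_haar)
qed

lemma zval_bound:
  assumes "\<forall>l i. 0 \<le> d l i \<and> d l i < int p"
  shows "0 \<le> zval p d k i" "zval p d k i < int p ^ k"
proof -
  show "0 \<le> zval p d k i" unfolding zval_def using assms by (intro sum_nonneg mult_nonneg_nonneg) auto
  show "zval p d k i < int p ^ k"
  proof (induction k)
    case (Suc k)
    have "d k i * int p ^ k \<le> (int p - 1) * int p ^ k" using assms[rule_format, of k i] by (intro mult_right_mono) auto
    then show ?case using Suc by (simp add: zval_def algebra_simps)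
  qed (simp add: zval_def)
qed

lemma zval_digit:
  assumes "\<forall>l i. 0 \<le> d l i \<and> d l i < int p" "l < k"
  shows "zval p d k i div int p ^ l mod int p = d l i"
  using assms(2)
proof (induction k)
  case (Suc k)
  have p: "int p > 0" using assms(1)[rule_format, of 0 i] by linarith
  have S: "zval p d (Suc k) i = zval p d k i + d k i * int p ^ k" by (simp add: zval_def)
  show ?case
  proof (cases "l = k")
    case True
    have "(zval p d k i + d k i * int p ^ k) div int p ^ k = d k i"
      using zval_bound[OF assms(1), where k = k and i = i] p by simp
    then show ?thesis unfolding S True using assms(1)[rule_format, of k i] by simp
  next
    case False
    then have lk: "l < k" using Suc by simp
    have "d k i * int p ^ k = (d k i * int p ^ (k - l - 1) * int p) * int p ^ l"
    proof -
      have "k = (k - l - 1) + 1 + l" using lk by simp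
      then have "int p ^ k = int p ^ (k - l - 1) * int p * int p ^ l"
        by (metis power_add power_one_right)
      then show ?thesis by simp
    qed
    then have "(zval p d k i + d k i * int p ^ k) div int p ^ l =
        zval p d k i div int p ^ l + d k i * int p ^ (k - l - 1) * int p"
      using p by (metis div_mult_self1 power_eq_0_iff less_irrefl mult.commute add.commute)
    then show ?thesis unfolding S using Suc.IH[OF lk] by simp
  qed
qed simp

lemma digit_expansion:
  fixes x :: int
  assumes "0 \<le> x" "x < int p ^ k" "p > 0"
  shows "(\<Sum>l<k. (x div int p ^ l mod int p) * int p ^ l) = x"
proof -
  have "(\<Sum>l<k. (x div int p ^ l mod int p) * int p ^ l) = x mod int p ^ k"
  proof (induction k)
    case (Suc k)
    have "x mod int p ^ Suc k = int p ^ k * (x div int p ^ k mod int p) + x mod int p ^ k"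
      unfolding power_Suc2 by (rule zmod_zmult2_eq) simp
    then show ?case using Suc by (simp add: mult.commute)
  qed simp
  then show ?thesis using assms by simp
qed

context
  fixes p :: nat assumes p: "p > 0"
begin

lemma zlev_nonempty: "(zlev p k :: ('i::finite \<Rightarrow> int) set) \<noteq> {}"
proof -
  have "(\<lambda>_. 0) \<in> (zlev p k :: ('i \<Rightarrow> int) set)" using p by (simp add: mem_zlev)
  then show ?thesis by blast
qed

lemma product_prob_space_zdigits:
  "product_prob_space (\<lambda>_::nat. uniform_count_measure (zlev p 1 :: ('i::finite \<Rightarrow> int) set))"
  by (intro product_prob_spaceI prob_space_uniform_count_measure) (auto simp: zlev_nonempty)

lemma space_zdigits: "d \<in> space (zdigits p) \<longleftrightarrow> (\<forall>l i. 0 \<le> d l i \<and> d l i < int p)"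
  by (auto simp: zdigits_def space_PiM mem_zlev PiE_UNIV_domain Pi_def space_uniform_count_measure)

lemma zval_zspace: "d \<in> space (zdigits p) \<Longrightarrow> zval p d \<in> zspace p"
proof -
  assume "d \<in> space (zdigits p)"
  then have d: "\<forall>l i. 0 \<le> d l i \<and> d l i < int p" by (simp add: space_zdigits)
  note b = zval_bound[OF d]
  have "zval p d (Suc k) i mod int p ^ k = zval p d k i" for k i
  proof -
    have "zval p d (Suc k) i = zval p d k i + d k i * int p ^ k" by (simp add: zval_def)
    then show ?thesis using b[of k i] by simp
  qed
  then show ?thesis using b by (auto simp: zspace_def mem_zlev)
qed

lemma zval_vimage_zcyl:
  assumes v: "v \<in> zlev p k"
  shows "zval p -` zcyl p k v \<inter> space (zdigits p) =
    prod_emb UNIV (\<lambda>_. uniform_count_measure (zlev p 1)) {..<k}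
      (Pi\<^sub>E {..<k} (\<lambda>l. {\<lambda>i. v i div int p ^ l mod int p}))"
proof (intro Set.set_eqI iffI)
  fix d assume d: "d \<in> zval p -` zcyl p k v \<inter> space (zdigits p)"
  then have b: "\<forall>l i. 0 \<le> d l i \<and> d l i < int p" by (simp add: space_zdigits)
  have "d l = (\<lambda>i. v i div int p ^ l mod int p)" if "l < k" for l
    using zval_digit[OF b that] d by (auto simp: zcyl_def)
  then show "d \<in> prod_emb UNIV (\<lambda>_. uniform_count_measure (zlev p 1)) {..<k}
      (Pi\<^sub>E {..<k} (\<lambda>l. {\<lambda>i. v i div int p ^ l mod int p}))"
    using b by (auto simp: prod_emb_def mem_zlev PiE_UNIV_domain Pi_def space_uniform_count_measure)
next
  fix d assume d: "d \<in> prod_emb UNIV (\<lambda>_. uniform_count_measure (zlev p 1)) {..<k}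
      (Pi\<^sub>E {..<k} (\<lambda>l. {\<lambda>i. v i div int p ^ l mod int p}))"
  then have sp: "d \<in> space (zdigits p)"
    by (auto simp: prod_emb_def zdigits_def space_PiM)
  have "d l = (\<lambda>i. v i div int p ^ l mod int p)" if "l < k" for l
    using d that by (auto simp: prod_emb_def PiE_iff restrict_def)
  then have "zval p d k i = v i" for i
    unfolding zval_def using digit_expansion[of "v i" p k] v p by (simp add: mem_zlev)
  then show "d \<in> zval p -` zcyl p k v \<inter> space (zdigits p)"
    using sp zval_zspace by (auto simp: zcyl_def)
qed

lemma zval_measurable: "zval p \<in> zdigits p \<rightarrow>\<^sub>M (zsigma p :: (nat \<Rightarrow> 'i::finite \<Rightarrow> int) measure)"
proof -
  interpret product_prob_space "\<lambda>_::nat. uniform_count_measure (zlev p 1 :: ('i \<Rightarrow> int) set)" UNIV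
    by (rule product_prob_space_zdigits)
  show ?thesis
    unfolding zsigma_def
  proof (rule measurable_measure_of)
    fix A :: "(nat \<Rightarrow> 'i \<Rightarrow> int) set" assume "A \<in> range (\<lambda>(k, v). zcyl p k v)"
    then obtain k v where A: "A = zcyl p k v" by auto
    show "zval p -` A \<inter> space (zdigits p) \<in> sets (zdigits p)"
    proof (cases "v \<in> zlev p k")
      case True
      show ?thesis
        unfolding A zval_vimage_zcyl[OF True] unfolding zdigits_def
        using True p by (intro sets_PiM_I) (auto simp: mem_zlev)
    next
      case False
      then have "A = {}" using zspaceD(1) by (auto simp: A zcyl_def)
      then show ?thesis by simp
    qed
  qed (auto simp: zcyl_def zval_zspace)
qed

lemma prob_space_haar: "prob_space (haar p :: (nat \<Rightarrow> 'i::finite \<Rightarrow> int) measure)"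
proof -
  interpret product_prob_space "\<lambda>_::nat. uniform_count_measure (zlev p 1 :: ('i \<Rightarrow> int) set)" UNIV
    by (rule product_prob_space_zdigits)
  show ?thesis
    unfolding haar_def by (rule prob_space.prob_space_distr[OF _ zval_measurable])
      (use P.prob_space_axioms in \<open>simp add: zdigits_def\<close>)
qed

lemma emeasure_zcyl:
  fixes v :: "'i::finite \<Rightarrow> int"
  assumes v: "v \<in> zlev p k"
  shows "emeasure (haar p) (zcyl p k v) = ennreal (1 / real ((p ^ k) ^ CARD('i)))"
proof -
  interpret product_prob_space "\<lambda>_::nat. uniform_count_measure (zlev p 1 :: ('i \<Rightarrow> int) set)" UNIV
    by (rule product_prob_space_zdigits)
  have "emeasure (haar p) (zcyl p k v) = emeasure (zdigits p) (zval p -` zcyl p k v \<inter> space (zdigits p))"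
    unfolding haar_def using zcyl_in_sets by (intro emeasure_distr zval_measurable) (auto simp: sets_haar)
  also have "\<dots> = (\<Prod>l<k. emeasure (uniform_count_measure (zlev p 1 :: ('i \<Rightarrow> int) set)) {\<lambda>i. v i div int p ^ l mod int p})"
    unfolding zval_vimage_zcyl[OF v] unfolding zdigits_def
    using p by (intro emeasure_PiM_emb) (auto simp: mem_zlev)
  also have "\<dots> = (\<Prod>l<k. ennreal (1 / real (p ^ CARD('i))))"
    using p by (intro prod.cong refl) (subst emeasure_uniform_count_measure, auto simp: mem_zlev card_zlev)
  also have "\<dots> = ennreal (1 / real ((p ^ k) ^ CARD('i)))"
    using p by (simp add: power_one_over ennreal_power mult.commute flip: power_mult)
  finally show ?thesis .
qed

text \<open>Two cylinders are nested or disjoint, so with the empty set they form a generator stable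
  under intersection. The whole space is the cylinder of level 0, where all residues are 0.\<close>

lemma haar_eqI:
  fixes N :: "(nat \<Rightarrow> 'i::finite \<Rightarrow> int) measure"
  assumes sets: "sets N = sets (haar p)"
    and cyl: "\<And>k v. v \<in> zlev p k \<Longrightarrow> emeasure N (zcyl p k v) = emeasure (haar p) (zcyl p k v)"
  shows "N = haar p"
proof (rule measure_eqI_generator_eq[where \<Omega> = "zspace p" and E = "range (\<lambda>(k, v). zcyl p k v)"
      and A = "\<lambda>_. zspace p"])
  have sp: "zspace p = (zcyl p 0 (\<lambda>_. 0) :: (nat \<Rightarrow> 'i \<Rightarrow> int) set)"
  proof -
    have "w 0 = (\<lambda>_. 0)" if "w \<in> zspace p" for w :: "nat \<Rightarrow> 'i \<Rightarrow> int"
      using zspaceD(3,4)[OF that, of 0] by (intro ext) (smt (verit) power_0)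
    then show ?thesis by (auto simp: zcyl_def)
  qed
  show "range (\<lambda>_::nat. zspace p) \<subseteq> range (\<lambda>(k, v). zcyl p k v :: (nat \<Rightarrow> 'i \<Rightarrow> int) set)"
    using sp by (auto intro!: image_eqI[of _ _ "(0, \<lambda>_. 0)"])
  have emp: "zcyl p k v = {}" if "v \<notin> zlev p k" for k and v :: "'i \<Rightarrow> int"
    using that zspaceD(1) by (auto simp: zcyl_def)
  have le: "zcyl p j u \<inter> zcyl p k v \<in> range (\<lambda>(k, v). zcyl p k v)" if "j \<le> k" for j k and u v :: "'i \<Rightarrow> int"
  proof (cases "zcyl p j u \<inter> zcyl p k v = {}")
    case True
    \<comment> \<open>The constant -1 is never a reduced residue, so its cylinder presents the empty
      set as a member of the generator.\<close>
    have "{} = zcyl p 0 (\<lambda>_::'i. - 1)" by (subst emp) (auto simp: mem_zlev)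
    then show ?thesis using True by (auto intro!: image_eqI[of _ _ "(0, \<lambda>_. - 1)"])
  next
    case False
    then obtain w where w: "w \<in> zspace p" "w j = u" "w k = v" by (auto simp: zcyl_def)
    have "zcyl p j u \<inter> zcyl p k v = zcyl p k v"
      using zspace_level_mono[OF _ w(1) _ that] w by (auto simp: zcyl_def)
    then show ?thesis by (auto intro!: image_eqI[of _ _ "(k, v)"])
  qed
  show "Int_stable (range (\<lambda>(k, v). zcyl p k v :: (nat \<Rightarrow> 'i \<Rightarrow> int) set))"
  proof (rule Int_stableI)
    fix a b :: "(nat \<Rightarrow> 'i \<Rightarrow> int) set"
    assume "a \<in> range (\<lambda>(k, v). zcyl p k v)" "b \<in> range (\<lambda>(k, v). zcyl p k v)"
    then obtain j u k v where ab: "a = zcyl p j u" "b = zcyl p k v" by auto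
    show "a \<inter> b \<in> range (\<lambda>(k, v). zcyl p k v)"
      unfolding ab using le[of j k u v] le[of k j v u] by (cases "j \<le> k") (auto simp: Int_commute)
  qed
  show "emeasure N X = emeasure (haar p) X" if "X \<in> range (\<lambda>(k, v). zcyl p k v)" for X :: "(nat \<Rightarrow> 'i \<Rightarrow> int) set"
  proof -
    from that obtain k v where X: "X = zcyl p k v" by (rule zcylE)
    show ?thesis using cyl[of v k] emp[of v k] by (cases "v \<in> zlev p k") (auto simp: X)
  qed
  show "emeasure N (zspace p) \<noteq> \<infinity>" for i :: nat
  proof -
    have "emeasure N (zspace p) = emeasure (haar p) (zspace p :: (nat \<Rightarrow> 'i \<Rightarrow> int) set)"
      unfolding sp by (rule cyl) (simp add: mem_zlev)
    also have "\<dots> = 1" using prob_space.emeasure_space_1[OF prob_space_haar] by simp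
    finally show ?thesis by simp
  qed
qed (auto simp: sets sets_haar_sigma_sets zcyl_def)

end

section \<open>Arithmetic and invariance of Haar measure\<close>

lemma zspace_cong:
  assumes "w \<in> zspace p"
  shows "[w (Suc k) i = w k i] (mod int p ^ k)"
  using zspaceD(2,5)[OF assms] by (metis cong_def)

definition zred :: "nat \<Rightarrow> (nat \<Rightarrow> 'i \<Rightarrow> int) \<Rightarrow> nat \<Rightarrow> 'i \<Rightarrow> int" where
  "zred p F = (\<lambda>k i. F k i mod int p ^ k)"

definition zadd :: "nat \<Rightarrow> (nat \<Rightarrow> 'i \<Rightarrow> int) \<Rightarrow> (nat \<Rightarrow> 'i \<Rightarrow> int) \<Rightarrow> nat \<Rightarrow> 'i \<Rightarrow> int" where
  "zadd p t u = zred p (\<lambda>k i. t k i + u k i)"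

definition zsub :: "nat \<Rightarrow> (nat \<Rightarrow> 'i \<Rightarrow> int) \<Rightarrow> (nat \<Rightarrow> 'i \<Rightarrow> int) \<Rightarrow> nat \<Rightarrow> 'i \<Rightarrow> int" where
  "zsub p t u = zred p (\<lambda>k i. t k i - u k i)"

definition zsmul :: "nat \<Rightarrow> int \<Rightarrow> (nat \<Rightarrow> 'i \<Rightarrow> int) \<Rightarrow> nat \<Rightarrow> 'i \<Rightarrow> int" where
  "zsmul p c t = zred p (\<lambda>k i. c * t k i)"

lemma zred_in_zspace:
  fixes F :: "nat \<Rightarrow> 'i::finite \<Rightarrow> int"
  assumes "p > 0" "\<And>k i. [F (Suc k) i = F k i] (mod int p ^ k)"
  shows "zred p F \<in> zspace p"
proof -
  have "F (Suc k) i mod int p ^ Suc k mod int p ^ k = F k i mod int p ^ k" for k i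
    using assms(2)[of k i] by (simp add: cong_def mod_mod_cancel)
  then show ?thesis using assms(1) by (simp add: zspace_def zred_def mem_zlev)
qed

lemma zadd_in [simp]: "p > 0 \<Longrightarrow> t \<in> zspace p \<Longrightarrow> u \<in> zspace p \<Longrightarrow> zadd p t u \<in> zspace p"
  unfolding zadd_def by (rule zred_in_zspace, assumption, rule cong_add; rule zspace_cong; assumption)

lemma zsub_in [simp]: "p > 0 \<Longrightarrow> t \<in> zspace p \<Longrightarrow> u \<in> zspace p \<Longrightarrow> zsub p t u \<in> zspace p"
  unfolding zsub_def by (rule zred_in_zspace, assumption, rule cong_diff; rule zspace_cong; assumption)

lemma zsmul_in [simp]: "p > 0 \<Longrightarrow> t \<in> zspace p \<Longrightarrow> zsmul p c t \<in> zspace p"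
  unfolding zsmul_def by (rule zred_in_zspace, assumption, rule cong_scalar_left, rule zspace_cong, assumption)

lemma zadd_commute: "zadd p t u = zadd p u t"
  by (simp add: zadd_def add.commute)

lemma zadd_assoc: "zadd p (zadd p t u) v = zadd p t (zadd p u v)"
  by (intro ext) (simp add: zadd_def zred_def mod_simps add.assoc)

lemma zadd_left_commute: "zadd p t (zadd p u v) = zadd p u (zadd p t v)"
  by (metis zadd_assoc zadd_commute)

lemma zsub_zadd: "t \<in> zspace p \<Longrightarrow> zadd p (zsub p t u) u = t"
  by (intro ext) (simp add: zadd_def zsub_def zred_def mod_simps zspaceD(5))

lemma zadd_zsub: "t \<in> zspace p \<Longrightarrow> zsub p (zadd p t u) u = t"
  by (intro ext) (simp add: zadd_def zsub_def zred_def mod_simps zspaceD(5))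

lemma zsmul_zadd: "zsmul p c (zadd p t u) = zadd p (zsmul p c t) (zsmul p c u)"
  by (intro ext) (simp add: zadd_def zsmul_def zred_def mod_simps distrib_left)

lemma zsmul_zsmul: "zsmul p c (zsmul p d t) = zsmul p (c * d) t"
  by (intro ext) (simp add: zsmul_def zred_def mod_simps mult.assoc)

lemma zsmul_one: "t \<in> zspace p \<Longrightarrow> zsmul p 1 t = t"
  by (intro ext) (simp add: zsmul_def zred_def zspaceD(5))

lemma zsmul_add: "zsmul p (c + d) t = zadd p (zsmul p c t) (zsmul p d t)"
  by (intro ext) (simp add: zadd_def zsmul_def zred_def mod_simps distrib_right)

text \<open>At level \<open>k + j\<close> the factor \<open>p ^ j\<close> cancels against the
  modulus and leaves level \<open>k\<close>: multiplication costs \<open>j\<close> levels but loses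
  nothing.\<close>

lemma zsmul_power_inj:
  assumes "p > 0" "t \<in> zspace p" "u \<in> zspace p" "zsmul p (int p ^ j) t = zsmul p (int p ^ j) u"
  shows "t = u"
proof (intro ext)
  fix k i
  have "zsmul p (int p ^ j) t (k + j) i = zsmul p (int p ^ j) u (k + j) i" using assms(4) by simp
  then have "[int p ^ j * t (k + j) i = int p ^ j * u (k + j) i] (mod int p ^ j * int p ^ k)"
    by (simp add: zsmul_def zred_def cong_def power_add mult.commute)
  then have "[t (k + j) i = u (k + j) i] (mod int p ^ k)"
    using assms(1) by (simp add: cong_iff_dvd_diff flip: right_diff_distrib)
  then have "t (k + j) i mod int p ^ k = u (k + j) i mod int p ^ k" by (simp add: cong_def)
  then show "t k i = u k i" using zspace_mod[OF assms(2), of k "k + j"] zspace_mod[OF assms(3), of k "k + j"] by simp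
qed

lemma zlev_surj:
  fixes v :: "'i::finite \<Rightarrow> int"
  assumes "p > 0" "v \<in> zlev p k"
  obtains w where "w \<in> zspace p" "w k = v"
proof
  show "zred p (\<lambda>_. v) \<in> zspace p" by (rule zred_in_zspace) (use assms in auto)
  show "zred p (\<lambda>_. v) k = v" using assms by (auto simp: zred_def mem_zlev)
qed

text \<open>An injection of the finite set of residues permutes the cylinders of each level, and
  these have equal measure.\<close>

lemma mpt_haarI:
  fixes T :: "(nat \<Rightarrow> 'i::finite \<Rightarrow> int) \<Rightarrow> _"
  assumes p: "p > 0" and T: "\<And>w. w \<in> zspace p \<Longrightarrow> T w \<in> zspace p"
    and lev: "\<And>w k. w \<in> zspace p \<Longrightarrow> T w k = \<tau> k (w k)"
    and inj: "\<And>k. inj_on (\<tau> k) (zlev p k)"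
  shows "mpt (haar p) T"
proof -
  have meas: "T \<in> haar p \<rightarrow>\<^sub>M haar p"
  proof (rule measurable_haarI)
    fix k
    have "(\<lambda>w. \<tau> k (w k)) \<in> haar p \<rightarrow>\<^sub>M count_space UNIV"
      by (rule measurable_compose[OF measurable_level]) simp
    then show "(\<lambda>w. T w k) \<in> haar p \<rightarrow>\<^sub>M count_space UNIV"
      by (rule measurable_cong[THEN iffD1, rotated]) (simp add: lev)
  qed (simp add: T)
  moreover have "distr (haar p) (haar p) T = haar p"
  proof (rule haar_eqI[OF p])
    fix k and v :: "'i \<Rightarrow> int" assume v: "v \<in> zlev p k"
    have "\<tau> k ` zlev p k \<subseteq> zlev p k"
    proof
      fix y assume "y \<in> \<tau> k ` zlev p k"
      then obtain u where u: "u \<in> zlev p k" "y = \<tau> k u" by auto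
      obtain w where w: "w \<in> zspace p" "w k = u" using zlev_surj[OF p u(1)] .
      show "y \<in> zlev p k" using zspaceD(1)[OF T[OF w(1)], of k] lev[OF w(1), of k] w u by auto
    qed
    then have "\<tau> k ` zlev p k = zlev p k" using inj by (intro endo_inj_surj) auto
    then obtain u where u: "u \<in> zlev p k" "\<tau> k u = v" using v by (metis imageE)
    have "T -` zcyl p k v \<inter> space (haar p) = zcyl p k u"
    proof (rule Set.set_eqI)
      fix w
      have "w \<in> zspace p \<Longrightarrow> \<tau> k (w k) = \<tau> k u \<longleftrightarrow> w k = u"
        by (rule inj_on_eq_iff[OF inj zspaceD(1) u(1)])
      then show "w \<in> T -` zcyl p k v \<inter> space (haar p) \<longleftrightarrow> w \<in> zcyl p k u"
        using u(2) by (auto simp: zcyl_def T lev)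
    qed
    then show "emeasure (distr (haar p) (haar p) T) (zcyl p k v) = emeasure (haar p) (zcyl p k v)"
      by (simp add: emeasure_distr[OF meas zcyl_in_sets] emeasure_zcyl[OF p] u v)
  qed simp
  ultimately show ?thesis by (simp add: mpt_def)
qed

lemma mod_add_inj:
  fixes x y z :: int
  assumes "(x + z) mod n = (y + z) mod n" "0 \<le> x" "x < n" "0 \<le> y" "y < n"
  shows "x = y"
proof -
  have "[x + z = y + z] (mod n)" using assms(1) by (simp add: cong_def)
  then have "[x = y] (mod n)" by (simp add: cong_add_rcancel)
  then show ?thesis using assms by (simp add: cong_def)
qed

lemma mpt_zadd: "p > 0 \<Longrightarrow> u \<in> zspace p \<Longrightarrow> mpt (haar p) (\<lambda>t. zadd p t u)"
proof (rule mpt_haarI[where \<tau> = "\<lambda>k v i. (v i + u k i) mod int p ^ k"])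
  fix k
  show "inj_on (\<lambda>v i. (v i + u k i) mod int p ^ k) (zlev p k)"
  proof (rule inj_onI, rule ext)
    fix v w i assume vw: "v \<in> zlev p k" "w \<in> zlev p k"
      "(\<lambda>i. (v i + u k i) mod int p ^ k) = (\<lambda>i. (w i + u k i) mod int p ^ k)"
    then have "(v i + u k i) mod int p ^ k = (w i + u k i) mod int p ^ k" by metis
    then show "v i = w i" by (rule mod_add_inj) (use vw in \<open>auto simp: mem_zlev\<close>)
  qed
qed (simp, simp, simp add: zadd_def zred_def)

lemma mpt_zsub: "p > 0 \<Longrightarrow> u \<in> zspace p \<Longrightarrow> mpt (haar p) (\<lambda>t. zsub p u t)"
proof (rule mpt_haarI[where \<tau> = "\<lambda>k v i. (u k i - v i) mod int p ^ k"])
  fix k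
  show "inj_on (\<lambda>v i. (u k i - v i) mod int p ^ k) (zlev p k)"
  proof (rule inj_onI, rule ext)
    fix v w i assume vw: "v \<in> zlev p k" "w \<in> zlev p k"
      "(\<lambda>i. (u k i - v i) mod int p ^ k) = (\<lambda>i. (u k i - w i) mod int p ^ k)"
    then have "(u k i - v i) mod int p ^ k = (u k i - w i) mod int p ^ k" by metis
    then have c: "[u k i - v i = u k i - w i] (mod int p ^ k)" by (simp add: cong_def)
    from cong_diff[OF cong_refl[of "u k i"] c] show "v i = w i" using vw by (simp add: cong_def mem_zlev)
  qed
qed (simp, simp, simp add: zsub_def zred_def)

text \<open>Residue vectors at one level form a countable type, so an arbitrary \<open>h\<close>
  preserves measurability.\<close>

lemma measurable_level2:
  fixes f g :: "'a \<Rightarrow> nat \<Rightarrow> 'i::finite \<Rightarrow> int"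
  assumes f: "f \<in> N \<rightarrow>\<^sub>M haar p" and g: "g \<in> N \<rightarrow>\<^sub>M haar q"
  shows "(\<lambda>x. h (f x k) (g x j)) \<in> N \<rightarrow>\<^sub>M count_space UNIV"
proof -
  have 1: "(\<lambda>x. f x k) \<in> N \<rightarrow>\<^sub>M count_space UNIV" by (rule measurable_compose[OF f measurable_level])
  have 2: "(\<lambda>x. g x j) \<in> N \<rightarrow>\<^sub>M count_space UNIV" by (rule measurable_compose[OF g measurable_level])
  show ?thesis
    by (rule measurable_compose_countable[OF measurable_compose[OF 2] 1]) simp
qed

lemma measurable_zadd:
  assumes "p > 0" "f \<in> N \<rightarrow>\<^sub>M haar p" "g \<in> N \<rightarrow>\<^sub>M haar p"
  shows "(\<lambda>x. zadd p (f x) (g x)) \<in> N \<rightarrow>\<^sub>M haar p"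
proof (rule measurable_haarI)
  show "(\<lambda>x. zadd p (f x) (g x) k) \<in> N \<rightarrow>\<^sub>M count_space UNIV" for k
    unfolding zadd_def zred_def by (rule measurable_level2[OF assms(2,3)])
  show "zadd p (f x) (g x) \<in> zspace p" if "x \<in> space N" for x
    using measurable_space[OF assms(2) that] measurable_space[OF assms(3) that] assms(1) by simp
qed

lemma measurable_zsmul:
  assumes "p > 0" "f \<in> N \<rightarrow>\<^sub>M haar p"
  shows "(\<lambda>x. zsmul p c (f x)) \<in> N \<rightarrow>\<^sub>M haar p"
proof (rule measurable_haarI)
  show "(\<lambda>x. zsmul p c (f x) k) \<in> N \<rightarrow>\<^sub>M count_space UNIV" for k
    unfolding zsmul_def zred_def by (rule measurable_level2[OF assms(2,2), where h = "\<lambda>u _ i. c * u i mod int p ^ k"])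
  show "zsmul p c (f x) \<in> zspace p" if "x \<in> space N" for x
    using measurable_space[OF assms(2) that] assms(1) by simp
qed

lemma haar_singleton:
  fixes w :: "nat \<Rightarrow> 'i::finite \<Rightarrow> int"
  assumes p: "p \<ge> 2" and w: "w \<in> zspace p"
  shows "{w} \<in> null_sets (haar p)"
proof -
  have "{w} = (\<Inter>k. zcyl p k (w k))"
    using w by (auto simp: zcyl_def)
  moreover have "(\<Inter>k. zcyl p k (w k)) \<in> sets (haar p)"
    by (rule sets.countable_INT) (auto simp: zcyl_in_sets)
  ultimately have sets: "{w} \<in> sets (haar p)" by simp
  have "emeasure (haar p) {w} \<le> ennreal (1 / 2 ^ k)" for k
  proof -
    have "emeasure (haar p) {w} \<le> emeasure (haar p) (zcyl p k (w k))"
      using w by (intro emeasure_mono zcyl_in_sets) (auto simp: zcyl_def)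
    also have "\<dots> = ennreal (1 / real ((p ^ k) ^ CARD('i)))"
      using p by (intro emeasure_zcyl zspaceD w) auto
    also have "\<dots> \<le> ennreal (1 / 2 ^ k)"
    proof (rule ennreal_leI)
      have "(2 :: nat) ^ k \<le> p ^ k" using p by (intro power_mono) auto
      also have "\<dots> \<le> (p ^ k) ^ CARD('i)"
        using p by (intro self_le_power) (auto simp: Suc_le_eq)
      finally have "(2::real) ^ k \<le> real ((p ^ k) ^ CARD('i))"
        by (metis of_nat_le_iff of_nat_numeral of_nat_power)
      then show "1 / real ((p ^ k) ^ CARD('i)) \<le> 1 / 2 ^ k"
        by (intro divide_left_mono) (use p in auto)
    qed
    finally show ?thesis .
  qed
  moreover have "(\<lambda>k. ennreal (1 / 2 ^ k)) \<longlonglongrightarrow> ennreal 0"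
  proof (rule tendsto_ennrealI)
    have "(\<lambda>k. (1 / 2 :: real) ^ k) \<longlonglongrightarrow> 0" by (rule LIMSEQ_power_zero) simp
    then show "(\<lambda>k. 1 / 2 ^ k :: real) \<longlonglongrightarrow> 0" by (simp add: power_one_over)
  qed
  ultimately have "emeasure (haar p) {w} \<le> ennreal 0" by (intro LIMSEQ_le_const) auto
  then show ?thesis using sets by (simp add: null_sets_def)
qed

lemma haar_countable_null:
  assumes "p \<ge> 2" "countable X" "X \<subseteq> zspace p"
  shows "X \<in> null_sets (haar p)"
proof -
  have "(\<Union>w\<in>X. {w}) \<in> null_sets (haar p)"
    using assms haar_singleton by (intro null_sets_UN') auto
  then show ?thesis by simp
qed

section \<open>Fibred translations and maps close to the identity\<close>

lemma mpt_pair_skew: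
  fixes N :: "'a measure" and \<tau> :: "'a \<Rightarrow> nat \<Rightarrow> 'i::finite \<Rightarrow> int"
  assumes p: "p > 0" and \<tau>: "\<tau> \<in> N \<rightarrow>\<^sub>M haar p"
  shows "mpt (N \<Otimes>\<^sub>M haar p) (\<lambda>(x, t). (x, zadd p t (\<tau> x)))"
proof -
  let ?S = "\<lambda>(x, t). (x, zadd p t (\<tau> x))" and ?M = "N \<Otimes>\<^sub>M (haar p :: (nat \<Rightarrow> 'i \<Rightarrow> int) measure)"
  interpret H: prob_space "haar p :: (nat \<Rightarrow> 'i \<Rightarrow> int) measure" by (rule prob_space_haar[OF p])
  have meas: "?S \<in> ?M \<rightarrow>\<^sub>M ?M"
  proof -
    have "(\<lambda>x. zadd p (snd x) (\<tau> (fst x))) \<in> ?M \<rightarrow>\<^sub>M haar p"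
      by (rule measurable_zadd[OF p measurable_snd measurable_compose[OF measurable_fst \<tau>]])
    then show ?thesis by (simp add: case_prod_unfold)
  qed
  moreover have "distr ?M ?M ?S = ?M"
  proof (rule measure_eqI)
    fix A assume "A \<in> sets (distr ?M ?M ?S)"
    then have A: "A \<in> sets ?M" by simp
    have "emeasure (distr ?M ?M ?S) A = emeasure ?M (?S -` A \<inter> space ?M)"
      by (rule emeasure_distr[OF meas A])
    also have "\<dots> = (\<integral>\<^sup>+x. emeasure (haar p) (Pair x -` (?S -` A \<inter> space ?M)) \<partial>N)"
      by (rule H.emeasure_pair_measure_alt[OF measurable_sets[OF meas A]])
    also have "\<dots> = (\<integral>\<^sup>+x. emeasure (haar p) (Pair x -` A) \<partial>N)"
    proof (rule nn_integral_cong)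
      fix x assume x: "x \<in> space N"
      have tx: "\<tau> x \<in> zspace p" using measurable_space[OF \<tau> x] by simp
      have m: "mpt (haar p) (\<lambda>t. zadd p t (\<tau> x))" by (rule mpt_zadd[OF p tx])
      have "Pair x -` (?S -` A \<inter> space ?M) = (\<lambda>t. zadd p t (\<tau> x)) -` (Pair x -` A) \<inter> space (haar p)"
        using x by (auto simp: space_pair_measure)
      also have "emeasure (haar p) \<dots> = emeasure (distr (haar p) (haar p) (\<lambda>t. zadd p t (\<tau> x))) (Pair x -` A)"
        by (rule emeasure_distr[symmetric, OF mpt_measurable[OF m] sets_Pair1[OF A]])
      also have "\<dots> = emeasure (haar p) (Pair x -` A)" using m by (simp add: mpt_def)
      finally show "emeasure (haar p) (Pair x -` (?S -` A \<inter> space ?M)) = emeasure (haar p) (Pair x -` A)" .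
    qed
    also have "\<dots> = emeasure ?M A" by (rule H.emeasure_pair_measure_alt[OF A, symmetric])
    finally show "emeasure (distr ?M ?M ?S) A = emeasure ?M A" .
  qed simp
  ultimately show ?thesis by (simp add: mpt_def)
qed

lemma mpt_pair_fst:
  assumes f: "mpt N f" and M: "sigma_finite_measure M"
  shows "mpt (N \<Otimes>\<^sub>M M) (\<lambda>(x, t). (f x, t))"
proof -
  have fm: "f \<in> N \<rightarrow>\<^sub>M N" by (rule mpt_measurable[OF f])
  have "distr N N f \<Otimes>\<^sub>M distr M M (\<lambda>t. t) = distr (N \<Otimes>\<^sub>M M) (N \<Otimes>\<^sub>M M) (\<lambda>(x, t). (f x, t))"
    using M by (intro pair_measure_distr fm) (auto simp: distr_id)
  then show ?thesis using f fm by (auto simp: mpt_def distr_id case_prod_unfold)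
qed

text \<open>Measure-preserving maps that keep the first coordinate and the level \<open>i\<close> residue of the second.\<close>

definition near_id :: "'a measure \<Rightarrow> nat \<Rightarrow> nat \<Rightarrow> ('a \<times> (nat \<Rightarrow> 'i::finite \<Rightarrow> int) \<Rightarrow> _) \<Rightarrow> bool" where
  "near_id N p i S \<longleftrightarrow> mpt (N \<Otimes>\<^sub>M haar p) S \<and>
    (\<forall>\<omega>\<in>space (N \<Otimes>\<^sub>M haar p). fst (S \<omega>) = fst \<omega> \<and> snd (S \<omega>) i = snd \<omega> i)"

lemma near_id_mono:
  assumes S: "near_id N p i S" and "j \<le> i"
  shows "near_id N p j S"
proof -
  have m: "S \<in> N \<Otimes>\<^sub>M haar p \<rightarrow>\<^sub>M N \<Otimes>\<^sub>M haar p"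
    using S by (auto simp: near_id_def mpt_def)
  have "snd (S \<omega>) j = snd \<omega> j" if w: "\<omega> \<in> space (N \<Otimes>\<^sub>M haar p)" for \<omega>
  proof (rule zspace_level_mono[OF _ _ _ \<open>j \<le> i\<close>])
    show "snd (S \<omega>) \<in> zspace p" "snd \<omega> \<in> zspace p"
      using measurable_space[OF m w] w by (auto simp: space_pair_measure)
    show "snd (S \<omega>) i = snd \<omega> i" using S w by (simp add: near_id_def)
  qed
  then show ?thesis using S by (simp add: near_id_def)
qed

text \<open>The parameter \<open>ty\<close> pins down the index type of the second factor, so that
  \<open>Om\<close> is one fixed measure.\<close>

locale near_identity = prob_space N for N :: "'a measure" +
  fixes p :: nat and ty :: "'i::finite itself"
  assumes p: "p > 0"
begin

abbreviation Om :: "('a \<times> (nat \<Rightarrow> 'i \<Rightarrow> int)) measure" where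
  "Om \<equiv> N \<Otimes>\<^sub>M haar p"

sublocale O: prob_space Om
  by (intro prob_space_pair prob_space_haar[OF p] prob_space_axioms)

text \<open>Almost invariance, uniform over all measure-preserving maps that fix the first
  coordinate and a deep level of the second. It plays the part of L^1 continuity of translations; by
  \<open>cont_all\<close> every measurable set has it.\<close>

definition cont :: "('a \<times> (nat \<Rightarrow> 'i \<Rightarrow> int)) set \<Rightarrow> bool" where
  "cont A \<longleftrightarrow> A \<in> sets Om \<and> (\<forall>e>0. \<exists>i. \<forall>S. near_id N p i S \<longrightarrow>
     measure Om {\<omega> \<in> space Om. (\<omega> \<in> A) \<noteq> (S \<omega> \<in> A)} \<le> e)"

lemma diff_sets:
  assumes "A \<in> sets Om" "near_id N p i S"
  shows "{\<omega> \<in> space Om. (\<omega> \<in> A) \<noteq> (S \<omega> \<in> A)} \<in> sets Om"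
proof -
  have "S \<in> Om \<rightarrow>\<^sub>M Om" using assms(2) by (simp add: near_id_def mpt_def)
  then have "S -` A \<inter> space Om \<in> sets Om" using assms(1) by (rule measurable_sets)
  moreover have "{\<omega> \<in> space Om. (\<omega> \<in> A) \<noteq> (S \<omega> \<in> A)} = (A - (S -` A \<inter> space Om)) \<union> ((S -` A \<inter> space Om) - A)"
    using sets.sets_into_space[OF assms(1)] by auto
  ultimately show ?thesis using assms(1) by simp
qed

lemma cont_compl: "cont A \<Longrightarrow> cont (space Om - A)"
proof -
  assume A: "cont A"
  have eq: "{\<omega> \<in> space Om. (\<omega> \<in> space Om - A) \<noteq> (S \<omega> \<in> space Om - A)} = {\<omega> \<in> space Om. (\<omega> \<in> A) \<noteq> (S \<omega> \<in> A)}"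
    if "near_id N p i S" for i S
  proof -
    have "S \<in> Om \<rightarrow>\<^sub>M Om" using that by (simp add: near_id_def mpt_def)
    from measurable_space[OF this] show ?thesis by auto
  qed
  show ?thesis
    unfolding cont_def
  proof (intro conjI allI impI)
    show "space Om - A \<in> sets Om" using A by (intro sets.compl_sets) (simp add: cont_def)
    fix e :: real assume "e > 0"
    then obtain i where "\<And>S. near_id N p i S \<Longrightarrow> measure Om {\<omega> \<in> space Om. (\<omega> \<in> A) \<noteq> (S \<omega> \<in> A)} \<le> e"
      using A unfolding cont_def by blast
    then show "\<exists>i. \<forall>S. near_id N p i S \<longrightarrow>
        measure Om {\<omega> \<in> space Om. (\<omega> \<in> space Om - A) \<noteq> (S \<omega> \<in> space Om - A)} \<le> e"
      using eq by (intro exI[of _ i]) simp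
  qed
qed

lemma mpt_measure_set:
  assumes "near_id N p i S" "A \<in> sets Om"
  shows "measure Om {\<omega> \<in> space Om. S \<omega> \<in> A} = measure Om A" "{\<omega> \<in> space Om. S \<omega> \<in> A} \<in> sets Om"
proof -
  have S: "mpt Om S" using assms by (simp add: near_id_def)
  have e: "{\<omega> \<in> space Om. \<omega> \<in> A} = A" using sets.sets_into_space[OF assms(2)] by auto
  show "measure Om {\<omega> \<in> space Om. S \<omega> \<in> A} = measure Om A"
    using mpt_measure[OF S, of "\<lambda>\<omega>. \<omega> \<in> A"] e assms(2) by simp
  have "{\<omega> \<in> space Om. S \<omega> \<in> A} = S -` A \<inter> space Om" by auto
  then show "{\<omega> \<in> space Om. S \<omega> \<in> A} \<in> sets Om"
    using measurable_sets[OF mpt_measurable[OF S] assms(2)] by simp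
qed

lemma tail_small:
  assumes A: "range A \<subseteq> sets Om" and e: "e > (0::real)"
  obtains n where "measure Om ((\<Union>i::nat. A i) - (\<Union>i<n. A i)) \<le> e"
proof -
  let ?B = "\<lambda>n. (\<Union>i::nat. A i) - (\<Union>i<n. A i)"
  have "(\<lambda>n. measure Om (?B n)) \<longlonglongrightarrow> measure Om (\<Inter>n. ?B n)"
    by (rule O.finite_Lim_measure_decseq) (use A in \<open>auto simp: decseq_def\<close>)
  also have "(\<Inter>n. ?B n) = {}"
  proof (rule ccontr)
    assume "(\<Inter>n. ?B n) \<noteq> {}"
    then obtain x where x: "\<And>n. x \<in> ?B n" by auto
    then obtain i where "x \<in> A i" by blast
    then show False using x[of "Suc i"] by auto
  qed
  finally have "(\<lambda>n. measure Om (?B n)) \<longlonglongrightarrow> 0" by simp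
  then have "eventually (\<lambda>n. measure Om (?B n) < e) sequentially" using e by (rule order_tendstoD)
  then obtain n where "measure Om (?B n) < e" by (auto simp: eventually_sequentially)
  then show thesis using that[of n] by simp
qed

lemma finite_cont:
  fixes n :: nat
  assumes A: "\<And>k. k < n \<Longrightarrow> cont (A k)" and e: "e > 0"
  shows "\<exists>i. \<forall>S. near_id N p i S \<longrightarrow>
     measure Om (\<Union>k<n. {\<omega> \<in> space Om. (\<omega> \<in> A k) \<noteq> (S \<omega> \<in> A k)}) \<le> e"
  using assms
proof (induction n arbitrary: e)
  case (Suc n)
  obtain i where i: "\<And>S. near_id N p i S \<Longrightarrow> measure Om (\<Union>k<n. {\<omega> \<in> space Om. (\<omega> \<in> A k) \<noteq> (S \<omega> \<in> A k)}) \<le> e / 2"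
    using Suc.IH[of "e / 2"] Suc.prems by auto
  have "cont (A n)" using Suc.prems by simp
  then obtain j where j: "\<And>S. near_id N p j S \<Longrightarrow> measure Om {\<omega> \<in> space Om. (\<omega> \<in> A n) \<noteq> (S \<omega> \<in> A n)} \<le> e / 2"
    unfolding cont_def using Suc.prems(2) by (meson half_gt_zero)
  have "measure Om (\<Union>k<Suc n. {\<omega> \<in> space Om. (\<omega> \<in> A k) \<noteq> (S \<omega> \<in> A k)}) \<le> e"
    if S: "near_id N p (max i j) S" for S
  proof -
    have d: "{\<omega> \<in> space Om. (\<omega> \<in> A k) \<noteq> (S \<omega> \<in> A k)} \<in> sets Om" if "k < Suc n" for k
      using Suc.prems(1)[OF that] S by (intro diff_sets) (auto simp: cont_def)
    have "measure Om (\<Union>k<Suc n. {\<omega> \<in> space Om. (\<omega> \<in> A k) \<noteq> (S \<omega> \<in> A k)}) =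
      measure Om ({\<omega> \<in> space Om. (\<omega> \<in> A n) \<noteq> (S \<omega> \<in> A n)} \<union> (\<Union>k<n. {\<omega> \<in> space Om. (\<omega> \<in> A k) \<noteq> (S \<omega> \<in> A k)}))"
      by (simp add: lessThan_Suc)
    also have "\<dots> \<le> measure Om {\<omega> \<in> space Om. (\<omega> \<in> A n) \<noteq> (S \<omega> \<in> A n)} + measure Om (\<Union>k<n. {\<omega> \<in> space Om. (\<omega> \<in> A k) \<noteq> (S \<omega> \<in> A k)})"
      by (rule measure_Un_le) (use d in auto)
    also have "\<dots> \<le> e / 2 + e / 2"
      by (intro add_mono i j near_id_mono[OF S]) auto
    finally show ?thesis by simp
  qed
  then show ?case by blast
qed auto

text \<open>Cut the union off at finitely many sets. The tail and its preimage under
  \<open>S\<close> have the same small measure, and the finite part has a common level; each of the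
  three costs \<open>e / 3\<close>.\<close>

lemma cont_union:
  assumes A: "\<And>n::nat. cont (A n)"
  shows "cont (\<Union>n. A n)"
  unfolding cont_def
proof (intro conjI allI impI)
  have sA: "range A \<subseteq> sets Om" using A by (auto simp: cont_def)
  then show U: "(\<Union>n. A n) \<in> sets Om" by auto
  fix e :: real assume e: "e > 0"
  obtain n where n: "measure Om ((\<Union>i. A i) - (\<Union>i<n. A i)) \<le> e / 3"
    using tail_small[OF sA, of "e / 3"] e by auto
  let ?R = "(\<Union>i. A i) - (\<Union>i<n. A i)"
  have R: "?R \<in> sets Om" using U sA by auto
  obtain i where i: "\<And>S. near_id N p i S \<Longrightarrow> measure Om (\<Union>k<n. {\<omega> \<in> space Om. (\<omega> \<in> A k) \<noteq> (S \<omega> \<in> A k)}) \<le> e / 3"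
    using finite_cont[of n A "e / 3"] A e by auto
  have "measure Om {\<omega> \<in> space Om. (\<omega> \<in> (\<Union>n. A n)) \<noteq> (S \<omega> \<in> (\<Union>n. A n))} \<le> e" if S: "near_id N p i S" for S
  proof -
    let ?D = "\<Union>k<n. {\<omega> \<in> space Om. (\<omega> \<in> A k) \<noteq> (S \<omega> \<in> A k)}"
    note m = mpt_measure_set[OF S R]
    have D: "?D \<in> sets Om" using diff_sets[OF _ S] A by (intro sets.finite_UN) (auto simp: cont_def)
    have "measure Om {\<omega> \<in> space Om. (\<omega> \<in> (\<Union>n. A n)) \<noteq> (S \<omega> \<in> (\<Union>n. A n))} \<le>
        measure Om (?R \<union> ({\<omega> \<in> space Om. S \<omega> \<in> ?R} \<union> ?D))"
      by (rule O.finite_measure_mono) (use R m D in auto)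
    also have "\<dots> \<le> measure Om ?R + (measure Om {\<omega> \<in> space Om. S \<omega> \<in> ?R} + measure Om ?D)"
      by (rule order_trans[OF measure_Un_le add_left_mono[OF measure_Un_le]]) (use R m D in auto)
    also have "\<dots> \<le> e / 3 + (e / 3 + e / 3)" using n i[OF S] m(1) by linarith
    finally show ?thesis by simp
  qed
  then show "\<exists>i. \<forall>S. near_id N p i S \<longrightarrow> measure Om {\<omega> \<in> space Om. (\<omega> \<in> (\<Union>n. A n)) \<noteq> (S \<omega> \<in> (\<Union>n. A n))} \<le> e"
    by blast
qed

lemma cont_inter:
  assumes "cont A" "cont B"
  shows "cont (A \<inter> B)"
proof -
  have sub: "A \<subseteq> space Om" using assms sets.sets_into_space by (auto simp: cont_def)
  have "cont (\<Union>n::nat. if n = 0 then space Om - A else space Om - B)"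
    by (rule cont_union) (use assms cont_compl in auto)
  then have "cont (space Om - (\<Union>n::nat. if n = 0 then space Om - A else space Om - B))" by (rule cont_compl)
  also have "space Om - (\<Union>n::nat. if n = 0 then space Om - A else space Om - B) = A \<inter> B"
    using sub by (auto split: if_splits)
  finally show ?thesis .
qed

lemma cont_exact:
  assumes "A \<in> sets Om" "\<And>S. near_id N p i S \<Longrightarrow> {\<omega> \<in> space Om. (\<omega> \<in> A) \<noteq> (S \<omega> \<in> A)} = {}"
  shows "cont A"
  unfolding cont_def
proof (intro conjI allI impI)
  fix e :: real assume "e > 0"
  then show "\<exists>i. \<forall>S. near_id N p i S \<longrightarrow> measure Om {\<omega> \<in> space Om. (\<omega> \<in> A) \<noteq> (S \<omega> \<in> A)} \<le> e"
    by (intro exI[of _ i] allI impI) (simp only: assms(2) measure_empty less_imp_le)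
qed (rule assms(1))

text \<open>The sets with this property form a sigma-algebra. It contains the rectangles: a cylinder
  of level \<open>k\<close> is preserved exactly by maps fixing level \<open>k\<close>, and a set
  from the first factor by all maps considered.\<close>

lemma cont_all:
  assumes "A \<in> sets Om"
  shows "cont A"
proof -
  have snd: "cont (space N \<times> B)" if "B \<in> sets (haar p)" for B
    using that unfolding sets_haar_sigma_sets
  proof (induction rule: sigma_sets.induct)
    case (Basic a)
    then obtain k v where a: "a = zcyl p k v" by (rule zcylE)
    show ?case
    proof (rule cont_exact[of _ k])
      fix S :: "'a \<times> (nat \<Rightarrow> 'i \<Rightarrow> int) \<Rightarrow> 'a \<times> (nat \<Rightarrow> 'i \<Rightarrow> int)" assume S: "near_id N p k S"
      have m: "S \<in> Om \<rightarrow>\<^sub>M Om" using S by (simp add: near_id_def mpt_def)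
      show "{\<omega> \<in> space Om. (\<omega> \<in> space N \<times> a) \<noteq> (S \<omega> \<in> space N \<times> a)} = {}"
        using S measurable_space[OF m] by (auto simp: near_id_def a zcyl_def space_pair_measure mem_Times_iff)
    qed (auto simp: a intro!: zcyl_in_sets)
  next
    case Empty
    show ?case by (rule cont_exact[of _ 0]) auto
  next
    case (Compl a)
    have "space N \<times> (zspace p - a) = space Om - space N \<times> a" by (auto simp: space_pair_measure)
    then show ?case using cont_compl[OF Compl.IH] by simp
  next
    case (Union a)
    have "space N \<times> (\<Union>i. a i) = (\<Union>i. space N \<times> a i)" by auto
    then show ?case using cont_union[OF Union.IH] by simp
  qed
  have fst: "cont (B \<times> zspace p)" if "B \<in> sets N" for B
  proof (rule cont_exact[of _ 0])
    fix S :: "'a \<times> (nat \<Rightarrow> 'i \<Rightarrow> int) \<Rightarrow> 'a \<times> (nat \<Rightarrow> 'i \<Rightarrow> int)" assume S: "near_id N p 0 S"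
    have m: "S \<in> Om \<rightarrow>\<^sub>M Om" using S by (simp add: near_id_def mpt_def)
    show "{\<omega> \<in> space Om. (\<omega> \<in> B \<times> zspace p) \<noteq> (S \<omega> \<in> B \<times> zspace p)} = {}"
      using S measurable_space[OF m] by (auto simp: near_id_def space_pair_measure mem_Times_iff)
  next
    have "(zspace p :: (nat \<Rightarrow> 'i \<Rightarrow> int) set) \<in> sets (haar p)"
      using sets.top[of "haar p :: (nat \<Rightarrow> 'i \<Rightarrow> int) measure"] by simp
    then show "B \<times> zspace p \<in> sets Om" using that by simp
  qed
  show ?thesis
    using assms unfolding sets_pair_measure
  proof (induction rule: sigma_sets.induct)
    case (Basic a)
    then obtain B C where a: "a = B \<times> C" "B \<in> sets N" "C \<in> sets (haar p)" by blast
    have "a = (B \<times> zspace p) \<inter> (space N \<times> C)"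
      using a sets.sets_into_space[OF a(2)] sets.sets_into_space[OF a(3)] by auto
    then show ?case using cont_inter[OF fst[OF a(2)] snd[OF a(3)]] by simp
  next
    case Empty
    show ?case by (rule cont_exact[of _ 0]) auto
  next
    case (Compl a)
    then show ?case using cont_compl[of a] by (simp add: space_pair_measure)
  next
    case (Union a)
    show ?case by (rule cont_union[OF Union.IH])
  qed
qed

text \<open>All but \<open>e / 2\<close> of the mass lies in finitely many value classes, which
  admit a common level. It is applied to cocycles with values in \<open>Lam\<close> and to single
  levels of group-valued maps.\<close>

lemma countable_valued_near:
  fixes C :: "'a \<times> (nat \<Rightarrow> 'i \<Rightarrow> int) \<Rightarrow> 'c"
  assumes cnt: "countable (C ` space Om)" and meas: "\<And>v. {\<omega> \<in> space Om. C \<omega> = v} \<in> sets Om"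
    and e: "e > 0"
  shows "\<exists>i. \<forall>S. near_id N p i S \<longrightarrow> measure Om {\<omega> \<in> space Om. C (S \<omega>) \<noteq> C \<omega>} \<le> e"
proof -
  define v where "v = from_nat_into (C ` space Om)"
  define A where "A n = {\<omega> \<in> space Om. C \<omega> = v n}" for n :: nat
  have sA: "range A \<subseteq> sets Om" using meas by (auto simp: A_def)
  have UA: "(\<Union>n. A n) = space Om"
  proof (intro equalityI subsetI)
    fix \<omega> assume w: "\<omega> \<in> space Om"
    obtain n where "v n = C \<omega>" unfolding v_def using from_nat_into_surj[OF cnt imageI[OF w]] by blast
    then have "\<omega> \<in> A n" using w unfolding A_def by simp
    then show "\<omega> \<in> (\<Union>n. A n)" by blast
  qed (auto simp: A_def)
  obtain n where n: "measure Om ((\<Union>i. A i) - (\<Union>i<n. A i)) \<le> e / 2"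
    using tail_small[OF sA, of "e / 2"] e by auto
  have cA: "cont (A k)" for k using sA by (intro cont_all) auto
  obtain i where i: "\<And>S. near_id N p i S \<Longrightarrow> measure Om (\<Union>k<n. {\<omega> \<in> space Om. (\<omega> \<in> A k) \<noteq> (S \<omega> \<in> A k)}) \<le> e / 2"
    using finite_cont[of n A "e / 2"] cA e by auto
  have "measure Om {\<omega> \<in> space Om. C (S \<omega>) \<noteq> C \<omega>} \<le> e" if S: "near_id N p i S" for S
  proof -
    let ?D = "\<Union>k<n. {\<omega> \<in> space Om. (\<omega> \<in> A k) \<noteq> (S \<omega> \<in> A k)}" and ?R = "(\<Union>i. A i) - (\<Union>i<n. A i)"
    have D: "?D \<in> sets Om" using diff_sets[OF _ S] sA by (intro sets.finite_UN) auto
    have R: "?R \<in> sets Om" using sA by (intro sets.Diff sets.countable_UN sets.finite_UN) auto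
    have "{\<omega> \<in> space Om. C (S \<omega>) \<noteq> C \<omega>} \<subseteq> ?R \<union> ?D"
    proof
      fix \<omega> assume w: "\<omega> \<in> {\<omega> \<in> space Om. C (S \<omega>) \<noteq> C \<omega>}"
      show "\<omega> \<in> ?R \<union> ?D"
      proof (cases "\<omega> \<in> (\<Union>i<n. A i)")
        case True
        then show ?thesis using w by (auto simp: A_def)
      qed (use w UA in auto)
    qed
    then have "measure Om {\<omega> \<in> space Om. C (S \<omega>) \<noteq> C \<omega>} \<le> measure Om (?R \<union> ?D)"
      by (rule O.finite_measure_mono) (use R D in auto)
    also have "\<dots> \<le> measure Om ?R + measure Om ?D" by (rule measure_Un_le[OF R D])
    also have "\<dots> \<le> e" using n i[OF S] by linarith
    finally show ?thesis .
  qed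
  then show ?thesis by blast
qed

end

section \<open>The action on block coordinates\<close>

text \<open>A point \<open>k\<close> stands for the matrix \<open>kap = 1 + p k\<close>, whose rows and columns are indexed by \<^typ>\<open>bool\<close>; its
  determinant \<open>kdet\<close> is a unit.\<close>

definition zemb :: "nat \<Rightarrow> int \<times> int \<Rightarrow> nat \<Rightarrow> bool \<Rightarrow> int" where
  "zemb p a = zred p (\<lambda>_ i. if i then snd a else fst a)"

definition kap :: "nat \<Rightarrow> (nat \<Rightarrow> bool \<times> bool \<Rightarrow> int) \<Rightarrow> nat \<Rightarrow> bool \<Rightarrow> bool \<Rightarrow> int" where
  "kap p k j r c = of_bool (r = c) + int p * k j (r, c)"

definition kdet :: "nat \<Rightarrow> (nat \<Rightarrow> bool \<times> bool \<Rightarrow> int) \<Rightarrow> nat \<Rightarrow> int" where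
  "kdet p k j = kap p k j False False * kap p k j True True - kap p k j False True * kap p k j True False"

text \<open>The change of \<open>t\<close> caused by an integral translation. In the chart
  \<open>emat\<close> the third column is \<open>kap^-1 t\<close> above the entry
  \<open>kdet\<close>, so a row operation adds \<open>kdet * w\<close> to \<open>kap^-1 t\<close>,
  that is, \<open>kdet * kap * w\<close> to \<open>t\<close>.\<close>

definition disp :: "nat \<Rightarrow> (nat \<Rightarrow> bool \<Rightarrow> int) \<Rightarrow> (nat \<Rightarrow> bool \<times> bool \<Rightarrow> int) \<Rightarrow> nat \<Rightarrow> bool \<Rightarrow> int" where
  "disp p w k = zred p (\<lambda>j r. kdet p k j * (kap p k j r False * w j False + kap p k j r True * w j True))"

definition transl :: "nat \<Rightarrow> (nat \<Rightarrow> bool \<Rightarrow> int) \<Rightarrow>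
    (nat \<Rightarrow> bool \<times> bool \<Rightarrow> int) \<times> (nat \<Rightarrow> bool \<Rightarrow> int) \<Rightarrow> _" where
  "transl p w = (\<lambda>(k, t). (k, zadd p t (disp p w k)))"

text \<open>Right multiplication of the matrix \<open>kap\<close> by the inverses of the two elementary matrices with
  entry \<open>5 * p\<close>, written in the coordinates \<open>k\<close>.\<close>

definition hshear :: "nat \<Rightarrow> (nat \<Rightarrow> bool \<times> bool \<Rightarrow> int) \<Rightarrow> nat \<Rightarrow> bool \<times> bool \<Rightarrow> int" where
  "hshear p k = zred p (\<lambda>j (r, c). if c then k j (r, c)
     else k j (r, c) + - (5 * of_bool r + 5 * int p * k j (r, True)))"

definition hshear' :: "nat \<Rightarrow> (nat \<Rightarrow> bool \<times> bool \<Rightarrow> int) \<Rightarrow> nat \<Rightarrow> bool \<times> bool \<Rightarrow> int" where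
  "hshear' p k = zred p (\<lambda>j (r, c). if \<not> c then k j (r, c)
     else k j (r, c) + - (5 * of_bool (\<not> r) + 5 * int p * k j (r, False)))"

context
  fixes p :: nat assumes p: "p > 1"
begin

lemma p0: "p > 0" using p by simp

lemma zemb_in: "zemb p a \<in> zspace p"
  unfolding zemb_def by (rule zred_in_zspace[OF p0]) auto

lemma kap_cong:
  assumes "k \<in> zspace p"
  shows "[kap p k (Suc j) r c = kap p k j r c] (mod int p ^ j)"
  unfolding kap_def by (intro cong_add[OF cong_refl] cong_scalar_left zspace_cong assms)

lemma kdet_cong:
  assumes "k \<in> zspace p"
  shows "[kdet p k (Suc j) = kdet p k j] (mod int p ^ j)"
  unfolding kdet_def by (rule cong_diff; rule cong_mult; rule kap_cong[OF assms])

lemma disp_in: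
  assumes "k \<in> zspace p" "w \<in> zspace p"
  shows "disp p w k \<in> zspace p"
  unfolding disp_def
proof (rule zred_in_zspace[OF p0])
  fix j r
  show "[kdet p k (Suc j) * (kap p k (Suc j) r False * w (Suc j) False + kap p k (Suc j) r True * w (Suc j) True) =
      kdet p k j * (kap p k j r False * w j False + kap p k j r True * w j True)] (mod int p ^ j)"
    by (rule cong_mult[OF kdet_cong[OF assms(1)] cong_add[OF cong_mult[OF kap_cong zspace_cong]
            cong_mult[OF kap_cong zspace_cong]]]) (use assms in auto)
qed

lemma disp_zadd: "disp p (zadd p w w') k = zadd p (disp p w k) (disp p w' k)"
proof (intro ext)
  fix j r
  let ?D = "kdet p k j" and ?a = "kap p k j r False" and ?b = "kap p k j r True" and ?m = "int p ^ j"
  have "disp p (zadd p w w') k j r = (?D * (?a * ((w j False + w' j False) mod ?m) + ?b * ((w j True + w' j True) mod ?m))) mod ?m"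
    by (simp add: disp_def zred_def zadd_def)
  also have "\<dots> = (?D * (?a * (w j False + w' j False) + ?b * (w j True + w' j True))) mod ?m"
  proof -
    have "[?D * (?a * ((w j False + w' j False) mod ?m) + ?b * ((w j True + w' j True) mod ?m)) =
       ?D * (?a * (w j False + w' j False) + ?b * (w j True + w' j True))] (mod ?m)"
      by (intro cong_scalar_left cong_add) (simp_all add: cong_def)
    then show ?thesis by (simp only: cong_def)
  qed
  also have "\<dots> = (?D * (?a * w j False + ?b * w j True) + ?D * (?a * w' j False + ?b * w' j True)) mod ?m"
    by (simp add: algebra_simps)
  also have "\<dots> = zadd p (disp p w k) (disp p w' k) j r"
    by (simp add: disp_def zred_def zadd_def mod_simps)
  finally show "disp p (zadd p w w') k j r = zadd p (disp p w k) (disp p w' k) j r" .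
qed

lemma zemb_add: "zemb p (a + b) = zadd p (zemb p a) (zemb p b)"
  by (intro ext) (simp add: zemb_def zadd_def zred_def mod_simps)

lemma zemb_zero: "zemb p 0 = (\<lambda>_ _. 0)"
  by (intro ext) (simp add: zemb_def zred_def)

lemma transl_zadd: "transl p (zadd p w w') \<omega> = transl p w (transl p w' \<omega>)"
  by (simp add: transl_def disp_zadd case_prod_unfold zadd_assoc zadd_left_commute zadd_commute)

lemma disp_zero_level:
  assumes "\<And>i. w j i = 0"
  shows "disp p w k j = (\<lambda>_. 0)"
  by (simp add: disp_def zred_def assms)

lemma transl_zero: "snd \<omega> \<in> zspace p \<Longrightarrow> transl p (\<lambda>_ _. 0) \<omega> = \<omega>"
  by (auto simp: transl_def disp_def zred_def zadd_def zspaceD(5) fun_eq_iff split: prod.splits)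

lemma disp_measurable:
  assumes w: "w \<in> zspace p"
  shows "disp p w \<in> haar p \<rightarrow>\<^sub>M haar p"
proof (rule measurable_haarI)
  show "(\<lambda>k. disp p w k j) \<in> haar p \<rightarrow>\<^sub>M count_space UNIV" for j
    unfolding disp_def zred_def kdet_def kap_def
    by (rule measurable_compose[OF measurable_level, where g = "\<lambda>v r. _ v r"]) simp
qed (simp add: disp_in w)

lemma disp_measurable2:
  "(\<lambda>(k, w). disp p w k) \<in> haar p \<Otimes>\<^sub>M haar p \<rightarrow>\<^sub>M haar p"
proof (rule measurable_haarI)
  fix j
  have 1: "(\<lambda>x. fst x j) \<in> (haar p \<Otimes>\<^sub>M haar p) \<rightarrow>\<^sub>M count_space UNIV"
    by (rule measurable_compose[OF measurable_fst measurable_level])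
  have 2: "(\<lambda>x. snd x j) \<in> (haar p \<Otimes>\<^sub>M haar p) \<rightarrow>\<^sub>M count_space UNIV"
    by (rule measurable_compose[OF measurable_snd measurable_level])
  have "(\<lambda>x. (\<lambda>u v r. (((of_bool (False = False) + int p * u (False, False)) * (of_bool (True = True) + int p * u (True, True))
     - (of_bool (False = True) + int p * u (False, True)) * (of_bool (True = False) + int p * u (True, False)))
      * ((of_bool (r = False) + int p * u (r, False)) * v False + (of_bool (r = True) + int p * u (r, True)) * v True)) mod int p ^ j)
      (fst x j) (snd x j)) \<in> (haar p \<Otimes>\<^sub>M haar p) \<rightarrow>\<^sub>M count_space UNIV"
    by (rule measurable_compose_countable[OF measurable_compose[OF 2] 1]) simp
  then show "(\<lambda>x. (case x of (k, w) \<Rightarrow> disp p w k) j) \<in> (haar p \<Otimes>\<^sub>M haar p) \<rightarrow>\<^sub>M count_space UNIV"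
    by (simp only: case_prod_unfold disp_def zred_def kdet_def kap_def)
qed (auto simp: space_pair_measure intro!: disp_in)

lemma mpt_transl:
  assumes w: "w \<in> zspace p"
  shows "mpt (haar p \<Otimes>\<^sub>M haar p) (transl p w)"
  unfolding transl_def by (rule mpt_pair_skew[OF p0 disp_measurable[OF w]])

lemma kdet_coprime: "coprime (kdet p k j) (int p ^ j)"
proof -
  have "[kdet p k j = 1 * 1 - 0 * 0] (mod int p)"
    unfolding kdet_def kap_def by (intro cong_diff cong_mult) (simp_all add: cong_def mod_simps)
  then have "coprime (kdet p k j) (int p)" by (metis cong_imp_coprime cong_sym coprime_1_left diff_zero mult_1 mult_zero_left)
  then show ?thesis by (rule coprime_power_right_iff[THEN iffD2, OF disjI1])
qed

text \<open>Multiplication by the adjugate of \<open>kap\<close> turns the value into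
  \<open>kdet * kdet\<close> times the vector, and \<open>kdet\<close> is a unit modulo
  \<open>p ^ j\<close>. This spreads translates of one point uniformly over its fibre in
  \<open>uncountable_fibre\<close>.\<close>

lemma mpt_disp:
  assumes k: "k \<in> zspace p"
  shows "mpt (haar p) (\<lambda>w. disp p w k)"
proof (rule mpt_haarI[where \<tau> = "\<lambda>j v r. (kdet p k j * (kap p k j r False * v False + kap p k j r True * v True)) mod int p ^ j"])
  fix j
  let ?m = "int p ^ j" and ?D = "kdet p k j" and ?k = "kap p k j"
  show "inj_on (\<lambda>v r. (?D * (?k r False * v False + ?k r True * v True)) mod ?m) (zlev p j)"
  proof (rule inj_onI, rule ext)
    fix v w :: "bool \<Rightarrow> int" and i
    assume vw: "v \<in> zlev p j" "w \<in> zlev p j"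
      "(\<lambda>r. (?D * (?k r False * v False + ?k r True * v True)) mod ?m) =
       (\<lambda>r. (?D * (?k r False * w False + ?k r True * w True)) mod ?m)"
    have c: "[?D * (?k r False * v False + ?k r True * v True) = ?D * (?k r False * w False + ?k r True * w True)] (mod ?m)" for r
      using fun_cong[OF vw(3), of r] by (simp add: cong_def)
    have D: "?D = ?k False False * ?k True True - ?k False True * ?k True False" by (simp add: kdet_def)
    have "[?D * ?D * v i = ?D * ?D * w i] (mod ?m)"
    proof (cases i)
      case True
      have "[?k False False * (?D * (?k True False * v False + ?k True True * v True)) -
          ?k True False * (?D * (?k False False * v False + ?k False True * v True)) =
          ?k False False * (?D * (?k True False * w False + ?k True True * w True)) -
          ?k True False * (?D * (?k False False * w False + ?k False True * w True))] (mod ?m)"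
        by (intro cong_diff cong_scalar_left c)
      then show ?thesis using True by (simp add: D algebra_simps)
    next
      case False
      have "[?k True True * (?D * (?k False False * v False + ?k False True * v True)) -
          ?k False True * (?D * (?k True False * v False + ?k True True * v True)) =
          ?k True True * (?D * (?k False False * w False + ?k False True * w True)) -
          ?k False True * (?D * (?k True False * w False + ?k True True * w True))] (mod ?m)"
        by (intro cong_diff cong_scalar_left c)
      then show ?thesis using False by (simp add: D algebra_simps)
    qed
    then have "[v i = w i] (mod ?m)"
      using cong_mult_lcancel[of "?D * ?D" ?m "v i" "w i"] kdet_coprime[of k j]
      by (simp del: coprime_power_right_iff)
    then show "v i = w i" using vw by (simp add: cong_def mem_zlev)
  qed
qed (simp add: p0, simp add: disp_in k, simp add: disp_def zred_def)

lemma hshear_in: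
  assumes k: "k \<in> zspace p"
  shows "hshear p k \<in> zspace p"
  unfolding hshear_def
  apply (rule zred_in_zspace[OF p0])
  subgoal for j i
    by (cases i; cases "snd i"; simp only: prod.case snd_conv if_True if_False not_True_eq_False not_False_eq_True;
      intro cong_add cong_minus_minus_iff[THEN iffD2] cong_scalar_left cong_refl zspace_cong[OF k])
  done

lemma hshear'_in:
  assumes k: "k \<in> zspace p"
  shows "hshear' p k \<in> zspace p"
  unfolding hshear'_def
  apply (rule zred_in_zspace[OF p0])
  subgoal for j i
    by (cases i; cases "snd i"; simp only: prod.case snd_conv if_True if_False not_True_eq_False not_False_eq_True;
      intro cong_add cong_minus_minus_iff[THEN iffD2] cong_scalar_left cong_refl zspace_cong[OF k])
  done

lemma mpt_hshear: "mpt (haar p) (hshear p)"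
proof (rule mpt_haarI[OF p0 hshear_in, where \<tau> = "\<lambda>j v (r, c). (if c then v (r, c)
     else v (r, c) + - (5 * of_bool r + 5 * int p * v (r, True))) mod int p ^ j"])
  fix j
  show "inj_on (\<lambda>v (r, c). (if c then v (r, c)
     else v (r, c) + - (5 * of_bool r + 5 * int p * v (r, True))) mod int p ^ j) (zlev p j)"
  proof (rule inj_onI)
    fix v w assume vw: "v \<in> zlev p j" "w \<in> zlev p j"
      "(\<lambda>(r, c). (if c then v (r, c) else v (r, c) + - (5 * of_bool r + 5 * int p * v (r, True))) mod int p ^ j) =
      (\<lambda>(r, c). (if c then w (r, c) else w (r, c) + - (5 * of_bool r + 5 * int p * w (r, True))) mod int p ^ j)"
    have T: "v (r, True) = w (r, True)" for r
      using fun_cong[OF vw(3), of "(r, True)"] vw(1,2) by (simp add: mem_zlev)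
    have F: "v (r, False) = w (r, False)" for r
      by (rule mod_add_inj[of _ "- (5 * of_bool r + 5 * int p * w (r, True))" "int p ^ j"])
        (use fun_cong[OF vw(3), of "(r, False)"] vw(1,2) T in \<open>auto simp: mem_zlev\<close>)
    show "v = w"
    proof
      fix x show "v x = w x" using T F by (cases x) (metis (full_types))
    qed
  qed
qed (auto simp: hshear_def zred_def)

lemma mpt_hshear': "mpt (haar p) (hshear' p)"
proof (rule mpt_haarI[OF p0 hshear'_in, where \<tau> = "\<lambda>j v (r, c). (if \<not> c then v (r, c)
     else v (r, c) + - (5 * of_bool (\<not> r) + 5 * int p * v (r, False))) mod int p ^ j"])
  fix j
  show "inj_on (\<lambda>v (r, c). (if \<not> c then v (r, c)
     else v (r, c) + - (5 * of_bool (\<not> r) + 5 * int p * v (r, False))) mod int p ^ j) (zlev p j)"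
  proof (rule inj_onI)
    fix v w assume vw: "v \<in> zlev p j" "w \<in> zlev p j"
      "(\<lambda>(r, c). (if \<not> c then v (r, c) else v (r, c) + - (5 * of_bool (\<not> r) + 5 * int p * v (r, False))) mod int p ^ j) =
      (\<lambda>(r, c). (if \<not> c then w (r, c) else w (r, c) + - (5 * of_bool (\<not> r) + 5 * int p * w (r, False))) mod int p ^ j)"
    have T: "v (r, False) = w (r, False)" for r
      using fun_cong[OF vw(3), of "(r, False)"] vw(1,2) by (simp add: mem_zlev)
    have F: "v (r, True) = w (r, True)" for r
      by (rule mod_add_inj[of _ "- (5 * of_bool (\<not> r) + 5 * int p * w (r, False))" "int p ^ j"])
        (use fun_cong[OF vw(3), of "(r, True)"] vw(1,2) T in \<open>auto simp: mem_zlev\<close>)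
    show "v = w"
    proof
      fix x show "v x = w x" using T F by (cases x) (metis (full_types))
    qed
  qed
qed (auto simp: hshear'_def zred_def)

lemma kap_hshear:
  "[kap p (hshear p k) j r True = kap p k j r True] (mod int p ^ j)"
  "[kap p (hshear p k) j r False = kap p k j r False - 5 * int p * kap p k j r True] (mod int p ^ j)"
proof -
  have 1: "[x mod int p ^ j = x] (mod int p ^ j)" for x by (simp add: cong_def)
  show "[kap p (hshear p k) j r True = kap p k j r True] (mod int p ^ j)"
    unfolding kap_def hshear_def zred_def by (intro cong_add[OF cong_refl] cong_scalar_left) (simp add: 1)
  have "[kap p (hshear p k) j r False = of_bool (r = False) + int p * (k j (r, False) + - (5 * of_bool r + 5 * int p * k j (r, True)))] (mod int p ^ j)"
    unfolding kap_def hshear_def zred_def prod.case by (intro cong_add[OF cong_refl] cong_scalar_left) (simp add: 1)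
  then show "[kap p (hshear p k) j r False = kap p k j r False - 5 * int p * kap p k j r True] (mod int p ^ j)"
    by (simp add: kap_def algebra_simps)
qed

lemma kap_hshear':
  "[kap p (hshear' p k) j r False = kap p k j r False] (mod int p ^ j)"
  "[kap p (hshear' p k) j r True = kap p k j r True - 5 * int p * kap p k j r False] (mod int p ^ j)"
proof -
  have 1: "[x mod int p ^ j = x] (mod int p ^ j)" for x by (simp add: cong_def)
  show "[kap p (hshear' p k) j r False = kap p k j r False] (mod int p ^ j)"
    unfolding kap_def hshear'_def zred_def by (intro cong_add[OF cong_refl] cong_scalar_left) (simp add: 1)
  have "[kap p (hshear' p k) j r True = of_bool (r = True) + int p * (k j (r, True) + - (5 * of_bool (\<not> r) + 5 * int p * k j (r, False)))] (mod int p ^ j)"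
    unfolding kap_def hshear'_def zred_def prod.case by (intro cong_add[OF cong_refl] cong_scalar_left) (simp add: 1)
  then show "[kap p (hshear' p k) j r True = kap p k j r True - 5 * int p * kap p k j r False] (mod int p ^ j)"
    by (simp add: kap_def algebra_simps)
qed

lemma kdet_hshear: "[kdet p (hshear p k) j = kdet p k j] (mod int p ^ j)"
proof -
  let ?k = "kap p k j"
  have "[kdet p (hshear p k) j = (?k False False - 5 * int p * ?k False True) * ?k True True
     - ?k False True * (?k True False - 5 * int p * ?k True True)] (mod int p ^ j)"
    unfolding kdet_def by (intro cong_diff cong_mult kap_hshear)
  then show ?thesis by (simp add: kdet_def algebra_simps)
qed

lemma kdet_hshear': "[kdet p (hshear' p k) j = kdet p k j] (mod int p ^ j)"
proof -
  let ?k = "kap p k j"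
  have "[kdet p (hshear' p k) j = ?k False False * (?k True True - 5 * int p * ?k True False)
     - (?k False True - 5 * int p * ?k False False) * ?k True False] (mod int p ^ j)"
    unfolding kdet_def by (intro cong_diff cong_mult kap_hshear')
  then show ?thesis by (simp add: kdet_def algebra_simps)
qed

lemma disp_zemb:
  "[disp p (zemb p a) k j r = kdet p k j * (kap p k j r False * fst a + kap p k j r True * snd a)] (mod int p ^ j)"
proof -
  have "[disp p (zemb p a) k j r = kdet p k j * (kap p k j r False * (fst a mod int p ^ j) + kap p k j r True * (snd a mod int p ^ j))] (mod int p ^ j)"
    by (simp add: disp_def zred_def zemb_def cong_def)
  also have "[kdet p k j * (kap p k j r False * (fst a mod int p ^ j) + kap p k j r True * (snd a mod int p ^ j)) =
     kdet p k j * (kap p k j r False * fst a + kap p k j r True * snd a)] (mod int p ^ j)"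
    by (intro cong_scalar_left cong_add) (simp_all add: cong_def)
  finally show ?thesis .
qed

lemma disp_eqI:
  assumes "\<And>j r. [disp p w k j r = disp p w' k' j r] (mod int p ^ j)"
  shows "disp p w k = disp p w' k'"
proof (intro ext)
  fix j r show "disp p w k j r = disp p w' k' j r"
    using assms[of j r] by (simp add: disp_def zred_def cong_def)
qed

text \<open>If E is the elementary matrix, \<open>kap\<close> becomes \<open>kap E^-1\<close> and
  the vector becomes \<open>E a\<close>; the product and the determinant are unchanged. This is the
  equivariance required by \<open>relative_rigidity\<close>.\<close>

lemma disp_hshear: "disp p (zemb p (shear (5 * int p) a)) (hshear p k) = disp p (zemb p a) k"
proof (rule disp_eqI)
  fix j r
  let ?k = "kap p k j"
  have "[disp p (zemb p (shear (5 * int p) a)) (hshear p k) j r =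
     kdet p (hshear p k) j * (kap p (hshear p k) j r False * fst a + kap p (hshear p k) j r True * (snd a + 5 * int p * fst a))] (mod int p ^ j)"
    using disp_zemb[of "shear (5 * int p) a"] by (simp add: shear_def)
  also have "[kdet p (hshear p k) j * (kap p (hshear p k) j r False * fst a + kap p (hshear p k) j r True * (snd a + 5 * int p * fst a)) =
     kdet p k j * ((?k r False - 5 * int p * ?k r True) * fst a + ?k r True * (snd a + 5 * int p * fst a))] (mod int p ^ j)"
    by (intro cong_mult kdet_hshear cong_add kap_hshear cong_refl)
  also have "kdet p k j * ((?k r False - 5 * int p * ?k r True) * fst a + ?k r True * (snd a + 5 * int p * fst a)) =
     kdet p k j * (?k r False * fst a + ?k r True * snd a)" by (simp add: algebra_simps)
  also have "[\<dots> = disp p (zemb p a) k j r] (mod int p ^ j)" by (rule cong_sym[OF disp_zemb])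
  finally show "[disp p (zemb p (shear (5 * int p) a)) (hshear p k) j r = disp p (zemb p a) k j r] (mod int p ^ j)" .
qed

lemma disp_hshear': "disp p (zemb p (shear' (5 * int p) a)) (hshear' p k) = disp p (zemb p a) k"
proof (rule disp_eqI)
  fix j r
  let ?k = "kap p k j"
  have "[disp p (zemb p (shear' (5 * int p) a)) (hshear' p k) j r =
     kdet p (hshear' p k) j * (kap p (hshear' p k) j r False * (fst a + 5 * int p * snd a) + kap p (hshear' p k) j r True * snd a)] (mod int p ^ j)"
    using disp_zemb[of "shear' (5 * int p) a"] by (simp add: shear'_def)
  also have "[kdet p (hshear' p k) j * (kap p (hshear' p k) j r False * (fst a + 5 * int p * snd a) + kap p (hshear' p k) j r True * snd a) =
     kdet p k j * (?k r False * (fst a + 5 * int p * snd a) + (?k r True - 5 * int p * ?k r False) * snd a)] (mod int p ^ j)"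
    by (intro cong_mult kdet_hshear' cong_add kap_hshear' cong_refl)
  also have "kdet p k j * (?k r False * (fst a + 5 * int p * snd a) + (?k r True - 5 * int p * ?k r False) * snd a) =
     kdet p k j * (?k r False * fst a + ?k r True * snd a)" by (simp add: algebra_simps)
  also have "[\<dots> = disp p (zemb p a) k j r] (mod int p ^ j)" by (rule cong_sym[OF disp_zemb])
  finally show "[disp p (zemb p (shear' (5 * int p) a)) (hshear' p k) j r = disp p (zemb p a) k j r] (mod int p ^ j)" .
qed

end

section \<open>Maps into a virtually pro-q group\<close>

text \<open>\<open>lev j\<close> is the coset modulo the \<open>j\<close>-th congruence subgroup; \<open>lev_torsion\<close> says that the subgroup of level
  \<open>0\<close> is pro-\<open>q\<close>.\<close>

locale lev_group = group G for G :: "('g, 'x) monoid_scheme" (structure) +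
  fixes lev :: "nat \<Rightarrow> 'g \<Rightarrow> 'l" and q :: nat
  assumes lev_countable: "countable (lev j ` carrier G)"
    and lev_mult: "\<lbrakk>x \<in> carrier G; y \<in> carrier G; a \<in> carrier G; b \<in> carrier G; lev j x = lev j y\<rbrakk>
      \<Longrightarrow> lev j (a \<otimes> x \<otimes> b) = lev j (a \<otimes> y \<otimes> b)"
    and lev_mono: "\<lbrakk>x \<in> carrier G; y \<in> carrier G; lev (Suc j) x = lev (Suc j) y\<rbrakk> \<Longrightarrow> lev j x = lev j y"
    and lev_sep: "\<lbrakk>x \<in> carrier G; y \<in> carrier G; \<And>j. lev j x = lev j y\<rbrakk> \<Longrightarrow> x = y"
    and lev_torsion: "\<lbrakk>x \<in> carrier G; lev 0 x = lev 0 \<one>\<rbrakk> \<Longrightarrow> \<exists>e. lev j (x [^] (q ^ e :: nat)) = lev j \<one>"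
begin

lemma lev_cong_mult:
  assumes "x \<in> carrier G" "x' \<in> carrier G" "y \<in> carrier G" "y' \<in> carrier G"
    and "lev j x = lev j x'" "lev j y = lev j y'"
  shows "lev j (x \<otimes> y) = lev j (x' \<otimes> y')"
  using lev_mult[of x x' \<one> y j] lev_mult[of y y' x' \<one> j] assms by simp

lemma lev_cong_inv:
  assumes "x \<in> carrier G" "y \<in> carrier G" "lev j x = lev j y"
  shows "lev j (inv x) = lev j (inv y)"
  using lev_mult[of x y "inv y" "inv x" j] assms by (simp add: m_assoc)

lemma lev_pow_one:
  assumes "x \<in> carrier G" "lev j x = lev j \<one>"
  shows "lev j (x [^] (n::nat)) = lev j \<one>"
proof (induction n)
  case (Suc n)
  have "lev j (x [^] n \<otimes> x) = lev j (\<one> \<otimes> \<one>)" by (rule lev_cong_mult) (use assms Suc in auto)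
  then show ?case by simp
qed simp

text \<open>Measurability is tested level by level, without a sigma-algebra on \<open>G\<close>. For
  the projective groups it follows from Borel measurability by
  \<open>plev_measurable\<close>.\<close>

definition levm :: "'w measure \<Rightarrow> ('w \<Rightarrow> 'g) \<Rightarrow> bool" where
  "levm N X \<longleftrightarrow> (\<forall>x\<in>space N. X x \<in> carrier G) \<and> (\<forall>j v. {x \<in> space N. lev j (X x) = v} \<in> sets N)"

lemma levm_carrier: "levm N X \<Longrightarrow> x \<in> space N \<Longrightarrow> X x \<in> carrier G"
  by (simp add: levm_def)

lemma levm_sets: "levm N X \<Longrightarrow> {x \<in> space N. lev j (X x) = v} \<in> sets N"
  by (simp add: levm_def)

lemma levm_const: "c \<in> carrier G \<Longrightarrow> levm N (\<lambda>_. c)"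
  by (simp add: levm_def)

lemma levm_compose:
  assumes "levm N X" "f \<in> N' \<rightarrow>\<^sub>M N"
  shows "levm N' (\<lambda>x. X (f x))"
proof -
  have "{x \<in> space N'. lev j (X (f x)) = v} = f -` {x \<in> space N. lev j (X x) = v} \<inter> space N'" for j v
    using measurable_space[OF assms(2)] by auto
  moreover have "f -` {x \<in> space N. lev j (X x) = v} \<inter> space N' \<in> sets N'" for j v
    by (rule measurable_sets[OF assms(2)]) (use assms(1) in \<open>simp add: levm_def\<close>)
  ultimately show ?thesis
    using assms(1) measurable_space[OF assms(2)] by (simp add: levm_def)
qed

text \<open>A level of the result depends only on the levels of the arguments, which take countably
  many values. The preimage is a countable union over pairs of levels, with representatives chosen
  by \<open>R\<close>.\<close>

lemma levm_binary:
  assumes X: "levm N X" and Y: "levm N Y"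
    and h: "\<And>x y. x \<in> carrier G \<Longrightarrow> y \<in> carrier G \<Longrightarrow> h x y \<in> carrier G"
    and hc: "\<And>x x' y y' j. \<lbrakk>x \<in> carrier G; x' \<in> carrier G; y \<in> carrier G; y' \<in> carrier G;
       lev j x = lev j x'; lev j y = lev j y'\<rbrakk> \<Longrightarrow> lev j (h x y) = lev j (h x' y')"
  shows "levm N (\<lambda>x. h (X x) (Y x))"
  unfolding levm_def
proof (intro conjI ballI allI)
  show "h (X x) (Y x) \<in> carrier G" if "x \<in> space N" for x
    using that X Y h by (simp add: levm_def)
  fix j v
  define V where "V = lev j ` carrier G"
  define R where "R = inv_into (carrier G) (lev j)"
  have R: "R a \<in> carrier G" "lev j (R a) = a" if "a \<in> V" for a
    using that inv_into_into[of a "lev j" "carrier G"] f_inv_into_f[of a "lev j" "carrier G"]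
    by (auto simp: R_def V_def)
  have cV: "countable V" using lev_countable by (simp add: V_def)
  have "{x \<in> space N. lev j (h (X x) (Y x)) = v} =
    (\<Union>ab\<in>{ab \<in> V \<times> V. lev j (h (R (fst ab)) (R (snd ab))) = v}.
      {x \<in> space N. lev j (X x) = fst ab} \<inter> {x \<in> space N. lev j (Y x) = snd ab})" (is "?A = ?B")
  proof (intro equalityI subsetI)
    fix x assume x: "x \<in> ?A"
    have c: "X x \<in> carrier G" "Y x \<in> carrier G" using x X Y by (auto simp: levm_def)
    have V: "lev j (X x) \<in> V" "lev j (Y x) \<in> V" using c by (auto simp: V_def)
    have "lev j (h (R (lev j (X x))) (R (lev j (Y x)))) = lev j (h (X x) (Y x))"
      by (rule hc) (use R V c in auto)
    then show "x \<in> ?B" using x V by (intro UN_I[of "(lev j (X x), lev j (Y x))"]) auto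
  next
    fix x assume "x \<in> ?B"
    then obtain ab where ab: "fst ab \<in> V" "snd ab \<in> V" "lev j (h (R (fst ab)) (R (snd ab))) = v"
      "x \<in> space N" "lev j (X x) = fst ab" "lev j (Y x) = snd ab" by auto
    have c: "X x \<in> carrier G" "Y x \<in> carrier G" using ab X Y by (auto simp: levm_def)
    have "lev j (h (R (fst ab)) (R (snd ab))) = lev j (h (X x) (Y x))"
      by (rule hc) (use R ab c in auto)
    then show "x \<in> ?A" using ab by simp
  qed
  also have "\<dots> \<in> sets N"
  proof (rule sets.countable_UN')
    show "countable {ab \<in> V \<times> V. lev j (h (R (fst ab)) (R (snd ab))) = v}"
      by (rule countable_subset[OF _ countable_SIGMA[OF cV cV]]) auto
  qed (blast intro: sets.Int levm_sets[OF X] levm_sets[OF Y])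
  finally show "{x \<in> space N. lev j (h (X x) (Y x)) = v} \<in> sets N" .
qed

lemma levm_mult: "levm N X \<Longrightarrow> levm N Y \<Longrightarrow> levm N (\<lambda>x. X x \<otimes> Y x)"
  by (rule levm_binary) (auto intro: lev_cong_mult)

lemma levm_inv: "levm N X \<Longrightarrow> levm N (\<lambda>x. inv (X x))"
  by (rule levm_binary[where Y = X and h = "\<lambda>x _. inv x"]) (auto intro: lev_cong_inv)

lemma levm_eq_lev:
  assumes X: "levm N X" and Y: "levm N Y"
  shows "{x \<in> space N. lev j (X x) = lev j (Y x)} \<in> sets N"
proof -
  have "{x \<in> space N. lev j (X x) = lev j (Y x)} =
    (\<Union>a\<in>lev j ` carrier G. {x \<in> space N. lev j (X x) = a} \<inter> {x \<in> space N. lev j (Y x) = a})"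
    using levm_carrier[OF X] levm_carrier[OF Y] by auto
  also have "\<dots> \<in> sets N"
    by (rule sets.countable_UN'[OF lev_countable]) (blast intro: sets.Int levm_sets[OF X] levm_sets[OF Y])
  finally show ?thesis .
qed

lemma levm_eq:
  assumes X: "levm N X" and Y: "levm N Y"
  shows "{x \<in> space N. X x = Y x} \<in> sets N"
proof -
  have "{x \<in> space N. X x = Y x} = (\<Inter>j. {x \<in> space N. lev j (X x) = lev j (Y x)})"
    using lev_sep levm_carrier[OF X] levm_carrier[OF Y] by auto
  also have "\<dots> \<in> sets N" using levm_eq_lev[OF X Y] by (intro sets.countable_INT) auto
  finally show ?thesis .
qed

lemma levm_neq:
  assumes X: "levm N X" and Y: "levm N Y"
  shows "{x \<in> space N. X x \<noteq> Y x} \<in> sets N" "{x \<in> space N. lev j (X x) \<noteq> lev j (Y x)} \<in> sets N"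
proof -
  have "{x \<in> space N. X x \<noteq> Y x} = space N - {x \<in> space N. X x = Y x}" by auto
  then show "{x \<in> space N. X x \<noteq> Y x} \<in> sets N" using levm_eq[OF X Y] by auto
  have "{x \<in> space N. lev j (X x) \<noteq> lev j (Y x)} = space N - {x \<in> space N. lev j (X x) = lev j (Y x)}" by auto
  then show "{x \<in> space N. lev j (X x) \<noteq> lev j (Y x)} \<in> sets N" using levm_eq_lev[OF X Y] by auto
qed

end

section \<open>Weak homomorphisms and almost invariance of their increments\<close>

type_synonym omega = "(nat \<Rightarrow> bool \<times> bool \<Rightarrow> int) \<times> (nat \<Rightarrow> bool \<Rightarrow> int)"

abbreviation Omega :: "nat \<Rightarrow> omega measure" where
  "Omega p \<equiv> haar p \<Otimes>\<^sub>M haar p"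

definition tr :: "nat \<Rightarrow> (nat \<Rightarrow> bool \<Rightarrow> int) \<Rightarrow> omega \<Rightarrow> omega" where
  "tr p u = (\<lambda>(k, t). (k, zadd p t u))"

definition lift_fst :: "('a \<Rightarrow> 'a) \<Rightarrow> 'a \<times> 'b \<Rightarrow> 'a \<times> 'b" where
  "lift_fst h = (\<lambda>(k, t). (h k, t))"

text \<open>What is kept of a Borel reduction composed with the chart: measurability, and for the
  two shears and the two unit translations a cocycle with values in the countable set
  \<open>Lam\<close>.\<close>

locale weak_hom = lev_group G lev q for G :: "('g, 'x) monoid_scheme" (structure) and lev :: "nat \<Rightarrow> 'g \<Rightarrow> 'l" and q +
  fixes p :: nat and F :: "omega \<Rightarrow> 'g" and Lam :: "'g set"
  assumes prime_p: "prime p" and prime_q: "prime q" and pq: "p \<noteq> q"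
    and levm_F: "levm (Omega p) F"
    and Lam: "countable Lam" "Lam \<subseteq> carrier G"
    and F_hshear: "\<omega> \<in> space (Omega p) \<Longrightarrow> \<exists>l\<in>Lam. F (lift_fst (hshear p) \<omega>) = l \<otimes> F \<omega>"
    and F_hshear': "\<omega> \<in> space (Omega p) \<Longrightarrow> \<exists>l\<in>Lam. F (lift_fst (hshear' p) \<omega>) = l \<otimes> F \<omega>"
    and F_transl: "\<omega> \<in> space (Omega p) \<Longrightarrow> a \<in> {(1, 0), (0, 1)} \<Longrightarrow> \<exists>l\<in>Lam. F (transl p (zemb p a) \<omega>) = l \<otimes> F \<omega>"
begin

lemma p1: "p > 1" using prime_p by (rule prime_gt_1_nat)
lemma p0: "p > 0" using p1 by simp

sublocale near_identity "haar p :: (nat \<Rightarrow> bool \<times> bool \<Rightarrow> int) measure" p "TYPE(bool)"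
  by (intro near_identity.intro near_identity_axioms.intro prob_space_haar p0)

lemma space_Omega: "\<omega> \<in> space (Omega p) \<longleftrightarrow> fst \<omega> \<in> zspace p \<and> snd \<omega> \<in> zspace p"
  by (auto simp: space_pair_measure mem_Times_iff)

lemma mpt_tr: "u \<in> zspace p \<Longrightarrow> mpt (Omega p) (tr p u)"
  unfolding tr_def by (rule mpt_pair_skew[OF p0]) simp

lemma near_id_tr:
  assumes "u \<in> zspace p" "u i = (\<lambda>_. 0)"
  shows "near_id (haar p) p i (tr p u)"
  unfolding near_id_def
proof (intro conjI ballI)
  fix \<omega> assume "\<omega> \<in> space (Omega p)"
  then show "fst (tr p u \<omega>) = fst \<omega>" "snd (tr p u \<omega>) i = snd \<omega> i"
    using assms(2) by (auto simp: tr_def space_pair_measure zadd_def zred_def zspaceD(5))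
qed (rule mpt_tr[OF assms(1)])

definition D :: "(nat \<Rightarrow> bool \<Rightarrow> int) \<Rightarrow> omega \<Rightarrow> 'g" where
  "D u \<omega> = inv (F \<omega>) \<otimes> F (tr p u \<omega>)"

lemma F_carrier: "\<omega> \<in> space (Omega p) \<Longrightarrow> F \<omega> \<in> carrier G"
  by (rule levm_carrier[OF levm_F])

lemma tr_space: "\<omega> \<in> space (Omega p) \<Longrightarrow> u \<in> zspace p \<Longrightarrow> tr p u \<omega> \<in> space (Omega p)"
  using measurable_space[OF mpt_measurable[OF mpt_tr]] by blast

lemma levm_D: "u \<in> zspace p \<Longrightarrow> levm (Omega p) (D u)"
  unfolding D_def
  by (intro levm_mult levm_inv levm_F levm_compose[OF levm_F mpt_measurable[OF mpt_tr]])

lemma D_almost_invariant: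
  assumes \<gamma>: "mpt (Omega p) \<gamma>"
    and comm: "\<And>u \<omega>. u \<in> zspace p \<Longrightarrow> \<omega> \<in> space (Omega p) \<Longrightarrow> \<gamma> (tr p u \<omega>) = tr p u (\<gamma> \<omega>)"
    and Fg: "\<And>\<omega>. \<omega> \<in> space (Omega p) \<Longrightarrow> \<exists>l\<in>Lam. F (\<gamma> \<omega>) = l \<otimes> F \<omega>"
    and e: "e > 0"
  shows "\<exists>i. \<forall>u\<in>zspace p. u i = (\<lambda>_. 0) \<longrightarrow> measure (Omega p) {\<omega> \<in> space (Omega p). D u (\<gamma> \<omega>) \<noteq> D u \<omega>} \<le> e"
proof -
  define C where "C \<omega> = F (\<gamma> \<omega>) \<otimes> inv (F \<omega>)" for \<omega>
  have gs: "\<gamma> \<omega> \<in> space (Omega p)" if "\<omega> \<in> space (Omega p)" for \<omega>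
    using measurable_space[OF mpt_measurable[OF \<gamma>] that] .
  have CL: "C \<omega> \<in> Lam" if w: "\<omega> \<in> space (Omega p)" for \<omega>
  proof -
    obtain l where l: "l \<in> Lam" "F (\<gamma> \<omega>) = l \<otimes> F \<omega>" using Fg[OF w] by blast
    have "C \<omega> = l" using l Lam(2) F_carrier[OF w] by (auto simp: C_def m_assoc)
    then show ?thesis using l by simp
  qed
  have lC: "levm (Omega p) C"
    unfolding C_def by (intro levm_mult levm_inv levm_F levm_compose[OF levm_F mpt_measurable[OF \<gamma>]])
  have mC: "{\<omega> \<in> space (Omega p). C \<omega> = v} \<in> sets (Omega p)" for v
  proof (cases "v \<in> carrier G")
    case True
    then show ?thesis by (rule levm_eq[OF lC levm_const])
  next
    case False
    then have "{\<omega> \<in> space (Omega p). C \<omega> = v} = {}" using levm_carrier[OF lC] by blast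
    then show ?thesis by (simp only: sets.empty_sets)
  qed
  have "countable (C ` space (Omega p))"
    by (rule countable_subset[OF _ Lam(1)]) (use CL in auto)
  from countable_valued_near[OF this mC e]
  obtain i where i: "\<And>S. near_id (haar p) p i S \<Longrightarrow> measure (Omega p) {\<omega> \<in> space (Omega p). C (S \<omega>) \<noteq> C \<omega>} \<le> e"
    by blast
  have "measure (Omega p) {\<omega> \<in> space (Omega p). D u (\<gamma> \<omega>) \<noteq> D u \<omega>} \<le> e" if u: "u \<in> zspace p" "u i = (\<lambda>_. 0)" for u
  proof -
    have "D u (\<gamma> \<omega>) = D u \<omega> \<longleftrightarrow> C (tr p u \<omega>) = C \<omega>" if w: "\<omega> \<in> space (Omega p)" for \<omega>
    proof -
      define a b c d where "a = F \<omega>" and "b = F (\<gamma> \<omega>)" and "c = F (tr p u \<omega>)" and "d = F (\<gamma> (tr p u \<omega>))"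
      have car: "a \<in> carrier G" "b \<in> carrier G" "c \<in> carrier G" "d \<in> carrier G"
        by (auto simp: a_def b_def c_def d_def intro!: F_carrier gs tr_space w u)
      have "D u (\<gamma> \<omega>) = D u \<omega> \<longleftrightarrow> inv b \<otimes> d = inv a \<otimes> c"
        by (simp add: D_def a_def b_def c_def d_def comm[OF u(1) w])
      also have "\<dots> \<longleftrightarrow> d = b \<otimes> (inv a \<otimes> c)" using car by (metis inv_solve_left inv_closed m_closed)
      also have "\<dots> \<longleftrightarrow> d = (b \<otimes> inv a) \<otimes> c" using car by (simp add: m_assoc)
      also have "\<dots> \<longleftrightarrow> d \<otimes> inv c = b \<otimes> inv a" using car by (metis inv_solve_right inv_closed m_closed)
      also have "\<dots> \<longleftrightarrow> C (tr p u \<omega>) = C \<omega>" by (simp add: C_def a_def b_def c_def d_def)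
      finally show ?thesis .
    qed
    then have "{\<omega> \<in> space (Omega p). D u (\<gamma> \<omega>) \<noteq> D u \<omega>} = {\<omega> \<in> space (Omega p). C (tr p u \<omega>) \<noteq> C \<omega>}" by auto
    then show ?thesis using i[OF near_id_tr[OF u]] by simp
  qed
  then show ?thesis by blast
qed

lemma prob_neq:
  assumes X: "levm (Omega p) X" and Y: "levm (Omega p) Y"
  shows "measure (Omega p) {\<omega> \<in> space (Omega p). X \<omega> \<noteq> Y \<omega>} = 1 - measure (Omega p) {\<omega> \<in> space (Omega p). X \<omega> = Y \<omega>}"
proof -
  have "{\<omega> \<in> space (Omega p). X \<omega> \<noteq> Y \<omega>} = space (Omega p) - {\<omega> \<in> space (Omega p). X \<omega> = Y \<omega>}" by blast
  then show ?thesis using O.prob_compl[OF levm_eq[OF X Y]] by simp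
qed

lemma mpt_lift_fst: "mpt (haar p) h \<Longrightarrow> mpt (Omega p) (lift_fst h)"
  unfolding lift_fst_def by (rule mpt_pair_fst) (use prob_space_haar[OF p0] in \<open>auto intro: prob_space_imp_sigma_finite\<close>)

lemma mpt_transl': "w \<in> zspace p \<Longrightarrow> mpt (Omega p) (transl p w)"
  by (rule mpt_transl[OF p1])

lemma coloured_action_D:
  assumes u: "u \<in> zspace p"
  shows "coloured_action (Omega p) (\<lambda>a. transl p (zemb p a)) (D u)"
proof (intro coloured_action.intro coloured_action_axioms.intro)
  show "prob_space (Omega p)" by (rule O.prob_space_axioms)
  show "mpt (Omega p) (transl p (zemb p a))" for a by (rule mpt_transl'[OF zemb_in[OF p1]])
  show "transl p (zemb p (a + b)) \<omega> = transl p (zemb p a) (transl p (zemb p b) \<omega>)" for a b \<omega>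
    by (simp add: zemb_add[OF p1] transl_zadd[OF p1])
  show "transl p (zemb p 0) \<omega> = \<omega>" if "\<omega> \<in> space (Omega p)" for \<omega>
    using that by (simp only: zemb_zero[OF p1] transl_zero[OF p1] space_Omega)
  show "{\<omega> \<in> space (Omega p). D u (f \<omega>) = D u (g \<omega>)} \<in> sets (Omega p)"
    if "f \<in> Omega p \<rightarrow>\<^sub>M Omega p" "g \<in> Omega p \<rightarrow>\<^sub>M Omega p" for f g
    by (rule levm_eq[OF levm_compose[OF levm_D[OF u] that(1)] levm_compose[OF levm_D[OF u] that(2)]])
qed

lemma tr_commute:
  "lift_fst h (tr p u \<omega>) = tr p u (lift_fst h \<omega>)"
  "transl p w (tr p u \<omega>) = tr p u (transl p w \<omega>)"
  by (simp_all add: lift_fst_def tr_def transl_def case_prod_unfold zadd_assoc zadd_left_commute zadd_commute)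

lemma level_zero_mono:
  assumes "u \<in> zspace p" "u j = (\<lambda>_. 0)" "i \<le> j"
  shows "u i = (\<lambda>_. 0)"
proof
  fix x show "u i x = 0" using zspace_mod[OF assms(1,3), of x] assms(2) by simp
qed

text \<open>Each of the four generators supplies a depth beyond which \<open>D u\<close> is
  invariant up to \<open>\<epsilon>\<close>. Beyond the deepest of them
  \<open>relative_rigidity\<close> treats all \<open>a\<close> at once.\<close>

lemma D_rigid_int:
  "\<exists>i. \<forall>u\<in>zspace p. u i = (\<lambda>_. 0) \<longrightarrow>
    (\<forall>a. measure (Omega p) {\<omega> \<in> space (Omega p). D u (transl p (zemb p a) \<omega>) \<noteq> D u \<omega>} \<le> 1 / 100)"
proof -
  define s where "s = 5 * p"
  \<comment> \<open>With \<open>\<epsilon> = r^2\<close> the two error terms are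
    \<open>1536 / 10^8\<close> and at most \<open>24 / 10^4\<close>, together below
    \<open>1 / 100\<close>.\<close>
  define r where "r = 1 / (10 ^ 4 * (real s)\<^sup>2)"
  define \<epsilon> where "\<epsilon> = r\<^sup>2"
  have s: "s \<ge> 5" using p1 by (simp add: s_def)
  have r: "r > 0" using s by (simp add: r_def)
  have \<epsilon>: "\<epsilon> > 0" "sqrt \<epsilon> = r" using r by (simp_all add: \<epsilon>_def)
  have sm: "1536 * (real s)^4 * \<epsilon> + 24 * sqrt \<epsilon> \<le> 1 / 100"
  proof -
    have s4: "(real s)^4 = ((real s)\<^sup>2)\<^sup>2" by (simp flip: power_mult)
    have "1536 * (real s)^4 * \<epsilon> = 1536 / 10 ^ 8"
      using s unfolding \<epsilon>_def r_def s4 by (simp add: power_divide power_mult_distrib)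
    moreover have "r \<le> 1 / 10 ^ 4"
    proof -
      have "(1::real)\<^sup>2 \<le> (real s)\<^sup>2" using s by (intro power_mono) auto
      then have "10 ^ 4 * 1 \<le> 10 ^ 4 * (real s)\<^sup>2" by (intro mult_left_mono) auto
      then show ?thesis unfolding r_def using s by (intro divide_left_mono) auto
    qed
    moreover have "(1536 / 10 ^ 8 :: real) + 24 * (1 / 10 ^ 4) \<le> 1 / 100" by simp
    ultimately show ?thesis unfolding \<epsilon>(2) by linarith
  qed
  obtain i1 where i1: "\<And>u. u \<in> zspace p \<Longrightarrow> u i1 = (\<lambda>_. 0) \<Longrightarrow>
      measure (Omega p) {\<omega> \<in> space (Omega p). D u (lift_fst (hshear p) \<omega>) \<noteq> D u \<omega>} \<le> \<epsilon>"
    using D_almost_invariant[OF mpt_lift_fst[OF mpt_hshear[OF p1]] tr_commute(1) F_hshear \<epsilon>(1)] by blast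
  obtain i2 where i2: "\<And>u. u \<in> zspace p \<Longrightarrow> u i2 = (\<lambda>_. 0) \<Longrightarrow>
      measure (Omega p) {\<omega> \<in> space (Omega p). D u (lift_fst (hshear' p) \<omega>) \<noteq> D u \<omega>} \<le> \<epsilon>"
    using D_almost_invariant[OF mpt_lift_fst[OF mpt_hshear'[OF p1]] tr_commute(1) F_hshear' \<epsilon>(1)] by blast
  have "\<exists>i. \<forall>u\<in>zspace p. u i = (\<lambda>_. 0) \<longrightarrow>
      measure (Omega p) {\<omega> \<in> space (Omega p). D u (transl p (zemb p a) \<omega>) \<noteq> D u \<omega>} \<le> \<epsilon>"
    if a: "a \<in> {(1, 0), (0, 1)}" for a
    by (rule D_almost_invariant[OF mpt_transl'[OF zemb_in[OF p1]] tr_commute(2) F_transl \<epsilon>(1)]) (use a in auto)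
  from this[of "(1, 0)"] this[of "(0, 1)"]
  obtain i3 i4 where i3: "\<And>u. u \<in> zspace p \<Longrightarrow> u i3 = (\<lambda>_. 0) \<Longrightarrow>
      measure (Omega p) {\<omega> \<in> space (Omega p). D u (transl p (zemb p (1, 0)) \<omega>) \<noteq> D u \<omega>} \<le> \<epsilon>"
    and i4: "\<And>u. u \<in> zspace p \<Longrightarrow> u i4 = (\<lambda>_. 0) \<Longrightarrow>
      measure (Omega p) {\<omega> \<in> space (Omega p). D u (transl p (zemb p (0, 1)) \<omega>) \<noteq> D u \<omega>} \<le> \<epsilon>"
    by auto
  define i where "i = Max {i1, i2, i3, i4}"
  have le: "i1 \<le> i" "i2 \<le> i" "i3 \<le> i" "i4 \<le> i" by (auto simp: i_def)
  have "measure (Omega p) {\<omega> \<in> space (Omega p). D u (transl p (zemb p a) \<omega>) \<noteq> D u \<omega>} \<le> 1 / 100"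
    if u: "u \<in> zspace p" "u i = (\<lambda>_. 0)" for u a
  proof -
    interpret CA: coloured_action "Omega p" "\<lambda>a. transl p (zemb p a)" "D u" by (rule coloured_action_D[OF u(1)])
    note lz = level_zero_mono[OF u]
    have ph: "1 - CA.\<phi> b = measure (Omega p) {\<omega> \<in> space (Omega p). D u (transl p (zemb p b) \<omega>) \<noteq> D u \<omega>}" for b
      unfolding CA.\<phi>_def
      by (rule prob_neq[symmetric, OF levm_compose[OF levm_D[OF u(1)] mpt_measurable[OF mpt_transl'[OF zemb_in[OF p1]]]] levm_D[OF u(1)]])
    have s5: "int s = 5 * int p" by (simp add: s_def)
    have "1 - CA.\<phi> a \<le> 1536 * (real s)^4 * \<epsilon> + 24 * sqrt \<epsilon>"
    proof (rule CA.relative_rigidity[OF s mpt_lift_fst[OF mpt_hshear[OF p1]] _ mpt_lift_fst[OF mpt_hshear'[OF p1]] _ \<epsilon>(1)])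
      show "lift_fst (hshear p) (transl p (zemb p a) \<omega>) = transl p (zemb p (shear (int s) a)) (lift_fst (hshear p) \<omega>)" for a \<omega>
        by (simp add: lift_fst_def transl_def case_prod_unfold disp_hshear[OF p1] s5)
      show "lift_fst (hshear' p) (transl p (zemb p a) \<omega>) = transl p (zemb p (shear' (int s) a)) (lift_fst (hshear' p) \<omega>)" for a \<omega>
        by (simp add: lift_fst_def transl_def case_prod_unfold disp_hshear'[OF p1] s5)
    qed (use i1[OF u(1) lz[OF le(1)]] i2[OF u(1) lz[OF le(2)]] i3[OF u(1) lz[OF le(3)]] i4[OF u(1) lz[OF le(4)]] ph in auto)
    then show ?thesis using sm ph by simp
  qed
  then show ?thesis by blast
qed

lemma near_id_transl:
  assumes "v \<in> zspace p" "v i = (\<lambda>_. 0)"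
  shows "near_id (haar p) p i (transl p v)"
  unfolding near_id_def
proof (intro conjI ballI)
  fix \<omega> assume "\<omega> \<in> space (Omega p)"
  then show "fst (transl p v \<omega>) = fst \<omega>" "snd (transl p v \<omega>) i = snd \<omega> i"
    using disp_zero_level[OF p1, of v i] assms(2)
    by (auto simp: transl_def space_pair_measure zadd_def zred_def zspaceD(5))
qed (rule mpt_transl'[OF assms(1)])

text \<open>Write \<open>w\<close> as an integral vector plus a remainder that vanishes at a deep
  level. The remainder hardly affects a fixed level of \<open>D u\<close>, since levels take
  countably many values. This bounds disagreement at each level \<open>L\<close>, and these events
  increase to disagreement of \<open>D u\<close> itself.\<close>

lemma D_rigid:
  "\<exists>i. \<forall>u\<in>zspace p. u i = (\<lambda>_. 0) \<longrightarrow>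
    (\<forall>w\<in>zspace p. measure (Omega p) {\<omega> \<in> space (Omega p). D u (transl p w \<omega>) \<noteq> D u \<omega>} \<le> 1 / 100)"
proof -
  obtain i where i: "\<And>u a. u \<in> zspace p \<Longrightarrow> u i = (\<lambda>_. 0) \<Longrightarrow>
      measure (Omega p) {\<omega> \<in> space (Omega p). D u (transl p (zemb p a) \<omega>) \<noteq> D u \<omega>} \<le> 1 / 100"
    using D_rigid_int by blast
  have "measure (Omega p) {\<omega> \<in> space (Omega p). D u (transl p w \<omega>) \<noteq> D u \<omega>} \<le> 1 / 100"
    if u: "u \<in> zspace p" "u i = (\<lambda>_. 0)" and w: "w \<in> zspace p" for u w
  proof -
    note lD = levm_D[OF u(1)]
    note lT = levm_compose[OF lD mpt_measurable[OF mpt_transl']]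
    define A where "A L = {\<omega> \<in> space (Omega p). lev L (D u (transl p w \<omega>)) \<noteq> lev L (D u \<omega>)}" for L
    have sA: "A L \<in> sets (Omega p)" for L unfolding A_def by (rule levm_neq(2)[OF lT[OF w] lD])
    have bound: "measure (Omega p) (A L) \<le> 1 / 100" for L
    proof (rule field_le_epsilon)
      fix e :: real assume e: "e > 0"
      define C where "C \<omega> = lev L (D u \<omega>)" for \<omega>
      have "countable (C ` space (Omega p))"
        by (rule countable_subset[OF _ lev_countable[of L]]) (use levm_carrier[OF lD] in \<open>auto simp: C_def\<close>)
      moreover have "{\<omega> \<in> space (Omega p). C \<omega> = v} \<in> sets (Omega p)" for v
        unfolding C_def by (rule levm_sets[OF lD])
      ultimately obtain l where l: "\<And>S. near_id (haar p) p l S \<Longrightarrow>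
          measure (Omega p) {\<omega> \<in> space (Omega p). C (S \<omega>) \<noteq> C \<omega>} \<le> e"
        using countable_valued_near[of C e] e by blast
      \<comment> \<open>The integral vector with the residues of \<open>w\<close> at level
        \<open>l\<close>; the remainder \<open>v\<close> then acts as a near-identity map.\<close>
      define a where "a = (w l False, w l True)"
      define v where "v = zsub p w (zemb p a)"
      have v: "v \<in> zspace p" unfolding v_def by (rule zsub_in[OF p0 w zemb_in[OF p1]])
      have vl: "v l = (\<lambda>_. 0)"
        by (rule ext) (auto simp: v_def zsub_def zred_def zemb_def a_def)
      have wv: "transl p w \<omega> = transl p v (transl p (zemb p a) \<omega>)" for \<omega>
        using zsub_zadd[OF w, of "zemb p a"] by (simp add: v_def flip: transl_zadd[OF p1])
      let ?T = "transl p (zemb p a)"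
      note mT = mpt_transl'[OF zemb_in[OF p1, of a]]
      let ?B = "{\<omega> \<in> space (Omega p). C (transl p v (?T \<omega>)) \<noteq> C (?T \<omega>)}"
      let ?B' = "{\<omega> \<in> space (Omega p). D u (?T \<omega>) \<noteq> D u \<omega>}"
      have sC: "{\<omega> \<in> space (Omega p). C (transl p v \<omega>) \<noteq> C \<omega>} \<in> sets (Omega p)"
        unfolding C_def by (rule levm_neq(2)[OF lT[OF v] lD])
      have B: "?B \<in> sets (Omega p)"
        unfolding C_def
        by (rule levm_neq(2)[OF levm_compose[OF lT[OF v] mpt_measurable[OF mT]] levm_compose[OF lD mpt_measurable[OF mT]]])
      have B': "?B' \<in> sets (Omega p)" by (rule levm_neq(1)[OF lT[OF zemb_in[OF p1]] lD])
      have "measure (Omega p) (A L) \<le> measure (Omega p) (?B \<union> ?B')"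
        by (rule O.finite_measure_mono) (use B B' in \<open>auto simp: A_def C_def wv\<close>)
      also have "\<dots> \<le> measure (Omega p) ?B + measure (Omega p) ?B'" by (rule measure_Un_le[OF B B'])
      also have "measure (Omega p) ?B = measure (Omega p) {\<omega> \<in> space (Omega p). C (transl p v \<omega>) \<noteq> C \<omega>}"
        by (rule mpt_measure[OF mT sC])
      also have "\<dots> \<le> e" by (rule l[OF near_id_transl[OF v vl]])
      finally show "measure (Omega p) (A L) \<le> 1 / 100 + e" using i[OF u, of a] by linarith
    qed
    have "(\<lambda>L. measure (Omega p) (A L)) \<longlonglongrightarrow> measure (Omega p) (\<Union>L. A L)"
    proof (rule O.finite_Lim_measure_incseq)
      show "range A \<subseteq> sets (Omega p)" using sA by blast
      show "incseq A"
        unfolding incseq_Suc_iff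
      proof (intro allI subsetI)
        fix L \<omega> assume w: "\<omega> \<in> A L"
        then have "\<omega> \<in> space (Omega p)" by (simp add: A_def)
        then have c: "D u (transl p w \<omega>) \<in> carrier G" "D u \<omega> \<in> carrier G"
          using levm_carrier[OF lT[OF \<open>w \<in> zspace p\<close>]] levm_carrier[OF lD] by auto
        show "\<omega> \<in> A (Suc L)" using w lev_mono[OF c] by (auto simp: A_def)
      qed
    qed
    then have "measure (Omega p) (\<Union>L. A L) \<le> 1 / 100"
      by (rule LIMSEQ_le_const2) (use bound in auto)
    moreover have "{\<omega> \<in> space (Omega p). D u (transl p w \<omega>) \<noteq> D u \<omega>} \<subseteq> (\<Union>L. A L)"
    proof
      fix \<omega> assume "\<omega> \<in> {\<omega> \<in> space (Omega p). D u (transl p w \<omega>) \<noteq> D u \<omega>}"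
      then have o: "\<omega> \<in> space (Omega p)" "D u (transl p w \<omega>) \<noteq> D u \<omega>" by auto
      then obtain L where "lev L (D u (transl p w \<omega>)) \<noteq> lev L (D u \<omega>)"
        using lev_sep[OF levm_carrier[OF lT[OF w] o(1)] levm_carrier[OF lD o(1)]] by blast
      then show "\<omega> \<in> (\<Union>L. A L)" using o(1) by (auto simp: A_def)
    qed
    moreover have "(\<Union>L. A L) \<in> sets (Omega p)" using sA by blast
    ultimately show ?thesis
      using O.finite_measure_mono order_trans by blast
  qed
  then show ?thesis by blast
qed

end

section \<open>From almost invariance to an uncountable fibre\<close>

lemma mpt_nn_integral:
  assumes "mpt M T" "f \<in> borel_measurable M"
  shows "(\<integral>\<^sup>+x. f (T x) \<partial>M) = (\<integral>\<^sup>+x. f x \<partial>M)"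
proof -
  have "(\<integral>\<^sup>+x. f x \<partial>M) = (\<integral>\<^sup>+x. f x \<partial>distr M M T)" using assms by (simp add: mpt_def)
  also have "\<dots> = (\<integral>\<^sup>+x. f (T x) \<partial>M)" using assms by (intro nn_integral_distr) (auto simp: mpt_def)
  finally show ?thesis by simp
qed

context weak_hom
begin

abbreviation H2 :: "(nat \<Rightarrow> bool \<Rightarrow> int) measure" where "H2 \<equiv> haar p"

sublocale H: prob_space H2 by (rule prob_space_haar[OF p0])

lemma avoid_two:
  assumes "A \<in> sets H2" "B \<in> sets H2" "measure H2 A + measure H2 B < 1"
  obtains x where "x \<in> zspace p" "x \<notin> A" "x \<notin> B"
proof -
  have "measure H2 (A \<union> B) < 1" using measure_Un_le[OF assms(1,2)] assms(3) by linarith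
  then have "A \<union> B \<noteq> space H2" using H.prob_space by auto
  moreover have "A \<union> B \<subseteq> space H2" using sets.sets_into_space assms by blast
  ultimately show thesis using that by auto
qed

text \<open>The exceptional set when \<open>g\<close> is proposed as the value at
  \<open>\<tau>\<close> of a homomorphism. Errors add under composition (\<open>bad_comp\<close>),
  and a small error determines \<open>g\<close> (\<open>bad_unique\<close>).\<close>

definition bad :: "((nat \<Rightarrow> bool \<Rightarrow> int) \<Rightarrow> 'g) \<Rightarrow> nat \<Rightarrow> (nat \<Rightarrow> bool \<Rightarrow> int) \<Rightarrow> 'g \<Rightarrow> (nat \<Rightarrow> bool \<Rightarrow> int) set" where
  "bad f i \<tau> g = {x \<in> space H2. f (zadd p x (zsmul p (int p ^ i) \<tau>)) \<noteq> f x \<otimes> g}"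

context
  fixes f :: "(nat \<Rightarrow> bool \<Rightarrow> int) \<Rightarrow> 'g" and i :: nat
  assumes f: "levm H2 f"
begin

lemma f_carrier: "x \<in> zspace p \<Longrightarrow> f x \<in> carrier G"
  using levm_carrier[OF f] by simp

lemma levm_f_shift: "u \<in> zspace p \<Longrightarrow> levm H2 (\<lambda>x. f (zadd p x u))"
  by (rule levm_compose[OF f mpt_measurable[OF mpt_zadd[OF p0]]])

lemma bad_sets: "\<tau> \<in> zspace p \<Longrightarrow> g \<in> carrier G \<Longrightarrow> bad f i \<tau> g \<in> sets H2"
  unfolding bad_def by (intro levm_neq(1) levm_f_shift levm_mult f levm_const zsmul_in[OF p0])

lemma bad_comp:
  assumes "\<tau> \<in> zspace p" "\<tau>' \<in> zspace p" "g \<in> carrier G" "g' \<in> carrier G"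
  shows "measure H2 (bad f i (zadd p \<tau> \<tau>') (g \<otimes> g')) \<le> measure H2 (bad f i \<tau> g) + measure H2 (bad f i \<tau>' g')"
proof -
  let ?u = "zsmul p (int p ^ i) \<tau>" and ?u' = "zsmul p (int p ^ i) \<tau>'"
  have u: "?u \<in> zspace p" "?u' \<in> zspace p" using assms p0 by auto
  let ?B = "{x \<in> space H2. zadd p x ?u \<in> bad f i \<tau>' g'}"
  have b: "{x \<in> space H2. x \<in> bad f i \<tau>' g'} = bad f i \<tau>' g'" by (auto simp: bad_def)
  have m: "measure H2 ?B = measure H2 (bad f i \<tau>' g')"
    using mpt_measure[OF mpt_zadd[OF p0 u(1)], of "\<lambda>x. x \<in> bad f i \<tau>' g'"] b bad_sets[OF assms(2,4)] by simp
  have "?B = (\<lambda>x. zadd p x ?u) -` bad f i \<tau>' g' \<inter> space H2" by auto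
  then have B: "?B \<in> sets H2"
    using measurable_sets[OF mpt_measurable[OF mpt_zadd[OF p0 u(1)]] bad_sets[OF assms(2,4)]] by simp
  have "bad f i (zadd p \<tau> \<tau>') (g \<otimes> g') \<subseteq> bad f i \<tau> g \<union> ?B"
  proof
    fix x assume x: "x \<in> bad f i (zadd p \<tau> \<tau>') (g \<otimes> g')"
    then have xs: "x \<in> zspace p" by (simp add: bad_def)
    show "x \<in> bad f i \<tau> g \<union> ?B"
    proof (rule ccontr)
      assume "\<not> ?thesis"
      then have "f (zadd p x ?u) = f x \<otimes> g" "f (zadd p (zadd p x ?u) ?u') = f (zadd p x ?u) \<otimes> g'"
        using xs u p0 by (auto simp: bad_def)
      then have "f (zadd p x (zsmul p (int p ^ i) (zadd p \<tau> \<tau>'))) = f x \<otimes> (g \<otimes> g')"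
        using f_carrier[OF xs] assms by (simp add: zsmul_zadd zadd_assoc m_assoc)
      then show False using x by (simp add: bad_def)
    qed
  qed
  then have "measure H2 (bad f i (zadd p \<tau> \<tau>') (g \<otimes> g')) \<le> measure H2 (bad f i \<tau> g \<union> ?B)"
    by (rule H.finite_measure_mono) (use bad_sets[OF assms(1,3)] B in auto)
  also have "\<dots> \<le> measure H2 (bad f i \<tau> g) + measure H2 ?B"
    by (rule measure_Un_le[OF bad_sets[OF assms(1,3)] B])
  finally show ?thesis by (simp only: m)
qed

lemma bad_unique:
  assumes "\<tau> \<in> zspace p" "g \<in> carrier G" "g' \<in> carrier G"
    "measure H2 (bad f i \<tau> g) + measure H2 (bad f i \<tau> g') < 1"
  shows "g = g'"
proof -
  obtain x where x: "x \<in> zspace p" "x \<notin> bad f i \<tau> g" "x \<notin> bad f i \<tau> g'"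
    using avoid_two[OF bad_sets[OF assms(1,2)] bad_sets[OF assms(1,3)] assms(4)] .
  then have "f x \<otimes> g = f x \<otimes> g'" by (auto simp: bad_def)
  then show ?thesis using f_carrier[OF x(1)] assms by simp
qed

text \<open>The near-identity estimate lives on \<open>Omega p\<close>; there \<open>f\<close>
  depends on the second coordinate, and translation by \<open>u\<close> is the near-identity map
  \<open>tr p u\<close>.\<close>

lemma level_continuity:
  "\<exists>l. \<forall>u\<in>zspace p. u l = (\<lambda>_. 0) \<longrightarrow> measure H2 {x \<in> space H2. lev L (f (zadd p x u)) \<noteq> lev L (f x)} \<le> 1 / 2"
proof -
  define C where "C \<omega> = lev L (f (snd \<omega>))" for \<omega> :: omega
  have lf: "levm (Omega p) (\<lambda>\<omega>. f (snd \<omega>))" by (rule levm_compose[OF f measurable_snd])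
  have "countable (C ` space (Omega p))"
    by (rule countable_subset[OF _ lev_countable[of L]]) (use levm_carrier[OF lf] in \<open>auto simp: C_def\<close>)
  moreover have "{\<omega> \<in> space (Omega p). C \<omega> = v} \<in> sets (Omega p)" for v
    unfolding C_def by (rule levm_sets[OF lf])
  ultimately obtain l where l: "\<And>S. near_id (haar p) p l S \<Longrightarrow>
      measure (Omega p) {\<omega> \<in> space (Omega p). C (S \<omega>) \<noteq> C \<omega>} \<le> 1 / 2"
    using countable_valued_near[of C "1 / 2"] by auto
  have "measure H2 {x \<in> space H2. lev L (f (zadd p x u)) \<noteq> lev L (f x)} \<le> 1 / 2"
    if u: "u \<in> zspace p" "u l = (\<lambda>_. 0)" for u
  proof -
    let ?A = "{x \<in> space H2. lev L (f (zadd p x u)) \<noteq> lev L (f x)}"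
    have A: "?A \<in> sets H2" by (rule levm_neq(2)[OF levm_f_shift[OF u(1)] f])
    have "{\<omega> \<in> space (Omega p). C (tr p u \<omega>) \<noteq> C \<omega>} = space (haar p) \<times> ?A"
      by (auto simp: C_def tr_def space_pair_measure)
    moreover have "emeasure (Omega p) (space (haar p) \<times> ?A) = emeasure H2 ?A"
      using H.emeasure_pair_measure_Times[OF sets.top A, of "haar p :: (nat \<Rightarrow> bool \<times> bool \<Rightarrow> int) measure"] emeasure_space_1 by simp
    ultimately show ?thesis using l[OF near_id_tr[OF u]] by (simp add: measure_def)
  qed
  then show ?thesis by blast
qed

text \<open>Stability of approximate homomorphisms: \<open>s0\<close> is right on average, and from
  it comes a homomorphism \<open>s\<close> that is right at every \<open>\<tau>\<close> up to
  16/100. Once \<open>s\<close> is trivial on multiples of \<open>p ^ l0\<close>, the map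
  \<open>f\<close> repeats its value along these translations for most points, and Fubini finds one
  point where this happens for a non-null, hence uncountable, set of \<open>\<tau>\<close>.\<close>

lemma approx_hom_fibre:
  assumes s0: "levm H2 s0"
    and int: "(\<integral>\<^sup>+\<tau>. emeasure H2 (bad f i \<tau> (s0 \<tau>)) \<partial>H2) \<le> ennreal (1 / 50)"
  shows "\<exists>x\<in>zspace p. uncountable {t \<in> zspace p. f t = f x}"
proof -
  have s0c: "s0 \<tau> \<in> carrier G" if "\<tau> \<in> zspace p" for \<tau> using levm_carrier[OF s0] that by simp
  have shm: "(\<lambda>x. zadd p (snd x) (zsmul p c (fst x))) \<in> H2 \<Otimes>\<^sub>M H2 \<rightarrow>\<^sub>M H2" for c
    by (intro measurable_zadd measurable_zsmul p0 measurable_snd measurable_fst)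
  define Q where "Q = {x \<in> space (H2 \<Otimes>\<^sub>M H2). f (zadd p (snd x) (zsmul p (int p ^ i) (fst x))) \<noteq> f (snd x) \<otimes> s0 (fst x)}"
  have Q: "Q \<in> sets (H2 \<Otimes>\<^sub>M H2)"
    unfolding Q_def
    by (intro levm_neq(1) levm_mult levm_compose[OF f shm] levm_compose[OF f measurable_snd] levm_compose[OF s0 measurable_fst])
  have Qs: "Pair \<tau> -` Q = bad f i \<tau> (s0 \<tau>)" if "\<tau> \<in> space H2" for \<tau>
    using that by (auto simp: Q_def bad_def space_pair_measure)
  define b where "b \<tau> = emeasure H2 (bad f i \<tau> (s0 \<tau>))" for \<tau>
  have bm: "b \<in> borel_measurable H2"
    using H.measurable_emeasure_Pair[OF Q] by (rule measurable_cong[THEN iffD1, rotated]) (simp add: b_def Qs)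
  \<comment> \<open>By Markov's inequality the \<open>\<tau>\<close> with error 8/100 or more have
    measure at most \<open>(1/50) / (8/100) = 1/4\<close>.\<close>
  define \<Gamma> where "\<Gamma> = {\<tau> \<in> space H2. \<not> 1 \<le> ennreal (100 / 8) * b \<tau>}"
  have G: "\<Gamma> \<in> sets H2" unfolding \<Gamma>_def using bm by measurable
  have Gm: "measure H2 \<Gamma> \<ge> 3 / 4"
  proof -
    have "emeasure H2 {\<tau> \<in> space H2. 1 \<le> ennreal (100 / 8) * b \<tau>} \<le>
        ennreal (100 / 8) * (\<integral>\<^sup>+\<tau>\<in>space H2. b \<tau> \<partial>H2)"
      by (rule nn_integral_Markov_inequality) (use bm in measurable)
    also have "(\<integral>\<^sup>+\<tau>\<in>space H2. b \<tau> \<partial>H2) = (\<integral>\<^sup>+\<tau>. b \<tau> \<partial>H2)" by (intro nn_integral_cong) simp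
    also have "ennreal (100 / 8) * (\<integral>\<^sup>+\<tau>. b \<tau> \<partial>H2) \<le> ennreal (100 / 8) * ennreal (1 / 50)"
      using int unfolding b_def by (intro mult_left_mono) auto
    also have "\<dots> = ennreal (1 / 4)" by (subst ennreal_mult[symmetric]) auto
    finally have "measure H2 {\<tau> \<in> space H2. 1 \<le> ennreal (100 / 8) * b \<tau>} \<le> 1 / 4"
      by (simp add: H.emeasure_eq_measure)
    moreover have "\<Gamma> = space H2 - {\<tau> \<in> space H2. 1 \<le> ennreal (100 / 8) * b \<tau>}" by (auto simp: \<Gamma>_def)
    moreover have "{\<tau> \<in> space H2. 1 \<le> ennreal (100 / 8) * b \<tau>} \<in> sets H2" using bm by measurable
    ultimately show ?thesis using H.prob_compl[of "{\<tau> \<in> space H2. 1 \<le> ennreal (100 / 8) * b \<tau>}"] by simp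
  qed
  have Gb: "measure H2 (bad f i \<tau> (s0 \<tau>)) < 8 / 100" if "\<tau> \<in> \<Gamma>" for \<tau>
  proof (rule ccontr)
    assume "\<not> ?thesis"
    then have "1 \<le> (100 / 8) * measure H2 (bad f i \<tau> (s0 \<tau>))" by simp
    then have "ennreal 1 \<le> ennreal ((100 / 8) * measure H2 (bad f i \<tau> (s0 \<tau>)))" by (rule ennreal_leI)
    moreover have "ennreal ((100 / 8) * measure H2 (bad f i \<tau> (s0 \<tau>))) = ennreal (100 / 8) * b \<tau>"
      unfolding b_def H.emeasure_eq_measure by (rule ennreal_mult) auto
    ultimately have "1 \<le> ennreal (100 / 8) * b \<tau>" by (simp only: ennreal_1)
    then show False using that by (simp add: \<Gamma>_def)
  qed
  \<comment> \<open>\<open>\<Gamma>\<close> and its reflection \<open>\<tau> - \<Gamma>\<close> both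
    fill more than half of the space, so \<open>\<tau>\<close> is a sum of two good elements, and
    their errors add up to less than 16/100.\<close>
  have ex: "\<exists>g. g \<in> carrier G \<and> measure H2 (bad f i \<tau> g) < 16 / 100" if t: "\<tau> \<in> zspace p" for \<tau>
  proof -
    let ?G' = "{\<sigma> \<in> space H2. zsub p \<tau> \<sigma> \<in> \<Gamma>}"
    have g: "{\<sigma> \<in> space H2. \<sigma> \<in> \<Gamma>} = \<Gamma>" by (auto simp: \<Gamma>_def)
    have m: "measure H2 ?G' = measure H2 \<Gamma>"
      using mpt_measure[OF mpt_zsub[OF p0 t], of "\<lambda>\<sigma>. \<sigma> \<in> \<Gamma>"] g G by simp
    have "?G' = (\<lambda>\<sigma>. zsub p \<tau> \<sigma>) -` \<Gamma> \<inter> space H2" by auto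
    then have G': "?G' \<in> sets H2" using measurable_sets[OF mpt_measurable[OF mpt_zsub[OF p0 t]] G] by simp
    have "measure H2 (space H2 - \<Gamma>) + measure H2 (space H2 - ?G') < 1"
      using H.prob_compl[OF G] H.prob_compl[OF G'] Gm m by simp
    then obtain \<sigma> where s: "\<sigma> \<in> zspace p" "\<sigma> \<notin> space H2 - \<Gamma>" "\<sigma> \<notin> space H2 - ?G'"
      using avoid_two[of "space H2 - \<Gamma>" "space H2 - ?G'"] G G' by blast
    then have s2: "\<sigma> \<in> \<Gamma>" "zsub p \<tau> \<sigma> \<in> \<Gamma>" by auto
    have z: "zsub p \<tau> \<sigma> \<in> zspace p" using t s p0 by simp
    have "measure H2 (bad f i (zadd p (zsub p \<tau> \<sigma>) \<sigma>) (s0 (zsub p \<tau> \<sigma>) \<otimes> s0 \<sigma>)) < 16 / 100"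
      using bad_comp[OF z s(1) s0c[OF z] s0c[OF s(1)]] Gb[OF s2(1)] Gb[OF s2(2)] by linarith
    then show ?thesis using zsub_zadd[OF t] s0c[OF z] s0c[OF s(1)] by auto
  qed
  define s where "s \<tau> = (SOME g. g \<in> carrier G \<and> measure H2 (bad f i \<tau> g) < 16 / 100)" for \<tau>
  have s: "s \<tau> \<in> carrier G" "measure H2 (bad f i \<tau> (s \<tau>)) < 16 / 100" if "\<tau> \<in> zspace p" for \<tau>
    using someI_ex[OF ex[OF that]] unfolding s_def by auto
  \<comment> \<open>The two candidates for the value have errors below 16/100 and 32/100; as these
    total less than 1, uniqueness applies.\<close>
  have hom: "s (zadd p \<tau> \<tau>') = s \<tau> \<otimes> s \<tau>'" if t: "\<tau> \<in> zspace p" "\<tau>' \<in> zspace p" for \<tau> \<tau>'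
  proof (rule bad_unique)
    show z: "zadd p \<tau> \<tau>' \<in> zspace p" using t p0 by simp
    show "measure H2 (bad f i (zadd p \<tau> \<tau>') (s (zadd p \<tau> \<tau>'))) + measure H2 (bad f i (zadd p \<tau> \<tau>') (s \<tau> \<otimes> s \<tau>')) < 1"
      using s[OF z] s[OF t(1)] s[OF t(2)] bad_comp[OF t s(1)[OF t(1)] s(1)[OF t(2)]] by linarith
  qed (use s t p0 in auto)
  have pow: "s (zsmul p (int n) \<tau>) = s \<tau> [^] n" if t: "\<tau> \<in> zspace p" for n \<tau>
  proof (induction n)
    case 0
    have z: "zsmul p (int 0) \<tau> \<in> zspace p" using t p0 by simp
    have "bad f i (zsmul p (int 0) \<tau>) \<one> = {}"
    proof -
      have "zadd p x (zsmul p (int p ^ i) (zsmul p (int 0) \<tau>)) = x" if "x \<in> zspace p" for x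
        using that by (intro ext) (simp add: zadd_def zsmul_def zred_def zspaceD(5))
      then show ?thesis using f_carrier by (auto simp: bad_def)
    qed
    then have "s (zsmul p (int 0) \<tau>) = \<one>" using s[OF z] by (intro bad_unique[OF z]) auto
    then show ?case by simp
  next
    case (Suc n)
    have "zsmul p (int (Suc n)) \<tau> = zadd p (zsmul p (int n) \<tau>) \<tau>"
      using zsmul_add[of p "int n" 1 \<tau>] zsmul_one[OF t] by (simp add: add.commute)
    then show ?case using Suc hom[of "zsmul p (int n) \<tau>" \<tau>] t p0 by simp
  qed
  \<comment> \<open>A translation by a deep multiple of \<open>p\<close> changes level
    \<open>L\<close> of \<open>f\<close> with probability at most 1/2. Since 1/2 + 16/100 is less
    than 1, some point avoids both exceptional sets, and there level \<open>L\<close> of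
    \<open>s\<close> is visibly trivial.\<close>
  have cont: "\<exists>l. \<forall>\<tau>\<in>zspace p. lev L (s (zsmul p (int (p ^ l)) \<tau>)) = lev L \<one>" for L
  proof -
    obtain l where l: "\<And>u. u \<in> zspace p \<Longrightarrow> u l = (\<lambda>_. 0) \<Longrightarrow>
        measure H2 {x \<in> space H2. lev L (f (zadd p x u)) \<noteq> lev L (f x)} \<le> 1 / 2"
      using level_continuity[of L] by blast
    have "lev L (s (zsmul p (int (p ^ l)) \<tau>)) = lev L \<one>" if t: "\<tau> \<in> zspace p" for \<tau>
    proof -
      let ?\<tau> = "zsmul p (int (p ^ l)) \<tau>"
      let ?u = "zsmul p (int p ^ i) ?\<tau>"
      have t': "?\<tau> \<in> zspace p" "?u \<in> zspace p" using t p0 by auto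
      have "?u l = (\<lambda>_. 0)" by (rule ext) (simp add: zsmul_def zred_def mod_simps)
      from l[OF t'(2) this]
      have "measure H2 {x \<in> space H2. lev L (f (zadd p x ?u)) \<noteq> lev L (f x)} + measure H2 (bad f i ?\<tau> (s ?\<tau>)) < 1"
        using s(2)[OF t'(1)] by linarith
      then obtain x where x: "x \<in> zspace p" "x \<notin> {x \<in> space H2. lev L (f (zadd p x ?u)) \<noteq> lev L (f x)}"
          "x \<notin> bad f i ?\<tau> (s ?\<tau>)"
        using avoid_two[OF levm_neq(2)[OF levm_f_shift[OF t'(2)] f] bad_sets[OF t'(1) s(1)[OF t'(1)]]] by blast
      then have "lev L (f x \<otimes> s ?\<tau>) = lev L (f x)" by (auto simp: bad_def)
      then have "lev L (inv (f x) \<otimes> (f x \<otimes> s ?\<tau>) \<otimes> \<one>) = lev L (inv (f x) \<otimes> f x \<otimes> \<one>)"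
        using f_carrier[OF x(1)] s(1)[OF t'(1)] by (intro lev_mult) auto
      then show ?thesis using f_carrier[OF x(1)] s(1)[OF t'(1)] by (simp flip: m_assoc)
    qed
    then show ?thesis by blast
  qed
  obtain l0 where l0: "\<And>\<tau>. \<tau> \<in> zspace p \<Longrightarrow> lev 0 (s (zsmul p (int (p ^ l0)) \<tau>)) = lev 0 \<one>"
    using cont[of 0] by blast
  \<comment> \<open>At every level \<open>L\<close> both a power of \<open>p\<close> and a power of
    \<open>q\<close> annihilate the value: the first by \<open>cont\<close>, the second by
    \<open>lev_torsion\<close>. These exponents are coprime, so the value itself is trivial.\<close>
  have triv: "s (zsmul p (int (p ^ l0)) \<tau>) = \<one>" if t: "\<tau> \<in> zspace p" for \<tau>
  proof (rule lev_sep)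
    let ?\<tau> = "zsmul p (int (p ^ l0)) \<tau>" and ?g = "s (zsmul p (int (p ^ l0)) \<tau>)"
    have t': "?\<tau> \<in> zspace p" using t p0 by auto
    show g: "?g \<in> carrier G" by (rule s(1)[OF t'])
    fix L
    obtain l where "\<And>\<tau>. \<tau> \<in> zspace p \<Longrightarrow> lev L (s (zsmul p (int (p ^ l)) \<tau>)) = lev L \<one>"
      using cont[of L] by blast
    from this[OF t'] have P: "lev L (?g [^] (p ^ l)) = lev L \<one>" by (simp only: pow[OF t'])
    obtain e where E: "lev L (?g [^] (q ^ e)) = lev L \<one>" using lev_torsion[OF g l0[OF t]] by blast
    have "coprime (p ^ l) (q ^ e)" using primes_coprime[OF prime_p prime_q pq] by simp
    then obtain a c where ac: "p ^ l * a = q ^ e * c + 1"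
      using bezout_nat[of "p ^ l" "q ^ e"] p0 by auto
    have "?g [^] (p ^ l * a) = ?g [^] (q ^ e * c) \<otimes> ?g" unfolding ac using g by simp
    then have "lev L (?g [^] (q ^ e * c) \<otimes> ?g) = lev L \<one>"
      using lev_pow_one[OF _ P, of a] g by (simp add: nat_pow_pow)
    moreover have "lev L (?g [^] (q ^ e * c) \<otimes> ?g) = lev L (\<one> \<otimes> ?g)"
      using lev_pow_one[OF _ E, of c] g by (intro lev_cong_mult) (auto simp: nat_pow_pow)
    ultimately show "lev L ?g = lev L \<one>" using g by simp
  qed simp
  \<comment> \<open>Every section over a fixed \<open>\<tau>\<close> has measure at least 84/100, so
    some section over a fixed \<open>x\<close> has positive measure.\<close>
  define W where "W = {x \<in> space (H2 \<Otimes>\<^sub>M H2). f (zadd p (snd x) (zsmul p (int p ^ (i + l0)) (fst x))) = f (snd x)}"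
  have W: "W \<in> sets (H2 \<Otimes>\<^sub>M H2)"
    unfolding W_def by (intro levm_eq levm_compose[OF f shm] levm_compose[OF f measurable_snd])
  have Wt: "emeasure H2 (Pair \<tau> -` W) \<ge> ennreal (84 / 100)" if t: "\<tau> \<in> space H2" for \<tau>
  proof -
    let ?\<tau> = "zsmul p (int (p ^ l0)) \<tau>"
    have t': "\<tau> \<in> zspace p" "?\<tau> \<in> zspace p" using t p0 by auto
    have "zsmul p (int p ^ (i + l0)) \<tau> = zsmul p (int p ^ i) ?\<tau>"
      by (simp add: zsmul_zsmul power_add)
    then have "Pair \<tau> -` W = space H2 - bad f i ?\<tau> \<one>"
      using t f_carrier by (auto simp: W_def bad_def space_pair_measure)
    moreover have "measure H2 (space H2 - bad f i ?\<tau> \<one>) \<ge> 84 / 100"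
      using s(2)[OF t'(2)] triv[OF t'(1)] H.prob_compl[OF bad_sets[OF t'(2) one_closed]] by simp
    ultimately show ?thesis by (simp add: H.emeasure_eq_measure ennreal_leI)
  qed
  interpret P: pair_sigma_finite H2 H2 ..
  have "ennreal (84 / 100) = (\<integral>\<^sup>+\<tau>. ennreal (84 / 100) \<partial>H2)"
    using H.emeasure_space_1 by simp
  also have "\<dots> \<le> (\<integral>\<^sup>+\<tau>. emeasure H2 (Pair \<tau> -` W) \<partial>H2)" by (rule nn_integral_mono) (rule Wt)
  also have "\<dots> = emeasure (H2 \<Otimes>\<^sub>M H2) W" by (rule H.emeasure_pair_measure_alt[OF W, symmetric])
  also have "\<dots> = (\<integral>\<^sup>+x. emeasure H2 ((\<lambda>\<tau>. (\<tau>, x)) -` W) \<partial>H2)" by (rule P.emeasure_pair_measure_alt2[OF W])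
  finally have pos: "(\<integral>\<^sup>+x. emeasure H2 ((\<lambda>\<tau>. (\<tau>, x)) -` W) \<partial>H2) > 0"
    by (rule less_le_trans[rotated]) simp
  have "\<exists>x\<in>space H2. emeasure H2 ((\<lambda>\<tau>. (\<tau>, x)) -` W) \<noteq> 0"
  proof (rule ccontr)
    assume "\<not> ?thesis"
    then have "(\<integral>\<^sup>+x. emeasure H2 ((\<lambda>\<tau>. (\<tau>, x)) -` W) \<partial>H2) = (\<integral>\<^sup>+x. 0 \<partial>H2)" by (intro nn_integral_cong) simp
    then show False using pos by simp
  qed
  then obtain x where x: "x \<in> zspace p" "emeasure H2 ((\<lambda>\<tau>. (\<tau>, x)) -` W) \<noteq> 0" by auto
  have sub: "(\<lambda>\<tau>. (\<tau>, x)) -` W \<subseteq> zspace p" by (auto simp: W_def space_pair_measure)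
  have unc: "uncountable ((\<lambda>\<tau>. (\<tau>, x)) -` W)"
  proof
    assume "countable ((\<lambda>\<tau>. (\<tau>, x)) -` W)"
    from haar_countable_null[OF _ this sub] show False using x(2) p1 by auto
  qed
  have inj: "inj_on (\<lambda>\<tau>. zadd p x (zsmul p (int p ^ (i + l0)) \<tau>)) ((\<lambda>\<tau>. (\<tau>, x)) -` W)"
  proof (rule inj_onI)
    fix \<tau> \<sigma> assume a: "\<tau> \<in> (\<lambda>\<tau>. (\<tau>, x)) -` W" "\<sigma> \<in> (\<lambda>\<tau>. (\<tau>, x)) -` W"
      "zadd p x (zsmul p (int p ^ (i + l0)) \<tau>) = zadd p x (zsmul p (int p ^ (i + l0)) \<sigma>)"
    have z: "\<tau> \<in> zspace p" "\<sigma> \<in> zspace p" using a sub by auto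
    have "zsmul p (int p ^ (i + l0)) \<tau> = zsmul p (int p ^ (i + l0)) \<sigma>"
      using a(3) zadd_zsub[of "zsmul p (int p ^ (i + l0)) \<tau>" p x] zadd_zsub[of "zsmul p (int p ^ (i + l0)) \<sigma>" p x] z p0
      by (metis zadd_commute zsmul_in)
    then show "\<tau> = \<sigma>" by (rule zsmul_power_inj[OF p0 z])
  qed
  have "(\<lambda>\<tau>. zadd p x (zsmul p (int p ^ (i + l0)) \<tau>)) ` ((\<lambda>\<tau>. (\<tau>, x)) -` W) \<subseteq> {t \<in> zspace p. f t = f x}"
    using x(1) p0 by (auto simp: W_def space_pair_measure)
  from countable_subset[OF this] countable_image_inj_on[OF _ inj] unc
  have "uncountable {t \<in> zspace p. f t = f x}" by iprover
  then show ?thesis using x(1) by blast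
qed

end

text \<open>Averaging \<open>D_rigid\<close> over all displacements selects a reference point
  \<open>\<omega> = (k, t)\<close> whose increments agree with those at most points of the fibre
  over \<open>k\<close>. That is the hypothesis of \<open>approx_hom_fibre\<close> for
  \<open>F\<close> on this fibre.\<close>

theorem uncountable_fibre:
  "\<exists>k\<in>zspace p. \<exists>x\<in>zspace p. uncountable {t \<in> zspace p. F (k, t) = F (k, x)}"
proof -
  obtain i where i: "\<And>u w. u \<in> zspace p \<Longrightarrow> u i = (\<lambda>_. 0) \<Longrightarrow> w \<in> zspace p \<Longrightarrow>
      measure (Omega p) {\<omega> \<in> space (Omega p). D u (transl p w \<omega>) \<noteq> D u \<omega>} \<le> 1 / 100"
    using D_rigid by blast
  define u where "u \<tau> = zsmul p (int p ^ i) \<tau>" for \<tau> :: "nat \<Rightarrow> bool \<Rightarrow> int"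
  have u: "u \<tau> \<in> zspace p" "u \<tau> i = (\<lambda>_. 0)" if "\<tau> \<in> zspace p" for \<tau>
    using that p0 by (auto simp: u_def zsmul_def zred_def fun_eq_iff intro!: zsmul_in[unfolded zsmul_def zred_def])
  let ?R = "H2 \<Otimes>\<^sub>M H2"
  let ?B = "Omega p \<Otimes>\<^sub>M ?R"
  interpret R: pair_prob_space H2 H2 ..
  interpret B: pair_prob_space "Omega p" ?R ..
  define X where "X y = D (u (fst (snd y))) (fst (fst y), snd (snd y))" for y :: "omega \<times> (nat \<Rightarrow> bool \<Rightarrow> int) \<times> (nat \<Rightarrow> bool \<Rightarrow> int)"
  define X' where "X' y = D (u (fst (snd y))) (transl p (snd (snd y)) (fst y))" for y :: "omega \<times> (nat \<Rightarrow> bool \<Rightarrow> int) \<times> (nat \<Rightarrow> bool \<Rightarrow> int)"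
  define Z where "Z y = D (u (fst (snd y))) (fst y)" for y :: "omega \<times> (nat \<Rightarrow> bool \<Rightarrow> int) \<times> (nat \<Rightarrow> bool \<Rightarrow> int)"
  have um: "(\<lambda>y. u (fst (snd y))) \<in> ?B \<rightarrow>\<^sub>M H2"
    unfolding u_def by (rule measurable_zsmul[OF p0]) measurable
  have DB: "levm ?B (\<lambda>y. D (u (fst (snd y))) (W y))" if W: "W \<in> ?B \<rightarrow>\<^sub>M Omega p" for W
  proof -
    have "(\<lambda>y. tr p (u (fst (snd y))) (W y)) = (\<lambda>y. (fst (W y), zadd p (snd (W y)) (u (fst (snd y)))))"
      by (simp add: tr_def case_prod_unfold)
    moreover have "\<dots> \<in> ?B \<rightarrow>\<^sub>M Omega p"
      by (intro measurable_Pair measurable_zadd[OF p0 _ um] measurable_compose[OF W] measurable_fst measurable_snd)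
    ultimately show ?thesis
      unfolding D_def by (intro levm_mult levm_inv levm_compose[OF levm_F]) (use W in auto)
  qed
  have Xm: "levm ?B X" unfolding X_def by (rule DB) measurable
  have Zm: "levm ?B Z" unfolding Z_def by (rule DB) measurable
  have X'm: "levm ?B X'"
  proof -
    have "(\<lambda>y. (fst (fst y), snd (snd y))) \<in> ?B \<rightarrow>\<^sub>M haar p \<Otimes>\<^sub>M haar p" by measurable
    from measurable_compose[OF this disp_measurable2[OF p1]]
    have "(\<lambda>y. disp p (snd (snd y)) (fst (fst y))) \<in> ?B \<rightarrow>\<^sub>M haar p" by simp
    then have "(\<lambda>y. (fst (fst y), zadd p (snd (fst y)) (disp p (snd (snd y)) (fst (fst y))))) \<in> ?B \<rightarrow>\<^sub>M Omega p"
      by (intro measurable_Pair measurable_zadd[OF p0]) measurable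
    then show ?thesis unfolding X'_def by (intro DB) (simp add: transl_def case_prod_unfold)
  qed
  define g where "g y = (indicator {y \<in> space ?B. X y \<noteq> Z y} y :: ennreal)" for y
  define g' where "g' y = (indicator {y \<in> space ?B. X' y \<noteq> Z y} y :: ennreal)" for y
  have gm: "g \<in> borel_measurable ?B" "g' \<in> borel_measurable ?B"
    unfolding g_def g'_def using levm_neq(1)[OF Xm Zm] levm_neq(1)[OF X'm Zm] by measurable
  \<comment> \<open>\<open>transl p v \<omega>\<close> has second coordinate
    \<open>t + disp p v k\<close>, which is Haar distributed in \<open>v\<close> by
    \<open>mpt_disp\<close>. Averaging over \<open>v\<close> is thus averaging over the fibre of
    \<open>\<omega>\<close>.\<close>
  have eq: "(\<integral>\<^sup>+\<tau>. \<integral>\<^sup>+x. g (\<omega>, \<tau>, x) \<partial>H2 \<partial>H2) = (\<integral>\<^sup>+y. g' (\<omega>, y) \<partial>?R)" if w: "\<omega> \<in> space (Omega p)" for \<omega>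
  proof -
    have ks: "fst \<omega> \<in> zspace p" "snd \<omega> \<in> zspace p" using w by (auto simp: space_Omega)
    have "(\<integral>\<^sup>+y. g' (\<omega>, y) \<partial>?R) = (\<integral>\<^sup>+\<tau>. \<integral>\<^sup>+v. g' (\<omega>, \<tau>, v) \<partial>H2 \<partial>H2)"
      by (rule H.nn_integral_fst[symmetric]) (rule measurable_compose[OF measurable_Pair1'[OF w] gm(2)])
    also have "\<dots> = (\<integral>\<^sup>+\<tau>. \<integral>\<^sup>+x. g (\<omega>, \<tau>, x) \<partial>H2 \<partial>H2)"
    proof (rule nn_integral_cong)
      fix \<tau> assume t: "\<tau> \<in> space H2"
      have m: "mpt H2 (\<lambda>v. zadd p (disp p v (fst \<omega>)) (snd \<omega>))"
        by (rule mpt_comp[OF mpt_zadd[OF p0 ks(2)] mpt_disp[OF p1 ks(1)]])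
      have "(\<lambda>x. g (\<omega>, \<tau>, x)) \<in> borel_measurable H2"
        using w t by (intro measurable_compose[OF _ gm(1)]) simp
      from mpt_nn_integral[OF m this]
      have "(\<integral>\<^sup>+x. g (\<omega>, \<tau>, x) \<partial>H2) = (\<integral>\<^sup>+v. g (\<omega>, \<tau>, zadd p (disp p v (fst \<omega>)) (snd \<omega>)) \<partial>H2)" by simp
      also have "\<dots> = (\<integral>\<^sup>+v. g' (\<omega>, \<tau>, v) \<partial>H2)"
      proof (rule nn_integral_cong)
        fix v assume v: "v \<in> space H2"
        have "zadd p (disp p v (fst \<omega>)) (snd \<omega>) \<in> zspace p"
          using zadd_in[OF p0 disp_in[OF p1 ks(1)] ks(2)] v by simp
        then show "g (\<omega>, \<tau>, zadd p (disp p v (fst \<omega>)) (snd \<omega>)) = g' (\<omega>, \<tau>, v)"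
          using w t v by (simp add: g_def g'_def X_def X'_def Z_def transl_def case_prod_unfold zadd_commute
              indicator_def space_pair_measure[of "Omega p"] space_pair_measure[of H2])
      qed
      finally show "(\<integral>\<^sup>+v. g' (\<omega>, \<tau>, v) \<partial>H2) = (\<integral>\<^sup>+x. g (\<omega>, \<tau>, x) \<partial>H2)" ..
    qed
    finally show ?thesis ..
  qed
  have "(\<integral>\<^sup>+\<omega>. \<integral>\<^sup>+\<tau>. \<integral>\<^sup>+x. g (\<omega>, \<tau>, x) \<partial>H2 \<partial>H2 \<partial>Omega p) = (\<integral>\<^sup>+\<omega>. \<integral>\<^sup>+y. g' (\<omega>, y) \<partial>?R \<partial>Omega p)"
    by (rule nn_integral_cong) (rule eq)
  also have "\<dots> = (\<integral>\<^sup>+y. \<integral>\<^sup>+\<omega>. g' (\<omega>, y) \<partial>Omega p \<partial>?R)"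
    by (rule B.Fubini[symmetric]) (rule gm(2))
  also have "\<dots> \<le> (\<integral>\<^sup>+y. ennreal (1 / 100) \<partial>?R)"
  proof (rule nn_integral_mono)
    fix y assume y: "y \<in> space ?R"
    then have y': "fst y \<in> zspace p" "snd y \<in> zspace p" by (auto simp: space_pair_measure)
    let ?S = "{\<omega> \<in> space (Omega p). D (u (fst y)) (transl p (snd y) \<omega>) \<noteq> D (u (fst y)) \<omega>}"
    have "(\<integral>\<^sup>+\<omega>. g' (\<omega>, y) \<partial>Omega p) = (\<integral>\<^sup>+\<omega>. indicator ?S \<omega> \<partial>Omega p)"
      using y by (intro nn_integral_cong) (simp add: g'_def X'_def Z_def indicator_def space_pair_measure[of "Omega p"])
    also have "\<dots> = emeasure (Omega p) ?S"
      by (rule nn_integral_indicator,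
          rule levm_neq(1)[OF levm_compose[OF levm_D[OF u(1)[OF y'(1)]] mpt_measurable[OF mpt_transl'[OF y'(2)]]] levm_D[OF u(1)[OF y'(1)]]])
    also have "\<dots> \<le> ennreal (1 / 100)"
      using i[OF u[OF y'(1)] y'(2)] by (simp only: O.emeasure_eq_measure ennreal_leI)
    finally show "(\<integral>\<^sup>+\<omega>. g' (\<omega>, y) \<partial>Omega p) \<le> ennreal (1 / 100)" .
  qed
  also have "\<dots> = ennreal (1 / 100)" using R.emeasure_space_1 by simp
  finally have tot: "(\<integral>\<^sup>+\<omega>. \<integral>\<^sup>+\<tau>. \<integral>\<^sup>+x. g (\<omega>, \<tau>, x) \<partial>H2 \<partial>H2 \<partial>Omega p) \<le> ennreal (1 / 100)" .
  \<comment> \<open>The total is at most 1/100, so the integrand cannot exceed the doubled value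
    1/50 everywhere.\<close>
  have "\<exists>\<omega>\<in>space (Omega p). (\<integral>\<^sup>+\<tau>. \<integral>\<^sup>+x. g (\<omega>, \<tau>, x) \<partial>H2 \<partial>H2) \<le> ennreal (1 / 50)"
  proof (rule ccontr)
    assume "\<not> ?thesis"
    then have "(\<integral>\<^sup>+\<omega>. ennreal (1 / 50) \<partial>Omega p) \<le> (\<integral>\<^sup>+\<omega>. \<integral>\<^sup>+\<tau>. \<integral>\<^sup>+x. g (\<omega>, \<tau>, x) \<partial>H2 \<partial>H2 \<partial>Omega p)"
      by (intro nn_integral_mono) (auto simp: not_le intro: less_imp_le)
    moreover have "(\<integral>\<^sup>+\<omega>. ennreal (1 / 50) \<partial>Omega p) = ennreal (1 / 50)"
      using O.emeasure_space_1 by simp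
    ultimately have "ennreal (1 / 50) \<le> ennreal (1 / 100)"
      using tot by (simp only: order_trans[OF _ tot])
    then show False by (simp add: ennreal_le_iff)
  qed
  then obtain \<omega> where w: "\<omega> \<in> space (Omega p)" "(\<integral>\<^sup>+\<tau>. \<integral>\<^sup>+x. g (\<omega>, \<tau>, x) \<partial>H2 \<partial>H2) \<le> ennreal (1 / 50)" by blast
  define k t where "k = fst \<omega>" and "t = snd \<omega>"
  have kt: "k \<in> zspace p" "t \<in> zspace p" "\<omega> = (k, t)" using w by (auto simp: space_Omega k_def t_def)
  define f where "f x = F (k, x)" for x
  have f: "levm H2 f"
    unfolding f_def by (rule levm_compose[OF levm_F]) (use kt in simp)
  \<comment> \<open>This is the increment \<open>D (u \<tau>) \<omega>\<close> at the reference
    point.\<close>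
  define s0 where "s0 \<tau> = inv (f t) \<otimes> f (zadd p t (u \<tau>))" for \<tau>
  have s0: "levm H2 s0"
    unfolding s0_def
  proof (intro levm_mult levm_const inv_closed)
    show "f t \<in> carrier G" using levm_carrier[OF f] kt by simp
    show "levm H2 (\<lambda>\<tau>. f (zadd p t (u \<tau>)))"
      unfolding u_def by (rule levm_compose[OF f], rule measurable_zadd[OF p0 measurable_const measurable_zsmul[OF p0]])
        (use kt in auto)
  qed
  have "(\<integral>\<^sup>+\<tau>. emeasure H2 (bad f i \<tau> (s0 \<tau>)) \<partial>H2) = (\<integral>\<^sup>+\<tau>. \<integral>\<^sup>+x. g (\<omega>, \<tau>, x) \<partial>H2 \<partial>H2)"
  proof (rule nn_integral_cong)
    fix \<tau> assume t: "\<tau> \<in> space H2"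
    then have sc: "s0 \<tau> \<in> carrier G" using levm_carrier[OF s0] by simp
    have "(\<integral>\<^sup>+x. g (\<omega>, \<tau>, x) \<partial>H2) = (\<integral>\<^sup>+x. indicator (bad f i \<tau> (s0 \<tau>)) x \<partial>H2)"
    proof (rule nn_integral_cong)
      fix x assume x: "x \<in> space H2"
      define a b where "a = f x" and "b = f (zadd p x (u \<tau>))"
      have ab: "a \<in> carrier G" "b \<in> carrier G"
        using x t p0 u(1)[of \<tau>] levm_carrier[OF f] by (auto simp: a_def b_def)
      have "D (u \<tau>) (k, x) = inv a \<otimes> b" "D (u \<tau>) \<omega> = s0 \<tau>"
        by (simp_all add: D_def a_def b_def f_def s0_def tr_def kt)
      moreover have "inv a \<otimes> b = s0 \<tau> \<longleftrightarrow> b = a \<otimes> s0 \<tau>"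
        using ab sc by (metis inv_solve_left inv_closed m_closed)
      ultimately show "g (\<omega>, \<tau>, x) = indicator (bad f i \<tau> (s0 \<tau>)) x"
        using x t w(1) by (simp add: g_def X_def Z_def indicator_def bad_def a_def b_def u_def k_def[symmetric]
            space_pair_measure[of "Omega p"] space_pair_measure[of H2])
    qed
    also have "\<dots> = emeasure H2 (bad f i \<tau> (s0 \<tau>))"
      by (rule nn_integral_indicator[OF bad_sets[OF f _ sc]]) (use t in simp)
    finally show "emeasure H2 (bad f i \<tau> (s0 \<tau>)) = (\<integral>\<^sup>+x. g (\<omega>, \<tau>, x) \<partial>H2)" ..
  qed
  then have "\<exists>x\<in>zspace p. uncountable {t \<in> zspace p. f t = f x}"
    using w(2) by (intro approx_hom_fibre[OF f s0, of i]) simp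
  then show ?thesis using kt unfolding f_def by blast
qed

end

section \<open>Special linear groups\<close>

definition mcong :: "int \<Rightarrow> nat \<Rightarrow> int mat \<Rightarrow> int mat \<Rightarrow> bool" where
  "mcong N n A B \<longleftrightarrow> (\<forall>i<n. \<forall>j<n. [A $$ (i, j) = B $$ (i, j)] (mod N))"

lemma mcong_refl: "mcong N n A A" by (simp add: mcong_def)

lemma mcong_sym: "mcong N n A B \<Longrightarrow> mcong N n B A" by (simp add: mcong_def cong_sym_eq)

lemma mcong_trans [trans]: "mcong N n A B \<Longrightarrow> mcong N n B C \<Longrightarrow> mcong N n A C"
  unfolding mcong_def by (blast intro: cong_trans)

lemma mcong_det:
  assumes "mcong N n A B" "A \<in> carrier_mat n n" "B \<in> carrier_mat n n"
  shows "[det A = det B] (mod N)"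
  unfolding det_def'[OF assms(2)] det_def'[OF assms(3)]
proof (rule cong_sum)
  fix \<sigma> assume "\<sigma> \<in> {\<sigma>. \<sigma> permutes {0..<n}}"
  then have "\<sigma> i < n" if "i < n" for i using that permutes_in_image[of \<sigma> "{0..<n}" i] by simp
  then show "[signof \<sigma> * (\<Prod>i = 0..<n. A $$ (i, \<sigma> i)) = signof \<sigma> * (\<Prod>i = 0..<n. B $$ (i, \<sigma> i))] (mod N)"
    using assms(1) by (intro cong_scalar_left cong_prod) (auto simp: mcong_def)
qed

lemma mult_mat_index:
  fixes A B :: "int mat"
  assumes "A \<in> carrier_mat n n" "B \<in> carrier_mat n n" "i < n" "j < n"
  shows "(A * B) $$ (i, j) = (\<Sum>l = 0..<n. A $$ (i, l) * B $$ (l, j))"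
  using assms by (simp add: scalar_prod_def)

lemma mcong_mult:
  assumes "mcong N n A A'" "mcong N n B B'"
    "A \<in> carrier_mat n n" "A' \<in> carrier_mat n n" "B \<in> carrier_mat n n" "B' \<in> carrier_mat n n"
  shows "mcong N n (A * B) (A' * B')"
  unfolding mcong_def
proof (intro allI impI)
  fix i j assume "i < n" "j < n"
  then show "[(A * B) $$ (i, j) = (A' * B') $$ (i, j)] (mod N)"
    unfolding mult_mat_index[OF assms(3,5) \<open>i < n\<close> \<open>j < n\<close>] mult_mat_index[OF assms(4,6) \<open>i < n\<close> \<open>j < n\<close>]
    by (intro cong_sum cong_mult) (use assms(1,2) in \<open>auto simp: mcong_def\<close>)
qed

lemma mcong_adj_mat:
  assumes "mcong N n A B" and A: "A \<in> carrier_mat n n" and B: "B \<in> carrier_mat n n"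
  shows "mcong N n (adj_mat A) (adj_mat B)"
  unfolding mcong_def
proof (intro allI impI)
  fix i j assume ij: "i < n" "j < n"
  have "[det (mat_delete A j i) = det (mat_delete B j i)] (mod N)"
  proof (rule mcong_det)
    show "mcong N (n - 1) (mat_delete A j i) (mat_delete B j i)"
      using assms by (auto simp: mcong_def mat_delete_def)
  qed (use A B in \<open>auto intro: mat_delete_carrier\<close>)
  then show "[adj_mat A $$ (i, j) = adj_mat B $$ (i, j)] (mod N)"
    using ij A B by (auto simp: adj_mat_def cofactor_def intro!: cong_scalar_left)
qed

lemma mat_carrier_in: "A \<in> mat_carrier n R \<Longrightarrow> i < n \<Longrightarrow> j < n \<Longrightarrow> A (i, j) \<in> carrier R"
  by (auto simp: mat_carrier_def)

text \<open>This covers \<open>\<int>\<close> (all moduli \<open>0\<close>) and \<open>\<int>\<^sub>p\<close> (moduli \<open>p ^ k\<close>), and reduces matrices over either ring to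
  integer matrices up to congruence.\<close>

locale lev_ring = cring R for R :: "('a, 'b) ring_scheme" (structure) +
  fixes ev :: "nat \<Rightarrow> 'a \<Rightarrow> int" and md :: "nat \<Rightarrow> int"
  assumes ev_add: "a \<in> carrier R \<Longrightarrow> b \<in> carrier R \<Longrightarrow> [ev k (a \<oplus> b) = ev k a + ev k b] (mod md k)"
    and ev_mult: "a \<in> carrier R \<Longrightarrow> b \<in> carrier R \<Longrightarrow> [ev k (a \<otimes> b) = ev k a * ev k b] (mod md k)"
    and ev_one: "[ev k \<one> = 1] (mod md k)"
    and ev_inj: "a \<in> carrier R \<Longrightarrow> b \<in> carrier R \<Longrightarrow> (\<And>k. [ev k a = ev k b] (mod md k)) \<Longrightarrow> a = b"
    and ev_coh: "a \<in> carrier R \<Longrightarrow> [ev (Suc k) a = ev k a] (mod md k)"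
    and ev_lift: "(\<And>k. [c (Suc k) = c k] (mod md k)) \<Longrightarrow> \<exists>a\<in>carrier R. \<forall>k. [ev k a = c k] (mod md k)"
begin

lemma ev_zero: "[ev k \<zero> = 0] (mod md k)"
proof -
  have "[ev k (\<zero> \<oplus> \<zero>) = ev k \<zero> + ev k \<zero>] (mod md k)" by (rule ev_add) auto
  then have "[ev k \<zero> + 0 = ev k \<zero> + ev k \<zero>] (mod md k)" by simp
  then show ?thesis by (metis cong_add_lcancel cong_sym)
qed

lemma ev_minus:
  assumes "a \<in> carrier R"
  shows "[ev k (\<ominus> a) = - ev k a] (mod md k)"
proof -
  have "[ev k (\<ominus> a \<oplus> a) = ev k (\<ominus> a) + ev k a] (mod md k)" by (rule ev_add) (use assms in auto)
  then have "[ev k (\<ominus> a) + ev k a = 0] (mod md k)" using ev_zero assms by (metis cong_sym cong_trans l_neg)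
  then have "[ev k (\<ominus> a) + ev k a = - ev k a + ev k a] (mod md k)" by simp
  then show ?thesis by (simp only: cong_add_rcancel)
qed

lemma ev_finsum:
  assumes "finite S" "\<And>i. i \<in> S \<Longrightarrow> f i \<in> carrier R"
  shows "[ev k (\<Oplus>i\<in>S. f i) = (\<Sum>i\<in>S. ev k (f i))] (mod md k)"
  using assms
proof (induction S)
  case empty
  then show ?case using ev_zero by simp
next
  case (insert x S)
  have "[ev k (f x \<oplus> (\<Oplus>i\<in>S. f i)) = ev k (f x) + ev k (\<Oplus>i\<in>S. f i)] (mod md k)"
    using insert by (intro ev_add finsum_closed) auto
  also have "[ev k (f x) + ev k (\<Oplus>i\<in>S. f i) = ev k (f x) + (\<Sum>i\<in>S. ev k (f i))] (mod md k)"
    using insert by (intro cong_add cong_refl) auto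
  finally show ?case using insert by (simp add: finsum_insert Pi_def)
qed

lemma ev_finprod:
  assumes "finite S" "\<And>i. i \<in> S \<Longrightarrow> f i \<in> carrier R"
  shows "[ev k (\<Otimes>i\<in>S. f i) = (\<Prod>i\<in>S. ev k (f i))] (mod md k)"
  using assms
proof (induction S)
  case empty
  then show ?case using ev_one by simp
next
  case (insert x S)
  have "[ev k (f x \<otimes> (\<Otimes>i\<in>S. f i)) = ev k (f x) * ev k (\<Otimes>i\<in>S. f i)] (mod md k)"
    using insert by (intro ev_mult finprod_closed) auto
  also have "[ev k (f x) * ev k (\<Otimes>i\<in>S. f i) = ev k (f x) * (\<Prod>i\<in>S. ev k (f i))] (mod md k)"
    using insert by (intro cong_mult cong_refl) auto
  finally show ?case using insert by (simp add: finprod_insert Pi_def)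
qed

lemma sign_pow:
  assumes a: "a \<in> carrier R"
  shows "add_pow R (sign \<sigma> :: int) a \<in> carrier R" "[ev k (add_pow R (sign \<sigma> :: int) a) = signof \<sigma> * ev k a] (mod md k)"
proof -
  have 1: "add_pow R (1 :: int) a = a" using a by (simp add: add_pow_int_ge)
  have 2: "add_pow R (- 1 :: int) a = \<ominus> a" using a by (simp add: add_pow_int_lt)
  show "add_pow R (sign \<sigma> :: int) a \<in> carrier R" using a 1 2 by (auto simp: sign_def)
  show "[ev k (add_pow R (sign \<sigma> :: int) a) = signof \<sigma> * ev k a] (mod md k)"
    using a 1 2 ev_minus[OF a, of k] by (auto simp: sign_def)
qed

definition lm :: "nat \<Rightarrow> nat \<Rightarrow> (nat \<times> nat \<Rightarrow> 'a) \<Rightarrow> int mat" where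
  "lm n k A = mat n n (\<lambda>ij. ev k (A ij))"

lemma lm_carrier [simp]: "lm n k A \<in> carrier_mat n n" by (simp add: lm_def)

lemma lm_mult_carrier [simp]: "lm n k A * lm n k B \<in> carrier_mat n n"
  by (rule mult_carrier_mat[OF lm_carrier lm_carrier])

lemma lm_index: "i < n \<Longrightarrow> j < n \<Longrightarrow> lm n k A $$ (i, j) = ev k (A (i, j))" by (simp add: lm_def)

lemma mat_eqI:
  assumes "A \<in> mat_carrier n R" "B \<in> mat_carrier n R" "\<And>k. mcong (md k) n (lm n k A) (lm n k B)"
  shows "A = B"
proof (rule PiE_ext[of A "{..<n} \<times> {..<n}" "\<lambda>_. carrier R"])
  fix x assume x: "x \<in> {..<n} \<times> {..<n}"
  obtain i j where ij: "x = (i, j)" "i < n" "j < n" using x by auto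
  show "A x = B x"
    by (rule ev_inj) (use assms ij in \<open>auto simp: mcong_def lm_index mat_carrier_in\<close>)
qed (use assms in \<open>auto simp: mat_carrier_def\<close>)

lemma mat_mult_carrier: "A \<in> mat_carrier n R \<Longrightarrow> B \<in> mat_carrier n R \<Longrightarrow> mat_mult n R A B \<in> mat_carrier n R"
  by (auto simp: mat_carrier_def mat_mult_def intro!: finsum_closed)

lemma lm_mult:
  assumes "A \<in> mat_carrier n R" "B \<in> mat_carrier n R"
  shows "mcong (md k) n (lm n k (mat_mult n R A B)) (lm n k A * lm n k B)"
  unfolding mcong_def
proof (intro allI impI)
  fix i j assume ij: "i < n" "j < n"
  have "[ev k (\<Oplus>l\<in>{..<n}. A (i, l) \<otimes> B (l, j)) = (\<Sum>l<n. ev k (A (i, l) \<otimes> B (l, j)))] (mod md k)"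
    by (rule ev_finsum) (use assms ij in \<open>auto intro!: m_closed mat_carrier_in\<close>)
  also have "[(\<Sum>l<n. ev k (A (i, l) \<otimes> B (l, j))) = (\<Sum>l<n. ev k (A (i, l)) * ev k (B (l, j)))] (mod md k)"
    by (intro cong_sum ev_mult) (use assms ij in \<open>auto intro!: mat_carrier_in\<close>)
  also have "(\<Sum>l<n. ev k (A (i, l)) * ev k (B (l, j))) = (lm n k A * lm n k B) $$ (i, j)"
    using ij by (auto simp: lm_def scalar_prod_def lessThan_atLeast0 intro!: sum.cong)
  finally show "[lm n k (mat_mult n R A B) $$ (i, j) = (lm n k A * lm n k B) $$ (i, j)] (mod md k)"
    using ij by (simp add: lm_index mat_mult_def)
qed

lemma mat_one_carrier: "mat_one n R \<in> mat_carrier n R"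
  by (auto simp: mat_carrier_def mat_one_def)

lemma lm_one: "mcong (md k) n (lm n k (mat_one n R)) (1\<^sub>m n)"
  using ev_one ev_zero by (auto simp: mcong_def lm_def mat_one_def)

lemma mat_det_carrier:
  assumes "A \<in> mat_carrier n R"
  shows "mat_det n R A \<in> carrier R"
  unfolding mat_det_def
proof (intro finsum_closed Pi_I sign_pow finprod_closed mat_carrier_in[OF assms])
  fix \<sigma> i assume "\<sigma> \<in> {\<sigma>. \<sigma> permutes {..<n}}" "i \<in> {..<n}"
  then show "i < n" "\<sigma> i < n" using permutes_in_image[of \<sigma> "{..<n}" i] by auto
qed

lemma ev_det:
  assumes A: "A \<in> mat_carrier n R"
  shows "[ev k (mat_det n R A) = det (lm n k A)] (mod md k)"
proof -
  have Ac: "(\<Otimes>i\<in>{..<n}. A (i, \<sigma> i)) \<in> carrier R" "\<And>i. i < n \<Longrightarrow> A (i, \<sigma> i) \<in> carrier R" "\<And>i. i < n \<Longrightarrow> \<sigma> i < n"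
    if "\<sigma> permutes {..<n}" for \<sigma>
  proof -
    show s: "\<And>i. i < n \<Longrightarrow> \<sigma> i < n" using permutes_in_image[OF that] by auto
    then show "\<And>i. i < n \<Longrightarrow> A (i, \<sigma> i) \<in> carrier R" using mat_carrier_in[OF A] by auto
    then show "(\<Otimes>i\<in>{..<n}. A (i, \<sigma> i)) \<in> carrier R" by (intro finprod_closed) auto
  qed
  have "[ev k (mat_det n R A) = (\<Sum>\<sigma>\<in>{\<sigma>. \<sigma> permutes {..<n}}. ev k (add_pow R (sign \<sigma> :: int) (\<Otimes>i\<in>{..<n}. A (i, \<sigma> i))))] (mod md k)"
    unfolding mat_det_def by (rule ev_finsum) (auto simp: finite_permutations intro!: sign_pow Ac)
  also have "[(\<Sum>\<sigma>\<in>{\<sigma>. \<sigma> permutes {..<n}}. ev k (add_pow R (sign \<sigma> :: int) (\<Otimes>i\<in>{..<n}. A (i, \<sigma> i)))) =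
     (\<Sum>\<sigma>\<in>{\<sigma>. \<sigma> permutes {..<n}}. signof \<sigma> * (\<Prod>i<n. ev k (A (i, \<sigma> i))))] (mod md k)"
  proof (rule cong_sum)
    fix \<sigma> assume "\<sigma> \<in> {\<sigma>. \<sigma> permutes {..<n}}"
    then have \<sigma>: "\<sigma> permutes {..<n}" by simp
    have "[ev k (add_pow R (sign \<sigma> :: int) (\<Otimes>i\<in>{..<n}. A (i, \<sigma> i))) = signof \<sigma> * ev k (\<Otimes>i\<in>{..<n}. A (i, \<sigma> i))] (mod md k)"
      by (rule sign_pow(2)[OF Ac(1)[OF \<sigma>]])
    also have "[signof \<sigma> * ev k (\<Otimes>i\<in>{..<n}. A (i, \<sigma> i)) = signof \<sigma> * (\<Prod>i<n. ev k (A (i, \<sigma> i)))] (mod md k)"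
      by (intro cong_scalar_left ev_finprod) (use Ac[OF \<sigma>] in auto)
    finally show "[ev k (add_pow R (sign \<sigma> :: int) (\<Otimes>i\<in>{..<n}. A (i, \<sigma> i))) = signof \<sigma> * (\<Prod>i<n. ev k (A (i, \<sigma> i)))] (mod md k)" .
  qed
  also have "(\<Sum>\<sigma>\<in>{\<sigma>. \<sigma> permutes {..<n}}. signof \<sigma> * (\<Prod>i<n. ev k (A (i, \<sigma> i)))) = det (lm n k A)"
    unfolding det_def'[OF lm_carrier] lessThan_atLeast0
    using Ac(3) by (intro sum.cong refl arg_cong2[where f = "(*)"] prod.cong) (auto simp: lm_index lessThan_atLeast0)
  finally show ?thesis .
qed

lemma SL_carrier: "A \<in> carrier (SL n R) \<longleftrightarrow> A \<in> mat_carrier n R \<and> (\<forall>k. [det (lm n k A) = 1] (mod md k))"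
proof (intro iffI conjI allI)
  assume A: "A \<in> carrier (SL n R)"
  then show Ac: "A \<in> mat_carrier n R" by (simp add: SL_def)
  have d: "mat_det n R A = \<one>" using A by (simp add: SL_def)
  show "[det (lm n k A) = 1] (mod md k)" for k
    using ev_det[OF Ac, of k] ev_one[of k] unfolding d by (meson cong_sym cong_trans)
next
  assume A: "A \<in> mat_carrier n R \<and> (\<forall>k. [det (lm n k A) = 1] (mod md k))"
  have "mat_det n R A = \<one>"
  proof (rule ev_inj)
    show "[ev k (mat_det n R A) = ev k \<one>] (mod md k)" for k
      using ev_det[of A n k] A ev_one[of k] by (meson cong_sym cong_trans)
  qed (use A mat_det_carrier in auto)
  then show "A \<in> carrier (SL n R)" using A by (simp add: SL_def)
qed

lemma SL_mat_carrier: "A \<in> carrier (SL n R) \<Longrightarrow> A \<in> mat_carrier n R"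
  by (simp add: SL_carrier)

lemma SL_det: "A \<in> carrier (SL n R) \<Longrightarrow> [det (lm n k A) = 1] (mod md k)"
  by (simp add: SL_carrier)

lemma SL_lm_mult:
  assumes "A \<in> carrier (SL n R)" "B \<in> carrier (SL n R)"
  shows "mcong (md k) n (lm n k (A \<otimes>\<^bsub>SL n R\<^esub> B)) (lm n k A * lm n k B)"
  using lm_mult[OF SL_mat_carrier SL_mat_carrier, OF assms] by (simp add: SL_def)

text \<open>The group laws hold for integer matrices modulo every \<open>md k\<close>, and
  \<open>mat_eqI\<close> transfers them to \<open>R\<close>. The inverse is assembled from
  adjugates.\<close>

lemma group_SL: "group (SL n R)"
proof (rule groupI)
  let ?G = "SL n R"
  have mult: "A \<otimes>\<^bsub>?G\<^esub> B = mat_mult n R A B" for A B by (simp add: SL_def)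
  have one: "\<one>\<^bsub>?G\<^esub> = mat_one n R" by (simp add: SL_def)
  show closed: "A \<otimes>\<^bsub>?G\<^esub> B \<in> carrier ?G" if "A \<in> carrier ?G" "B \<in> carrier ?G" for A B
  proof -
    have "[det (lm n k (A \<otimes>\<^bsub>?G\<^esub> B)) = 1] (mod md k)" for k
    proof -
      have "[det (lm n k (A \<otimes>\<^bsub>?G\<^esub> B)) = det (lm n k A * lm n k B)] (mod md k)"
        by (rule mcong_det[OF SL_lm_mult[OF that]]) auto
      also have "det (lm n k A * lm n k B) = det (lm n k A) * det (lm n k B)" by (rule det_mult[OF lm_carrier lm_carrier])
      also have "[det (lm n k A) * det (lm n k B) = 1 * 1] (mod md k)" by (intro cong_mult SL_det that)
      finally show ?thesis by simp
    qed
    then show ?thesis using that mat_mult_carrier by (auto simp: SL_carrier mult)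
  qed
  have "[det (lm n k (mat_one n R)) = 1] (mod md k)" for k
    using mcong_det[OF lm_one[of k n]] by simp
  then show "\<one>\<^bsub>?G\<^esub> \<in> carrier ?G" by (auto simp: SL_carrier one mat_one_carrier)
  show "A \<otimes>\<^bsub>?G\<^esub> B \<otimes>\<^bsub>?G\<^esub> C = A \<otimes>\<^bsub>?G\<^esub> (B \<otimes>\<^bsub>?G\<^esub> C)"
    if "A \<in> carrier ?G" "B \<in> carrier ?G" "C \<in> carrier ?G" for A B C
  proof (rule mat_eqI)
    fix k
    let ?a = "lm n k A" and ?b = "lm n k B" and ?c = "lm n k C"
    have "mcong (md k) n (lm n k (A \<otimes>\<^bsub>?G\<^esub> B \<otimes>\<^bsub>?G\<^esub> C)) (?a * ?b * ?c)"
      by (rule mcong_trans[OF SL_lm_mult[OF closed[OF that(1,2)] that(3)] mcong_mult[OF SL_lm_mult[OF that(1,2)] mcong_refl]]) auto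
    moreover have "mcong (md k) n (lm n k (A \<otimes>\<^bsub>?G\<^esub> (B \<otimes>\<^bsub>?G\<^esub> C))) (?a * (?b * ?c))"
      by (rule mcong_trans[OF SL_lm_mult[OF that(1) closed[OF that(2,3)]] mcong_mult[OF mcong_refl SL_lm_mult[OF that(2,3)]]]) auto
    moreover have "?a * ?b * ?c = ?a * (?b * ?c)" by (rule assoc_mult_mat[OF lm_carrier lm_carrier lm_carrier])
    ultimately show "mcong (md k) n (lm n k (A \<otimes>\<^bsub>?G\<^esub> B \<otimes>\<^bsub>?G\<^esub> C)) (lm n k (A \<otimes>\<^bsub>?G\<^esub> (B \<otimes>\<^bsub>?G\<^esub> C)))"
      by (metis (no_types) mcong_trans[OF _ mcong_sym])
  qed (use that closed SL_mat_carrier in auto)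
  show "\<one>\<^bsub>?G\<^esub> \<otimes>\<^bsub>?G\<^esub> A = A" if A: "A \<in> carrier ?G" for A
  proof (rule mat_eqI)
    fix k
    have "mcong (md k) n (lm n k (\<one>\<^bsub>?G\<^esub> \<otimes>\<^bsub>?G\<^esub> A)) (1\<^sub>m n * lm n k A)"
      unfolding mult one
      by (rule mcong_trans[OF lm_mult[OF mat_one_carrier SL_mat_carrier[OF A]] mcong_mult[OF lm_one mcong_refl]]) auto
    then show "mcong (md k) n (lm n k (\<one>\<^bsub>?G\<^esub> \<otimes>\<^bsub>?G\<^esub> A)) (lm n k A)"
      by (simp only: left_mult_one_mat[OF lm_carrier])
  qed (use A SL_mat_carrier mat_mult_carrier mat_one_carrier in \<open>auto simp: mult one\<close>)
  show "\<exists>B\<in>carrier ?G. B \<otimes>\<^bsub>?G\<^esub> A = \<one>\<^bsub>?G\<^esub>" if A: "A \<in> carrier ?G" for A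
  proof -
    note Am = SL_mat_carrier[OF A]
    have coh: "mcong (md k) n (lm n (Suc k) A) (lm n k A)" for k
      using ev_coh mat_carrier_in[OF Am] by (auto simp: mcong_def lm_index)
    \<comment> \<open>Adjugates of successive levels are congruent, so by \<open>ev_lift\<close>
      each entry is realised by one element of \<open>R\<close>; determinant 1 makes the result an
      inverse.\<close>
    have "\<exists>a\<in>carrier R. \<forall>k. [ev k a = adj_mat (lm n k A) $$ (i, j)] (mod md k)" if "i < n" "j < n" for i j
      by (rule ev_lift) (use mcong_adj_mat[OF coh] that in \<open>auto simp: mcong_def\<close>)
    then have "\<forall>i j. \<exists>a. i < n \<longrightarrow> j < n \<longrightarrow> a \<in> carrier R \<and> (\<forall>k. [ev k a = adj_mat (lm n k A) $$ (i, j)] (mod md k))"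
      by blast
    then obtain b where b': "\<forall>i j. i < n \<longrightarrow> j < n \<longrightarrow> b i j \<in> carrier R \<and> (\<forall>k. [ev k (b i j) = adj_mat (lm n k A) $$ (i, j)] (mod md k))"
      unfolding choice_iff by blast
    have b: "\<And>i j. i < n \<Longrightarrow> j < n \<Longrightarrow> b i j \<in> carrier R"
      "\<And>i j k. i < n \<Longrightarrow> j < n \<Longrightarrow> [ev k (b i j) = adj_mat (lm n k A) $$ (i, j)] (mod md k)"
      using b' by auto
    define B where "B = (\<lambda>ij\<in>{..<n} \<times> {..<n}. b (fst ij) (snd ij))"
    have Bm: "B \<in> mat_carrier n R" using b by (auto simp: B_def mat_carrier_def)
    have Ba: "mcong (md k) n (lm n k B) (adj_mat (lm n k A))" for k
      using b by (auto simp: mcong_def lm_index B_def)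
    have BA: "mcong (md k) n (lm n k B * lm n k A) (1\<^sub>m n)" for k
    proof -
      have "mcong (md k) n (lm n k B * lm n k A) (adj_mat (lm n k A) * lm n k A)"
        by (rule mcong_mult[OF Ba mcong_refl]) (auto intro: adj_mat[OF lm_carrier])
      also have "adj_mat (lm n k A) * lm n k A = det (lm n k A) \<cdot>\<^sub>m 1\<^sub>m n" by (rule adj_mat[OF lm_carrier])
      also have "mcong (md k) n (det (lm n k A) \<cdot>\<^sub>m 1\<^sub>m n) (1\<^sub>m n)"
        using SL_det[OF A, of k] by (auto simp: mcong_def)
      finally (mcong_trans) show ?thesis .
    qed
    have "[det (lm n k B) = 1] (mod md k)" for k
    proof -
      have "[det (lm n k B) * 1 = det (lm n k B) * det (lm n k A)] (mod md k)"
        by (intro cong_mult cong_refl cong_sym[OF SL_det[OF A]])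
      also have "det (lm n k B) * det (lm n k A) = det (lm n k B * lm n k A)" by (rule det_mult[OF lm_carrier lm_carrier, symmetric])
      also have "[det (lm n k B * lm n k A) = det (1\<^sub>m n)] (mod md k)" by (rule mcong_det[OF BA]) auto
      finally show ?thesis by simp
    qed
    then have B: "B \<in> carrier ?G" using Bm by (simp add: SL_carrier)
    have "B \<otimes>\<^bsub>?G\<^esub> A = \<one>\<^bsub>?G\<^esub>"
    proof (rule mat_eqI)
      fix k
      show "mcong (md k) n (lm n k (B \<otimes>\<^bsub>?G\<^esub> A)) (lm n k \<one>\<^bsub>?G\<^esub>)"
        unfolding one by (rule mcong_trans[OF mcong_trans[OF SL_lm_mult[OF B A] BA] mcong_sym[OF lm_one]])
    qed (use Am Bm mat_mult_carrier mat_one_carrier in \<open>auto simp: mult one\<close>)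
    then show ?thesis using B by blast
  qed
qed

end

section \<open>Centres of special linear groups and the projective quotient\<close>

lemma (in group) normal_group_center: "group_center G \<lhd> G"
proof (rule normal_invI)
  show "subgroup (group_center G) G"
  proof
    show "group_center G \<subseteq> carrier G" by (auto simp: group_center_def)
    show "\<one> \<in> group_center G" by (simp add: group_center_def)
    fix x y assume xy: "x \<in> group_center G" "y \<in> group_center G"
    then have c: "x \<in> carrier G" "y \<in> carrier G" by (auto simp: group_center_def)
    have comm: "x \<otimes> g = g \<otimes> x" "y \<otimes> g = g \<otimes> y" if "g \<in> carrier G" for g
      using xy that by (auto simp: group_center_def)
    have "x \<otimes> y \<otimes> g = g \<otimes> (x \<otimes> y)" if g: "g \<in> carrier G" for g
    proof -
      have "x \<otimes> y \<otimes> g = x \<otimes> (y \<otimes> g)" by (rule m_assoc[OF c g])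
      also have "\<dots> = x \<otimes> (g \<otimes> y)" by (simp only: comm(2)[OF g])
      also have "\<dots> = (x \<otimes> g) \<otimes> y" by (rule m_assoc[OF c(1) g c(2), symmetric])
      also have "\<dots> = (g \<otimes> x) \<otimes> y" by (simp only: comm(1)[OF g])
      also have "\<dots> = g \<otimes> (x \<otimes> y)" by (rule m_assoc[OF g c])
      finally show ?thesis .
    qed
    then show "x \<otimes> y \<in> group_center G" using c by (simp add: group_center_def)
    have "inv x \<otimes> g = g \<otimes> inv x" if g: "g \<in> carrier G" for g
    proof -
      have "inv x \<otimes> g \<otimes> x = inv x \<otimes> (g \<otimes> x)" using c g by (simp add: m_assoc)
      also have "\<dots> = inv x \<otimes> (x \<otimes> g)" by (simp only: comm(1)[OF g])
      also have "\<dots> = g" using c g by (simp flip: m_assoc)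
      finally have "g = inv x \<otimes> g \<otimes> x" ..
      then show ?thesis using inv_solve_right[of "inv x \<otimes> g" g x] c g by simp
    qed
    then show "inv x \<in> group_center G" using c by (simp add: group_center_def)
  qed
  fix x h assume x: "x \<in> carrier G" and h: "h \<in> group_center G"
  then have hx: "h \<in> carrier G" "x \<otimes> h = h \<otimes> x" by (auto simp: group_center_def)
  have "x \<otimes> h \<otimes> inv x = h" unfolding hx(2) using x hx(1) by (simp add: m_assoc)
  then show "x \<otimes> h \<otimes> inv x \<in> group_center G" using h by simp
qed

context lev_ring
begin

definition elem :: "nat \<Rightarrow> nat \<Rightarrow> nat \<Rightarrow> nat \<times> nat \<Rightarrow> 'a" where
  "elem n a b = (\<lambda>(i, j)\<in>{..<n} \<times> {..<n}. if i = j \<or> (i = a \<and> j = b) then \<one> else \<zero>)"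

lemma elem_mat_carrier: "elem n a b \<in> mat_carrier n R"
  by (auto simp: elem_def mat_carrier_def)

lemma lm_elem: "a \<noteq> b \<Longrightarrow> mcong (md k) n (lm n k (elem n a b)) (addrow_mat n 1 a b)"
  using ev_one ev_zero by (auto simp: mcong_def lm_index elem_def addrow_mat_def)

lemma elem_SL: "a \<noteq> b \<Longrightarrow> elem n a b \<in> carrier (SL n R)"
  using mcong_det[OF lm_elem[of a b _ n]] by (auto simp: SL_carrier elem_mat_carrier det_addrow_mat)

lemma mult_addrow_mat:
  fixes X :: "int mat"
  assumes "X \<in> carrier_mat n n" "a \<noteq> b" "a < n" "b < n" "i < n" "j < n"
  shows "(X * addrow_mat n 1 a b) $$ (i, j) = X $$ (i, j) + (if j = b then X $$ (i, a) else 0)"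
    and "(addrow_mat n 1 a b * X) $$ (i, j) = X $$ (i, j) + (if i = a then X $$ (b, j) else 0)"
proof -
  have E: "addrow_mat n 1 a b \<in> carrier_mat n n" by simp
  have Eij: "addrow_mat n 1 a b $$ (r, c) = (if r = c then 1 else 0) + (if r = a then (if c = b then 1 else 0) else (0 :: int))" if "r < n" "c < n" for r c
    using that assms(2) by (auto simp: addrow_mat_def)
  have "(X * addrow_mat n 1 a b) $$ (i, j) = (\<Sum>l = 0..<n. (if l = j then X $$ (i, l) else 0) + (if l = a then (if j = b then X $$ (i, l) else 0) else 0))"
    unfolding mult_mat_index[OF assms(1) E assms(5,6)] by (intro sum.cong refl) (use assms(6) Eij in auto)
  then show "(X * addrow_mat n 1 a b) $$ (i, j) = X $$ (i, j) + (if j = b then X $$ (i, a) else 0)"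
    using assms by (simp add: sum.distrib)
  have "(addrow_mat n 1 a b * X) $$ (i, j) = (\<Sum>l = 0..<n. (if l = i then X $$ (l, j) else 0) + (if l = b then (if i = a then X $$ (l, j) else 0) else 0))"
    unfolding mult_mat_index[OF E assms(1) assms(5,6)] by (intro sum.cong refl) (use assms(5) Eij in auto)
  then show "(addrow_mat n 1 a b * X) $$ (i, j) = X $$ (i, j) + (if i = a then X $$ (b, j) else 0)"
    using assms by (simp add: sum.distrib)
qed

text \<open>With E elementary and X the level matrix of \<open>z\<close>, both relations are entries
  of \<open>X E = E X\<close>: the first at position (b, b), the second at (a, b).\<close>

lemma center_levels:
  assumes z: "z \<in> group_center (SL n R)" and ab: "a \<noteq> b" "a < n" "b < n"
  shows "[ev k (z (b, a)) = 0] (mod md k)" "[ev k (z (a, a)) = ev k (z (b, b))] (mod md k)"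
proof -
  let ?E = "addrow_mat n 1 a b :: int mat" and ?X = "lm n k z"
  have zS: "z \<in> carrier (SL n R)" using z by (simp add: group_center_def)
  have comm: "z \<otimes>\<^bsub>SL n R\<^esub> elem n a b = elem n a b \<otimes>\<^bsub>SL n R\<^esub> z"
    using z elem_SL[OF ab(1)] by (simp add: group_center_def)
  have "mcong (md k) n (lm n k (z \<otimes>\<^bsub>SL n R\<^esub> elem n a b)) (?X * ?E)"
    by (rule mcong_trans[OF SL_lm_mult[OF zS elem_SL[OF ab(1)]] mcong_mult[OF mcong_refl lm_elem[OF ab(1)]]]) auto
  moreover have "mcong (md k) n (lm n k (z \<otimes>\<^bsub>SL n R\<^esub> elem n a b)) (?E * ?X)"
    unfolding comm
    by (rule mcong_trans[OF SL_lm_mult[OF elem_SL[OF ab(1)] zS] mcong_mult[OF lm_elem[OF ab(1)] mcong_refl]]) auto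
  ultimately have m: "mcong (md k) n (?X * ?E) (?E * ?X)" using mcong_trans[OF mcong_sym] by blast
  have e: "[(if j = b then ?X $$ (i, a) else 0) = (if i = a then ?X $$ (b, j) else 0)] (mod md k)" if "i < n" "j < n" for i j
  proof -
    have "[?X $$ (i, j) + (if j = b then ?X $$ (i, a) else 0) = ?X $$ (i, j) + (if i = a then ?X $$ (b, j) else 0)] (mod md k)"
      using m that unfolding mcong_def mult_addrow_mat[OF lm_carrier ab that, symmetric] by blast
    then show ?thesis by (simp only: cong_add_lcancel)
  qed
  show "[ev k (z (b, a)) = 0] (mod md k)" using e[of b b] ab by (simp add: lm_index)
  show "[ev k (z (a, a)) = ev k (z (b, b))] (mod md k)" using e[of a b] ab by (simp add: lm_index)
qed

lemma center_scalar:
  assumes z: "z \<in> group_center (SL n R)"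
  shows "i < n \<Longrightarrow> j < n \<Longrightarrow> i \<noteq> j \<Longrightarrow> z (i, j) = \<zero>" and "i < n \<Longrightarrow> j < n \<Longrightarrow> z (i, i) = z (j, j)"
proof -
  have zc: "z \<in> mat_carrier n R" using z by (auto simp: group_center_def intro: SL_mat_carrier)
  show "z (i, j) = \<zero>" if "i < n" "j < n" "i \<noteq> j"
  proof (rule ev_inj)
    show "[ev k (z (i, j)) = ev k \<zero>] (mod md k)" for k
      by (rule cong_trans[OF center_levels(1)[OF z] cong_sym[OF ev_zero]]) (use that in auto)
  qed (use that mat_carrier_in[OF zc] in auto)
  show "z (i, i) = z (j, j)" if "i < n" "j < n"
  proof (cases "i = j")
    case False
    show ?thesis by (rule ev_inj) (use that False mat_carrier_in[OF zc] center_levels(2)[OF z, of i j] in auto)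
  qed simp
qed

lemma scalar_mult:
  fixes X :: "int mat"
  assumes "mcong N n Y (c \<cdot>\<^sub>m 1\<^sub>m n)" "X \<in> carrier_mat n n" "Y \<in> carrier_mat n n"
  shows "mcong N n (Y * X) (c \<cdot>\<^sub>m X)" "mcong N n (X * Y) (c \<cdot>\<^sub>m X)"
proof -
  have "mcong N n (Y * X) (c \<cdot>\<^sub>m 1\<^sub>m n * X)" by (rule mcong_mult[OF assms(1) mcong_refl assms(3)]) (use assms in auto)
  then show "mcong N n (Y * X) (c \<cdot>\<^sub>m X)" using assms(2) by (simp add: mult_smult_assoc_mat[OF one_carrier_mat])
  have "mcong N n (X * Y) (X * (c \<cdot>\<^sub>m 1\<^sub>m n))" by (rule mcong_mult[OF mcong_refl assms(1)]) (use assms in auto)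
  then show "mcong N n (X * Y) (c \<cdot>\<^sub>m X)" using assms(2) by (simp add: mult_smult_distrib[OF _ one_carrier_mat])
qed

text \<open>Scalar matrices commute with all others, and equality is tested at each level
  separately, so the scalar is allowed to depend on the level.\<close>

lemma scalar_center:
  assumes zS: "z \<in> carrier (SL n R)" and sc: "\<And>k. \<exists>c. mcong (md k) n (lm n k z) (c \<cdot>\<^sub>m 1\<^sub>m n)"
  shows "z \<in> group_center (SL n R)"
  unfolding group_center_def
proof (intro CollectI conjI ballI zS)
  interpret G: group "SL n R" by (rule group_SL)
  fix g assume g: "g \<in> carrier (SL n R)"
  show "z \<otimes>\<^bsub>SL n R\<^esub> g = g \<otimes>\<^bsub>SL n R\<^esub> z"
  proof (rule mat_eqI)
    fix k
    obtain c where c: "mcong (md k) n (lm n k z) (c \<cdot>\<^sub>m 1\<^sub>m n)" using sc by blast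
    note s = scalar_mult[OF c lm_carrier[of n k g] lm_carrier]
    show "mcong (md k) n (lm n k (z \<otimes>\<^bsub>SL n R\<^esub> g)) (lm n k (g \<otimes>\<^bsub>SL n R\<^esub> z))"
      by (rule mcong_trans[OF mcong_trans[OF SL_lm_mult[OF zS g] s(1)] mcong_sym[OF mcong_trans[OF SL_lm_mult[OF g zS] s(2)]]])
  qed (use zS g SL_mat_carrier in auto)
qed

lemma center_mcong:
  assumes "z \<in> group_center (SL n R)"
  shows "mcong (md k) n (lm n k z) (ev k (z (0, 0)) \<cdot>\<^sub>m 1\<^sub>m n)"
  unfolding mcong_def
proof (intro allI impI)
  fix i j assume ij: "i < n" "j < n"
  then have "z (i, i) = z (0, 0)" using center_scalar(2)[OF assms, of i 0] by simp
  then show "[lm n k z $$ (i, j) = (ev k (z (0, 0)) \<cdot>\<^sub>m 1\<^sub>m n) $$ (i, j)] (mod md k)"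
    using ij center_scalar(1)[OF assms ij] ev_zero[of k] by (cases "i = j") (auto simp: lm_index)
qed

lemma normal_center: "group_center (SL n R) \<lhd> SL n R"
  by (rule group.normal_group_center[OF group_SL])

lemma group_PSL: "group (PSL n R)"
  unfolding PSL_def by (rule normal.factorgroup_is_group[OF normal_center])

definition cls :: "nat \<Rightarrow> (nat \<times> nat \<Rightarrow> 'a) \<Rightarrow> (nat \<times> nat \<Rightarrow> 'a) set" where
  "cls n A = group_center (SL n R) #>\<^bsub>SL n R\<^esub> A"

lemma carrier_PSL: "carrier (PSL n R) = cls n ` carrier (SL n R)"
  by (auto simp: PSL_def FactGroup_def RCOSETS_def cls_def)

lemma cls_mult:
  assumes "A \<in> carrier (SL n R)" "B \<in> carrier (SL n R)"
  shows "cls n A \<otimes>\<^bsub>PSL n R\<^esub> cls n B = cls n (A \<otimes>\<^bsub>SL n R\<^esub> B)"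
  unfolding PSL_def FactGroup_def cls_def using normal.rcos_sum[OF normal_center assms] by simp

lemma cls_one: "\<one>\<^bsub>PSL n R\<^esub> = cls n \<one>\<^bsub>SL n R\<^esub>"
proof -
  interpret G: group "SL n R" by (rule group_SL)
  show ?thesis
    unfolding PSL_def FactGroup_def cls_def
    using G.coset_mult_one[OF normal_imp_subgroup[OF normal_center, THEN subgroup.subset]] by simp
qed

lemma mem_cls: "B \<in> cls n A \<longleftrightarrow> (\<exists>z\<in>group_center (SL n R). B = z \<otimes>\<^bsub>SL n R\<^esub> A)"
  by (auto simp: cls_def r_coset_def)

lemma cls_eqI:
  assumes "A \<in> carrier (SL n R)" "z \<in> group_center (SL n R)"
  shows "cls n (z \<otimes>\<^bsub>SL n R\<^esub> A) = cls n A"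
proof -
  interpret G: group "SL n R" by (rule group_SL)
  have "z \<otimes>\<^bsub>SL n R\<^esub> A \<in> group_center (SL n R) #>\<^bsub>SL n R\<^esub> A" using assms by (auto simp: r_coset_def)
  from G.repr_independence[OF this assms(1) normal_imp_subgroup[OF normal_center]]
  show ?thesis by (simp add: cls_def)
qed

lemma cls_self: "A \<in> carrier (SL n R) \<Longrightarrow> A \<in> cls n A"
proof -
  interpret G: group "SL n R" by (rule group_SL)
  assume "A \<in> carrier (SL n R)"
  then show ?thesis
    unfolding cls_def using G.rcos_self[OF _ normal_imp_subgroup[OF normal_center]] by blast
qed

end

section \<open>The two rings and the orbit relation on representatives\<close>

lemma lev_ring_padic:
  assumes p: "p > 0"
  shows "lev_ring (padic_int p) (\<lambda>k a. a k) (\<lambda>k. int p ^ k)"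
proof (intro lev_ring.intro lev_ring_axioms.intro cring_padic_int[OF p])
  fix a b k assume ab: "a \<in> carrier (padic_int p)" "b \<in> carrier (padic_int p)"
  show "[(a \<oplus>\<^bsub>padic_int p\<^esub> b) k = a k + b k] (mod int p ^ k)"
    "[(a \<otimes>\<^bsub>padic_int p\<^esub> b) k = a k * b k] (mod int p ^ k)"
    by (simp_all add: padic_int_def cong_def)
next
  show "[\<one>\<^bsub>padic_int p\<^esub> k = 1] (mod int p ^ k)" for k by (simp add: padic_int_def cong_def)
next
  fix a b assume ab: "a \<in> carrier (padic_int p)" "b \<in> carrier (padic_int p)"
    and eq: "\<And>k. [a k = b k] (mod int p ^ k)"
  show "a = b"
  proof
    fix k show "a k = b k" using eq[of k] padic_intD(4)[OF ab(1), of k] padic_intD(4)[OF ab(2), of k] by (simp add: cong_def)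
  qed
next
  fix a k assume "a \<in> carrier (padic_int p)"
  then show "[a (Suc k) = a k] (mod int p ^ k)" using padic_intD(3,4)[of a p k] by (simp add: cong_def)
next
  fix c :: "nat \<Rightarrow> int" assume c: "\<And>k. [c (Suc k) = c k] (mod int p ^ k)"
  have "(\<lambda>k. c k mod int p ^ k) \<in> carrier (padic_int p)"
    by (rule padic_intI[OF p, where b = c]) (use c in \<open>auto simp: cong_def\<close>)
  then show "\<exists>a\<in>carrier (padic_int p). \<forall>k. [a k = c k] (mod int p ^ k)"
    by (intro bexI[of _ "\<lambda>k. c k mod int p ^ k"]) (auto simp: cong_def)
qed

lemma lev_ring_int: "lev_ring \<Z> (\<lambda>_ z. z) (\<lambda>_. 0)"
proof (intro lev_ring.intro lev_ring_axioms.intro int_is_cring)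
  fix c :: "nat \<Rightarrow> int" assume "\<And>k. [c (Suc k) = c k] (mod 0)"
  then have c: "c (Suc k) = c k" for k by (simp add: cong_def)
  have "c 0 = c k" for k by (induction k) (simp_all add: c)
  then show "\<exists>a\<in>carrier \<Z>. \<forall>k. [a = c k] (mod 0)" by (intro bexI[of _ "c 0"]) auto
qed (auto simp: cong_def)

interpretation Zr: lev_ring \<Z> "\<lambda>_ z. z" "\<lambda>_. 0" by (rule lev_ring_int)

definition hm :: "nat \<Rightarrow> nat \<Rightarrow> (nat \<times> nat \<Rightarrow> int) \<Rightarrow> nat \<times> nat \<Rightarrow> nat \<Rightarrow> int" where
  "hm n p A = (\<lambda>ij\<in>{..<n} \<times> {..<n}. padic_of_int p (A ij))"

context
  fixes p n :: nat assumes p: "p > 0"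
begin

interpretation P: lev_ring "padic_int p" "\<lambda>k a. a k" "\<lambda>k. int p ^ k" by (rule lev_ring_padic[OF p])

lemma lm_hm: "mcong (int p ^ k) n (P.lm n k (hm n p A)) (Zr.lm n 0 A)"
  by (auto simp: mcong_def P.lm_index Zr.lm_index hm_def padic_of_int_def cong_def)

lemma hm_mat_carrier: "hm n p A \<in> mat_carrier n (padic_int p)"
  using ring_hom_closed[OF padic_of_int_ring_hom[OF p]] by (auto simp: hm_def mat_carrier_def)

lemma hm_SL:
  assumes "A \<in> carrier (SL n \<Z>)"
  shows "hm n p A \<in> carrier (SL n (padic_int p))"
proof -
  have "det (Zr.lm n 0 A) = 1" using Zr.SL_det[OF assms, of 0] by (simp add: cong_def)
  then have "[det (P.lm n k (hm n p A)) = 1] (mod int p ^ k)" for k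
    using mcong_det[OF lm_hm P.lm_carrier Zr.lm_carrier] by metis
  then show ?thesis by (simp add: P.SL_carrier hm_mat_carrier)
qed

lemma hm_mult:
  assumes A: "A \<in> carrier (SL n \<Z>)" and B: "B \<in> carrier (SL n \<Z>)"
  shows "hm n p (A \<otimes>\<^bsub>SL n \<Z>\<^esub> B) = hm n p A \<otimes>\<^bsub>SL n (padic_int p)\<^esub> hm n p B"
proof (rule P.mat_eqI[OF hm_mat_carrier])
  interpret G: group "SL n (padic_int p)" by (rule P.group_SL)
  show "hm n p A \<otimes>\<^bsub>SL n (padic_int p)\<^esub> hm n p B \<in> mat_carrier n (padic_int p)"
    by (intro P.SL_mat_carrier G.m_closed hm_SL assms)
  fix k
  have "mcong (int p ^ k) n (Zr.lm n 0 (A \<otimes>\<^bsub>SL n \<Z>\<^esub> B)) (Zr.lm n 0 A * Zr.lm n 0 B)"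
    using Zr.SL_lm_mult[OF A B, of 0] by (auto simp: mcong_def cong_def)
  then show "mcong (int p ^ k) n (P.lm n k (hm n p (A \<otimes>\<^bsub>SL n \<Z>\<^esub> B))) (P.lm n k (hm n p A \<otimes>\<^bsub>SL n (padic_int p)\<^esub> hm n p B))"
    by (intro mcong_trans[OF lm_hm mcong_trans[OF _ mcong_sym[OF mcong_trans[OF P.SL_lm_mult[OF hm_SL[OF A] hm_SL[OF B]]
          mcong_mult[OF lm_hm lm_hm]]]]]) auto
qed

lemma hm_center:
  assumes "z \<in> group_center (SL n \<Z>)"
  shows "hm n p z \<in> group_center (SL n (padic_int p))"
proof (rule P.scalar_center)
  show "hm n p z \<in> carrier (SL n (padic_int p))" using assms by (intro hm_SL) (simp add: group_center_def)
  fix k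
  have "mcong (int p ^ k) n (Zr.lm n 0 z) (z (0, 0) \<cdot>\<^sub>m 1\<^sub>m n)"
    using Zr.center_mcong[OF assms, of 0] by (auto simp: mcong_def cong_def)
  then show "\<exists>c. mcong (int p ^ k) n (P.lm n k (hm n p z)) (c \<cdot>\<^sub>m 1\<^sub>m n)"
    using mcong_trans[OF lm_hm] by blast
qed

text \<open>\<open>PSL_map\<close> multiplies the entrywise image of a coset by the centre of the
  target. The image of the integral centre is absorbed by it (\<open>hm_center\<close>), and a
  single coset remains.\<close>

lemma PSL_map_cls:
  assumes A: "A \<in> carrier (SL n \<Z>)"
  shows "PSL_map n (padic_int p) (padic_of_int p) (Zr.cls n A) = P.cls n (hm n p A)"
proof -
  interpret G: group "SL n (padic_int p)" by (rule P.group_SL)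
  interpret C: subgroup "group_center (SL n (padic_int p))" "SL n (padic_int p)"
    by (rule normal_imp_subgroup[OF P.normal_center])
  have one: "\<one>\<^bsub>SL n \<Z>\<^esub> \<in> group_center (SL n \<Z>)"
    by (rule subgroup.one_closed[OF normal_imp_subgroup[OF Zr.normal_center]])
  have e: "PSL_map n (padic_int p) (padic_of_int p) (Zr.cls n A) =
     {z \<otimes>\<^bsub>SL n (padic_int p)\<^esub> hm n p B |z B. z \<in> group_center (SL n (padic_int p)) \<and> B \<in> Zr.cls n A}"
    unfolding PSL_map_def set_mult_def hm_def by auto
  show ?thesis
  proof (intro equalityI subsetI)
    fix X assume "X \<in> PSL_map n (padic_int p) (padic_of_int p) (Zr.cls n A)"
    then obtain z B where z: "z \<in> group_center (SL n (padic_int p))" "B \<in> Zr.cls n A" "X = z \<otimes>\<^bsub>SL n (padic_int p)\<^esub> hm n p B"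
      unfolding e by auto
    obtain y where y: "y \<in> group_center (SL n \<Z>)" "B = y \<otimes>\<^bsub>SL n \<Z>\<^esub> A" using z(2) by (auto simp: Zr.mem_cls)
    have yS: "y \<in> carrier (SL n \<Z>)" using y by (simp add: group_center_def)
    have "X = (z \<otimes>\<^bsub>SL n (padic_int p)\<^esub> hm n p y) \<otimes>\<^bsub>SL n (padic_int p)\<^esub> hm n p A"
      using z y hm_mult[OF yS A] G.m_assoc[OF C.mem_carrier[OF z(1)] hm_SL[OF yS] hm_SL[OF A]] by simp
    then show "X \<in> P.cls n (hm n p A)" unfolding P.mem_cls using z hm_center[OF y(1)] by blast
  next
    fix X assume "X \<in> P.cls n (hm n p A)"
    then show "X \<in> PSL_map n (padic_int p) (padic_of_int p) (Zr.cls n A)"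
      unfolding e P.mem_cls using Zr.cls_self[OF A] by blast
  qed
qed

lemma PSL_action:
  assumes A: "A \<in> carrier (SL n \<Z>)" and X: "X \<in> carrier (SL n (padic_int p))"
  shows "PSL_left_action n p (Zr.cls n A) (P.cls n X) = P.cls n (hm n p A \<otimes>\<^bsub>SL n (padic_int p)\<^esub> X)"
  using X by (simp add: PSL_left_action_def PSL_map_cls[OF A] P.carrier_PSL P.cls_mult[OF hm_SL[OF A] X])

lemma orbit_cls:
  assumes X: "X \<in> carrier (SL n (padic_int p))"
  shows "orbit (PSL n \<Z>) (PSL_left_action n p) (P.cls n X) =
    (\<lambda>A. P.cls n (hm n p A \<otimes>\<^bsub>SL n (padic_int p)\<^esub> X)) ` carrier (SL n \<Z>)"
proof -
  have "orbit (PSL n \<Z>) (PSL_left_action n p) (P.cls n X) =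
      (\<lambda>g. PSL_left_action n p g (P.cls n X)) ` Zr.cls n ` carrier (SL n \<Z>)"
    unfolding orbit_def Zr.carrier_PSL by blast
  then show ?thesis by (simp add: image_image PSL_action[OF _ X])
qed

lemma hm_one: "hm n p \<one>\<^bsub>SL n \<Z>\<^esub> = \<one>\<^bsub>SL n (padic_int p)\<^esub>"
proof -
  interpret G: group "SL n (padic_int p)" by (rule P.group_SL)
  interpret Z: group "SL n \<Z>" by (rule Zr.group_SL)
  have "hm n p \<one>\<^bsub>SL n \<Z>\<^esub> \<otimes>\<^bsub>SL n (padic_int p)\<^esub> hm n p \<one>\<^bsub>SL n \<Z>\<^esub> = hm n p \<one>\<^bsub>SL n \<Z>\<^esub>"
    using hm_mult[of "\<one>\<^bsub>SL n \<Z>\<^esub>" "\<one>\<^bsub>SL n \<Z>\<^esub>"] by simp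
  then show ?thesis using hm_SL[OF Z.one_closed] by simp
qed

text \<open>Orbits are compared as sets: the identity puts a point into its own orbit, and the
  inverse of \<open>A\<close> supplies the reverse inclusion.\<close>

lemma PSL_orbit_rel_iff:
  assumes X: "X \<in> carrier (SL n (padic_int p))" and Y: "Y \<in> carrier (SL n (padic_int p))"
  shows "(P.cls n X, P.cls n Y) \<in> PSL_orbit_rel n p \<longleftrightarrow>
    (\<exists>A\<in>carrier (SL n \<Z>). P.cls n X = P.cls n (hm n p A \<otimes>\<^bsub>SL n (padic_int p)\<^esub> Y))"
proof -
  interpret G: group "SL n (padic_int p)" by (rule P.group_SL)
  interpret Z: group "SL n \<Z>" by (rule Zr.group_SL)
  interpret Q: group "PSL n (padic_int p)" by (rule P.group_PSL)
  let ?O = "\<lambda>X. orbit (PSL n \<Z>) (PSL_left_action n p) (P.cls n X)"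
  have self: "P.cls n W \<in> ?O W" if W: "W \<in> carrier (SL n (padic_int p))" for W
    unfolding orbit_cls[OF W] by (rule image_eqI[of _ _ "\<one>\<^bsub>SL n \<Z>\<^esub>"]) (use W hm_one in auto)
  have sub: "?O V \<subseteq> ?O W"
    if VW: "V \<in> carrier (SL n (padic_int p))" "W \<in> carrier (SL n (padic_int p))"
      and A: "A \<in> carrier (SL n \<Z>)" "P.cls n V = P.cls n (hm n p A \<otimes>\<^bsub>SL n (padic_int p)\<^esub> W)" for V W A
  proof
    fix x assume "x \<in> ?O V"
    then obtain B where B: "B \<in> carrier (SL n \<Z>)" "x = P.cls n (hm n p B \<otimes>\<^bsub>SL n (padic_int p)\<^esub> V)"
      unfolding orbit_cls[OF VW(1)] by blast
    note h = hm_SL[OF A(1)] hm_SL[OF B(1)]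
    have "x = P.cls n (hm n p B) \<otimes>\<^bsub>PSL n (padic_int p)\<^esub> P.cls n (hm n p A \<otimes>\<^bsub>SL n (padic_int p)\<^esub> W)"
      unfolding B A(2)[symmetric] by (rule P.cls_mult[OF h(2) VW(1), symmetric])
    also have "\<dots> = P.cls n (hm n p B \<otimes>\<^bsub>SL n (padic_int p)\<^esub> (hm n p A \<otimes>\<^bsub>SL n (padic_int p)\<^esub> W))"
      by (rule P.cls_mult[OF h(2) G.m_closed[OF h(1) VW(2)]])
    also have "\<dots> = P.cls n (hm n p (B \<otimes>\<^bsub>SL n \<Z>\<^esub> A) \<otimes>\<^bsub>SL n (padic_int p)\<^esub> W)"
      using h VW(2) by (simp add: hm_mult[OF B(1) A(1)] G.m_assoc)
    finally show "x \<in> ?O W" unfolding orbit_cls[OF VW(2)] using B(1) A(1) by blast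
  qed
  show ?thesis
  proof
    assume "(P.cls n X, P.cls n Y) \<in> PSL_orbit_rel n p"
    then have "?O X = ?O Y" by (simp add: PSL_orbit_rel_def orbit_eq_rel_def)
    then have "P.cls n X \<in> ?O Y" using self[OF X] by simp
    then show "\<exists>A\<in>carrier (SL n \<Z>). P.cls n X = P.cls n (hm n p A \<otimes>\<^bsub>SL n (padic_int p)\<^esub> Y)"
      unfolding orbit_cls[OF Y] by blast
  next
    assume "\<exists>A\<in>carrier (SL n \<Z>). P.cls n X = P.cls n (hm n p A \<otimes>\<^bsub>SL n (padic_int p)\<^esub> Y)"
    then obtain A where A: "A \<in> carrier (SL n \<Z>)" "P.cls n X = P.cls n (hm n p A \<otimes>\<^bsub>SL n (padic_int p)\<^esub> Y)" by blast
    let ?A' = "inv\<^bsub>SL n \<Z>\<^esub> A"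
    have A': "?A' \<in> carrier (SL n \<Z>)" using A by simp
    note h = hm_SL[OF A(1)] hm_SL[OF A']
    have "P.cls n (hm n p ?A' \<otimes>\<^bsub>SL n (padic_int p)\<^esub> X) = P.cls n (hm n p ?A') \<otimes>\<^bsub>PSL n (padic_int p)\<^esub> P.cls n (hm n p A \<otimes>\<^bsub>SL n (padic_int p)\<^esub> Y)"
      unfolding A(2)[symmetric] by (rule P.cls_mult[OF h(2) X, symmetric])
    also have "\<dots> = P.cls n (hm n p ?A' \<otimes>\<^bsub>SL n (padic_int p)\<^esub> (hm n p A \<otimes>\<^bsub>SL n (padic_int p)\<^esub> Y))"
      by (rule P.cls_mult[OF h(2) G.m_closed[OF h(1) Y]])
    also have "hm n p ?A' \<otimes>\<^bsub>SL n (padic_int p)\<^esub> (hm n p A \<otimes>\<^bsub>SL n (padic_int p)\<^esub> Y) = Y"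
      using h Y A hm_mult[OF A' A(1)] hm_one by (simp flip: G.m_assoc)
    finally have Y': "P.cls n Y = P.cls n (hm n p ?A' \<otimes>\<^bsub>SL n (padic_int p)\<^esub> X)" by simp
    have "?O X = ?O Y" using sub[OF X Y A] sub[OF Y X A' Y'] by blast
    then show "(P.cls n X, P.cls n Y) \<in> PSL_orbit_rel n p"
      using X Y by (simp add: PSL_orbit_rel_def orbit_eq_rel_def P.carrier_PSL)
  qed
qed

end

section \<open>Congruence levels on projective groups\<close>

lemma mcong_dvd: "mcong M n A B \<Longrightarrow> N dvd M \<Longrightarrow> mcong N n A B"
  unfolding mcong_def by (blast intro: cong_dvd_modulus)

lemma mcong_smult: "mcong N n A B \<Longrightarrow> A \<in> carrier_mat n n \<Longrightarrow> B \<in> carrier_mat n n \<Longrightarrow> mcong N n (c \<cdot>\<^sub>m A) (c \<cdot>\<^sub>m B)"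
  by (auto simp: mcong_def intro!: cong_scalar_left)

locale padic_PSL =
  fixes q n :: nat assumes q: "q > 0" and n: "n > 0"
begin

sublocale P: lev_ring "padic_int q" "\<lambda>k a. a k" "\<lambda>k. int q ^ k" by (rule lev_ring_padic[OF q])

abbreviation S where "S \<equiv> SL n (padic_int q)"

sublocale G: group S by (rule P.group_SL)

sublocale Q: group "PSL n (padic_int q)" by (rule P.group_PSL)

abbreviation lm where "lm \<equiv> P.lm n"

lemma lm_coh:
  assumes "A \<in> mat_carrier n (padic_int q)" "l \<le> k"
  shows "mcong (int q ^ l) n (lm k A) (lm l A)"
  using assms(2)
proof (induction k rule: dec_induct)
  case base
  show ?case by (rule mcong_refl)
next
  case (step k)
  have "mcong (int q ^ k) n (lm (Suc k) A) (lm k A)"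
    using P.ev_coh mat_carrier_in[OF assms(1)] by (auto simp: mcong_def P.lm_index)
  then have "mcong (int q ^ l) n (lm (Suc k) A) (lm k A)"
    by (rule mcong_dvd) (use step in \<open>simp add: le_imp_power_dvd\<close>)
  then show ?case using step.IH by (rule mcong_trans)
qed

lemma lm_SL_one: "mcong (int q ^ k) n (lm k \<one>\<^bsub>S\<^esub>) (1\<^sub>m n)"
  using P.lm_one[of k n] by (simp add: SL_def)

text \<open>Central elements are scalars, so levels in the quotient are classes of matrices up to a scalar
  factor. The exponent \<open>Suc j\<close> makes level \<open>0\<close> reduction modulo \<open>q\<close>.\<close>

definition psim :: "nat \<Rightarrow> (nat \<times> nat \<Rightarrow> nat \<Rightarrow> int) \<Rightarrow> (nat \<times> nat \<Rightarrow> nat \<Rightarrow> int) \<Rightarrow> bool" where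
  "psim j A B \<longleftrightarrow> (\<exists>c. mcong (int q ^ Suc j) n (lm (Suc j) A) (c \<cdot>\<^sub>m lm (Suc j) B))"

lemma psim_refl: "psim j A A"
  unfolding psim_def by (rule exI[of _ 1]) (auto simp: mcong_def P.lm_def)

text \<open>Comparing determinants gives \<open>c ^ n\<close> congruent to 1, so
  \<open>c ^ (n - 1)\<close> is the inverse scalar.\<close>

lemma psim_sym:
  assumes "psim j A B" "A \<in> carrier S" "B \<in> carrier S"
  shows "psim j B A"
proof -
  let ?N = "int q ^ Suc j"
  obtain c where c: "mcong ?N n (lm (Suc j) A) (c \<cdot>\<^sub>m lm (Suc j) B)" using assms(1) by (auto simp: psim_def)
  have dc: "det (c \<cdot>\<^sub>m lm (Suc j) B) = c ^ n * det (lm (Suc j) B)" by (simp add: P.lm_def)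
  have "[c ^ n * 1 = c ^ n * det (lm (Suc j) B)] (mod ?N)"
    by (intro cong_scalar_left cong_sym[OF P.SL_det] assms)
  also have "[c ^ n * det (lm (Suc j) B) = det (lm (Suc j) A)] (mod ?N)"
    unfolding dc[symmetric] by (rule cong_sym[OF mcong_det[OF c]]) auto
  also have "[det (lm (Suc j) A) = 1] (mod ?N)" by (intro P.SL_det assms)
  finally have cn: "[c ^ n = 1] (mod ?N)" by (simp only: mult_1_right)
  have "mcong ?N n (lm (Suc j) B) (c ^ (n - 1) \<cdot>\<^sub>m lm (Suc j) A)"
    unfolding mcong_def
  proof (intro allI impI)
    fix i k assume ik: "i < n" "k < n"
    have "[c ^ (n - 1) * lm (Suc j) A $$ (i, k) = c ^ (n - 1) * (c * lm (Suc j) B $$ (i, k))] (mod ?N)"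
      using c ik by (intro cong_scalar_left) (simp add: mcong_def P.lm_def)
    also have "c ^ (n - 1) * (c * lm (Suc j) B $$ (i, k)) = c ^ n * lm (Suc j) B $$ (i, k)"
      using n by (cases n) auto
    also have "[c ^ n * lm (Suc j) B $$ (i, k) = 1 * lm (Suc j) B $$ (i, k)] (mod ?N)"
      by (rule cong_scalar_right[OF cn])
    finally show "[lm (Suc j) B $$ (i, k) = (c ^ (n - 1) \<cdot>\<^sub>m lm (Suc j) A) $$ (i, k)] (mod ?N)"
      using ik by (simp add: cong_sym P.lm_def)
  qed
  then show ?thesis by (auto simp: psim_def)
qed

lemma psim_trans:
  assumes "psim j A B" "psim j B C"
  shows "psim j A C"
proof -
  let ?N = "int q ^ Suc j"
  obtain c d where c: "mcong ?N n (lm (Suc j) A) (c \<cdot>\<^sub>m lm (Suc j) B)"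
    and d: "mcong ?N n (lm (Suc j) B) (d \<cdot>\<^sub>m lm (Suc j) C)" using assms by (auto simp: psim_def)
  have "mcong ?N n (c \<cdot>\<^sub>m lm (Suc j) B) (c \<cdot>\<^sub>m (d \<cdot>\<^sub>m lm (Suc j) C))" by (rule mcong_smult[OF d]) auto
  moreover have "c \<cdot>\<^sub>m (d \<cdot>\<^sub>m lm (Suc j) C) = (c * d) \<cdot>\<^sub>m lm (Suc j) C" by (auto simp: P.lm_def)
  ultimately show ?thesis unfolding psim_def using mcong_trans[OF c] by auto
qed

lemma psim_center:
  assumes "z \<in> group_center S" "A \<in> carrier S"
  shows "psim j (z \<otimes>\<^bsub>S\<^esub> A) A"
proof -
  have zS: "z \<in> carrier S" using assms by (simp add: group_center_def)
  show ?thesis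
    unfolding psim_def
    by (rule exI, rule mcong_trans[OF P.SL_lm_mult[OF zS assms(2)] P.scalar_mult(1)[OF P.center_mcong[OF assms(1)]]]) auto
qed

text \<open>A level is encoded as a whole class of \<open>psim\<close>, so that equality of levels
  is congruence up to a scalar (\<open>plev_eq\<close>).\<close>

definition plev :: "nat \<Rightarrow> (nat \<times> nat \<Rightarrow> nat \<Rightarrow> int) set \<Rightarrow> (nat \<times> nat \<Rightarrow> nat \<Rightarrow> int) set" where
  "plev j C = {B \<in> carrier S. \<exists>A\<in>C. psim j A B}"

lemma center_carrier: "z \<in> group_center S \<Longrightarrow> z \<in> carrier S" by (simp add: group_center_def)

lemma plev_cls:
  assumes A: "A \<in> carrier S"
  shows "plev j (P.cls n A) = {B \<in> carrier S. psim j A B}"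
proof (intro equalityI subsetI)
  fix B assume "B \<in> plev j (P.cls n A)"
  then obtain z where z: "B \<in> carrier S" "z \<in> group_center S" "psim j (z \<otimes>\<^bsub>S\<^esub> A) B"
    by (auto simp: plev_def P.mem_cls)
  have "psim j A (z \<otimes>\<^bsub>S\<^esub> A)"
    by (rule psim_sym[OF psim_center[OF z(2) A]]) (use A center_carrier[OF z(2)] in auto)
  then show "B \<in> {B \<in> carrier S. psim j A B}" using z psim_trans by auto
next
  fix B assume "B \<in> {B \<in> carrier S. psim j A B}"
  then show "B \<in> plev j (P.cls n A)" using P.cls_self[OF A] by (auto simp: plev_def)
qed

lemma plev_eq:
  assumes A: "A \<in> carrier S" and B: "B \<in> carrier S"
  shows "plev j (P.cls n A) = plev j (P.cls n B) \<longleftrightarrow> psim j A B"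
proof
  assume "plev j (P.cls n A) = plev j (P.cls n B)"
  then have "B \<in> {X \<in> carrier S. psim j A X}"
    unfolding plev_cls[OF A] plev_cls[OF B] using B psim_refl by simp
  then show "psim j A B" by simp
next
  assume AB: "psim j A B"
  have "psim j A X \<longleftrightarrow> psim j B X" for X
    by (rule iffI; erule psim_trans[OF psim_sym[OF AB A B]] psim_trans[OF AB])
  then show "plev j (P.cls n A) = plev j (P.cls n B)"
    unfolding plev_cls[OF A] plev_cls[OF B] by simp
qed

lemma psim_mult:
  assumes "psim j A B" "A \<in> carrier S" "B \<in> carrier S" "X \<in> carrier S" "Y \<in> carrier S"
  shows "psim j (X \<otimes>\<^bsub>S\<^esub> A \<otimes>\<^bsub>S\<^esub> Y) (X \<otimes>\<^bsub>S\<^esub> B \<otimes>\<^bsub>S\<^esub> Y)"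
proof -
  let ?N = "int q ^ Suc j" and ?l = "lm (Suc j)"
  obtain c where c: "mcong ?N n (?l A) (c \<cdot>\<^sub>m ?l B)" using assms(1) by (auto simp: psim_def)
  have e: "mcong ?N n (?l (X \<otimes>\<^bsub>S\<^esub> D \<otimes>\<^bsub>S\<^esub> Y)) (?l X * ?l D * ?l Y)" if "D \<in> carrier S" for D
    by (rule mcong_trans[OF P.SL_lm_mult mcong_mult[OF P.SL_lm_mult mcong_refl]]) (use assms that in auto)
  have "mcong ?N n (?l X * ?l A * ?l Y) (?l X * (c \<cdot>\<^sub>m ?l B) * ?l Y)"
    by (rule mcong_mult[OF mcong_mult[OF mcong_refl c] mcong_refl])
      (auto intro!: mult_carrier_mat[OF P.lm_carrier smult_carrier_mat])
  also have "?l X * (c \<cdot>\<^sub>m ?l B) * ?l Y = c \<cdot>\<^sub>m (?l X * ?l B * ?l Y)"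
    by (simp add: mult_smult_distrib[OF P.lm_carrier P.lm_carrier]
        mult_smult_assoc_mat[OF P.lm_mult_carrier P.lm_carrier])
  also have "mcong ?N n (c \<cdot>\<^sub>m (?l X * ?l B * ?l Y)) (c \<cdot>\<^sub>m ?l (X \<otimes>\<^bsub>S\<^esub> B \<otimes>\<^bsub>S\<^esub> Y))"
    by (rule mcong_smult[OF mcong_sym[OF e[OF assms(3)]]]) (auto intro!: mult_carrier_mat[OF P.lm_mult_carrier P.lm_carrier])
  finally (mcong_trans) have "mcong ?N n (?l X * ?l A * ?l Y) (c \<cdot>\<^sub>m ?l (X \<otimes>\<^bsub>S\<^esub> B \<otimes>\<^bsub>S\<^esub> Y))" .
  then show ?thesis unfolding psim_def using mcong_trans[OF e[OF assms(2)]] by blast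
qed

lemma psim_mono:
  assumes "psim (Suc j) A B" "A \<in> carrier S" "B \<in> carrier S"
  shows "psim j A B"
proof -
  let ?N = "int q ^ Suc j"
  obtain c where "mcong (int q ^ Suc (Suc j)) n (lm (Suc (Suc j)) A) (c \<cdot>\<^sub>m lm (Suc (Suc j)) B)"
    using assms(1) by (auto simp: psim_def)
  then have "mcong ?N n (lm (Suc (Suc j)) A) (c \<cdot>\<^sub>m lm (Suc (Suc j)) B)" by (rule mcong_dvd) simp
  moreover have "mcong ?N n (lm (Suc j) A) (lm (Suc (Suc j)) A)"
    by (rule mcong_sym[OF lm_coh[OF P.SL_mat_carrier[OF assms(2)]]]) simp
  moreover have "mcong ?N n (c \<cdot>\<^sub>m lm (Suc (Suc j)) B) (c \<cdot>\<^sub>m lm (Suc j) B)"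
    by (rule mcong_smult[OF lm_coh[OF P.SL_mat_carrier[OF assms(3)]]]) auto
  ultimately have "mcong ?N n (lm (Suc j) A) (c \<cdot>\<^sub>m lm (Suc j) B)" by (blast intro: mcong_trans)
  then show ?thesis by (auto simp: psim_def)
qed

text \<open>The quotient \<open>W\<close> of the two matrices is scalar at every level, hence
  central by \<open>scalar_center\<close>. Level 0 is trivial because its modulus is 1.\<close>

lemma psim_all:
  assumes "\<And>j. psim j A B" and A: "A \<in> carrier S" and B: "B \<in> carrier S"
  shows "P.cls n A = P.cls n B"
proof -
  define W where "W = A \<otimes>\<^bsub>S\<^esub> inv\<^bsub>S\<^esub> B"
  have W: "W \<in> carrier S" and AW: "A = W \<otimes>\<^bsub>S\<^esub> B" using A B by (auto simp: W_def G.m_assoc)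
  have "\<exists>c. mcong (int q ^ k) n (lm k W) (c \<cdot>\<^sub>m 1\<^sub>m n)" for k
  proof (cases k)
    case 0
    then show ?thesis by (auto simp: mcong_def)
  next
    case (Suc j)
    let ?N = "int q ^ k"
    obtain c where c: "mcong ?N n (lm k A) (c \<cdot>\<^sub>m lm k B)" using assms(1)[of j] Suc by (auto simp: psim_def)
    have iB: "inv\<^bsub>S\<^esub> B \<in> carrier S" using B by simp
    have "mcong ?N n (lm k W) (lm k A * lm k (inv\<^bsub>S\<^esub> B))" unfolding W_def by (rule P.SL_lm_mult[OF A iB])
    also have "mcong ?N n (lm k A * lm k (inv\<^bsub>S\<^esub> B)) (c \<cdot>\<^sub>m lm k B * lm k (inv\<^bsub>S\<^esub> B))"
      by (rule mcong_mult[OF c mcong_refl]) auto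
    also have "c \<cdot>\<^sub>m lm k B * lm k (inv\<^bsub>S\<^esub> B) = c \<cdot>\<^sub>m (lm k B * lm k (inv\<^bsub>S\<^esub> B))"
      by (rule mult_smult_assoc_mat[OF P.lm_carrier P.lm_carrier])
    also have "mcong ?N n (c \<cdot>\<^sub>m (lm k B * lm k (inv\<^bsub>S\<^esub> B))) (c \<cdot>\<^sub>m 1\<^sub>m n)"
    proof (rule mcong_smult)
      have "mcong ?N n (lm k (B \<otimes>\<^bsub>S\<^esub> inv\<^bsub>S\<^esub> B)) (1\<^sub>m n)"
        unfolding G.r_inv[OF B] by (rule lm_SL_one)
      then show "mcong ?N n (lm k B * lm k (inv\<^bsub>S\<^esub> B)) (1\<^sub>m n)"
        by (rule mcong_trans[OF mcong_sym[OF P.SL_lm_mult[OF B iB]]])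
    qed auto
    finally (mcong_trans) show ?thesis by blast
  qed
  then have "W \<in> group_center S" by (rule P.scalar_center[OF W])
  then show ?thesis unfolding AW by (rule P.cls_eqI[OF B])
qed

text \<open>Write the matrix as \<open>c + q^m Y\<close>. Modulo \<open>q^(m + 1)\<close> its r-th
  power is \<open>c^r + r c^(r - 1) q^m Y\<close>, and the second term vanishes for
  \<open>r = q\<close>.\<close>

lemma scalar_pow:
  assumes X: "X \<in> carrier S" and m: "1 \<le> m" "Suc m \<le> k" and c: "mcong (int q ^ m) n (lm k X) (c \<cdot>\<^sub>m 1\<^sub>m n)"
  shows "\<exists>c'. mcong (int q ^ Suc m) n (lm k (X [^]\<^bsub>S\<^esub> q)) (c' \<cdot>\<^sub>m 1\<^sub>m n)"
proof -
  let ?N = "int q ^ Suc m" and ?Z = "lm k X"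
  have "\<exists>y. ?Z $$ (i, j) = c * (1\<^sub>m n) $$ (i, j) + int q ^ m * y" if "i < n" "j < n" for i j
  proof -
    have "[?Z $$ (i, j) = c * (1\<^sub>m n) $$ (i, j)] (mod int q ^ m)" using c that by (auto simp: mcong_def)
    then have "int q ^ m dvd ?Z $$ (i, j) - c * (1\<^sub>m n) $$ (i, j)" by (simp add: cong_iff_dvd_diff)
    then obtain y where "?Z $$ (i, j) - c * (1\<^sub>m n) $$ (i, j) = int q ^ m * y" by (elim dvdE)
    then have "?Z $$ (i, j) = c * (1\<^sub>m n) $$ (i, j) + int q ^ m * y" by linarith
    then show ?thesis by blast
  qed
  then have "\<forall>i j. \<exists>y. i < n \<longrightarrow> j < n \<longrightarrow> ?Z $$ (i, j) = c * (1\<^sub>m n) $$ (i, j) + int q ^ m * y" by blast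
  then obtain y where y: "\<forall>i j. i < n \<longrightarrow> j < n \<longrightarrow> ?Z $$ (i, j) = c * (1\<^sub>m n) $$ (i, j) + int q ^ m * y i j"
    unfolding choice_iff by blast
  define Y where "Y = mat n n (\<lambda>(i, j). y i j)"
  have Yc: "Y \<in> carrier_mat n n" by (simp add: Y_def)
  have YZ: "[(Y * ?Z) $$ (i, j) = c * y i j] (mod int q ^ m)" if "i < n" "j < n" for i j
    using P.scalar_mult(2)[OF c Yc P.lm_carrier] that Yc by (auto simp: mcong_def Y_def)
  \<comment> \<open>The linear coefficient of the binomial expansion. At \<open>r = 0\<close> the
    truncated exponent does no harm, because of the factor \<open>r\<close>.\<close>
  define d where "d r = int r * c ^ (r - 1) * int q ^ m" for r :: nat
  have main: "mcong ?N n (lm k (X [^]\<^bsub>S\<^esub> r)) (c ^ r \<cdot>\<^sub>m 1\<^sub>m n + d r \<cdot>\<^sub>m Y)" for r :: nat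
  proof (induction r)
    case 0
    from lm_SL_one[of k] have "mcong ?N n (lm k \<one>\<^bsub>S\<^esub>) (1\<^sub>m n)" by (rule mcong_dvd) (use m in \<open>simp only: le_imp_power_dvd\<close>)
    then show ?case using Yc by (auto simp: mcong_def d_def)
  next
    case (Suc r)
    have Xr: "X [^]\<^bsub>S\<^esub> r \<in> carrier S" using X by simp
    have "mcong (int q ^ k) n (lm k (X [^]\<^bsub>S\<^esub> Suc r)) (lm k (X [^]\<^bsub>S\<^esub> r) * ?Z)"
      using P.SL_lm_mult[OF Xr X, of k] by simp
    then have "mcong ?N n (lm k (X [^]\<^bsub>S\<^esub> Suc r)) (lm k (X [^]\<^bsub>S\<^esub> r) * ?Z)"
      by (rule mcong_dvd) (use m in \<open>simp only: le_imp_power_dvd\<close>)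
    also have "mcong ?N n (lm k (X [^]\<^bsub>S\<^esub> r) * ?Z) ((c ^ r \<cdot>\<^sub>m 1\<^sub>m n + d r \<cdot>\<^sub>m Y) * ?Z)"
      by (rule mcong_mult[OF Suc mcong_refl]) (use Yc in auto)
    also have "(c ^ r \<cdot>\<^sub>m 1\<^sub>m n + d r \<cdot>\<^sub>m Y) * ?Z = c ^ r \<cdot>\<^sub>m ?Z + d r \<cdot>\<^sub>m (Y * ?Z)"
    proof -
      have "(c ^ r \<cdot>\<^sub>m 1\<^sub>m n + d r \<cdot>\<^sub>m Y) * ?Z = c ^ r \<cdot>\<^sub>m 1\<^sub>m n * ?Z + d r \<cdot>\<^sub>m Y * ?Z"
        by (rule add_mult_distrib_mat[OF _ _ P.lm_carrier]) (use Yc in auto)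
      then show ?thesis
        by (simp only: mult_smult_assoc_mat[OF one_carrier_mat P.lm_carrier] mult_smult_assoc_mat[OF Yc P.lm_carrier]
            left_mult_one_mat[OF P.lm_carrier])
    qed
    also have "mcong ?N n (c ^ r \<cdot>\<^sub>m ?Z + d r \<cdot>\<^sub>m (Y * ?Z)) (c ^ Suc r \<cdot>\<^sub>m 1\<^sub>m n + d (Suc r) \<cdot>\<^sub>m Y)"
      unfolding mcong_def
    proof (intro allI impI)
      fix i j assume ij: "i < n" "j < n"
      \<comment> \<open>Replacing \<open>Y * ?Z\<close> by \<open>c\<close> times \<open>Y\<close>
        costs a multiple of \<open>q ^ m\<close>, and \<open>d r\<close> contains another;
        \<open>m \<ge> 1\<close> makes their product divisible by \<open>q ^ Suc m\<close>.\<close>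
      have "?N dvd int q ^ (m + m)" using m by (intro le_imp_power_dvd) auto
      then have dN: "[d r * (Y * ?Z) $$ (i, j) = d r * (c * y i j)] (mod ?N)"
      proof -
        obtain w where w: "(Y * ?Z) $$ (i, j) - c * y i j = int q ^ m * w"
          using YZ[OF ij] by (auto simp: cong_iff_dvd_diff)
        have "d r * (Y * ?Z) $$ (i, j) - d r * (c * y i j) = d r * (int q ^ m * w)"
          unfolding right_diff_distrib[symmetric] w ..
        also have "\<dots> = int q ^ (m + m) * (int r * c ^ (r - 1) * w)" by (simp add: d_def power_add mult_ac)
        finally show ?thesis using \<open>?N dvd int q ^ (m + m)\<close> by (simp only: cong_iff_dvd_diff dvd_mult2)
      qed
      have "[c ^ r * ?Z $$ (i, j) + d r * (Y * ?Z) $$ (i, j) =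
         c ^ r * (c * (1\<^sub>m n) $$ (i, j) + int q ^ m * y i j) + d r * (c * y i j)] (mod ?N)"
        using y ij by (intro cong_add dN) auto
      also have "c ^ r * (c * (1\<^sub>m n) $$ (i, j) + int q ^ m * y i j) + d r * (c * y i j) =
         c ^ Suc r * (1\<^sub>m n) $$ (i, j) + d (Suc r) * y i j"
        by (cases r) (simp_all add: d_def algebra_simps)
      finally have *: "[c ^ r * ?Z $$ (i, j) + d r * (Y * ?Z) $$ (i, j) =
         c ^ Suc r * (1\<^sub>m n) $$ (i, j) + d (Suc r) * y i j] (mod ?N)" .
      have dims: "dim_row (Y * ?Z) = n" "dim_col (Y * ?Z) = n" "dim_row ?Z = n" "dim_col ?Z = n" "dim_row Y = n" "dim_col Y = n"
        using Yc by (auto simp: P.lm_def)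
      have "Y $$ (i, j) = y i j" using ij by (simp add: Y_def)
      then show "[(c ^ r \<cdot>\<^sub>m ?Z + d r \<cdot>\<^sub>m (Y * ?Z)) $$ (i, j) = (c ^ Suc r \<cdot>\<^sub>m 1\<^sub>m n + d (Suc r) \<cdot>\<^sub>m Y) $$ (i, j)] (mod ?N)"
        using * ij by (simp only: index_add_mat index_smult_mat index_one_mat(2,3) dims)
    qed
    finally (mcong_trans) show ?case .
  qed
  have "mcong ?N n (c ^ q \<cdot>\<^sub>m 1\<^sub>m n + d q \<cdot>\<^sub>m Y) (c ^ q \<cdot>\<^sub>m 1\<^sub>m n)"
    using Yc by (auto simp: mcong_def d_def cong_iff_dvd_diff mult_ac)
  then show ?thesis using mcong_trans[OF main] by blast
qed

text \<open>Level 0 says that the matrix is scalar modulo \<open>q\<close>. Each further q-th power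
  improves this by one power of \<open>q\<close>.\<close>

lemma psim_torsion:
  assumes X: "X \<in> carrier S" and 0: "psim 0 X \<one>\<^bsub>S\<^esub>"
  shows "psim j (X [^]\<^bsub>S\<^esub> (q ^ j)) \<one>\<^bsub>S\<^esub>"
proof -
  let ?k = "Suc j"
  have one: "mcong (int q ^ l) n (c \<cdot>\<^sub>m lm l \<one>\<^bsub>S\<^esub>) (c \<cdot>\<^sub>m 1\<^sub>m n)" for c l
    by (rule mcong_smult[OF lm_SL_one]) auto
  have "\<exists>c. mcong (int q ^ Suc m) n (lm ?k (X [^]\<^bsub>S\<^esub> (q ^ m))) (c \<cdot>\<^sub>m 1\<^sub>m n)" if "m \<le> j" for m
    using that
  proof (induction m)
    case 0
    obtain c where "mcong (int q ^ 1) n (lm 1 X) (c \<cdot>\<^sub>m lm 1 \<one>\<^bsub>S\<^esub>)" using assms(2) by (auto simp: psim_def)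
    from mcong_trans[OF this one] have c: "mcong (int q ^ 1) n (lm 1 X) (c \<cdot>\<^sub>m 1\<^sub>m n)" .
    have "mcong (int q ^ 1) n (lm ?k X) (lm 1 X)" by (rule lm_coh[OF P.SL_mat_carrier[OF X]]) simp
    from mcong_trans[OF this c] show ?case using X by (intro exI[of _ c]) simp
  next
    case (Suc m)
    then obtain c where c: "mcong (int q ^ Suc m) n (lm ?k (X [^]\<^bsub>S\<^esub> (q ^ m))) (c \<cdot>\<^sub>m 1\<^sub>m n)" by auto
    have "\<exists>c'. mcong (int q ^ Suc (Suc m)) n (lm ?k ((X [^]\<^bsub>S\<^esub> (q ^ m)) [^]\<^bsub>S\<^esub> q)) (c' \<cdot>\<^sub>m 1\<^sub>m n)"
      by (rule scalar_pow[OF _ _ _ c]) (use X Suc.prems in auto)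
    then show ?case using X by (simp add: G.nat_pow_pow mult.commute)
  qed
  from this[of j] obtain c where "mcong (int q ^ ?k) n (lm ?k (X [^]\<^bsub>S\<^esub> (q ^ j))) (c \<cdot>\<^sub>m 1\<^sub>m n)" by auto
  from mcong_trans[OF this mcong_sym[OF one]] show ?thesis by (auto simp: psim_def)
qed

lemma cls_pow:
  assumes "X \<in> carrier S"
  shows "P.cls n X [^]\<^bsub>PSL n (padic_int q)\<^esub> (r::nat) = P.cls n (X [^]\<^bsub>S\<^esub> r)"
proof (induction r)
  case 0
  show ?case by (simp add: P.cls_one)
next
  case (Suc r)
  then show ?case using P.cls_mult[OF G.nat_pow_closed[OF assms] assms] by simp
qed

lemma lev_group_PSL: "lev_group (PSL n (padic_int q)) plev q"
proof (intro lev_group.intro lev_group_axioms.intro)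
  let ?Q = "PSL n (padic_int q)"
  show "Group.group ?Q" by (rule P.group_PSL)
  show "countable (plev j ` carrier ?Q)" for j
  proof -
    define I where "I = {..<n} \<times> {..<n}"
    have "countable (I \<rightarrow>\<^sub>E (UNIV :: int set))" by (rule countable_PiE) (auto simp: I_def)
    \<comment> \<open>A class is determined by the residues of one representative at level
      \<open>Suc j\<close>, which form an integer matrix.\<close>
    moreover have "plev j ` carrier ?Q \<subseteq> (\<lambda>f. {B \<in> carrier S. \<exists>c. mcong (int q ^ Suc j) n (mat n n f) (c \<cdot>\<^sub>m lm (Suc j) B)}) ` (I \<rightarrow>\<^sub>E (UNIV :: int set))"
    proof
      fix v assume "v \<in> plev j ` carrier ?Q"
      then obtain A where A: "A \<in> carrier S" "v = plev j (P.cls n A)" by (auto simp: P.carrier_PSL)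
      define f where "f = restrict (\<lambda>ij. A ij (Suc j)) I"
      have "mat n n f = lm (Suc j) A" by (auto simp: P.lm_def f_def I_def)
      then have "v = {B \<in> carrier S. \<exists>c. mcong (int q ^ Suc j) n (mat n n f) (c \<cdot>\<^sub>m lm (Suc j) B)}"
        by (simp add: A(2) plev_cls[OF A(1)] psim_def)
      moreover have "f \<in> I \<rightarrow>\<^sub>E UNIV" by (simp add: f_def)
      ultimately show "v \<in> (\<lambda>f. {B \<in> carrier S. \<exists>c. mcong (int q ^ Suc j) n (mat n n f) (c \<cdot>\<^sub>m lm (Suc j) B)}) ` (I \<rightarrow>\<^sub>E UNIV)"
        by blast
    qed
    ultimately show ?thesis by (blast intro: countable_subset[OF _ countable_image])
  qed
  show "plev j (a \<otimes>\<^bsub>?Q\<^esub> x \<otimes>\<^bsub>?Q\<^esub> b) = plev j (a \<otimes>\<^bsub>?Q\<^esub> y \<otimes>\<^bsub>?Q\<^esub> b)"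
    if xy: "x \<in> carrier ?Q" "y \<in> carrier ?Q" "a \<in> carrier ?Q" "b \<in> carrier ?Q" "plev j x = plev j y" for x y a b j
  proof -
    obtain X Y A B where r: "X \<in> carrier S" "x = P.cls n X" "Y \<in> carrier S" "y = P.cls n Y"
      "A \<in> carrier S" "a = P.cls n A" "B \<in> carrier S" "b = P.cls n B"
      using xy(1-4) unfolding P.carrier_PSL by blast
    have "psim j X Y" using xy(5) r plev_eq by simp
    then have "psim j (A \<otimes>\<^bsub>S\<^esub> X \<otimes>\<^bsub>S\<^esub> B) (A \<otimes>\<^bsub>S\<^esub> Y \<otimes>\<^bsub>S\<^esub> B)" by (rule psim_mult) (use r in auto)
    then show ?thesis using r by (simp add: P.cls_mult plev_eq)
  qed
  show "plev j x = plev j y" if xy: "x \<in> carrier ?Q" "y \<in> carrier ?Q" "plev (Suc j) x = plev (Suc j) y" for x y j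
  proof -
    obtain X Y where r: "X \<in> carrier S" "x = P.cls n X" "Y \<in> carrier S" "y = P.cls n Y"
      using xy(1,2) unfolding P.carrier_PSL by blast
    then show ?thesis using xy(3) psim_mono[of j X Y] by (simp add: plev_eq)
  qed
  show "x = y" if xy: "x \<in> carrier ?Q" "y \<in> carrier ?Q" "\<And>j. plev j x = plev j y" for x y
  proof -
    obtain X Y where r: "X \<in> carrier S" "x = P.cls n X" "Y \<in> carrier S" "y = P.cls n Y"
      using xy(1,2) unfolding P.carrier_PSL by blast
    then show ?thesis using xy(3) psim_all[of X Y] by (simp add: plev_eq)
  qed
  show "\<exists>e. plev j (x [^]\<^bsub>?Q\<^esub> (q ^ e)) = plev j \<one>\<^bsub>?Q\<^esub>"
    if x: "x \<in> carrier ?Q" "plev 0 x = plev 0 \<one>\<^bsub>?Q\<^esub>" for x j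
  proof -
    obtain X where r: "X \<in> carrier S" "x = P.cls n X" using x(1) unfolding P.carrier_PSL by blast
    have "psim 0 X \<one>\<^bsub>S\<^esub>" using x(2) r by (simp add: P.cls_one plev_eq)
    then have "psim j (X [^]\<^bsub>S\<^esub> (q ^ j)) \<one>\<^bsub>S\<^esub>" by (rule psim_torsion[OF r(1)])
    then have "plev j (x [^]\<^bsub>?Q\<^esub> (q ^ j)) = plev j \<one>\<^bsub>?Q\<^esub>" using r by (simp add: cls_pow P.cls_one plev_eq)
    then show ?thesis by blast
  qed
qed

end

section \<open>The topology on the quotient\<close>

definition level_nbhd :: "nat \<Rightarrow> nat \<Rightarrow> nat \<Rightarrow> (nat \<times> nat \<Rightarrow> nat \<Rightarrow> int) \<Rightarrow> (nat \<times> nat \<Rightarrow> nat \<Rightarrow> int) set" where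
  "level_nbhd n p k A = {B \<in> carrier (SL n (padic_int p)). \<forall>ij\<in>{..<n} \<times> {..<n}. B ij k = A ij k}"

lemma topspace_SL_padic: "topspace (SL_padic_topology n p) = carrier (SL n (padic_int p))"
  by (auto simp: SL_padic_topology_def padic_topology_def SL_def mat_carrier_def)

lemma openin_level_nbhd: "openin (SL_padic_topology n p) (level_nbhd n p k A)"
proof -
  let ?I = "{..<n} \<times> {..<n}"
  have o: "openin (padic_topology p) {b \<in> carrier (padic_int p). b k = r}" for r
  proof -
    have "openin (product_topology (\<lambda>k. discrete_topology UNIV) UNIV) (\<Pi>\<^sub>E l\<in>UNIV. if l = k then {r} else UNIV)"
      by (rule product_topology_basis) (auto intro: finite_subset[of _ "{k}"])
    moreover have "{b \<in> carrier (padic_int p). b k = r} = (\<Pi>\<^sub>E l\<in>UNIV. if l = k then {r} else UNIV) \<inter> carrier (padic_int p)"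
      by (auto simp: PiE_iff) (metis (full_types) singletonD)
    ultimately show ?thesis unfolding padic_topology_def openin_subtopology by blast
  qed
  have "openin (product_topology (\<lambda>_. padic_topology p) ?I) (\<Pi>\<^sub>E ij\<in>?I. {b \<in> carrier (padic_int p). b k = A ij k})"
    by (subst openin_PiE) (auto simp: o)
  moreover have "level_nbhd n p k A = (\<Pi>\<^sub>E ij\<in>?I. {b \<in> carrier (padic_int p). b k = A ij k}) \<inter> carrier (SL n (padic_int p))"
  proof (intro equalityI subsetI)
    fix B assume "B \<in> level_nbhd n p k A"
    then have B: "B \<in> carrier (SL n (padic_int p))" "\<And>ij. ij \<in> ?I \<Longrightarrow> B ij k = A ij k"
      unfolding level_nbhd_def by blast+
    then have Bc: "B \<in> ?I \<rightarrow>\<^sub>E carrier (padic_int p)" by (simp add: SL_def mat_carrier_def)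
    have "B \<in> (\<Pi>\<^sub>E ij\<in>?I. {b \<in> carrier (padic_int p). b k = A ij k})"
      using B(2) PiE_mem[OF Bc] PiE_arb[OF Bc] by (intro PiE_I) blast+
    then show "B \<in> (\<Pi>\<^sub>E ij\<in>?I. {b \<in> carrier (padic_int p). b k = A ij k}) \<inter> carrier (SL n (padic_int p))"
      using B(1) by blast
  next
    fix B assume B: "B \<in> (\<Pi>\<^sub>E ij\<in>?I. {b \<in> carrier (padic_int p). b k = A ij k}) \<inter> carrier (SL n (padic_int p))"
    then have "B \<in> (\<Pi>\<^sub>E ij\<in>?I. {b \<in> carrier (padic_int p). b k = A ij k})" by blast
    from PiE_mem[OF this] show "B \<in> level_nbhd n p k A" unfolding level_nbhd_def using B by blast
  qed
  ultimately show ?thesis unfolding SL_padic_topology_def openin_subtopology by blast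
qed

lemma padic_level_mono:
  assumes "a \<in> carrier (padic_int p)" "b \<in> carrier (padic_int p)" "a k = b k" "l \<le> k"
  shows "a l = b l"
  using assms(4,3)
proof (induction k rule: dec_induct)
  case (step k)
  then show ?case using padic_intD(3)[OF assms(1), of k] padic_intD(3)[OF assms(2), of k] by metis
qed

lemma padic_open_level:
  assumes "openin (padic_topology p) U" "a \<in> U"
  obtains k where "\<And>b. b \<in> carrier (padic_int p) \<Longrightarrow> b k = a k \<Longrightarrow> b \<in> U"
proof -
  obtain W where W: "openin (product_topology (\<lambda>k. discrete_topology (UNIV :: int set)) UNIV) W" "U = W \<inter> carrier (padic_int p)"
    using assms(1) unfolding padic_topology_def openin_subtopology by blast
  then have "a \<in> W" and a: "a \<in> carrier (padic_int p)" using assms(2) by auto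
  then obtain V where V: "finite {l. V l \<noteq> (UNIV :: int set)}" "a \<in> Pi\<^sub>E UNIV V" "Pi\<^sub>E UNIV V \<subseteq> W"
    using W(1) unfolding openin_product_topology_alt by auto
  define k where "k = Max (insert 0 {l. V l \<noteq> UNIV})"
  have "b \<in> U" if b: "b \<in> carrier (padic_int p)" "b k = a k" for b
  proof -
    have "b l \<in> V l" for l
    proof (cases "V l = UNIV")
      case False
      then have "l \<le> k" unfolding k_def using V(1) by (intro Max_ge) auto
      then have "b l = a l" using padic_level_mono[OF b(1) a b(2)] by blast
      then show ?thesis using V(2) by (auto simp: PiE_iff)
    qed simp
    then show ?thesis using V(3) b W(2) by (auto simp: PiE_iff)
  qed
  then show thesis by (rule that)
qed

text \<open>Around a point an open set can be shrunk to constraints on finitely many levels of each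
  entry. A residue determines those of lower level, so the largest level implies all
  constraints.\<close>

lemma SL_open_level:
  assumes V: "openin (SL_padic_topology n p) V" and A: "A \<in> V"
  obtains k where "level_nbhd n p k A \<subseteq> V"
proof -
  let ?I = "{..<n} \<times> {..<n}"
  obtain W where W: "openin (product_topology (\<lambda>_. padic_topology p) ?I) W" "V = W \<inter> carrier (SL n (padic_int p))"
    using V unfolding SL_padic_topology_def openin_subtopology by blast
  then have "A \<in> W" and AS: "A \<in> carrier (SL n (padic_int p))" using A by auto
  then obtain U where U: "\<And>i. i \<in> ?I \<Longrightarrow> openin (padic_topology p) (U i)" "A \<in> Pi\<^sub>E ?I U" "Pi\<^sub>E ?I U \<subseteq> W"
    using W(1) unfolding openin_product_topology_alt by metis
  have "\<exists>k. \<forall>b. b \<in> carrier (padic_int p) \<longrightarrow> b k = A i k \<longrightarrow> b \<in> U i" if "i \<in> ?I" for i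
  proof -
    have "A i \<in> U i" using U(2) that by (auto simp: PiE_iff)
    from padic_open_level[OF U(1)[OF that] this] show ?thesis by metis
  qed
  then have "\<forall>i. \<exists>k. i \<in> ?I \<longrightarrow> (\<forall>b. b \<in> carrier (padic_int p) \<longrightarrow> b k = A i k \<longrightarrow> b \<in> U i)" by blast
  then obtain K where K: "\<forall>i. i \<in> ?I \<longrightarrow> (\<forall>b. b \<in> carrier (padic_int p) \<longrightarrow> b (K i) = A i (K i) \<longrightarrow> b \<in> U i)"
    unfolding choice_iff by blast
  define k where "k = Max (insert 0 (K ` ?I))"
  have Kk: "K i \<le> k" if "i \<in> ?I" for i unfolding k_def using that by (intro Max_ge) auto
  have "level_nbhd n p k A \<subseteq> V"
  proof
    fix B assume B: "B \<in> level_nbhd n p k A"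
    then have BS: "B \<in> carrier (SL n (padic_int p))" by (simp add: level_nbhd_def)
    have c: "A i \<in> carrier (padic_int p)" "B i \<in> carrier (padic_int p)" if "i \<in> ?I" for i
      using AS BS that by (auto simp: SL_def mat_carrier_def PiE_iff)
    have "B i \<in> U i" if i: "i \<in> ?I" for i
    proof -
      have "B i k = A i k" using B i by (auto simp: level_nbhd_def)
      then have "B i (K i) = A i (K i)" by (rule padic_level_mono[OF c(2)[OF i] c(1)[OF i] _ Kk[OF i]])
      then show ?thesis using K i c(2)[OF i] by blast
    qed
    moreover have "B \<in> extensional ?I" using BS by (auto simp: SL_def mat_carrier_def PiE_iff)
    ultimately have "B \<in> Pi\<^sub>E ?I U" by (simp only: PiE_iff) blast
    then show "B \<in> V" using U(3) W(2) BS by blast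
  qed
  then show thesis by (rule that)
qed

section \<open>Borel structure of the projective groups\<close>

lemma sets_borel_of: "sets (borel_of X) = sigma_sets (topspace X) {U. openin X U}"
  unfolding borel_of_def by (rule sets_measure_of) (auto dest: openin_subset)

context padic_PSL
begin

lemma space_borel_PSL: "space (borel_of (PSL_padic_topology n q)) = carrier (PSL n (padic_int q))"
  by (simp add: space_borel_of topspace_PSL_padic_topology)

lemma openin_PSL_iff:
  "openin (PSL_padic_topology n q) U \<longleftrightarrow> U \<subseteq> carrier (PSL n (padic_int q)) \<and>
    openin (SL_padic_topology n q) {A \<in> carrier S. P.cls n A \<in> U}"
  unfolding PSL_padic_topology_def openin_quotient_topology topspace_SL_padic P.carrier_PSL P.cls_def ..

text \<open>\<open>plev j\<close> depends only on residues at level \<open>Suc j\<close>. The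
  preimage in the special linear group is thus a union of level neighbourhoods, and the set is open
  in the quotient.\<close>

lemma plev_measurable: "{x \<in> carrier (PSL n (padic_int q)). plev j x = v} \<in> sets (borel_of (PSL_padic_topology n q))"
proof -
  let ?V = "{A \<in> carrier S. P.cls n A \<in> {x \<in> carrier (PSL n (padic_int q)). plev j x = v}}"
  have "openin (SL_padic_topology n q) ?V"
  proof (subst openin_subopen, intro ballI)
    fix A assume A: "A \<in> ?V"
    then have AS: "A \<in> carrier S" by simp
    have sub: "B \<in> ?V" if B: "B \<in> level_nbhd n q (Suc j) A" for B
    proof -
      have BS: "B \<in> carrier S" using B by (simp add: level_nbhd_def)
      have "lm (Suc j) A = lm (Suc j) B"
        unfolding P.lm_def by (rule cong_mat) (use B in \<open>auto simp: level_nbhd_def\<close>)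
      then have "psim j A B" using psim_refl[of j A] by (simp add: psim_def)
      then have "plev j (P.cls n A) = plev j (P.cls n B)" by (simp only: plev_eq[OF AS BS])
      then have "plev j (P.cls n B) = v" using A by simp
      then show ?thesis using BS by (simp add: P.carrier_PSL)
    qed
    have self: "A \<in> level_nbhd n q (Suc j) A" using AS by (simp add: level_nbhd_def)
    show "\<exists>T. openin (SL_padic_topology n q) T \<and> A \<in> T \<and> T \<subseteq> ?V"
      by (rule exI[of _ "level_nbhd n q (Suc j) A"], rule conjI[OF openin_level_nbhd conjI[OF self subsetI[OF sub]]])
  qed
  then have "openin (PSL_padic_topology n q) {x \<in> carrier (PSL n (padic_int q)). plev j x = v}"
    unfolding openin_PSL_iff by auto
  then show ?thesis unfolding sets_borel_of by (intro sigma_sets.Basic) simp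
qed

text \<open>Here \<open>chart_mat\<close> is a variable. The preimage of an open set is the union
  over \<open>k\<close> of the points whose entire level \<open>k\<close> neighbourhood lies in it,
  a condition that depends only on the level \<open>k\<close> data.\<close>

lemma measurable_cls:
  assumes M: "\<And>\<omega>. \<omega> \<in> space N \<Longrightarrow> chart_mat \<omega> \<in> carrier S"
    and lev: "\<And>k. \<omega>lev k \<in> N \<rightarrow>\<^sub>M count_space UNIV"
    and det: "\<And>k \<omega> \<omega>' ij. \<omega> \<in> space N \<Longrightarrow> \<omega>' \<in> space N \<Longrightarrow> \<omega>lev k \<omega> = \<omega>lev k \<omega>' \<Longrightarrow> chart_mat \<omega> ij k = chart_mat \<omega>' ij k"
  shows "(\<lambda>\<omega>. P.cls n (chart_mat \<omega>)) \<in> N \<rightarrow>\<^sub>M borel_of (PSL_padic_topology n q)"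
  unfolding borel_of_def
proof (rule measurable_measure_of)
  show "(\<lambda>\<omega>. P.cls n (chart_mat \<omega>)) \<in> space N \<rightarrow> topspace (PSL_padic_topology n q)"
    using M by (auto simp: topspace_PSL_padic_topology P.carrier_PSL)
  fix U assume "U \<in> {U. openin (PSL_padic_topology n q) U}"
  then have U: "openin (PSL_padic_topology n q) U" by simp
  define V where "V = {A \<in> carrier S. P.cls n A \<in> U}"
  have V: "openin (SL_padic_topology n q) V" using U by (simp add: openin_PSL_iff V_def)
  define W where "W k = {\<omega> \<in> space N. level_nbhd n q k (chart_mat \<omega>) \<subseteq> V}" for k
  have self: "chart_mat \<omega> \<in> level_nbhd n q k (chart_mat \<omega>)" if "\<omega> \<in> space N" for \<omega> k
    using M[OF that] by (simp add: level_nbhd_def)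
  have "(\<lambda>\<omega>. P.cls n (chart_mat \<omega>)) -` U \<inter> space N = (\<Union>k. W k)"
  proof (intro equalityI subsetI)
    fix \<omega> assume "\<omega> \<in> (\<lambda>\<omega>. P.cls n (chart_mat \<omega>)) -` U \<inter> space N"
    then have w: "\<omega> \<in> space N" "chart_mat \<omega> \<in> V" using M by (auto simp: V_def)
    obtain k where "level_nbhd n q k (chart_mat \<omega>) \<subseteq> V" by (rule SL_open_level[OF V w(2)])
    then show "\<omega> \<in> (\<Union>k. W k)" using w by (auto simp: W_def)
  next
    fix \<omega> assume "\<omega> \<in> (\<Union>k. W k)"
    then obtain k where "\<omega> \<in> space N" "level_nbhd n q k (chart_mat \<omega>) \<subseteq> V" by (auto simp: W_def)
    then show "\<omega> \<in> (\<lambda>\<omega>. P.cls n (chart_mat \<omega>)) -` U \<inter> space N" using self[of \<omega> k] by (auto simp: V_def)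
  qed
  moreover have "W k \<in> sets N" for k
  proof -
    have "W k = \<omega>lev k -` (\<omega>lev k ` W k) \<inter> space N"
    proof (intro equalityI subsetI)
      fix \<omega> assume "\<omega> \<in> \<omega>lev k -` (\<omega>lev k ` W k) \<inter> space N"
      then obtain \<omega>' where w: "\<omega> \<in> space N" "\<omega>' \<in> W k" "\<omega>lev k \<omega> = \<omega>lev k \<omega>'" by auto
      then have "\<omega>' \<in> space N" by (simp add: W_def)
      then have "level_nbhd n q k (chart_mat \<omega>) = level_nbhd n q k (chart_mat \<omega>')"
        using det[OF w(1) _ w(3)] by (simp add: level_nbhd_def)
      then show "\<omega> \<in> W k" using w by (simp add: W_def)
    qed (auto simp: W_def)
    then show ?thesis using measurable_sets[OF lev[of k], of "\<omega>lev k ` W k"] by simp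
  qed
  ultimately show "(\<lambda>\<omega>. P.cls n (chart_mat \<omega>)) -` U \<inter> space N \<in> sets N" by auto
qed (auto dest: openin_subset)

end

section \<open>Block matrices and the proof of incomparability\<close>

lemma det_mat_2: "det (mat 2 2 f :: int mat) = f (0, 0) * f (1, 1) - f (0, 1) * f (1, 0)"
proof -
  have s: "{0..<2::nat} = {0, 1}" by auto
  have p: "{\<sigma>. \<sigma> permutes {0..<2::nat}} = {id, Transposition.transpose 0 1}"
    unfolding s by (auto simp: permutes_doubleton_iff)
  have ne: "id \<noteq> Transposition.transpose (0::nat) 1" by (metis id_apply transpose_apply_first zero_neq_one)
  have "det (mat 2 2 f :: int mat) = (\<Sum>\<sigma>\<in>{id, Transposition.transpose 0 1}. signof \<sigma> * (\<Prod>i = 0..<2. mat 2 2 f $$ (i, \<sigma> i)))"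
    using det_def'[of "mat 2 2 f :: int mat" 2] p by simp
  then show ?thesis using ne by (simp add: s sign_swap_id)
qed

text \<open>A truncated geometric series: it inverts \<open>kdet\<close>, which is congruent to \<open>1\<close> modulo \<open>p\<close>, modulo \<open>p ^ j\<close>.\<close>

definition kinv :: "nat \<Rightarrow> (nat \<Rightarrow> bool \<times> bool \<Rightarrow> int) \<Rightarrow> nat \<Rightarrow> int" where
  "kinv p k j = (\<Sum>l<j. (1 - kdet p k j) ^ l)"

text \<open>The upper left block is the inverse of the matrix \<open>kap\<close>, the third column carries \<open>t\<close>, and the
  entry \<open>kdet\<close> makes the determinant \<open>1\<close>.\<close>

definition emat :: "nat \<Rightarrow> omega \<Rightarrow> nat \<Rightarrow> nat \<times> nat \<Rightarrow> int" where
  "emat p \<omega> j = (\<lambda>(r, c).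
     let k = kap p (fst \<omega>) j; e = kinv p (fst \<omega>) j; t = snd \<omega> j in
     if r = 0 then (if c = 0 then e * k True True else if c = 1 then - (e * k False True)
       else if c = 2 then e * (k True True * t False - k False True * t True) else 0)
     else if r = 1 then (if c = 0 then - (e * k True False) else if c = 1 then e * k False False
       else if c = 2 then e * (k False False * t True - k True False * t False) else 0)
     else if r = c then (if r = 2 then kdet p (fst \<omega>) j else 1) else 0)"

definition chart_mat :: "nat \<Rightarrow> nat \<Rightarrow> omega \<Rightarrow> nat \<times> nat \<Rightarrow> nat \<Rightarrow> int" where
  "chart_mat n p \<omega> = (\<lambda>ij\<in>{..<n} \<times> {..<n}. \<lambda>j. emat p \<omega> j ij mod int p ^ j)"

definition elemZ :: "nat \<Rightarrow> nat \<Rightarrow> nat \<Rightarrow> int \<Rightarrow> nat \<times> nat \<Rightarrow> int" where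
  "elemZ n a b s = (\<lambda>(i, j)\<in>{..<n} \<times> {..<n}. (if i = j then 1 else 0) + (if i = a \<and> j = b then s else 0))"

lemma elemZ_SL:
  assumes "a \<noteq> b"
  shows "elemZ n a b s \<in> carrier (SL n \<Z>)"
proof -
  have "Zr.lm n k (elemZ n a b s) = addrow_mat n s a b" for k
    unfolding Zr.lm_def addrow_mat_def using assms by (intro cong_mat) (auto simp: elemZ_def)
  then show ?thesis
    using assms by (auto simp: Zr.SL_carrier mat_carrier_def elemZ_def det_addrow_mat)
qed

lemma addrow_mat_mult_index:
  fixes X :: "int mat"
  assumes "X \<in> carrier_mat n n" "a \<noteq> b" "a < n" "b < n" "i < n" "j < n"
  shows "(addrow_mat n s a b * X) $$ (i, j) = X $$ (i, j) + (if i = a then s * X $$ (b, j) else 0)"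
proof -
  have E: "addrow_mat n s a b \<in> carrier_mat n n" by simp
  have Eij: "addrow_mat n s a b $$ (r, c) = (if r = c then 1 else 0) + (if r = a then (if c = b then s else 0) else 0)" if "r < n" "c < n" for r c
    using that assms(2) by (auto simp: addrow_mat_def)
  have "(addrow_mat n s a b * X) $$ (i, j) = (\<Sum>l = 0..<n. (if l = i then X $$ (l, j) else 0) + (if l = b then (if i = a then s * X $$ (l, j) else 0) else 0))"
    unfolding mult_mat_index[OF E assms(1) assms(5,6)] by (intro sum.cong refl) (use assms(2,5) Eij in \<open>auto simp del: index_mat_addrow_mat\<close>)
  then show ?thesis using assms by (simp add: sum.distrib)
qed

lemma mat_carrier: "mat n n f \<in> carrier_mat n n" by simp

lemma cong_if:
  assumes "P \<Longrightarrow> [a = b] (mod N)" "\<not> P \<Longrightarrow> [c = d] (mod N)"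
  shows "[(if P then a else c) = (if P then b else d)] (mod N)"
  using assms by simp

section \<open>The chart and the generators in its coordinates\<close>

locale SL_chart =
  fixes p n :: nat assumes prime_p: "prime p" and n3: "n \<ge> 3"
begin

lemma p1: "p > 1" using prime_p by (rule prime_gt_1_nat)
lemma p0: "p > 0" using p1 by simp

sublocale padic_PSL p n using p0 n3 by unfold_locales auto

lemma kdet_one: "[kdet p k j = 1] (mod int p)"
proof -
  have "[kdet p k j = 1 * 1 - 0 * 0] (mod int p)"
    unfolding kdet_def kap_def by (intro cong_diff cong_mult) (simp_all add: cong_def mod_simps)
  then show ?thesis by simp
qed

lemma kinv_kdet: "[kinv p k j * kdet p k j = 1] (mod int p ^ j)"
proof -
  let ?x = "1 - kdet p k j"
  have "kinv p k j * kdet p k j = 1 - ?x ^ j"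
    using one_diff_power_eq[of ?x j] by (simp add: kinv_def mult.commute)
  moreover have "int p dvd ?x" using kdet_one[of k j] by (simp add: cong_iff_dvd_diff dvd_diff_commute)
  then have "int p ^ j dvd ?x ^ j" by (rule dvd_power_same)
  ultimately show ?thesis by (simp add: cong_iff_dvd_diff)
qed

text \<open>Inverses modulo \<open>p ^ l\<close> are unique, so series truncated at different
  lengths agree there.\<close>

lemma kinv_unique:
  assumes "[kdet p k j = kdet p k' j'] (mod int p ^ l)" "l \<le> j" "l \<le> j'"
  shows "[kinv p k j = kinv p k' j'] (mod int p ^ l)"
proof -
  let ?N = "int p ^ l"
  have 1: "[kinv p k j * kdet p k j = 1] (mod ?N)" "[kinv p k' j' * kdet p k' j' = 1] (mod ?N)"
    using kinv_kdet assms(2,3) by (blast intro: cong_dvd_modulus le_imp_power_dvd)+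
  have "[kinv p k j * 1 = kinv p k j * (kinv p k' j' * kdet p k' j')] (mod ?N)"
    by (rule cong_scalar_left[OF cong_sym[OF 1(2)]])
  also have "[kinv p k j * (kinv p k' j' * kdet p k' j') = kinv p k j * (kinv p k' j' * kdet p k j)] (mod ?N)"
    by (intro cong_scalar_left cong_sym[OF assms(1)])
  also have "kinv p k j * (kinv p k' j' * kdet p k j) = kinv p k' j' * (kinv p k j * kdet p k j)" by simp
  also have "[kinv p k' j' * (kinv p k j * kdet p k j) = kinv p k' j' * 1] (mod ?N)"
    by (rule cong_scalar_left[OF 1(1)])
  finally show ?thesis by simp
qed

text \<open>Entries are polynomials in \<open>kap\<close>, \<open>kinv\<close>, \<open>kdet\<close>
  and \<open>t\<close>. Two points and two levels are allowed, which yields both the coherence of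
  one matrix and its dependence on residues alone.\<close>

lemma emat_cong:
  assumes k: "\<And>r c. [kap p (fst \<omega>) j r c = kap p (fst \<omega>') j' r c] (mod int p ^ l)"
    and t: "\<And>i. [snd \<omega> j i = snd \<omega>' j' i] (mod int p ^ l)" and l: "l \<le> j" "l \<le> j'"
  shows "[emat p \<omega> j ij = emat p \<omega>' j' ij] (mod int p ^ l)"
proof -
  have d: "[kdet p (fst \<omega>) j = kdet p (fst \<omega>') j'] (mod int p ^ l)"
    unfolding kdet_def by (intro cong_diff cong_mult k)
  have e: "[kinv p (fst \<omega>) j = kinv p (fst \<omega>') j'] (mod int p ^ l)" by (rule kinv_unique[OF d l])
  obtain r c where ij: "ij = (r, c)" by (cases ij)
  show ?thesis
    unfolding emat_def ij Let_def prod.case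
    by (intro cong_if cong_diff cong_add cong_mult cong_minus_minus_iff[THEN iffD2] k t d e cong_refl)
qed

lemma Omega_in: "\<omega> \<in> space (Omega p) \<Longrightarrow> fst \<omega> \<in> zspace p \<and> snd \<omega> \<in> zspace p"
  by (auto simp: space_pair_measure)

lemma chart_mat_mat_carrier:
  assumes "\<omega> \<in> space (Omega p)"
  shows "chart_mat n p \<omega> \<in> mat_carrier n (padic_int p)"
proof -
  have "(\<lambda>j. emat p \<omega> j ij mod int p ^ j) \<in> carrier (padic_int p)" for ij
  proof (rule padic_intI[OF p0, where b = "\<lambda>j. emat p \<omega> j ij"])
    show "emat p \<omega> (Suc k) ij mod int p ^ k = emat p \<omega> k ij mod int p ^ k" for k
    proof -
      have "[emat p \<omega> (Suc k) ij = emat p \<omega> k ij] (mod int p ^ k)"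
        by (rule emat_cong) (use Omega_in[OF assms] in \<open>auto intro: kap_cong[OF p1] zspace_cong\<close>)
      then show ?thesis by (simp add: cong_def)
    qed
  qed simp
  then show ?thesis by (auto simp: chart_mat_def mat_carrier_def)
qed

lemma lm_chart_mat: "mcong (int p ^ j) n (lm j (chart_mat n p \<omega>)) (mat n n (emat p \<omega> j))"
  by (auto simp: mcong_def P.lm_index chart_mat_def cong_def)

lemma det_emat: "det (mat n n (emat p \<omega> j)) =
   (kinv p (fst \<omega>) j)\<^sup>2 * kdet p (fst \<omega>) j * kdet p (fst \<omega>) j"
proof -
  define A where "A = mat 2 2 (emat p \<omega> j)"
  define B where "B = mat 2 (n - 2) (\<lambda>(r, c). emat p \<omega> j (r, c + 2))"
  define D where "D = mat (n - 2) (n - 2) (\<lambda>(r, c). emat p \<omega> j (r + 2, c + 2))"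
  have "mat n n (emat p \<omega> j) = four_block_mat A B (0\<^sub>m (n - 2) 2) D"
  proof (rule eq_matI)
    fix r c assume rc: "r < dim_row (four_block_mat A B (0\<^sub>m (n - 2) 2) D)" "c < dim_col (four_block_mat A B (0\<^sub>m (n - 2) 2) D)"
    then have rn: "r < n" "c < n" using n3 by (auto simp: A_def D_def)
    have z: "emat p \<omega> j (r, c) = 0" if "r \<ge> 2" "c < 2" using that by (auto simp: emat_def)
    show "mat n n (emat p \<omega> j) $$ (r, c) = four_block_mat A B (0\<^sub>m (n - 2) 2) D $$ (r, c)"
    proof -
      have s2: "Suc (Suc (x - 2)) = x" if "\<not> x < 2" for x :: nat using that by arith
      show ?thesis using rc rn z by (auto simp: A_def B_def D_def s2)
    qed
  qed (use n3 in \<open>auto simp: A_def D_def\<close>)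
  moreover have "det (four_block_mat A B (0\<^sub>m (n - 2) 2) D) = det A * det D"
    by (rule det_four_block_mat_lower_left_zero) (auto simp: A_def B_def D_def)
  moreover have "det A = (kinv p (fst \<omega>) j)\<^sup>2 * kdet p (fst \<omega>) j"
    unfolding A_def det_mat_2 by (simp add: emat_def Let_def kdet_def power2_eq_square algebra_simps)
  moreover have "det D = kdet p (fst \<omega>) j"
  proof -
    have "det D = prod_list (diag_mat D)"
      by (rule det_upper_triangular[of _ "n - 2"]) (auto simp: D_def upper_triangular_def emat_def)
    also have "\<dots> = (\<Prod>i\<in>{0..<n - 2}. D $$ (i, i))" by (simp add: prod_list_diag_prod D_def)
    also have "\<dots> = (\<Prod>i\<in>{0..<n - 2}. if i = 0 then kdet p (fst \<omega>) j else 1)"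
      by (intro prod.cong) (auto simp: D_def emat_def)
    also have "\<dots> = kdet p (fst \<omega>) j" using n3 by (simp add: prod.delta)
    finally show ?thesis .
  qed
  ultimately show ?thesis by simp
qed

lemma chart_mat_SL:
  assumes "\<omega> \<in> space (Omega p)"
  shows "chart_mat n p \<omega> \<in> carrier S"
proof -
  have "[det (lm j (chart_mat n p \<omega>)) = 1] (mod int p ^ j)" for j
  proof -
    let ?e = "kinv p (fst \<omega>) j" and ?d = "kdet p (fst \<omega>) j"
    have "[det (lm j (chart_mat n p \<omega>)) = det (mat n n (emat p \<omega> j))] (mod int p ^ j)"
      by (rule mcong_det[OF lm_chart_mat]) auto
    also have "det (mat n n (emat p \<omega> j)) = (?e * ?d) * (?e * ?d)"
      unfolding det_emat by (simp add: power2_eq_square)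
    also have "[(?e * ?d) * (?e * ?d) = 1 * 1] (mod int p ^ j)" by (intro cong_mult kinv_kdet)
    finally show ?thesis by simp
  qed
  then show ?thesis by (simp add: P.SL_carrier chart_mat_mat_carrier[OF assms])
qed

text \<open>Left multiplication by an elementary matrix is a row operation. At each level this
  leaves an entrywise congruence for \<open>emat\<close> to be checked for every generator.\<close>

lemma hm_elemZ_mult:
  assumes ab: "a \<noteq> b" "a < n" "b < n" and w: "\<omega> \<in> space (Omega p)" "\<omega>' \<in> space (Omega p)"
    and eq: "\<And>i j l. i < n \<Longrightarrow> j < n \<Longrightarrow>
      [emat p \<omega>' l (i, j) = emat p \<omega> l (i, j) + (if i = a then s * emat p \<omega> l (b, j) else 0)] (mod int p ^ l)"
  shows "chart_mat n p \<omega>' = hm n p (elemZ n a b s) \<otimes>\<^bsub>S\<^esub> chart_mat n p \<omega>"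
proof (rule P.mat_eqI[OF chart_mat_mat_carrier[OF w(2)]])
  note E = hm_SL[OF p0 elemZ_SL[OF ab(1)]]
  show "hm n p (elemZ n a b s) \<otimes>\<^bsub>S\<^esub> chart_mat n p \<omega> \<in> mat_carrier n (padic_int p)"
    by (intro P.SL_mat_carrier G.m_closed E chart_mat_SL w)
  fix l
  let ?N = "int p ^ l" and ?X = "mat n n (emat p \<omega> l)"
  have lmE: "Zr.lm n 0 (elemZ n a b s) = addrow_mat n s a b"
    unfolding Zr.lm_def addrow_mat_def using ab by (intro cong_mat) (auto simp: elemZ_def)
  have "mcong ?N n (lm l (hm n p (elemZ n a b s))) (addrow_mat n s a b)"
    using lm_hm[OF p0, where n = n and k = l and A = "elemZ n a b s"] unfolding lmE .
  from mcong_trans[OF P.SL_lm_mult[OF E chart_mat_SL[OF w(1)]] mcong_mult[OF this lm_chart_mat]]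
  have "mcong ?N n (lm l (hm n p (elemZ n a b s) \<otimes>\<^bsub>S\<^esub> chart_mat n p \<omega>)) (addrow_mat n s a b * ?X)" by auto
  moreover have "mcong ?N n (mat n n (emat p \<omega>' l)) (addrow_mat n s a b * ?X)"
    unfolding mcong_def
  proof (intro allI impI)
    fix i j assume ij: "i < n" "j < n"
    show "[mat n n (emat p \<omega>' l) $$ (i, j) = (addrow_mat n s a b * ?X) $$ (i, j)] (mod ?N)"
      unfolding addrow_mat_mult_index[OF mat_carrier ab ij] using eq[OF ij, of l] ab ij by (cases "i = a") auto
  qed
  ultimately show "mcong ?N n (lm l (chart_mat n p \<omega>')) (lm l (hm n p (elemZ n a b s) \<otimes>\<^bsub>S\<^esub> chart_mat n p \<omega>))"
    by (blast intro: mcong_trans lm_chart_mat mcong_sym)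
qed

lemma lift_fst_in: "\<omega> \<in> space (Omega p) \<Longrightarrow> (\<And>k. k \<in> zspace p \<Longrightarrow> h k \<in> zspace p) \<Longrightarrow> lift_fst h \<omega> \<in> space (Omega p)"
  by (auto simp: lift_fst_def space_pair_measure)

text \<open>With E the elementary matrix, \<open>E kap^-1 = (kap E^-1)^-1\<close>, and
  \<open>kap E^-1\<close> arises by subtracting \<open>5 * p\<close> times the second column from
  the first. The third column \<open>kap^-1 t\<close> changes accordingly, with the same
  \<open>t\<close>.\<close>

lemma chart_mat_hshear:
  assumes w: "\<omega> \<in> space (Omega p)"
  shows "chart_mat n p (lift_fst (hshear p) \<omega>) = hm n p (elemZ n 1 0 (5 * int p)) \<otimes>\<^bsub>S\<^esub> chart_mat n p \<omega>"
proof (rule hm_elemZ_mult[OF _ _ _ w lift_fst_in[OF w hshear_in[OF p1]]])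
  fix i j l :: nat
  let ?N = "int p ^ l" and ?k = "kap p (fst \<omega>) l" and ?k' = "kap p (hshear p (fst \<omega>)) l"
    and ?e = "kinv p (fst \<omega>) l" and ?t = "snd \<omega> l" and ?s = "5 * int p"
  note kk = kap_hshear[OF p1, of "fst \<omega>" l]
  have e: "[kinv p (hshear p (fst \<omega>)) l = ?e] (mod ?N)" by (rule kinv_unique[OF kdet_hshear[OF p1]]) auto
  have "[emat p (lift_fst (hshear p) \<omega>) l (i, j) =
     (if i = 0 then (if j = 0 then ?e * ?k True True else if j = 1 then - (?e * ?k False True)
       else if j = 2 then ?e * (?k True True * ?t False - ?k False True * ?t True) else 0)
     else if i = 1 then (if j = 0 then - (?e * (?k True False - ?s * ?k True True)) else if j = 1 then ?e * (?k False False - ?s * ?k False True)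
       else if j = 2 then ?e * ((?k False False - ?s * ?k False True) * ?t True - (?k True False - ?s * ?k True True) * ?t False) else 0)
     else if i = j then (if i = 2 then kdet p (fst \<omega>) l else 1) else 0)] (mod ?N)"
    unfolding emat_def lift_fst_def case_prod_unfold fst_conv snd_conv Let_def
    by (intro cong_if cong_diff cong_add cong_mult cong_minus_minus_iff[THEN iffD2] kk e kdet_hshear[OF p1] cong_refl)
  also have "(if i = 0 then (if j = 0 then ?e * ?k True True else if j = 1 then - (?e * ?k False True)
       else if j = 2 then ?e * (?k True True * ?t False - ?k False True * ?t True) else 0)
     else if i = 1 then (if j = 0 then - (?e * (?k True False - ?s * ?k True True)) else if j = 1 then ?e * (?k False False - ?s * ?k False True)
       else if j = 2 then ?e * ((?k False False - ?s * ?k False True) * ?t True - (?k True False - ?s * ?k True True) * ?t False) else 0)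
     else if i = j then (if i = 2 then kdet p (fst \<omega>) l else 1) else 0) =
     emat p \<omega> l (i, j) + (if i = 1 then ?s * emat p \<omega> l (0, j) else 0)"
    by (simp add: emat_def Let_def algebra_simps)
  finally show "[emat p (lift_fst (hshear p) \<omega>) l (i, j) = emat p \<omega> l (i, j) + (if i = 1 then ?s * emat p \<omega> l (0, j) else 0)] (mod ?N)" .
qed (use n3 in auto)

lemma chart_mat_hshear':
  assumes w: "\<omega> \<in> space (Omega p)"
  shows "chart_mat n p (lift_fst (hshear' p) \<omega>) = hm n p (elemZ n 0 1 (5 * int p)) \<otimes>\<^bsub>S\<^esub> chart_mat n p \<omega>"
proof (rule hm_elemZ_mult[OF _ _ _ w lift_fst_in[OF w hshear'_in[OF p1]]])
  fix i j l :: nat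
  let ?N = "int p ^ l" and ?k = "kap p (fst \<omega>) l"
    and ?e = "kinv p (fst \<omega>) l" and ?t = "snd \<omega> l" and ?s = "5 * int p"
  note kk = kap_hshear'[OF p1, of "fst \<omega>" l]
  have e: "[kinv p (hshear' p (fst \<omega>)) l = ?e] (mod ?N)" by (rule kinv_unique[OF kdet_hshear'[OF p1]]) auto
  have "[emat p (lift_fst (hshear' p) \<omega>) l (i, j) =
     (if i = 0 then (if j = 0 then ?e * (?k True True - ?s * ?k True False) else if j = 1 then - (?e * (?k False True - ?s * ?k False False))
       else if j = 2 then ?e * ((?k True True - ?s * ?k True False) * ?t False - (?k False True - ?s * ?k False False) * ?t True) else 0)
     else if i = 1 then (if j = 0 then - (?e * ?k True False) else if j = 1 then ?e * ?k False False
       else if j = 2 then ?e * (?k False False * ?t True - ?k True False * ?t False) else 0)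
     else if i = j then (if i = 2 then kdet p (fst \<omega>) l else 1) else 0)] (mod ?N)"
    unfolding emat_def lift_fst_def case_prod_unfold fst_conv snd_conv Let_def
    by (intro cong_if cong_diff cong_add cong_mult cong_minus_minus_iff[THEN iffD2] kk e kdet_hshear'[OF p1] cong_refl)
  also have "(if i = 0 then (if j = 0 then ?e * (?k True True - ?s * ?k True False) else if j = 1 then - (?e * (?k False True - ?s * ?k False False))
       else if j = 2 then ?e * ((?k True True - ?s * ?k True False) * ?t False - (?k False True - ?s * ?k False False) * ?t True) else 0)
     else if i = 1 then (if j = 0 then - (?e * ?k True False) else if j = 1 then ?e * ?k False False
       else if j = 2 then ?e * (?k False False * ?t True - ?k True False * ?t False) else 0)
     else if i = j then (if i = 2 then kdet p (fst \<omega>) l else 1) else 0) =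
     emat p \<omega> l (i, j) + (if i = 0 then ?s * emat p \<omega> l (1, j) else 0)"
    by (simp add: emat_def Let_def algebra_simps)
  finally show "[emat p (lift_fst (hshear' p) \<omega>) l (i, j) = emat p \<omega> l (i, j) + (if i = 0 then ?s * emat p \<omega> l (1, j) else 0)] (mod ?N)" .
qed (use n3 in auto)

lemma transl_in: "\<omega> \<in> space (Omega p) \<Longrightarrow> transl p (zemb p a) \<omega> \<in> space (Omega p)"
  by (auto simp: transl_def space_pair_measure intro!: zadd_in[OF p0] disp_in[OF p1] zemb_in[OF p1])

lemma transl_level:
  "[snd (transl p (zemb p a) \<omega>) l r = snd \<omega> l r + kdet p (fst \<omega>) l * (kap p (fst \<omega>) l r False * fst a + kap p (fst \<omega>) l r True * snd a)] (mod int p ^ l)"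
proof -
  have "[snd (transl p (zemb p a) \<omega>) l r = snd \<omega> l r + disp p (zemb p a) (fst \<omega>) l r] (mod int p ^ l)"
    by (simp add: transl_def case_prod_unfold zadd_def zred_def cong_def)
  also have "[snd \<omega> l r + disp p (zemb p a) (fst \<omega>) l r = snd \<omega> l r + kdet p (fst \<omega>) l * (kap p (fst \<omega>) l r False * fst a + kap p (fst \<omega>) l r True * snd a)] (mod int p ^ l)"
    by (intro cong_add cong_refl disp_zemb[OF p1])
  finally show ?thesis .
qed

text \<open>The only nonzero entry of the third row is \<open>kdet\<close>, in the third column.
  Adding this row to row 0 or 1 changes \<open>kap^-1 t\<close> to \<open>kap^-1 t + kdet a\<close>,
  which is \<open>kap^-1 (t + kdet kap a)\<close>.\<close>

lemma chart_mat_transl: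
  assumes w: "\<omega> \<in> space (Omega p)" and a: "a \<in> {(1, 0), (0, 1)}"
  shows "chart_mat n p (transl p (zemb p a) \<omega>) = hm n p (elemZ n (if a = (1, 0) then 0 else 1) 2 1) \<otimes>\<^bsub>S\<^esub> chart_mat n p \<omega>"
proof (rule hm_elemZ_mult[OF _ _ _ w transl_in[OF w]])
  fix i j l :: nat
  let ?N = "int p ^ l" and ?k = "kap p (fst \<omega>) l" and ?w = "transl p (zemb p a) \<omega>"
    and ?e = "kinv p (fst \<omega>) l" and ?d = "kdet p (fst \<omega>) l" and ?t = "snd \<omega> l" and ?r = "if a = (1, 0) then 0 else (1::nat)"
  have fw: "fst ?w = fst \<omega>" by (simp add: transl_def case_prod_unfold)
  note tl = transl_level[of a \<omega> l]
  have d: "?d = ?k False False * ?k True True - ?k False True * ?k True False" by (simp add: kdet_def)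
  have r0: "[?e * (?k True True * snd ?w l False - ?k False True * snd ?w l True) =
      ?e * (?k True True * ?t False - ?k False True * ?t True) + ?d * fst a] (mod ?N)"
  proof -
    have "[?e * (?k True True * snd ?w l False - ?k False True * snd ?w l True) =
      ?e * (?k True True * (?t False + ?d * (?k False False * fst a + ?k False True * snd a)) -
        ?k False True * (?t True + ?d * (?k True False * fst a + ?k True True * snd a)))] (mod ?N)"
      by (intro cong_mult cong_diff cong_refl tl)
    also have "?e * (?k True True * (?t False + ?d * (?k False False * fst a + ?k False True * snd a)) -
        ?k False True * (?t True + ?d * (?k True False * fst a + ?k True True * snd a))) =
      ?e * (?k True True * ?t False - ?k False True * ?t True) + (?e * ?d) * ((?k False False * ?k True True - ?k False True * ?k True False) * fst a)"
      by (simp add: algebra_simps)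
    also have "[\<dots> = ?e * (?k True True * ?t False - ?k False True * ?t True) + 1 * ((?k False False * ?k True True - ?k False True * ?k True False) * fst a)] (mod ?N)"
      by (intro cong_add cong_refl cong_scalar_right kinv_kdet)
    finally show ?thesis by (simp only: d[symmetric] mult_1_left)
  qed
  have r1: "[?e * (?k False False * snd ?w l True - ?k True False * snd ?w l False) =
      ?e * (?k False False * ?t True - ?k True False * ?t False) + ?d * snd a] (mod ?N)"
  proof -
    have "[?e * (?k False False * snd ?w l True - ?k True False * snd ?w l False) =
      ?e * (?k False False * (?t True + ?d * (?k True False * fst a + ?k True True * snd a)) -
        ?k True False * (?t False + ?d * (?k False False * fst a + ?k False True * snd a)))] (mod ?N)"
      by (intro cong_mult cong_diff cong_refl tl)
    also have "?e * (?k False False * (?t True + ?d * (?k True False * fst a + ?k True True * snd a)) -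
        ?k True False * (?t False + ?d * (?k False False * fst a + ?k False True * snd a))) =
      ?e * (?k False False * ?t True - ?k True False * ?t False) + (?e * ?d) * ((?k False False * ?k True True - ?k False True * ?k True False) * snd a)"
      by (simp add: algebra_simps)
    also have "[\<dots> = ?e * (?k False False * ?t True - ?k True False * ?t False) + 1 * ((?k False False * ?k True True - ?k False True * ?k True False) * snd a)] (mod ?N)"
      by (intro cong_add cong_refl cong_scalar_right kinv_kdet)
    finally show ?thesis by (simp only: d[symmetric] mult_1_left)
  qed
  have "i = 0 \<and> j = 2 \<or> i = 1 \<and> j = 2 \<or> \<not> (i < 2 \<and> j = 2)" by linarith
  then show "[emat p ?w l (i, j) = emat p \<omega> l (i, j) + (if i = ?r then 1 * emat p \<omega> l (2, j) else 0)] (mod ?N)"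
  proof (elim disjE)
    assume ij: "i = 0 \<and> j = 2"
    have "(if i = ?r then 1 * emat p \<omega> l (2, j) else 0) = ?d * fst a"
      using a by (elim insertE emptyE) (simp_all add: ij emat_def)
    then show ?thesis using r0 by (simp add: ij emat_def Let_def fw)
  next
    assume ij: "i = 1 \<and> j = 2"
    have "(if i = ?r then 1 * emat p \<omega> l (2, j) else 0) = ?d * snd a"
      using a by (elim insertE emptyE) (simp_all add: ij emat_def)
    then show ?thesis using r1 by (simp add: ij emat_def Let_def fw)
  next
    assume ij: "\<not> (i < 2 \<and> j = 2)"
    then have "emat p ?w l (i, j) = emat p \<omega> l (i, j)"
      by (cases "i = 0"; cases "i = 1"; cases "j = 2") (simp_all add: emat_def Let_def fw)
    moreover have "(if i = ?r then 1 * emat p \<omega> l (2, j) else 0) = 0"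
      using ij by (cases "j = 2") (simp_all add: emat_def)
    ultimately show ?thesis by (simp only: add_0_right cong_refl)
  qed
qed (use n3 a in auto)

lemma cls_chart_mat_measurable: "(\<lambda>\<omega>. P.cls n (chart_mat n p \<omega>)) \<in> Omega p \<rightarrow>\<^sub>M borel_of (PSL_padic_topology n p)"
proof (rule measurable_cls[where \<omega>lev = "\<lambda>k \<omega>. (fst \<omega> k, snd \<omega> k)"])
  fix k
  have 1: "(\<lambda>\<omega>. fst \<omega> k) \<in> Omega p \<rightarrow>\<^sub>M count_space UNIV" by (rule measurable_compose[OF measurable_fst measurable_level])
  have 2: "(\<lambda>\<omega>. snd \<omega> k) \<in> Omega p \<rightarrow>\<^sub>M count_space UNIV" by (rule measurable_compose[OF measurable_snd measurable_level])
  show "(\<lambda>\<omega>. (fst \<omega> k, snd \<omega> k)) \<in> Omega p \<rightarrow>\<^sub>M count_space UNIV"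
    by (rule measurable_compose_countable[OF measurable_compose[OF 2] 1]) simp
next
  fix k and \<omega> \<omega>' :: omega and ij
  assume "(fst \<omega> k, snd \<omega> k) = (fst \<omega>' k, snd \<omega>' k)"
  then show "chart_mat n p \<omega> ij k = chart_mat n p \<omega>' ij k"
    using emat_cong[of \<omega> k \<omega>' k k ij] by (auto simp: chart_mat_def kap_def cong_def restrict_def)
qed (rule chart_mat_SL)

text \<open>Matrices of the same class differ by a central scalar. The entry \<open>kdet\<close> at
  (2, 2) is a unit that does not involve \<open>t\<close>, so the scalar is 1; then the third
  columns \<open>kap^-1 t\<close> agree, and multiplication by \<open>kap\<close> recovers
  \<open>t\<close>.\<close>

lemma cls_chart_mat_inj:
  assumes k: "k \<in> zspace p"
  shows "inj_on (\<lambda>t. P.cls n (chart_mat n p (k, t))) (zspace p)"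
proof (rule inj_onI)
  fix t t' assume t: "t \<in> zspace p" "t' \<in> zspace p" and eq: "P.cls n (chart_mat n p (k, t)) = P.cls n (chart_mat n p (k, t'))"
  have w: "(k, t) \<in> space (Omega p)" "(k, t') \<in> space (Omega p)" using k t by (auto simp: space_pair_measure)
  have "chart_mat n p (k, t) \<in> P.cls n (chart_mat n p (k, t'))" using P.cls_self[OF chart_mat_SL[OF w(1)]] eq by simp
  then obtain z where z: "z \<in> group_center S" "chart_mat n p (k, t) = z \<otimes>\<^bsub>S\<^esub> chart_mat n p (k, t')" by (auto simp: P.mem_cls)
  show "t = t'"
  proof (intro ext)
    fix l i
    let ?N = "int p ^ l" and ?k = "kap p k l" and ?e = "kinv p k l" and ?d = "kdet p k l"
    define c where "c = z (0, 0) l"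
    have zc: "mcong ?N n (lm l z) (c \<cdot>\<^sub>m 1\<^sub>m n)" unfolding c_def by (rule P.center_mcong[OF z(1)])
    have "mcong ?N n (lm l (chart_mat n p (k, t))) (lm l z * lm l (chart_mat n p (k, t')))"
      unfolding z(2) by (rule P.SL_lm_mult[OF center_carrier[OF z(1)] chart_mat_SL[OF w(2)]])
    from mcong_trans[OF this P.scalar_mult(1)[OF zc P.lm_carrier P.lm_carrier]]
    have "mcong ?N n (lm l (chart_mat n p (k, t))) (c \<cdot>\<^sub>m lm l (chart_mat n p (k, t')))" .
    from mcong_trans[OF mcong_sym[OF lm_chart_mat] mcong_trans[OF this mcong_smult[OF lm_chart_mat]]]
    have m: "mcong ?N n (mat n n (emat p (k, t) l)) (c \<cdot>\<^sub>m mat n n (emat p (k, t') l))" by auto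
    have E: "[emat p (k, t) l (r, s) = c * emat p (k, t') l (r, s)] (mod ?N)" if "r < n" "s < n" for r s
      using m that by (auto simp: mcong_def)
    have "[?d = c * ?d] (mod ?N)" using E[of 2 2] n3 by (simp add: emat_def Let_def)
    then have "[?e * ?d = ?e * (c * ?d)] (mod ?N)" by (rule cong_scalar_left)
    moreover have "?e * (c * ?d) = c * (?e * ?d)" by simp
    moreover have "[c * (?e * ?d) = c * 1] (mod ?N)" by (rule cong_scalar_left[OF kinv_kdet])
    ultimately have c1: "[c = 1] (mod ?N)" using kinv_kdet[of k l] by (metis cong_sym cong_trans mult.right_neutral)
    have E1: "[emat p (k, t) l (r, s) = emat p (k, t') l (r, s)] (mod ?N)" if "r < n" "s < n" for r s
      using cong_trans[OF E[OF that] cong_scalar_right[OF c1]] by simp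
    have A: "[?e * (?k True True * t l False - ?k False True * t l True) = ?e * (?k True True * t' l False - ?k False True * t' l True)] (mod ?N)"
      using E1[of 0 2] n3 by (simp add: emat_def Let_def)
    have B: "[?e * (?k False False * t l True - ?k True False * t l False) = ?e * (?k False False * t' l True - ?k True False * t' l False)] (mod ?N)"
      using E1[of 1 2] n3 by (simp add: emat_def Let_def)
    have d: "?d = ?k False False * ?k True True - ?k False True * ?k True False" by (simp add: kdet_def)
    have "[(?e * ?d) * t l i = (?e * ?d) * t' l i] (mod ?N)"
    proof (cases i)
      case True
      have "[?k True False * (?e * (?k True True * t l False - ?k False True * t l True)) + ?k True True * (?e * (?k False False * t l True - ?k True False * t l False)) =
        ?k True False * (?e * (?k True True * t' l False - ?k False True * t' l True)) + ?k True True * (?e * (?k False False * t' l True - ?k True False * t' l False))] (mod ?N)"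
        by (intro cong_add cong_scalar_left A B)
      then show ?thesis using True by (simp add: d algebra_simps)
    next
      case False
      have "[?k False False * (?e * (?k True True * t l False - ?k False True * t l True)) + ?k False True * (?e * (?k False False * t l True - ?k True False * t l False)) =
        ?k False False * (?e * (?k True True * t' l False - ?k False True * t' l True)) + ?k False True * (?e * (?k False False * t' l True - ?k True False * t' l False))] (mod ?N)"
        by (intro cong_add cong_scalar_left A B)
      then show ?thesis using False by (simp add: d algebra_simps)
    qed
    moreover have "[(?e * ?d) * x = 1 * x] (mod ?N)" for x by (rule cong_scalar_right[OF kinv_kdet])
    ultimately have "[t l i = t' l i] (mod ?N)" by (metis cong_sym cong_trans mult_1_left)
    then show "t l i = t' l i" using zspaceD(5)[OF t(1), of l i] zspaceD(5)[OF t(2), of l i] by (simp add: cong_def)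
  qed
qed

end

section \<open>Incomparability\<close>

lemma countable_SL_int: "countable (carrier (SL n \<Z>))"
proof (rule countable_subset)
  show "carrier (SL n \<Z>) \<subseteq> {..<n} \<times> {..<n} \<rightarrow>\<^sub>E UNIV" by (auto simp: SL_def mat_carrier_def)
  show "countable ({..<n} \<times> {..<n} \<rightarrow>\<^sub>E (UNIV :: int set))" by (rule countable_PiE) auto
qed

text \<open>The size 3 concerns the source, which has to accommodate the block chart; the target
  enters through its congruence levels and its countable group of integral points. Points of one
  fibre of \<open>F\<close> have related images, so the reduction puts them into one orbit of the
  source. Orbits are countable and the chart is injective for fixed \<open>k\<close>, which
  contradicts \<open>uncountable_fibre\<close>.\<close>

theorem not_borel_reducible:
  fixes m n p q :: nat
  assumes m: "m \<ge> 3" and n: "n > 0" and pr: "prime p" "prime q" "p \<noteq> q"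
  shows "\<not> borel_reducible (borel_of (PSL_padic_topology m p)) (PSL_orbit_rel m p)
            (borel_of (PSL_padic_topology n q)) (PSL_orbit_rel n q)"
proof
  assume "borel_reducible (borel_of (PSL_padic_topology m p)) (PSL_orbit_rel m p)
            (borel_of (PSL_padic_topology n q)) (PSL_orbit_rel n q)"
  then obtain f where f: "f \<in> borel_of (PSL_padic_topology m p) \<rightarrow>\<^sub>M borel_of (PSL_padic_topology n q)"
    and red: "\<And>x y. x \<in> space (borel_of (PSL_padic_topology m p)) \<Longrightarrow> y \<in> space (borel_of (PSL_padic_topology m p)) \<Longrightarrow>
      (x, y) \<in> PSL_orbit_rel m p \<longleftrightarrow> (f x, f y) \<in> PSL_orbit_rel n q"
    unfolding borel_reducible_def by blast
  have q0: "q > 0" using pr(2) by (simp add: prime_gt_0_nat)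
  interpret X: SL_chart p m using pr m by unfold_locales auto
  interpret Y: padic_PSL q n using q0 n by unfold_locales auto
  define \<Theta> where "\<Theta> \<omega> = X.P.cls m (chart_mat m p \<omega>)" for \<omega>
  have \<Theta>: "\<Theta> \<in> Omega p \<rightarrow>\<^sub>M borel_of (PSL_padic_topology m p)" unfolding \<Theta>_def by (rule X.cls_chart_mat_measurable)
  define F where "F \<omega> = f (\<Theta> \<omega>)" for \<omega>
  have Fm: "F \<in> Omega p \<rightarrow>\<^sub>M borel_of (PSL_padic_topology n q)"
    unfolding F_def by (rule measurable_compose[OF \<Theta> f])
  have Fc: "F \<omega> \<in> carrier (PSL n (padic_int q))" if "\<omega> \<in> space (Omega p)" for \<omega>
    using measurable_space[OF Fm that] by (simp add: Y.space_borel_PSL)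
  define Lam where "Lam = (\<lambda>A. Y.P.cls n (hm n q A)) ` carrier (SL n \<Z>)"
  interpret LG: lev_group "PSL n (padic_int q)" Y.plev q by (rule Y.lev_group_PSL)
  have one: "\<exists>l\<in>Lam. F \<omega>' = l \<otimes>\<^bsub>PSL n (padic_int q)\<^esub> F \<omega>"
    if w: "\<omega> \<in> space (Omega p)" "\<omega>' \<in> space (Omega p)" and A: "A \<in> carrier (SL m \<Z>)" "chart_mat m p \<omega>' = hm m p A \<otimes>\<^bsub>SL m (padic_int p)\<^esub> chart_mat m p \<omega>"
    for \<omega> \<omega>' A
  proof -
    have "(\<Theta> \<omega>', \<Theta> \<omega>) \<in> PSL_orbit_rel m p"
      unfolding \<Theta>_def PSL_orbit_rel_iff[OF X.p0 X.chart_mat_SL[OF w(2)] X.chart_mat_SL[OF w(1)]] using A by auto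
    then have r: "(F \<omega>', F \<omega>) \<in> PSL_orbit_rel n q"
      unfolding F_def using red[OF measurable_space[OF \<Theta> w(2)] measurable_space[OF \<Theta> w(1)]] by simp
    obtain V W where VW: "V \<in> carrier Y.S" "F \<omega>' = Y.P.cls n V" "W \<in> carrier Y.S" "F \<omega> = Y.P.cls n W"
      using Fc[OF w(1)] Fc[OF w(2)] unfolding Y.P.carrier_PSL by blast
    obtain B where B: "B \<in> carrier (SL n \<Z>)" "Y.P.cls n V = Y.P.cls n (hm n q B \<otimes>\<^bsub>Y.S\<^esub> W)"
      using r unfolding VW(2,4) PSL_orbit_rel_iff[OF q0 VW(1,3)] by blast
    have "F \<omega>' = Y.P.cls n (hm n q B) \<otimes>\<^bsub>PSL n (padic_int q)\<^esub> F \<omega>"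
      unfolding VW(2,4) B(2) by (rule Y.P.cls_mult[OF hm_SL[OF q0 B(1)] VW(3), symmetric])
    then show ?thesis using B(1) by (auto simp: Lam_def)
  qed
  interpret W: weak_hom "PSL n (padic_int q)" Y.plev q p F Lam
  proof (intro weak_hom.intro weak_hom_axioms.intro pr LG.lev_group_axioms)
    show "LG.levm (Omega p) F"
      unfolding LG.levm_def
    proof (intro conjI ballI allI Fc)
      fix j v
      have "{\<omega> \<in> space (Omega p). Y.plev j (F \<omega>) = v} =
         F -` {x \<in> carrier (PSL n (padic_int q)). Y.plev j x = v} \<inter> space (Omega p)" using Fc by auto
      then show "{\<omega> \<in> space (Omega p). Y.plev j (F \<omega>) = v} \<in> sets (Omega p)"
        using measurable_sets[OF Fm Y.plev_measurable[of j v]] by simp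
    qed
    show "countable Lam" unfolding Lam_def by (intro countable_image countable_SL_int)
    show "Lam \<subseteq> carrier (PSL n (padic_int q))"
      unfolding Lam_def Y.P.carrier_PSL using hm_SL[OF q0] by blast
    fix \<omega> assume w: "\<omega> \<in> space (Omega p)"
    show "\<exists>l\<in>Lam. F (lift_fst (hshear p) \<omega>) = l \<otimes>\<^bsub>PSL n (padic_int q)\<^esub> F \<omega>"
      by (rule one[OF w X.lift_fst_in[OF w hshear_in[OF X.p1]] elemZ_SL X.chart_mat_hshear[OF w]]) auto
    show "\<exists>l\<in>Lam. F (lift_fst (hshear' p) \<omega>) = l \<otimes>\<^bsub>PSL n (padic_int q)\<^esub> F \<omega>"
      by (rule one[OF w X.lift_fst_in[OF w hshear'_in[OF X.p1]] elemZ_SL X.chart_mat_hshear'[OF w]]) auto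
    fix a :: "int \<times> int" assume a: "a \<in> {(1, 0), (0, 1)}"
    show "\<exists>l\<in>Lam. F (transl p (zemb p a) \<omega>) = l \<otimes>\<^bsub>PSL n (padic_int q)\<^esub> F \<omega>"
      by (rule one[OF w X.transl_in[OF w] elemZ_SL X.chart_mat_transl[OF w a]]) auto
  qed
  obtain k x where k: "k \<in> zspace p" "x \<in> zspace p" "uncountable {t \<in> zspace p. F (k, t) = F (k, x)}"
    using W.uncountable_fibre by blast
  have w: "(k, t) \<in> space (Omega p)" if "t \<in> zspace p" for t using k(1) that by (auto simp: space_pair_measure)
  let ?T = "{t \<in> zspace p. F (k, t) = F (k, x)}"
  let ?C = "(\<lambda>A. X.P.cls m (hm m p A \<otimes>\<^bsub>SL m (padic_int p)\<^esub> chart_mat m p (k, x))) ` carrier (SL m \<Z>)"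
  have "(\<lambda>t. \<Theta> (k, t)) ` ?T \<subseteq> ?C"
  proof
    fix y assume "y \<in> (\<lambda>t. \<Theta> (k, t)) ` ?T"
    then obtain t where t: "t \<in> zspace p" "F (k, t) = F (k, x)" "y = \<Theta> (k, t)" by auto
    have "(F (k, t), F (k, x)) \<in> PSL_orbit_rel n q"
      unfolding t(2) using Fc[OF w[OF k(2)]] by (simp add: PSL_orbit_rel_def orbit_eq_rel_def)
    then have "(\<Theta> (k, t), \<Theta> (k, x)) \<in> PSL_orbit_rel m p"
      unfolding F_def using red[OF measurable_space[OF \<Theta> w[OF t(1)]] measurable_space[OF \<Theta> w[OF k(2)]]] by simp
    then show "y \<in> ?C"
      unfolding t(3) \<Theta>_def PSL_orbit_rel_iff[OF X.p0 X.chart_mat_SL[OF w[OF t(1)]] X.chart_mat_SL[OF w[OF k(2)]]] by blast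
  qed
  then have "countable ((\<lambda>t. \<Theta> (k, t)) ` ?T)"
    by (rule countable_subset) (intro countable_image countable_SL_int)
  moreover have "inj_on (\<lambda>t. \<Theta> (k, t)) ?T"
    unfolding \<Theta>_def by (rule inj_on_subset[OF X.cls_chart_mat_inj[OF k(1)]]) auto
  ultimately have "countable ?T" by (rule countable_image_inj_on)
  then show False using k(3) by simp
qed

theorem theorem3p2:
  fixes m n p q :: nat
  assumes "m \<ge> 3" and "n \<ge> 3"
    and "prime p" and "prime q" and "p \<noteq> q"
  shows "\<not> borel_reducible
            (borel_of (PSL_padic_topology m p)) (PSL_orbit_rel m p)
            (borel_of (PSL_padic_topology n q)) (PSL_orbit_rel n q)
       \<and> \<not> borel_reducible
            (borel_of (PSL_padic_topology n q)) (PSL_orbit_rel n q)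
            (borel_of (PSL_padic_topology m p)) (PSL_orbit_rel m p)"
  using not_borel_reducible[of m n p q] not_borel_reducible[of n m q p] assms by auto

end
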